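(* Let $S,g_0,\omega,\Lambda$, the Randers-Kropina metric $F$ and the Randers metrics $F_\varepsilon$ be as in the context, and assume that there exists $\bar\varepsilon\in(0,1]$ such that the intersections $\bar B^+_{\bar\varepsilon}(x,r)\cap\bar B^-_{\bar\varepsilon}(y,s)$, $x,y\in S$, $r,s>0$, of the closed forward and closed backward balls of $F_{\bar\varepsilon}$ are compact. Let $x_0\ne x_1\in S$ and, for each $\varepsilon\in(0,1]$, let $\sigma_\varepsilon:[0,1]\to S$ be a geodesic of the Randers metric $F_\varepsilon$ such that $\sigma_\varepsilon(0)=x_0$ and $\sigma_\varepsilon(1)=x_1$, and assume that $\sup_{\varepsilon\in(0,1]}E_\varepsilon(\sigma_\varepsilon)<+\infty$. Then there exist a sequence $\varepsilon_n\to0$ and a geodesic $\sigma$ of $(S,F)$ from $x_0$ to $x_1$ such that $\sigma_{\varepsilon_n}$ converges uniformly to $\sigma$ and $\ell_{\varepsilon_n}(\sigma_{\varepsilon_n})\to\ell_F(\sigma)$. Moreover, if $\Lambda(x_0)\ne0$, or $\Lambda(x_0)=0$ but $d\Lambda_{x_0}(\mathcal D_{x_0})\neq 0$ (that is, $d\Lambda_{x_0}$ does not vanish identically on $\mathcal D_{x_0}=\ker\omega_{x_0}$), then the point $x_1$ can be taken to be equal to $x_0$.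
   Context: $S$ is a connected smooth manifold of finite dimension $m\ge 2$, with a smooth Riemannian metric $g_0$, a smooth one-form $\omega$ and a smooth function $\Lambda:S\to\mathbb R$ with $\Lambda\geq 0$ and $\omega_x\neq 0$ for all $x\in S$; $\pi:TS\to S$ is the projection. The Randers-Kropina metric is $$F(v)=\frac{g_0(v,v)}{-\omega(v)+\sqrt{\Lambda g_0(v,v)+\omega^2(v)}}$$ (with $F(0)=0$ at points where $\Lambda>0$), with domain $\mathcal A\subset TS$ consisting of all $v$ with $\Lambda(\pi(v))>0$ together with all $v$ with $\Lambda(\pi(v))=0$ and $\omega(v)<0$. $\Omega_{x_0x_1}(\mathcal A)$ is the set of continuous piecewise smooth $\gamma:[0,1]\to S$ with $\gamma(0)=x_0$, $\gamma(1)=x_1$ and left and right derivatives in $\mathcal A$ for all $s\in(0,1)$. A geodesic of $(S,F)$ from $x_0$ to $x_1$ is a critical point of $E(\gamma)=\frac12\int_0^1F^2(\dot\gamma)\,ds$ on $\Omega_{x_0x_1}(\mathcal A)$ (piecewise smooth variations with fixed endpoints). $\ell_F(\gamma)=\int_0^1F(\dot\gamma)\,ds$. For $\varepsilon>0$, $F_\varepsilon$ is the Randers metric $$F_\varepsilon(v)=\frac{1}{\Lambda+\varepsilon}\Big(\sqrt{(\Lambda+\varepsilon)g_0(v,v)+\omega^2(v)}+\omega(v)\Big),\quad v\in TS,$$ with energy $E_\varepsilon(\sigma)=\frac12\int_0^1F_\varepsilon^2(\dot\sigma)\,ds$ and length $\ell_\varepsilon(\sigma)=\int_0^1F_\varepsilon(\dot\sigma)\,ds$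 on continuous piecewise smooth curves $\sigma:[0,1]\to S$ from $x_0$ to $x_1$; geodesics of $F_\varepsilon$ are critical points of $E_\varepsilon$ among such curves (hence have constant $F_\varepsilon(\dot\sigma)$). $d_\varepsilon(x,y)=\inf_\sigma\ell_\varepsilon(\sigma)$ over continuous piecewise smooth curves from $x$ to $y$; $B^+_\varepsilon(x,r)=\{z:d_\varepsilon(x,z)<r\}$, $B^-_\varepsilon(x,r)=\{z:d_\varepsilon(z,x)<r\}$, and $\bar B_\varepsilon^\pm(x,r)$ are their closures. *)

theory Defs
  imports "HOL-Analysis.Analysis"
begin

subsection \<open>Smooth maps between Euclidean spaces\<close>

text \<open>\<open>Ck_on k W f\<close> is meant for open \<open>W\<close>.\<close>

primrec Ck_on ::
  "nat \<Rightarrow> 'e::euclidean_space set \<Rightarrow> ('e \<Rightarrow> 'f::real_normed_vector) \<Rightarrow> bool" where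
  "Ck_on 0 W f \<longleftrightarrow> continuous_on W f"
| "Ck_on (Suc k) W f \<longleftrightarrow>
     (\<forall>x\<in>W. f differentiable (at x)) \<and>
     (\<forall>v. Ck_on k W (\<lambda>x. frechet_derivative f (at x) v))"

definition smooth_on ::
  "'e::euclidean_space set \<Rightarrow> ('e \<Rightarrow> 'f::real_normed_vector) \<Rightarrow> bool" where
  "smooth_on W f \<longleftrightarrow> (\<forall>k. Ck_on k W f)"

subsection \<open>Smooth manifolds and tangent vectors\<close>

text \<open>
  The manifold is the whole of a Hausdorff, second countable type \<open>'a\<close>; its smooth structure is
  given by a (not necessarily maximal) atlas of charts \<open>(U, \<phi>)\<close> with values in the
  Euclidean space \<open>'b\<close>.
\<close>

type_synonym ('a, 'b) chart = "'a set \<times> ('a \<Rightarrow> 'b)"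

definition transition :: "('a, 'b) chart \<Rightarrow> ('a, 'b) chart \<Rightarrow> 'b \<Rightarrow> 'b" where
  "transition c c' = snd c' \<circ> inv_into (fst c) (snd c)"

definition smooth_atlas ::
  "('a::{t2_space, second_countable_topology}, 'b::euclidean_space) chart set \<Rightarrow> bool" where
  "smooth_atlas At \<longleftrightarrow>
     (\<Union>c\<in>At. fst c) = UNIV \<and>
     (\<forall>(U, \<phi>)\<in>At. open U \<and> open (\<phi> ` U) \<and> homeomorphism U (\<phi> ` U) \<phi> (inv_into U \<phi>)) \<and>
     (\<forall>c\<in>At. \<forall>c'\<in>At. smooth_on (snd c ` (fst c \<inter> fst c')) (transition c c'))"

text \<open>
  A tangent vector at \<open>x\<close> is the family of its coordinate representations in all charts around
  \<open>x\<close>, related by the derivatives of the transition maps (and set to \<open>0\<close> at all other arguments).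
  The vector space operations of \<open>T\<^sub>x S\<close> are pointwise.
\<close>

type_synonym ('a, 'b) tvec = "('a, 'b) chart \<Rightarrow> 'b"

definition charts_at :: "('a, 'b) chart set \<Rightarrow> 'a \<Rightarrow> ('a, 'b) chart set" where
  "charts_at At x = {c \<in> At. x \<in> fst c}"

definition tangent_space ::
  "('a, 'b::euclidean_space) chart set \<Rightarrow> 'a \<Rightarrow> ('a, 'b) tvec set" where
  "tangent_space At x =
     {v. (\<forall>c\<in>charts_at At x. \<forall>c'\<in>charts_at At x.
            v c' = frechet_derivative (transition c c') (at (snd c x)) (v c)) \<and>
         (\<forall>c. c \<notin> charts_at At x \<longrightarrow> v c = 0)}"

definition tangent_bundle ::
  "('a, 'b::euclidean_space) chart set \<Rightarrow> ('a \<times> ('a, 'b) tvec) set" where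
  "tangent_bundle At = {(x, v). v \<in> tangent_space At x}"

text \<open>The tangent vector at \<open>x\<close> whose representation in the chart \<open>c\<close> is \<open>e\<close>.\<close>

definition coord_vec ::
  "('a, 'b::euclidean_space) chart set \<Rightarrow> ('a, 'b) chart \<Rightarrow> 'a \<Rightarrow> 'b \<Rightarrow> ('a, 'b) tvec" where
  "coord_vec At c x e =
     (\<lambda>c'. if c' \<in> charts_at At x
            then frechet_derivative (transition c c') (at (snd c x)) e else 0)"

subsection \<open>Functions, one-forms and Riemannian metrics\<close>

definition smooth_fun ::
  "('a, 'b::euclidean_space) chart set \<Rightarrow> ('a \<Rightarrow> real) \<Rightarrow> bool" where
  "smooth_fun At f \<longleftrightarrow> (\<forall>(U, \<phi>)\<in>At. smooth_on (\<phi> ` U) (f \<circ> inv_into U \<phi>))"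

text \<open>The value does not depend on the choice of the chart if \<open>v\<close> is tangent at \<open>x\<close>.\<close>

definition differential ::
  "('a, 'b::euclidean_space) chart set \<Rightarrow> ('a \<Rightarrow> real) \<Rightarrow> 'a \<Rightarrow> ('a, 'b) tvec \<Rightarrow> real" where
  "differential At f x v =
     (let c = (SOME c. c \<in> charts_at At x) in
        frechet_derivative (f \<circ> inv_into (fst c) (snd c)) (at (snd c x)) (v c))"

definition linear_on_tangent ::
  "('a, 'b::euclidean_space) chart set \<Rightarrow> 'a \<Rightarrow> (('a, 'b) tvec \<Rightarrow> real) \<Rightarrow> bool" where
  "linear_on_tangent At x l \<longleftrightarrow>
     (\<forall>u\<in>tangent_space At x. \<forall>v\<in>tangent_space At x. \<forall>a b.
        l (\<lambda>c. a *\<^sub>R u c + b *\<^sub>R v c) = a * l u + b * l v)"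

definition smooth_one_form ::
  "('a, 'b::euclidean_space) chart set \<Rightarrow> ('a \<Rightarrow> ('a, 'b) tvec \<Rightarrow> real) \<Rightarrow> bool" where
  "smooth_one_form At \<omega> \<longleftrightarrow>
     (\<forall>x. linear_on_tangent At x (\<omega> x)) \<and>
     (\<forall>c\<in>At. \<forall>e. smooth_on (snd c ` fst c)
        (\<lambda>y. let x = inv_into (fst c) (snd c) y in \<omega> x (coord_vec At c x e)))"

definition riemannian_metric ::
  "('a, 'b::euclidean_space) chart set \<Rightarrow> ('a \<Rightarrow> ('a, 'b) tvec \<Rightarrow> ('a, 'b) tvec \<Rightarrow> real) \<Rightarrow> bool" where
  "riemannian_metric At g \<longleftrightarrow>
     (\<forall>x. \<forall>u\<in>tangent_space At x.
        linear_on_tangent At x (g x u) \<and>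
        (\<forall>v\<in>tangent_space At x. g x u v = g x v u) \<and>
        (u \<noteq> (\<lambda>c. 0) \<longrightarrow> g x u u > 0)) \<and>
     (\<forall>c\<in>At. \<forall>e e'. smooth_on (snd c ` fst c)
        (\<lambda>y. let x = inv_into (fst c) (snd c) y in
               g x (coord_vec At c x e) (coord_vec At c x e')))"

subsection \<open>Piecewise smooth curves\<close>

text \<open>
  Smoothness of a map into the manifold on a not necessarily open set \<open>D\<close> (such as a
  closed interval): locally, its coordinate representations extend smoothly to open sets.
\<close>

definition smooth_map ::
  "('a::topological_space, 'b::euclidean_space) chart set \<Rightarrow> 'e::euclidean_space set \<Rightarrow>
   ('e \<Rightarrow> 'a) \<Rightarrow> bool" where
  "smooth_map At D f \<longleftrightarrow> continuous_on D f \<and>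
     (\<forall>p\<in>D. \<forall>c\<in>charts_at At (f p). \<exists>W h.
        open W \<and> p \<in> W \<and> smooth_on W h \<and>
        (\<forall>q\<in>D \<inter> W. f q \<in> fst c \<and> h q = snd c (f q)))"

definition partition01 :: "nat \<Rightarrow> (nat \<Rightarrow> real) \<Rightarrow> bool" where
  "partition01 n t \<longleftrightarrow> t 0 = 0 \<and> t n = 1 \<and> (\<forall>i<n. t i < t (Suc i))"

definition piecewise_smooth_curve ::
  "('a::topological_space, 'b::euclidean_space) chart set \<Rightarrow> (real \<Rightarrow> 'a) \<Rightarrow> bool" where
  "piecewise_smooth_curve At \<gamma> \<longleftrightarrow> continuous_on {0..1} \<gamma> \<and>
     (\<exists>n t. partition01 n t \<and> (\<forall>i<n. smooth_map At {t i..t (Suc i)} \<gamma>))"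

text \<open>
  \<open>velocity_within At \<gamma> I s\<close> is the derivative at \<open>s\<close> of the restriction of \<open>\<gamma>\<close> to \<open>I\<close>: the left
  derivative for \<open>I = {0..s}\<close> and the right derivative for \<open>I = {s..1}\<close>. The value of
  \<open>velocity At \<gamma> s\<close> at the finitely many break points of \<open>\<gamma>\<close> is arbitrary.
\<close>

definition velocity_within ::
  "('a, 'b::euclidean_space) chart set \<Rightarrow> (real \<Rightarrow> 'a) \<Rightarrow> real set \<Rightarrow> real \<Rightarrow> ('a, 'b) tvec" where
  "velocity_within At \<gamma> I s =
     (\<lambda>c. if c \<in> charts_at At (\<gamma> s)
           then vector_derivative (snd c \<circ> \<gamma>) (at s within I) else 0)"

definition velocity ::
  "('a, 'b::euclidean_space) chart set \<Rightarrow> (real \<Rightarrow> 'a) \<Rightarrow> real \<Rightarrow> ('a, 'b) tvec" where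
  "velocity At \<gamma> s = velocity_within At \<gamma> {0..1} s"

definition curves_between ::
  "('a::topological_space, 'b::euclidean_space) chart set \<Rightarrow> ('a \<times> ('a, 'b) tvec) set \<Rightarrow>
   'a \<Rightarrow> 'a \<Rightarrow> (real \<Rightarrow> 'a) set" where
  "curves_between At Dom x0 x1 =
     {\<gamma>. piecewise_smooth_curve At \<gamma> \<and> \<gamma> 0 = x0 \<and> \<gamma> 1 = x1 \<and>
         (\<forall>s\<in>{0<..<1}. (\<gamma> s, velocity_within At \<gamma> {0..s} s) \<in> Dom \<and>
                        (\<gamma> s, velocity_within At \<gamma> {s..1} s) \<in> Dom)}"

subsection \<open>Length, energy, geodesics and distances\<close>

definition curve_length ::
  "('a, 'b::euclidean_space) chart set \<Rightarrow> ('a \<Rightarrow> ('a, 'b) tvec \<Rightarrow> real) \<Rightarrow>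
   (real \<Rightarrow> 'a) \<Rightarrow> real" where
  "curve_length At F \<gamma> = integral {0..1} (\<lambda>s. F (\<gamma> s) (velocity At \<gamma> s))"

definition finite_energy ::
  "('a, 'b::euclidean_space) chart set \<Rightarrow> ('a \<Rightarrow> ('a, 'b) tvec \<Rightarrow> real) \<Rightarrow>
   (real \<Rightarrow> 'a) \<Rightarrow> bool" where
  "finite_energy At F \<gamma> \<longleftrightarrow> (\<lambda>s. (F (\<gamma> s) (velocity At \<gamma> s))\<^sup>2) integrable_on {0..1}"

definition energy ::
  "('a, 'b::euclidean_space) chart set \<Rightarrow> ('a \<Rightarrow> ('a, 'b) tvec \<Rightarrow> real) \<Rightarrow>
   (real \<Rightarrow> 'a) \<Rightarrow> real" where
  "energy At F \<gamma> = 1 / 2 * integral {0..1} (\<lambda>s. (F (\<gamma> s) (velocity At \<gamma> s))\<^sup>2)"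

text \<open>Piecewise smooth variations with fixed end points, through curves in the same class.\<close>

definition variation_of ::
  "('a::topological_space, 'b::euclidean_space) chart set \<Rightarrow> ('a \<times> ('a, 'b) tvec) set \<Rightarrow>
   'a \<Rightarrow> 'a \<Rightarrow> (real \<Rightarrow> 'a) \<Rightarrow> real \<Rightarrow> (real \<times> real \<Rightarrow> 'a) \<Rightarrow> bool" where
  "variation_of At Dom x0 x1 \<gamma> \<delta> H \<longleftrightarrow>
     \<delta> > 0 \<and>
     continuous_on ({-\<delta><..<\<delta>} \<times> {0..1}) H \<and>
     (\<exists>n t. partition01 n t \<and>
        (\<forall>i<n. smooth_map At ({-\<delta><..<\<delta>} \<times> {t i..t (Suc i)}) H)) \<and>
     (\<forall>s\<in>{0..1}. H (0, s) = \<gamma> s) \<and>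
     (\<forall>w\<in>{-\<delta><..<\<delta>}. (\<lambda>s. H (w, s)) \<in> curves_between At Dom x0 x1)"

text \<open>
  Critical points of the energy on \<open>curves_between At Dom x0 x1\<close>. The integral of a
  non-integrable function is \<open>0\<close> by convention, hence the explicit finiteness condition:
  membership in \<open>Dom\<close> is not required at \<open>s = 0\<close> and \<open>s = 1\<close>, so the energy may be infinite.
\<close>

definition geodesic_between ::
  "('a::topological_space, 'b::euclidean_space) chart set \<Rightarrow> ('a \<times> ('a, 'b) tvec) set \<Rightarrow>
   ('a \<Rightarrow> ('a, 'b) tvec \<Rightarrow> real) \<Rightarrow> 'a \<Rightarrow> 'a \<Rightarrow> (real \<Rightarrow> 'a) \<Rightarrow> bool" where
  "geodesic_between At Dom F x0 x1 \<gamma> \<longleftrightarrow>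
     \<gamma> \<in> curves_between At Dom x0 x1 \<and>
     (\<forall>\<delta> H. variation_of At Dom x0 x1 \<gamma> \<delta> H \<longrightarrow>
        (\<forall>\<^sub>F w in nhds 0. finite_energy At F (\<lambda>s. H (w, s))) \<and>
        ((\<lambda>w. energy At F (\<lambda>s. H (w, s))) has_real_derivative 0) (at 0))"

definition path_dist ::
  "('a::topological_space, 'b::euclidean_space) chart set \<Rightarrow> ('a \<Rightarrow> ('a, 'b) tvec \<Rightarrow> real) \<Rightarrow>
   'a \<Rightarrow> 'a \<Rightarrow> real" where
  "path_dist At F x y = (INF \<gamma>\<in>curves_between At (tangent_bundle At) x y. curve_length At F \<gamma>)"

definition forward_ball ::
  "('a::topological_space, 'b::euclidean_space) chart set \<Rightarrow> ('a \<Rightarrow> ('a, 'b) tvec \<Rightarrow> real) \<Rightarrow>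
   'a \<Rightarrow> real \<Rightarrow> 'a set" where
  "forward_ball At F x r = {z. path_dist At F x z < r}"

definition backward_ball ::
  "('a::topological_space, 'b::euclidean_space) chart set \<Rightarrow> ('a \<Rightarrow> ('a, 'b) tvec \<Rightarrow> real) \<Rightarrow>
   'a \<Rightarrow> real \<Rightarrow> 'a set" where
  "backward_ball At F x r = {z. path_dist At F z x < r}"

text \<open>
  Uniform convergence on \<open>[0,1]\<close> with respect to the Riemannian distance of \<open>g\<close>. Every
  distance inducing the manifold topology gives the same notion when the limit is continuous.
\<close>

definition uniformly_converges ::
  "('a::topological_space, 'b::euclidean_space) chart set \<Rightarrow>
   ('a \<Rightarrow> ('a, 'b) tvec \<Rightarrow> ('a, 'b) tvec \<Rightarrow> real) \<Rightarrow> (nat \<Rightarrow> real \<Rightarrow> 'a) \<Rightarrow> (real \<Rightarrow> 'a) \<Rightarrow> bool" where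
  "uniformly_converges At g \<gamma> \<sigma> \<longleftrightarrow>
     (\<forall>e>0. \<forall>\<^sub>F n in sequentially. \<forall>s\<in>{0..1}.
        path_dist At (\<lambda>x v. sqrt (g x v v)) (\<gamma> n s) (\<sigma> s) < e)"

subsection \<open>Randers-Kropina and Randers metrics\<close>

text \<open>For \<open>v = 0\<close> the formula gives \<open>0\<close>, as \<open>0 / 0 = 0\<close>.\<close>

definition rk_metric ::
  "('a \<Rightarrow> ('a, 'b) tvec \<Rightarrow> ('a, 'b) tvec \<Rightarrow> real) \<Rightarrow> ('a \<Rightarrow> ('a, 'b) tvec \<Rightarrow> real) \<Rightarrow>
   ('a \<Rightarrow> real) \<Rightarrow> 'a \<Rightarrow> ('a, 'b) tvec \<Rightarrow> real" where
  "rk_metric g0 \<omega> \<Lambda> x v =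
     g0 x v v / (- \<omega> x v + sqrt (\<Lambda> x * g0 x v v + (\<omega> x v)\<^sup>2))"

definition rk_domain ::
  "('a, 'b::euclidean_space) chart set \<Rightarrow> ('a \<Rightarrow> ('a, 'b) tvec \<Rightarrow> real) \<Rightarrow> ('a \<Rightarrow> real) \<Rightarrow>
   ('a \<times> ('a, 'b) tvec) set" where
  "rk_domain At \<omega> \<Lambda> =
     {(x, v). v \<in> tangent_space At x \<and> (\<Lambda> x > 0 \<or> \<Lambda> x = 0 \<and> \<omega> x v < 0)}"

definition randers_metric ::
  "('a \<Rightarrow> ('a, 'b) tvec \<Rightarrow> ('a, 'b) tvec \<Rightarrow> real) \<Rightarrow> ('a \<Rightarrow> ('a, 'b) tvec \<Rightarrow> real) \<Rightarrow>
   ('a \<Rightarrow> real) \<Rightarrow> real \<Rightarrow> 'a \<Rightarrow> ('a, 'b) tvec \<Rightarrow> real" where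
  "randers_metric g0 \<omega> \<Lambda> \<epsilon> x v =
     1 / (\<Lambda> x + \<epsilon>) * (sqrt ((\<Lambda> x + \<epsilon>) * g0 x v v + (\<omega> x v)\<^sup>2) + \<omega> x v)"

end

theory Submission
  imports Defs "HOL-Complex_Analysis.Great_Picard"
begin

text \<open>
  \<open>F\<^sub>\<epsilon>\<close> is the Randers-Kropina metric with \<open>\<Lambda> + \<epsilon>\<close> in place of \<open>\<Lambda>\<close>, so the Randers metrics and their limit
  are treated uniformly. In a chart, testing criticality with trapezoidal variations shows that a
  geodesic of speed \<open>k\<close> is constant or solves, with its momentum \<open>p\<close>, the Hamiltonian system
  \<open>y' = k V(y, p)\<close>, \<open>p' = k B(y, p)\<close> of the dual metric, where \<open>V\<close> is homogeneous of degree \<open>0\<close> and \<open>B\<close> of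
  degree \<open>1\<close> in \<open>p\<close>. Both depend smoothly on \<open>\<epsilon> \<ge> 0\<close> as long as \<open>p \<noteq> 0\<close>, which is why the momentum
  formulation survives \<open>\<epsilon> \<rightarrow> 0\<close> although the Lagrangian degenerates.

  Since \<open>F\<^sub>\<epsilon>\<close> decreases in \<open>\<epsilon>\<close>, all \<open>\<sigma>\<^sub>\<epsilon>\<close> lie in a compact intersection of balls and are equicontinuous, so
  a subsequence converges. As \<open>p\<close> matters only up to scale, the momenta may be normalised, and Gronwall's
  inequality gives a limit \<open>\<pi> \<noteq> 0\<close>. The dual norm of \<open>\<pi>\<close> is locally constant along the limit; where it
  vanishes, the limit rests at a zero of \<open>\<Lambda>\<close>. The degenerate parameters are open and closed, hence the
  limit is either a point with \<open>\<Lambda> = 0\<close>, excluded by the hypotheses, or a geodesic of \<open>F\<close>.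

  If \<open>\<Lambda>(x\<^sub>0) = 0\<close>, then \<open>x\<^sub>0\<close> is a minimum of \<open>\<Lambda>\<close> and \<open>d\<Lambda>\<close> vanishes there, so for \<open>x\<^sub>1 = x\<^sub>0\<close> only
  \<open>\<Lambda>(x\<^sub>0) > 0\<close> can occur.
\<close>

text \<open>Where \<Lambda> vanishes, F is defined only on a half-space of vectors and its unit
  sphere reaches the origin. By squaring, F = 1 means g0(v,v) + 2 \<omega>(v) = \<Lambda> + \<mu>: a
  g0-sphere centred at minus the dual vector of \<omega>, with squared radius |\<omega>|^2 +
  \<Lambda> + \<mu>. The radius stays positive at \<mu> = 0 because \<omega> has no zeros, and the
  support function of a round sphere is explicit; this is where \<open>N2\<close>,
  \<open>V1\<close>, \<open>Fs\<close> and \<open>B1\<close> come from and why they are smooth for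
  every nonzero momentum. If \<Lambda> = \<mu> = 0, the sphere passes through the origin, and the
  dual norm of a nonzero p vanishes exactly when p is a positive multiple of \<omega>. Normalising
  the momenta decouples their dual norm from the speed, so the limit carries two numbers, and a zero
  dual norm is the degenerate case.

  Curves are only piecewise smooth and are seen only through charts. Hence momenta are built as
  primitives, which are continuous across corners, and passages from charts to the whole of [0,1]
  are bisection arguments.\<close>

section \<open>Calculus of k times differentiable and smooth maps\<close>

lemma Ck_on_subset: "Ck_on k W f \<Longrightarrow> W' \<subseteq> W \<Longrightarrow> Ck_on k W' f"
  by (induction k arbitrary: f) (auto intro: continuous_on_subset)

lemma smooth_on_subset: "smooth_on W f \<Longrightarrow> W' \<subseteq> W \<Longrightarrow> smooth_on W' f"
  unfolding smooth_on_def using Ck_on_subset by blast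

text \<open>The successor step compares derivatives at a point, and these depend on a whole
  neighbourhood; openness of \<open>W\<close> supplies it.\<close>

lemma Ck_on_cong_imp:
  assumes "open W" "\<And>x. x \<in> W \<Longrightarrow> f x = g x" "Ck_on k W f"
  shows "Ck_on k W g"
  using assms(2,3)
proof (induction k arbitrary: f g)
  case 0
  then show ?case by (simp add: continuous_on_eq)
next
  case (Suc k)
  have d: "(g has_derivative frechet_derivative f (at x)) (at x)" if "x \<in> W" for x
  proof -
    have "(f has_derivative frechet_derivative f (at x)) (at x)"
      using Suc.prems that frechet_derivative_works by auto
    then show ?thesis
      using has_derivative_transform_within_open[OF _ assms(1) that] Suc.prems(1) by blast
  qed
  then have e: "frechet_derivative f (at x) = frechet_derivative g (at x)" if "x \<in> W" for x
    using that frechet_derivative_at by blast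
  have "Ck_on k W (\<lambda>x. frechet_derivative g (at x) v)" for v
    using Suc.IH[of "\<lambda>x. frechet_derivative f (at x) v"] e Suc.prems(2) by simp
  then show ?case
    using d by (auto simp: differentiable_def)
qed

lemma Ck_on_cong:
  assumes "open W" "\<And>x. x \<in> W \<Longrightarrow> f x = g x"
  shows "Ck_on k W f \<longleftrightarrow> Ck_on k W g"
  using Ck_on_cong_imp[OF assms(1), of f g] Ck_on_cong_imp[OF assms(1), of g f] assms(2) by fastforce

lemma smooth_on_cong_imp:
  "open W \<Longrightarrow> (\<And>x. x \<in> W \<Longrightarrow> f x = g x) \<Longrightarrow> smooth_on W f \<Longrightarrow> smooth_on W g"
  unfolding smooth_on_def using Ck_on_cong_imp[of W f g] by blast

lemma Ck_on_Suc_imp: "Ck_on (Suc k) W f \<Longrightarrow> Ck_on k W f"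
proof (induction k arbitrary: f)
  case 0
  then show ?case
    by (auto intro!: differentiable_imp_continuous_on simp: differentiable_on_def differentiable_at_withinI)
next
  case (Suc k)
  then show ?case by (auto simp del: Ck_on.simps(1))
qed

text \<open>Allows a derivative to be exhibited in closed form instead of through
  \<open>frechet_derivative\<close>; the inductions on \<open>k\<close> below run on this
  rule.\<close>

lemma Ck_on_SucI:
  assumes "open W" "\<And>x. x \<in> W \<Longrightarrow> (f has_derivative f' x) (at x)" "\<And>v. Ck_on k W (\<lambda>x. f' x v)"
  shows "Ck_on (Suc k) W f"
proof -
  have e: "frechet_derivative f (at x) = f' x" if "x \<in> W" for x
    using assms(2)[OF that] frechet_derivative_at by metis
  have "Ck_on k W (\<lambda>x. frechet_derivative f (at x) v)" for v
    using Ck_on_cong_imp[OF assms(1) _ assms(3)[of v]] e by simp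
  then show ?thesis
    using assms(2) by (auto simp: differentiable_def)
qed

lemma Ck_on_SucD:
  assumes "Ck_on (Suc k) W f"
  shows "x \<in> W \<Longrightarrow> (f has_derivative frechet_derivative f (at x)) (at x)"
    and "Ck_on k W (\<lambda>x. frechet_derivative f (at x) v)"
  using assms frechet_derivative_works by auto

lemma Ck_on_continuous: "Ck_on k W f \<Longrightarrow> continuous_on W f"
  by (induction k) (use Ck_on_Suc_imp in \<open>auto simp del: Ck_on.simps(2)\<close>)

lemma smooth_on_continuous: "smooth_on W f \<Longrightarrow> continuous_on W f"
  unfolding smooth_on_def using Ck_on_continuous by blast

lemma smooth_onD:
  assumes "smooth_on W f"
  shows "x \<in> W \<Longrightarrow> (f has_derivative frechet_derivative f (at x)) (at x)"
    and "smooth_on W (\<lambda>x. frechet_derivative f (at x) v)"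
proof -
  have "Ck_on (Suc k) W f" for k
    using assms smooth_on_def by blast
  then show "x \<in> W \<Longrightarrow> (f has_derivative frechet_derivative f (at x)) (at x)"
    and "smooth_on W (\<lambda>x. frechet_derivative f (at x) v)"
    using Ck_on_SucD unfolding smooth_on_def by blast+
qed

lemma Ck_on_const: "open W \<Longrightarrow> Ck_on k W (\<lambda>x. c)"
proof (induction k arbitrary: c)
  case (Suc k)
  then show ?case
    by (intro Ck_on_SucI[where f' = "\<lambda>x v. 0"]) auto
qed auto

lemma Ck_on_linear: "open W \<Longrightarrow> bounded_linear f \<Longrightarrow> Ck_on k W f"
proof (cases k)
  case 0
  assume "bounded_linear f"
  then show ?thesis using 0 by (simp add: linear_continuous_on)
next
  case (Suc k)
  assume "open W" "bounded_linear f"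
  then show ?thesis unfolding Suc
    by (intro Ck_on_SucI[where f' = "\<lambda>x. f"] Ck_on_const) (auto intro: bounded_linear_imp_has_derivative)
qed

lemma Ck_on_add:
  assumes "open W"
  shows "Ck_on k W f \<Longrightarrow> Ck_on k W g \<Longrightarrow> Ck_on k W (\<lambda>x. f x + g x)"
proof (induction k arbitrary: f g)
  case 0 then show ?case by (auto intro: continuous_intros)
next
  case (Suc k)
  show ?case
    by (rule Ck_on_SucI[OF assms has_derivative_add, OF Ck_on_SucD(1)[OF Suc.prems(1)] Ck_on_SucD(1)[OF Suc.prems(2)]])
      (auto intro!: Suc.IH Ck_on_SucD(2) simp del: Ck_on.simps simp: Suc.prems)
qed

lemma Ck_on_bilinear:
  assumes "open W" "bounded_bilinear B"
  shows "Ck_on k W f \<Longrightarrow> Ck_on k W g \<Longrightarrow> Ck_on k W (\<lambda>x. B (f x) (g x))"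
proof (induction k arbitrary: f g)
  case 0 then show ?case by (auto intro: bounded_bilinear.continuous_on[OF assms(2)])
next
  case (Suc k)
  show ?case
    by (rule Ck_on_SucI[OF assms(1) bounded_bilinear.FDERIV[OF assms(2)],
          OF Ck_on_SucD(1)[OF Suc.prems(1)] Ck_on_SucD(1)[OF Suc.prems(2)]])
      (assumption+, intro Ck_on_add[OF assms(1)] Suc.IH Ck_on_SucD(2)[OF Suc.prems(1)] Ck_on_SucD(2)[OF Suc.prems(2)]
        Ck_on_Suc_imp[OF Suc.prems(1)] Ck_on_Suc_imp[OF Suc.prems(2)])
qed

lemma Ck_on_bounded_linear:
  assumes "open W" "bounded_linear L"
  shows "Ck_on k W f \<Longrightarrow> Ck_on k W (\<lambda>x. L (f x))"
proof (induction k arbitrary: f)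
  case 0 then show ?case by (auto intro: bounded_linear.continuous_on[OF assms(2)])
next
  case (Suc k)
  show ?case
    by (rule Ck_on_SucI[OF assms(1) bounded_linear.has_derivative[OF assms(2)],
          OF Ck_on_SucD(1)[OF Suc.prems(1)]])
      (auto intro!: Suc.IH Ck_on_SucD(2) simp del: Ck_on.simps simp: Suc.prems)
qed

lemma Ck_on_sum:
  assumes "open W" "\<And>i. i \<in> I \<Longrightarrow> Ck_on k W (f i)"
  shows "Ck_on k W (\<lambda>x. \<Sum>i\<in>I. f i x)"
  using assms(2) by (induction I rule: infinite_finite_induct) (auto intro: Ck_on_const Ck_on_add assms(1))

lemma linear_euclidean_sum:
  fixes L :: "'e::euclidean_space \<Rightarrow> 'f::real_vector"
  assumes "linear L"
  shows "L v = (\<Sum>i\<in>Basis. (v \<bullet> i) *\<^sub>R L i)"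
proof -
  have "L v = L (\<Sum>i\<in>Basis. (v \<bullet> i) *\<^sub>R i)" by (simp add: euclidean_representation)
  then show ?thesis using assms by (simp add: linear_sum linear_scale)
qed

text \<open>The chain rule applies a varying linear map to a varying vector. Expanding that vector
  in the basis leaves products of scalar coordinates with derivatives of \<open>g\<close> along
  fixed vectors, and to these the induction hypothesis applies.\<close>

lemma Ck_on_compose:
  fixes f :: "'e::euclidean_space \<Rightarrow> 'f::euclidean_space" and g :: "'f \<Rightarrow> 'g::real_normed_vector"
  assumes "open W" "open V" "f ` W \<subseteq> V"
  shows "Ck_on k W f \<Longrightarrow> Ck_on k V g \<Longrightarrow> Ck_on k W (\<lambda>x. g (f x))"
proof (induction k arbitrary: g)
  case 0 then show ?case using assms(3) by (auto intro: continuous_on_compose2)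
next
  case (Suc k)
  have fV: "f x \<in> V" if "x \<in> W" for x using assms(3) that by auto
  have *: "frechet_derivative g (at (f x)) (frechet_derivative f (at x) v) =
    (\<Sum>i\<in>Basis. (frechet_derivative f (at x) v \<bullet> i) *\<^sub>R frechet_derivative g (at (f x)) i)" if "x \<in> W" for x v
    using linear_euclidean_sum[OF has_derivative_linear[OF Ck_on_SucD(1)[OF Suc.prems(2) fV[OF that]]]] .
  have "Ck_on k W (\<lambda>x. \<Sum>i\<in>Basis. (frechet_derivative f (at x) v \<bullet> i) *\<^sub>R frechet_derivative g (at (f x)) i)" for v
    by (intro Ck_on_sum assms(1) Ck_on_bilinear[OF _ bounded_bilinear_scaleR]
        Ck_on_bounded_linear[OF _ bounded_linear_inner_left] Ck_on_SucD(2)[OF Suc.prems(1)]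
        Suc.IH[OF Ck_on_Suc_imp[OF Suc.prems(1)] Ck_on_SucD(2)[OF Suc.prems(2)]])
  then have "Ck_on k W (\<lambda>x. frechet_derivative g (at (f x)) (frechet_derivative f (at x) v))" for v
    using * by (subst Ck_on_cong[OF assms(1)]) auto
  moreover have "((\<lambda>x. g (f x)) has_derivative (\<lambda>v. frechet_derivative g (at (f x)) (frechet_derivative f (at x) v))) (at x)"
    if "x \<in> W" for x
    using has_derivative_compose[OF Ck_on_SucD(1)[OF Suc.prems(1) that] Ck_on_SucD(1)[OF Suc.prems(2) fV[OF that]]] .
  ultimately show ?case by (intro Ck_on_SucI[OF assms(1)])
qed

text \<open>The derivative is a polynomial in the function itself, so the induction closes.\<close>

lemma Ck_on_inverse: "Ck_on k {0<..} (inverse :: real \<Rightarrow> real)"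
proof (induction k)
  case 0 then show ?case by (auto intro!: continuous_intros)
next
  case (Suc k)
  show ?case
    by (rule Ck_on_SucI[where f' = "\<lambda>x v. - (inverse x * v * inverse x)"])
      (auto intro!: Ck_on_bounded_linear[OF _ bounded_linear_minus[OF bounded_linear_ident]] Ck_on_bilinear[OF _ bounded_bilinear_mult] Suc Ck_on_const has_derivative_inverse' simp del: Ck_on.simps)
qed

lemma Ck_on_sqrt: "Ck_on k {0<..} sqrt"
proof (induction k)
  case 0 then show ?case by (auto intro!: continuous_intros)
next
  case (Suc k)
  have "Ck_on k {0<..} (\<lambda>x. inverse (2 * sqrt x))"
    by (rule Ck_on_compose[where V = "{0<..}"])
      (auto intro!: Ck_on_bilinear[OF _ bounded_bilinear_mult] Suc Ck_on_const Ck_on_inverse simp del: Ck_on.simps)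
  then have "Ck_on k {0<..} (\<lambda>x. v * inverse (2 * sqrt x))" for v
    by (rule Ck_on_bilinear[OF open_greaterThan bounded_bilinear_mult Ck_on_const[OF open_greaterThan]])
  then show ?case
    by (intro Ck_on_SucI[where f' = "\<lambda>x v. v * inverse (2 * sqrt x)"])
      (auto simp del: Ck_on.simps intro!: derivative_eq_intros simp: field_simps)
qed

named_theorems smooth_intros

lemma smooth_on_const [smooth_intros]: "open W \<Longrightarrow> smooth_on W (\<lambda>x. c)"
  by (simp add: smooth_on_def Ck_on_const)

lemma smooth_on_linear: "open W \<Longrightarrow> bounded_linear f \<Longrightarrow> smooth_on W f"
  by (simp add: smooth_on_def Ck_on_linear)

lemma smooth_on_id [smooth_intros]: "open W \<Longrightarrow> smooth_on W (\<lambda>x. x)"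
  by (simp add: smooth_on_linear bounded_linear_ident)

lemma smooth_on_fst [smooth_intros]: "open W \<Longrightarrow> smooth_on W fst"
  and smooth_on_snd [smooth_intros]: "open W \<Longrightarrow> smooth_on W snd"
  by (simp_all add: smooth_on_linear bounded_linear_fst bounded_linear_snd)

lemma smooth_on_add [smooth_intros]:
  "open W \<Longrightarrow> smooth_on W f \<Longrightarrow> smooth_on W g \<Longrightarrow> smooth_on W (\<lambda>x. f x + g x)"
  by (simp add: smooth_on_def Ck_on_add)

lemma smooth_on_bilinear:
  "open W \<Longrightarrow> bounded_bilinear B \<Longrightarrow> smooth_on W f \<Longrightarrow> smooth_on W g \<Longrightarrow> smooth_on W (\<lambda>x. B (f x) (g x))"
  by (simp add: smooth_on_def Ck_on_bilinear)

lemmas smooth_on_scaleR [smooth_intros] = smooth_on_bilinear[OF _ bounded_bilinear_scaleR]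
  and smooth_on_mult [smooth_intros] = smooth_on_bilinear[OF _ bounded_bilinear_mult]
  and smooth_on_inner [smooth_intros] = smooth_on_bilinear[OF _ bounded_bilinear_inner]

lemma smooth_on_bounded_linear:
  "open W \<Longrightarrow> bounded_linear L \<Longrightarrow> smooth_on W f \<Longrightarrow> smooth_on W (\<lambda>x. L (f x))"
  by (simp add: smooth_on_def Ck_on_bounded_linear)

lemma smooth_on_minus [smooth_intros]:
  "open W \<Longrightarrow> smooth_on W f \<Longrightarrow> smooth_on W (\<lambda>x. - f x)"
  by (rule smooth_on_bounded_linear[OF _ bounded_linear_minus[OF bounded_linear_ident]])

lemma smooth_on_diff [smooth_intros]:
  "open W \<Longrightarrow> smooth_on W f \<Longrightarrow> smooth_on W g \<Longrightarrow> smooth_on W (\<lambda>x. f x - g x)"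
  using smooth_on_add[of W f "\<lambda>x. - g x"] smooth_on_minus[of W g] by simp

lemma smooth_on_sum [smooth_intros]:
  "open W \<Longrightarrow> (\<And>i. i \<in> I \<Longrightarrow> smooth_on W (f i)) \<Longrightarrow> smooth_on W (\<lambda>x. \<Sum>i\<in>I. f i x)"
  by (simp add: smooth_on_def Ck_on_sum)

lemma smooth_on_compose:
  fixes f :: "'e::euclidean_space \<Rightarrow> 'f::euclidean_space" and g :: "'f \<Rightarrow> 'g::real_normed_vector"
  shows "open W \<Longrightarrow> open V \<Longrightarrow> f ` W \<subseteq> V \<Longrightarrow> smooth_on W f \<Longrightarrow> smooth_on V g \<Longrightarrow> smooth_on W (\<lambda>x. g (f x))"
  by (simp add: smooth_on_def Ck_on_compose)

lemma smooth_on_sqrt [smooth_intros]: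
  "open W \<Longrightarrow> smooth_on W f \<Longrightarrow> (\<And>x. x \<in> W \<Longrightarrow> f x > 0) \<Longrightarrow> smooth_on W (\<lambda>x. sqrt (f x))"
  by (rule smooth_on_compose[where V = "{0<..}"]) (auto simp: smooth_on_def Ck_on_sqrt simp del: Ck_on.simps)

lemma smooth_on_divide [smooth_intros]:
  fixes f g :: "'e::euclidean_space \<Rightarrow> real"
  assumes "open W" "smooth_on W f" "smooth_on W g" "\<And>x. x \<in> W \<Longrightarrow> g x > 0"
  shows "smooth_on W (\<lambda>x. f x / g x)"
proof -
  have "smooth_on W (\<lambda>x. inverse (g x))"
    by (rule smooth_on_compose[where V = "{0<..}" and f = g])
      (use assms in \<open>auto simp: smooth_on_def Ck_on_inverse simp del: Ck_on.simps\<close>)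
  then show ?thesis
    unfolding divide_inverse by (intro smooth_on_mult assms)
qed

lemma smooth_on_Pair [smooth_intros]:
  fixes f :: "'e::euclidean_space \<Rightarrow> 'f::real_normed_vector" and g :: "'e \<Rightarrow> 'g::real_normed_vector"
  assumes "open W" "smooth_on W f" "smooth_on W g"
  shows "smooth_on W (\<lambda>x. (f x, g x))"
proof -
  have "smooth_on W (\<lambda>x. (f x, 0::'g) + (0::'f, g x))"
    by (rule smooth_on_add[OF assms(1) smooth_on_bounded_linear[OF assms(1) _ assms(2)]
          smooth_on_bounded_linear[OF assms(1) _ assms(3)]])
      (auto intro: bounded_linear_Pair bounded_linear_ident bounded_linear_zero)
  then show ?thesis by simp
qed

lemma continuous_on_frechet:
  fixes f :: "'e::euclidean_space \<Rightarrow> 'g::real_normed_vector"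
  assumes "smooth_on W f" "continuous_on S y" "continuous_on S v" "y ` S \<subseteq> W"
  shows "continuous_on S (\<lambda>x. frechet_derivative f (at (y x)) (v x))"
proof -
  have "continuous_on S (\<lambda>x. \<Sum>i\<in>Basis. (v x \<bullet> i) *\<^sub>R frechet_derivative f (at (y x)) i)"
    by (intro continuous_intros assms continuous_on_compose2[OF smooth_on_continuous[OF smooth_onD(2)[OF assms(1)]] assms(2,4)])
  moreover have "(\<Sum>i\<in>Basis. (v x \<bullet> i) *\<^sub>R frechet_derivative f (at (y x)) i) = frechet_derivative f (at (y x)) (v x)" if "x \<in> S" for x
    using linear_euclidean_sum[OF has_derivative_linear[OF smooth_onD(1)[OF assms(1)]], of "y x"] assms(4) that
    by (metis image_subset_iff)
  ultimately show ?thesis by simp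
qed

text \<open>Bootstrapping: the right-hand side composed with \<open>z\<close> is as regular as
  \<open>z\<close>, and it is the derivative of \<open>z\<close>, so each order of differentiability
  yields the next.\<close>

lemma smooth_ode_solution:
  fixes z :: "real \<Rightarrow> 'e::euclidean_space"
  assumes "open W" "smooth_on W f" "open I" "z ` I \<subseteq> W"
    and "\<And>s. s \<in> I \<Longrightarrow> (z has_vector_derivative f (z s)) (at s)"
  shows "smooth_on I z"
proof -
  have "Ck_on k I z" for k
  proof (induction k)
    case 0
    have "continuous_on I z"
      using assms(5) by (intro continuous_at_imp_continuous_on) (blast intro: has_vector_derivative_continuous)
    then show ?case by simp
  next
    case (Suc k)
    have "Ck_on k I (\<lambda>s. f (z s))"
      using Ck_on_compose[OF assms(3,1,4) Suc] assms(2) smooth_on_def by blast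
    then show ?case
      by (intro Ck_on_SucI[OF assms(3), where f' = "\<lambda>s v. v *\<^sub>R f (z s)"])
        (use assms(5) in \<open>auto simp: has_vector_derivative_def assms(3) simp del: Ck_on.simps
           intro!: Ck_on_bilinear[OF _ bounded_bilinear_scaleR] Ck_on_const\<close>)
  qed
  then show ?thesis by (simp add: smooth_on_def)
qed

text \<open>Bisection with all intervals confined to \<open>{a..b}\<close>, so that the predicates
  glued with it need no meaning outside the parameter interval.\<close>

lemma Bolzano_within:
  fixes P :: "real \<Rightarrow> real \<Rightarrow> bool"
  assumes ab: "a \<le> b"
    and trans: "\<And>u v w. P u v \<Longrightarrow> P v w \<Longrightarrow> a \<le> u \<Longrightarrow> u \<le> v \<Longrightarrow> v \<le> w \<Longrightarrow> w \<le> b \<Longrightarrow> P u w"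
    and local: "\<And>x. a \<le> x \<Longrightarrow> x \<le> b \<Longrightarrow>
      \<exists>d>0. \<forall>u v. a \<le> u \<and> u \<le> x \<and> x \<le> v \<and> v \<le> b \<and> v - u < d \<longrightarrow> P u v"
  shows "P a b"
proof -
  have "a \<le> a \<and> b \<le> b \<longrightarrow> P a b"
  proof (rule Bolzano[OF ab, where P = "\<lambda>u v. a \<le> u \<and> v \<le> b \<longrightarrow> P u v"])
    fix u v w
    assume "a \<le> u \<and> v \<le> b \<longrightarrow> P u v" "a \<le> v \<and> w \<le> b \<longrightarrow> P v w" "u \<le> v" "v \<le> w"
    then show "a \<le> u \<and> w \<le> b \<longrightarrow> P u w" using trans by auto
  next
    fix x assume "a \<le> x" "x \<le> b"
    then show "\<exists>d>0. \<forall>u v. u \<le> x \<and> x \<le> v \<and> v - u < d \<longrightarrow> a \<le> u \<and> v \<le> b \<longrightarrow> P u v"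
      using local by meson
  qed
  then show ?thesis by simp
qed

text \<open>The term of the product rule that contains the derivative of \<open>g\<close> is
  multiplied by \<open>f x = 0\<close>, so continuity of \<open>g\<close> is enough. This is how
  \<open>sharp\<close> is differentiated when only its continuity is known.\<close>

lemma has_derivative_mult_vanishing:
  fixes f :: "'e::real_normed_vector \<Rightarrow> real" and g :: "'e \<Rightarrow> 'g::real_normed_vector"
  assumes "(f has_derivative f') (at x)" "f x = 0" "isCont g x"
  shows "((\<lambda>y. f y *\<^sub>R g y) has_derivative (\<lambda>h. f' h *\<^sub>R g x)) (at x)"
proof -
  obtain K where K: "\<And>h. norm (f' h) \<le> norm h * K"
    using has_derivative_bounded_linear[OF assms(1)] bounded_linear.bounded by blast
  have bl: "bounded_linear (\<lambda>h. f' h *\<^sub>R g x)"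
    by (rule bounded_linear_compose[OF bounded_linear_scaleR_left has_derivative_bounded_linear[OF assms(1)]])
  define r where "r y = norm (f y - f x - f' (y - x)) / norm (y - x)" for y
  have r: "(r \<longlongrightarrow> 0) (at x)"
    using assms(1) unfolding has_derivative_iff_norm r_def by simp
  have g: "(g \<longlongrightarrow> g x) (at x)" using assms(3) isCont_def by blast
  have lim: "((\<lambda>y. r y * norm (g y) + \<bar>K\<bar> * norm (g y - g x)) \<longlongrightarrow> 0 * norm (g x) + \<bar>K\<bar> * norm (g x - g x)) (at x)"
    by (intro tendsto_intros r g)
  have "((\<lambda>y. norm (f y *\<^sub>R g y - f x *\<^sub>R g x - f' (y - x) *\<^sub>R g x) / norm (y - x)) \<longlongrightarrow> 0) (at x)"
  proof (rule tendsto_sandwich[OF _ _ tendsto_const])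
    show "\<forall>\<^sub>F y in at x. 0 \<le> norm (f y *\<^sub>R g y - f x *\<^sub>R g x - f' (y - x) *\<^sub>R g x) / norm (y - x)"
      by simp
    show "\<forall>\<^sub>F y in at x. norm (f y *\<^sub>R g y - f x *\<^sub>R g x - f' (y - x) *\<^sub>R g x) / norm (y - x)
        \<le> r y * norm (g y) + \<bar>K\<bar> * norm (g y - g x)"
    proof (rule eventually_at_topological[THEN iffD2], intro exI[of _ UNIV] conjI ballI impI)
      fix y assume "y \<noteq> x"
      then have n: "norm (y - x) > 0" by simp
      have e: "f y *\<^sub>R g y - f x *\<^sub>R g x - f' (y - x) *\<^sub>R g x = (f y - f x - f' (y - x)) *\<^sub>R g y + f' (y - x) *\<^sub>R (g y - g x)"
        using assms(2) by (simp add: algebra_simps)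
      have "norm (f y *\<^sub>R g y - f x *\<^sub>R g x - f' (y - x) *\<^sub>R g x)
        \<le> norm (f y - f x - f' (y - x)) * norm (g y) + norm (f' (y - x)) * norm (g y - g x)"
        unfolding e by (rule order_trans[OF norm_triangle_ineq]) simp
      also have "norm (f' (y - x)) * norm (g y - g x) \<le> (norm (y - x) * \<bar>K\<bar>) * norm (g y - g x)"
        by (intro mult_right_mono order_trans[OF K]) (auto intro: mult_left_mono)
      finally have a: "norm (f y *\<^sub>R g y - f x *\<^sub>R g x - f' (y - x) *\<^sub>R g x)
        \<le> norm (f y - f x - f' (y - x)) * norm (g y) + (norm (y - x) * \<bar>K\<bar>) * norm (g y - g x)"
        by simp
      have b: "norm (f y - f x - f' (y - x)) * norm (g y) + (norm (y - x) * \<bar>K\<bar>) * norm (g y - g x)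
          = (r y * norm (g y) + \<bar>K\<bar> * norm (g y - g x)) * norm (y - x)"
        using n by (simp add: r_def field_simps)
      show "norm (f y *\<^sub>R g y - f x *\<^sub>R g x - f' (y - x) *\<^sub>R g x) / norm (y - x)
        \<le> r y * norm (g y) + \<bar>K\<bar> * norm (g y - g x)"
        using a unfolding b by (simp add: pos_divide_le_eq[OF n])
    qed simp_all
  qed (use lim in simp)
  then show ?thesis
    using bl unfolding has_derivative_iff_norm by simp
qed

section \<open>The dual metric in a chart\<close>

text \<open>\<open>G\<close>, \<open>w\<close> and \<open>l\<close> stand for the coordinate
  expressions of the Riemannian metric, the one-form and \<Lambda> on the image \<open>Y\<close> of
  a chart.\<close>

locale rk_chart =
  fixes Y :: "'b::euclidean_space set" and G :: "'b \<Rightarrow> 'b \<Rightarrow> 'b \<Rightarrow> real"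
    and w :: "'b \<Rightarrow> 'b \<Rightarrow> real" and l :: "'b \<Rightarrow> real"
  assumes open_Y: "open Y"
    and G_linear: "y \<in> Y \<Longrightarrow> linear (G y e)"
    and G_sym: "y \<in> Y \<Longrightarrow> G y e e' = G y e' e"
    and G_pos: "y \<in> Y \<Longrightarrow> e \<noteq> 0 \<Longrightarrow> G y e e > 0"
    and w_linear: "y \<in> Y \<Longrightarrow> linear (w y)"
    and w_nonzero: "y \<in> Y \<Longrightarrow> \<exists>e. w y e \<noteq> 0"
    and l_nonneg: "y \<in> Y \<Longrightarrow> l y \<ge> 0"
    and G_smooth: "smooth_on Y (\<lambda>y. G y e e')"
    and w_smooth: "smooth_on Y (\<lambda>y. w y e)"
    and l_smooth: "smooth_on Y l"
begin

text \<open>The musical isomorphisms of \<open>G\<close>. Covectors are stored as vectors through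
  the Euclidean inner product; \<open>wvec y\<close> is the covector \<open>w y\<close> in this
  form.\<close>

definition flat :: "'b \<Rightarrow> 'b \<Rightarrow> 'b" where "flat y u = (\<Sum>i\<in>Basis. G y u i *\<^sub>R i)"
definition sharp :: "'b \<Rightarrow> 'b \<Rightarrow> 'b" where "sharp y = inv (flat y)"
definition wvec :: "'b \<Rightarrow> 'b" where "wvec y = (\<Sum>i\<in>Basis. w y i *\<^sub>R i)"

lemma G_nonneg: "y \<in> Y \<Longrightarrow> G y e e \<ge> 0"
  using G_pos[of y e] linear_0[OF G_linear[of y e]] by (cases "e = 0") auto

lemma G_linear_left: assumes "y \<in> Y" shows "linear (\<lambda>e. G y e e')"
proof -
  have "(\<lambda>e. G y e e') = G y e'" using G_sym[OF assms] by auto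
  then show ?thesis using G_linear[OF assms] by simp
qed

lemma inner_flat: "y \<in> Y \<Longrightarrow> flat y u \<bullet> e = G y u e"
  using linear_euclidean_sum[OF G_linear[of y u], of e]
  by (simp add: flat_def inner_sum_left inner_commute[of e] mult.commute)

lemma inner_wvec: "y \<in> Y \<Longrightarrow> wvec y \<bullet> e = w y e"
  using linear_euclidean_sum[OF w_linear[of y], of e]
  by (simp add: wvec_def inner_sum_left inner_commute[of e] mult.commute)

lemma flat_linear: "y \<in> Y \<Longrightarrow> linear (flat y)"
  unfolding flat_def
  by (intro linear_compose_sum ballI) (auto simp: linear_iff algebra_simps linear_add[OF G_linear_left] linear_scale[OF G_linear_left])

lemma flat_inj: "y \<in> Y \<Longrightarrow> inj (flat y)"
proof (subst linear_injective_0[OF flat_linear], assumption, safe)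
  fix u assume "y \<in> Y" "flat y u = 0"
  then have "G y u u = 0" using inner_flat[of y u u] by simp
  then show "u = 0" using G_pos[OF \<open>y \<in> Y\<close>, of u] by force
qed

lemma flat_sharp: "y \<in> Y \<Longrightarrow> flat y (sharp y p) = p"
  unfolding sharp_def
  using linear_injective_imp_surjective[OF flat_linear flat_inj] by (simp add: surj_f_inv_f)

lemma sharp_flat: "y \<in> Y \<Longrightarrow> sharp y (flat y u) = u"
  unfolding sharp_def using flat_inj by simp

lemma sharp_linear: assumes "y \<in> Y" shows "linear (sharp y)"
proof (rule linearI)
  fix p q r
  show "sharp y (p + q) = sharp y p + sharp y q"
    using sharp_flat[OF assms, of "sharp y p + sharp y q"] linear_add[OF flat_linear[OF assms]] flat_sharp[OF assms] by simp
  show "sharp y (r *\<^sub>R p) = r *\<^sub>R sharp y p"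
    using sharp_flat[OF assms, of "r *\<^sub>R sharp y p"] linear_scale[OF flat_linear[OF assms]] flat_sharp[OF assms] by simp
qed

lemma G_sharp: "y \<in> Y \<Longrightarrow> G y (sharp y p) e = p \<bullet> e"
  using inner_flat[of y "sharp y p" e] flat_sharp by simp

lemma sharp_sym: "y \<in> Y \<Longrightarrow> p \<bullet> sharp y q = q \<bullet> sharp y p"
  using G_sharp[of y p "sharp y q"] G_sharp[of y q "sharp y p"] G_sym by simp

lemma sharp_pos: "y \<in> Y \<Longrightarrow> p \<noteq> 0 \<Longrightarrow> p \<bullet> sharp y p > 0"
proof -
  assume a: "y \<in> Y" "p \<noteq> 0"
  then have "sharp y p \<noteq> 0" using flat_sharp[of y p] linear_0[OF flat_linear] by force
  then show ?thesis using G_pos[OF a(1), of "sharp y p"] G_sharp[OF a(1)] by simp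
qed

lemma wvec_nonzero: "y \<in> Y \<Longrightarrow> wvec y \<noteq> 0"
  using w_nonzero[of y] inner_wvec[of y] by force

lemma G_expand: "y \<in> Y \<Longrightarrow> G y u v = (\<Sum>i\<in>Basis. \<Sum>j\<in>Basis. (u \<bullet> i) * (v \<bullet> j) * G y i j)"
  by (subst linear_euclidean_sum[OF G_linear_left], assumption, subst linear_euclidean_sum[OF G_linear], assumption)
    (simp add: sum_distrib_left mult.assoc)

lemma G_continuous:
  assumes "continuous_on S y" "continuous_on S u" "continuous_on S v" "y ` S \<subseteq> Y"
  shows "continuous_on S (\<lambda>x. G (y x) (u x) (v x))"
proof -
  have "continuous_on S (\<lambda>x. \<Sum>i\<in>Basis. \<Sum>j\<in>Basis. (u x \<bullet> i) * (v x \<bullet> j) * G (y x) i j)"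
    by (intro continuous_intros assms continuous_on_compose2[OF smooth_on_continuous[OF G_smooth] assms(1,4)])
  then show ?thesis
    by (rule continuous_on_eq) (rule G_expand[symmetric], use assms(4) in auto)
qed

text \<open>By homogeneity it suffices to take the minimum over the compact set of pairs of a point
  of \<open>C\<close> and a unit vector.\<close>

lemma G_lower_bound:
  assumes "compact C" "C \<subseteq> Y"
  obtains m where "m > 0" "\<And>y u. y \<in> C \<Longrightarrow> G y u u \<ge> m * (norm u)\<^sup>2"
proof (cases "C = {}")
  case True
  show ?thesis using that[of 1] True by simp
next
  case False
  let ?S = "C \<times> sphere (0::'b) 1"
  \<comment> \<open>A basis vector shows that the unit sphere is nonempty, so that the minimum is
    attained.\<close>
  obtain b :: 'b where "b \<in> Basis" by (metis all_not_in_conv nonempty_Basis)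
  then have ne: "?S \<noteq> {}" using False by (auto intro: norm_Basis)
  have "continuous_on ?S (\<lambda>z. G (fst z) (snd z) (snd z))"
    using assms(2) by (intro G_continuous continuous_intros) auto
  then obtain z where z: "z \<in> ?S" "\<And>x. x \<in> ?S \<Longrightarrow> G (fst z) (snd z) (snd z) \<le> G (fst x) (snd x) (snd x)"
    using continuous_attains_inf[OF compact_Times[OF assms(1) compact_sphere] ne] by blast
  define m where "m = G (fst z) (snd z) (snd z)"
  have "snd z \<noteq> 0" using z(1) by auto
  then have m: "m > 0" using G_pos z(1) assms(2) m_def by auto
  have "G y u u \<ge> m * (norm u)\<^sup>2" if "y \<in> C" for y u
  proof (cases "u = 0")
    case True then show ?thesis using G_nonneg that assms(2) by auto
  next
    case False
    have yY: "y \<in> Y" using that assms(2) by auto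
    have "m \<le> G y (u /\<^sub>R norm u) (u /\<^sub>R norm u)"
      using z(2)[of "(y, u /\<^sub>R norm u)"] that False by (simp add: m_def)
    also have "\<dots> = G y u u / (norm u)\<^sup>2"
      by (simp add: linear_scale[OF G_linear[OF yY]] linear_scale[OF G_linear_left[OF yY]] power2_eq_square field_simps)
    finally show ?thesis using False by (simp add: field_simps)
  qed
  then show ?thesis using that m by blast
qed

text \<open>With u = \<open>sharp y p\<close>, the lower bound of \<open>G\<close> gives m |u|^2
  \<le> G(u,u) = p \<bullet> u \<le> |p| |u|.\<close>

lemma sharp_bound:
  assumes "compact C" "C \<subseteq> Y"
  obtains M where "M > 0" "\<And>y p. y \<in> C \<Longrightarrow> norm (sharp y p) \<le> M * norm p"
proof -
  obtain m where m: "m > 0" "\<And>y u. y \<in> C \<Longrightarrow> G y u u \<ge> m * (norm u)\<^sup>2"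
    using G_lower_bound[OF assms] by blast
  have "norm (sharp y p) \<le> (1 / m) * norm p" if "y \<in> C" for y p
  proof -
    have "m * (norm (sharp y p))\<^sup>2 \<le> p \<bullet> sharp y p"
      using m(2)[OF that, of "sharp y p"] G_sharp[of y p "sharp y p"] that assms(2) by auto
    also have "\<dots> \<le> norm p * norm (sharp y p)" by (rule norm_cauchy_schwarz)
    finally have "m * norm (sharp y p) * norm (sharp y p) \<le> norm p * norm (sharp y p)"
      by (simp add: power2_eq_square mult.assoc)
    then have "m * norm (sharp y p) \<le> norm p"
      by (cases "norm (sharp y p) = 0") (auto simp: mult_le_cancel_right)
    then show ?thesis using m(1) by (simp add: field_simps)
  qed
  then show ?thesis using that[of "1 / m"] m(1) by simp
qed

lemma G_has_derivative: "y \<in> Y \<Longrightarrow> ((\<lambda>y. G y u v) has_derivative frechet_derivative (\<lambda>y. G y u v) (at y)) (at y)"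
  using smooth_onD(1)[OF G_smooth] .

text \<open>The resolvent identity for the inverses of two linear maps, with the difference of the
  maps expanded in the basis.\<close>

lemma sharp_difference:
  assumes "y \<in> Y" "y' \<in> Y"
  shows "sharp y' p - sharp y p = - (\<Sum>i\<in>Basis. (G y' (sharp y p) i - G y (sharp y p) i) *\<^sub>R sharp y' i)"
proof -
  have "(\<Sum>i\<in>Basis. (G y' (sharp y p) i - G y (sharp y p) i) *\<^sub>R sharp y' i)
    = sharp y' (flat y' (sharp y p) - flat y (sharp y p))"
    by (subst (2) linear_euclidean_sum[OF sharp_linear[OF assms(2)]])
      (simp add: inner_diff_left inner_flat assms)
  also have "\<dots> = sharp y p - sharp y' p"
    by (simp add: linear_diff[OF sharp_linear] assms sharp_flat flat_sharp)
  finally show ?thesis by simp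
qed

text \<open>In \<open>sharp_difference\<close> the coefficients tend to 0 by continuity of
  \<open>G\<close>, while \<open>sharp_bound\<close> keeps the vectors bounded near
  \<open>y\<close>.\<close>

lemma sharp_isCont:
  assumes "y \<in> Y" shows "isCont (\<lambda>y. sharp y p) y"
proof -
  obtain r where r: "r > 0" "cball y r \<subseteq> Y" using open_Y assms open_contains_cball by blast
  obtain M where M: "M > 0" "\<And>y' p. y' \<in> cball y r \<Longrightarrow> norm (sharp y' p) \<le> M * norm p"
    using sharp_bound[OF compact_cball r(2)] by blast
  have cont: "isCont (\<lambda>y'. G y' (sharp y p) i) y" for i
    using smooth_on_continuous[OF G_smooth] open_Y assms continuous_on_eq_continuous_at by blast
  have "((\<lambda>y'. \<Sum>i\<in>Basis. \<bar>G y' (sharp y p) i - G y (sharp y p) i\<bar> * M) \<longlongrightarrow> (\<Sum>i\<in>(Basis::'b set). \<bar>G y (sharp y p) i - G y (sharp y p) i\<bar> * M)) (at y)"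
    using cont by (intro tendsto_intros) (simp add: isCont_def)
  then have lim: "((\<lambda>y'. \<Sum>i\<in>Basis. \<bar>G y' (sharp y p) i - G y (sharp y p) i\<bar> * M) \<longlongrightarrow> 0) (at y)" by simp
  have "((\<lambda>y'. sharp y' p - sharp y p) \<longlongrightarrow> 0) (at y)"
  proof (rule Lim_null_comparison[OF _ lim])
    show "\<forall>\<^sub>F y' in at y. norm (sharp y' p - sharp y p) \<le> (\<Sum>i\<in>Basis. \<bar>G y' (sharp y p) i - G y (sharp y p) i\<bar> * M)"
      unfolding eventually_at
    proof (intro exI[of _ r] conjI ballI impI)
      fix y' assume "y' \<noteq> y \<and> dist y' y < r"
      then have y': "y' \<in> cball y r" by (simp add: dist_commute)
      then have "sharp y' p - sharp y p = - (\<Sum>i\<in>Basis. (G y' (sharp y p) i - G y (sharp y p) i) *\<^sub>R sharp y' i)"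
        using sharp_difference assms r(2) by blast
      then have "norm (sharp y' p - sharp y p) \<le> (\<Sum>i\<in>Basis. norm ((G y' (sharp y p) i - G y (sharp y p) i) *\<^sub>R sharp y' i))"
        by (simp only: norm_minus_cancel) (rule norm_sum)
      also have "\<dots> \<le> (\<Sum>i\<in>Basis. \<bar>G y' (sharp y p) i - G y (sharp y p) i\<bar> * M)"
      proof (intro sum_mono)
        fix i :: 'b assume "i \<in> Basis"
        then have "norm (sharp y' i) \<le> M" using M(2)[OF y', of i] by simp
        then show "norm ((G y' (sharp y p) i - G y (sharp y p) i) *\<^sub>R sharp y' i) \<le> \<bar>G y' (sharp y p) i - G y (sharp y p) i\<bar> * M"
          by (auto intro: mult_left_mono)
      qed
      finally show "norm (sharp y' p - sharp y p) \<le> (\<Sum>i\<in>Basis. \<bar>G y' (sharp y p) i - G y (sharp y p) i\<bar> * M)" .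
    qed (use r in auto)
  qed
  then show ?thesis by (simp add: isCont_def LIM_zero_iff)
qed

text \<open>The coefficients in \<open>sharp_difference\<close> vanish at \<open>y\<close>, so
  \<open>has_derivative_mult_vanishing\<close> applies. The result is the usual derivative of an
  inverse matrix.\<close>

lemma sharp_has_derivative:
  assumes "y \<in> Y"
  shows "((\<lambda>y. sharp y p) has_derivative
    (\<lambda>v. - (\<Sum>i\<in>Basis. frechet_derivative (\<lambda>y'. G y' (sharp y p) i) (at y) v *\<^sub>R sharp y i))) (at y)"
proof -
  have "((\<lambda>y'. sharp y p - (\<Sum>i\<in>Basis. (G y' (sharp y p) i - G y (sharp y p) i) *\<^sub>R sharp y' i)) has_derivative
    (\<lambda>v. 0 - (\<Sum>i\<in>Basis. frechet_derivative (\<lambda>y'. G y' (sharp y p) i) (at y) v *\<^sub>R sharp y i))) (at y)"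
  proof (intro has_derivative_diff has_derivative_const has_derivative_sum has_derivative_mult_vanishing sharp_isCont[OF assms])
    fix i
    have "((\<lambda>y'. G y' (sharp y p) i - G y (sharp y p) i) has_derivative
       (\<lambda>v. frechet_derivative (\<lambda>y'. G y' (sharp y p) i) (at y) v - 0)) (at y)"
      by (intro has_derivative_diff has_derivative_const G_has_derivative assms)
    then show "((\<lambda>y'. G y' (sharp y p) i - G y (sharp y p) i) has_derivative
        frechet_derivative (\<lambda>y'. G y' (sharp y p) i) (at y)) (at y)" by simp
  qed simp
  then have "((\<lambda>y'. sharp y p - (\<Sum>i\<in>Basis. (G y' (sharp y p) i - G y (sharp y p) i) *\<^sub>R sharp y' i)) has_derivative
    (\<lambda>v. - (\<Sum>i\<in>Basis. frechet_derivative (\<lambda>y'. G y' (sharp y p) i) (at y) v *\<^sub>R sharp y i))) (at y)" by simp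
  moreover have "sharp y p - (\<Sum>i\<in>Basis. (G y' (sharp y p) i - G y (sharp y p) i) *\<^sub>R sharp y' i) = sharp y' p" if "y' \<in> Y" for y'
    using sharp_difference[OF assms that, of p] by (simp add: algebra_simps)
  ultimately show ?thesis
    using has_derivative_transform_within_open[OF _ open_Y assms] by fastforce
qed

lemma G_expand_left: "y \<in> Y \<Longrightarrow> G y u v = (\<Sum>j\<in>Basis. (u \<bullet> j) * G y j v)"
  using linear_euclidean_sum[OF G_linear_left[of y v], of u] by (simp only: real_scaleR_def)

lemma frechet_G_expand:
  assumes "y \<in> Y"
  shows "frechet_derivative (\<lambda>y. G y u v) (at y) d = (\<Sum>j\<in>Basis. (u \<bullet> j) * frechet_derivative (\<lambda>y. G y j v) (at y) d)"
proof -
  have "((\<lambda>y. \<Sum>j\<in>Basis. (u \<bullet> j) * G y j v) has_derivative (\<lambda>d. \<Sum>j\<in>Basis. (u \<bullet> j) * frechet_derivative (\<lambda>y. G y j v) (at y) d)) (at y)"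
    by (intro has_derivative_sum has_derivative_mult_right G_has_derivative assms)
  then have "((\<lambda>y. G y u v) has_derivative (\<lambda>d. \<Sum>j\<in>Basis. (u \<bullet> j) * frechet_derivative (\<lambda>y. G y j v) (at y) d)) (at y)"
    by (rule has_derivative_transform_within_open[OF _ open_Y assms]) (rule G_expand_left[symmetric])
  from fun_cong[OF frechet_derivative_at[OF this], of d] show ?thesis by (rule sym)
qed

text \<open>The derivative is a polynomial in \<open>sharp\<close> and the derivatives of
  \<open>G\<close>; hence the induction on \<open>k\<close>, for all \<open>p\<close> at
  once.\<close>

lemma sharp_smooth: "smooth_on Y (\<lambda>y. sharp y p)"
proof -
  have "Ck_on k Y (\<lambda>y. sharp y p)" for k
  proof (induction k arbitrary: p)
    case 0
    show ?case using sharp_isCont open_Y by (auto simp: continuous_on_eq_continuous_at)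
  next
    case (Suc k)
    let ?D = "\<lambda>y v. - (\<Sum>i\<in>Basis. (\<Sum>j\<in>Basis. (sharp y p \<bullet> j) * frechet_derivative (\<lambda>y. G y j i) (at y) v) *\<^sub>R sharp y i)"
    have G: "Ck_on k Y (\<lambda>y. frechet_derivative (\<lambda>y. G y j i) (at y) v)" for i j v
      using smooth_onD(2)[OF G_smooth] unfolding smooth_on_def by blast
    have "Ck_on k Y (\<lambda>y. ?D y v)" for v
      by (intro Ck_on_bounded_linear[OF open_Y bounded_linear_minus[OF bounded_linear_ident]] Ck_on_sum open_Y
        Ck_on_bilinear[OF open_Y bounded_bilinear_scaleR] Ck_on_bilinear[OF open_Y bounded_bilinear_mult]
        Ck_on_bounded_linear[OF open_Y bounded_linear_inner_left] Suc G)
    moreover have "((\<lambda>y. sharp y p) has_derivative ?D y) (at y)" if "y \<in> Y" for y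
      using sharp_has_derivative[OF that, of p] frechet_G_expand[OF that, of "sharp y p"] by simp
    ultimately show ?case by (intro Ck_on_SucI[OF open_Y])
  qed
  then show ?thesis by (simp add: smooth_on_def)
qed

section \<open>Metric, Lagrangian and Legendre transform in coordinates\<close>

definition "Dw y e v = (\<Sum>j\<in>Basis. (e \<bullet> j) * frechet_derivative (\<lambda>y. w y j) (at y) v)"
definition "DG y e v = (\<Sum>i\<in>Basis. \<Sum>j\<in>Basis. (e \<bullet> i) * (e \<bullet> j) * frechet_derivative (\<lambda>y. G y i j) (at y) v)"
definition "Dl y v = frechet_derivative l (at y) v"
text \<open>The metric solves (l + \<mu>) F^2 = G(e,e) + 2 F w(e). Differentiating at fixed
  \<open>e\<close> in the direction \<open>v\<close> and using (l + \<mu>) F - w(e) = sqrt Q shows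
  that sqrt Q times the derivative of F is \<open>bb\<close> taken at \<open>c = F\<close>.\<close>

definition "bb c y e v = c * Dw y e v + DG y e v / 2 - c\<^sup>2 * Dl y v / 2"
definition "Q \<mu> y e = (l y + \<mu>) * G y e e + (w y e)\<^sup>2"
definition "F \<mu> y e = G y e e / (- w y e + sqrt (Q \<mu> y e))"
definition "Omega \<mu> = {(y, e). y \<in> Y \<and> (l y + \<mu> > 0 \<or> w y e < 0)}"
definition "Lag \<mu> z = (F \<mu> (fst z) (snd z))\<^sup>2 / 2"
text \<open>The fibre derivative of F^2 / 2, again stored as a vector; it comes from the same
  quadratic equation, differentiated in \<open>e\<close>.\<close>

definition "mom \<mu> y e = (F \<mu> y e / sqrt (Q \<mu> y e)) *\<^sub>R (F \<mu> y e *\<^sub>R wvec y + flat y e)"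
definition "DLag \<mu> z d = (F \<mu> (fst z) (snd z) / sqrt (Q \<mu> (fst z) (snd z))) *
    bb (F \<mu> (fst z) (snd z)) (fst z) (snd z) (fst d) + mom \<mu> (fst z) (snd z) \<bullet> snd d"
text \<open>The unit sphere of F is the \<open>G\<close>-sphere of squared radius \<open>N2\<close>
  centred at minus \<open>sharp y (wvec y)\<close>. \<open>V1\<close> is its point at which
  \<open>p\<close> is largest, and \<open>Fs\<close> is that largest value, the dual norm of
  \<open>p\<close>. \<open>B1\<close> is minus the derivative of \<open>Fs\<close> in the base
  point, so that a geodesic of speed k has velocity k \<open>V1\<close> and momentum derivative k
  \<open>B1\<close>.\<close>

definition "nrm2 y p = p \<bullet> sharp y p"
definition "N2 \<mu> y = wvec y \<bullet> sharp y (wvec y) + l y + \<mu>"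
definition "V1 \<mu> y p = sqrt (N2 \<mu> y / nrm2 y p) *\<^sub>R sharp y p - sharp y (wvec y)"
definition "B1 \<mu> y p = sqrt (nrm2 y p / N2 \<mu> y) *\<^sub>R (\<Sum>i\<in>Basis. bb 1 y (V1 \<mu> y p) i *\<^sub>R i)"
definition "Fs \<mu> y p = sqrt (N2 \<mu> y * nrm2 y p) - p \<bullet> sharp y (wvec y)"

lemma nrm2_pos: "y \<in> Y \<Longrightarrow> p \<noteq> 0 \<Longrightarrow> nrm2 y p > 0"
  unfolding nrm2_def by (rule sharp_pos)

text \<open>The dual square norm of \<open>wvec y\<close> is already positive because
  \<open>w y\<close> is nonzero. Hence \<open>N2\<close> stays positive even where
  \<open>l y + \<mu> = 0\<close>, and the square roots below remain smooth there.\<close>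

lemma N2_pos: "y \<in> Y \<Longrightarrow> \<mu> \<ge> 0 \<Longrightarrow> N2 \<mu> y > 0"
  using sharp_pos[OF _ wvec_nonzero, of y y] l_nonneg[of y] unfolding N2_def by simp

lemma w_expand: "y \<in> Y \<Longrightarrow> w y e = (\<Sum>j\<in>Basis. (e \<bullet> j) * w y j)"
  using linear_euclidean_sum[OF w_linear[of y], of e] by (simp only: real_scaleR_def)

lemma sharp_expand: "y \<in> Y \<Longrightarrow> sharp y p = (\<Sum>j\<in>Basis. (p \<bullet> j) *\<^sub>R sharp y j)"
  by (rule linear_euclidean_sum[OF sharp_linear])

lemma smooth_on_pull:
  fixes f :: "'b \<Rightarrow> 'g::real_normed_vector" and a :: "'e::euclidean_space \<Rightarrow> 'b"
  shows "open W \<Longrightarrow> smooth_on W a \<Longrightarrow> a ` W \<subseteq> Y \<Longrightarrow> smooth_on Y f \<Longrightarrow> smooth_on W (\<lambda>x. f (a x))"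
  using smooth_on_compose[OF _ open_Y] by blast

lemma continuous_on_pull:
  fixes f :: "'b \<Rightarrow> 'g::real_normed_vector"
  shows "continuous_on W a \<Longrightarrow> a ` W \<subseteq> Y \<Longrightarrow> smooth_on Y f \<Longrightarrow> continuous_on W (\<lambda>x. f (a x))"
  using continuous_on_compose2[OF smooth_on_continuous] by blast

lemma wvec_smooth: "smooth_on Y wvec"
  unfolding wvec_def by (intro smooth_intros open_Y w_smooth)

context
  fixes W :: "'e::euclidean_space set" and a :: "'e \<Rightarrow> 'b" and e :: "'e \<Rightarrow> 'b"
  assumes W: "open W" "smooth_on W a" "a ` W \<subseteq> Y" "smooth_on W e"
begin

lemma smooth_sharp: "smooth_on W (\<lambda>x. sharp (a x) (e x))"
proof -
  have "smooth_on W (\<lambda>x. \<Sum>j\<in>Basis. (e x \<bullet> j) *\<^sub>R sharp (a x) j)"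
    by (intro smooth_intros W smooth_on_pull[OF W(1-3)] sharp_smooth)
  then show ?thesis
    by (rule smooth_on_cong_imp[OF W(1), rotated]) (rule sharp_expand[symmetric], use W(3) in auto)
qed

lemma smooth_Dw: "smooth_on W (\<lambda>x. Dw (a x) (e x) v)"
  unfolding Dw_def by (intro smooth_intros W smooth_on_pull[OF W(1-3)] smooth_onD(2)[OF w_smooth])

lemma smooth_DG: "smooth_on W (\<lambda>x. DG (a x) (e x) v)"
  unfolding DG_def by (intro smooth_intros W smooth_on_pull[OF W(1-3)] smooth_onD(2)[OF G_smooth])

lemma smooth_bb: "smooth_on W (\<lambda>x. bb 1 (a x) (e x) v)"
  unfolding bb_def Dl_def diff_conv_add_uminus divide_inverse
  by (intro smooth_intros W smooth_Dw smooth_DG smooth_on_pull[OF W(1-3)] smooth_onD(2)[OF l_smooth])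

lemma smooth_nrm2: "smooth_on W (\<lambda>x. nrm2 (a x) (e x))"
  unfolding nrm2_def by (intro smooth_intros W smooth_sharp)

end

lemma smooth_N2: "open W \<Longrightarrow> smooth_on W a \<Longrightarrow> a ` W \<subseteq> Y \<Longrightarrow> smooth_on W (\<lambda>x. N2 \<mu> (a x))"
  unfolding N2_def
  by (intro smooth_intros smooth_on_pull[OF _ _ _ l_smooth] smooth_sharp smooth_on_pull[OF _ _ _ wvec_smooth])

lemma smooth_V1:
  assumes "open W" "smooth_on W a" "a ` W \<subseteq> Y" "smooth_on W p" "\<And>x. x \<in> W \<Longrightarrow> p x \<noteq> 0" "\<mu> \<ge> 0"
  shows "smooth_on W (\<lambda>x. V1 \<mu> (a x) (p x))"
  unfolding V1_def
  by (intro smooth_intros assms smooth_sharp smooth_N2 smooth_nrm2 smooth_on_pull[OF _ _ _ wvec_smooth])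
    (use assms in \<open>auto intro!: divide_pos_pos N2_pos nrm2_pos\<close>)

lemma smooth_B1:
  assumes "open W" "smooth_on W a" "a ` W \<subseteq> Y" "smooth_on W p" "\<And>x. x \<in> W \<Longrightarrow> p x \<noteq> 0" "\<mu> \<ge> 0"
  shows "smooth_on W (\<lambda>x. B1 \<mu> (a x) (p x))"
  unfolding B1_def
  by (intro smooth_intros assms smooth_bb smooth_V1 smooth_N2 smooth_nrm2)
    (use assms in \<open>auto intro!: divide_pos_pos N2_pos nrm2_pos\<close>)

lemma smooth_field:
  assumes "\<mu> \<ge> 0"
  shows "smooth_on (Y \<times> (- {0})) (\<lambda>z. (V1 \<mu> (fst z) (snd z), B1 \<mu> (fst z) (snd z)))"
proof -
  have "open (Y \<times> (- {0::'b}))" by (intro open_Times open_Y) auto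
  then show ?thesis
    by (intro smooth_on_Pair smooth_V1 smooth_B1 smooth_on_fst smooth_on_snd) (use assms in auto)
qed

context
  fixes W :: "'e::topological_space set" and a :: "'e \<Rightarrow> 'b" and e :: "'e \<Rightarrow> 'b"
  assumes W: "continuous_on W a" "a ` W \<subseteq> Y" "continuous_on W e"
begin

lemma continuous_w: "continuous_on W (\<lambda>x. w (a x) (e x))"
proof -
  have "continuous_on W (\<lambda>x. \<Sum>j\<in>Basis. (e x \<bullet> j) * w (a x) j)"
    by (intro continuous_intros W continuous_on_pull[OF W(1,2)] w_smooth)
  then show ?thesis
    by (rule continuous_on_eq) (rule w_expand[symmetric], use W(2) in auto)
qed

lemma continuous_sharp: "continuous_on W (\<lambda>x. sharp (a x) (e x))"
proof -
  have "continuous_on W (\<lambda>x. \<Sum>j\<in>Basis. (e x \<bullet> j) *\<^sub>R sharp (a x) j)"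
    by (intro continuous_intros W continuous_on_pull[OF W(1,2)] sharp_smooth)
  then show ?thesis
    by (rule continuous_on_eq) (rule sharp_expand[symmetric], use W(2) in auto)
qed

lemma continuous_Dw: "continuous_on W (\<lambda>x. Dw (a x) (e x) v)"
  unfolding Dw_def by (intro continuous_intros W continuous_on_pull[OF W(1,2)] smooth_onD(2)[OF w_smooth])

lemma continuous_DG: "continuous_on W (\<lambda>x. DG (a x) (e x) v)"
  unfolding DG_def by (intro continuous_intros W continuous_on_pull[OF W(1,2)] smooth_onD(2)[OF G_smooth])

lemma continuous_bb: "continuous_on W c \<Longrightarrow> continuous_on W (\<lambda>x. bb (c x) (a x) (e x) v)"
  unfolding bb_def Dl_def
  by (intro continuous_intros W continuous_Dw continuous_DG continuous_on_pull[OF W(1,2)] smooth_onD(2)[OF l_smooth]) auto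

lemma continuous_nrm2: "continuous_on W (\<lambda>x. nrm2 (a x) (e x))"
  unfolding nrm2_def by (intro continuous_intros W continuous_sharp)

lemma continuous_flat: "continuous_on W (\<lambda>x. flat (a x) (e x))"
  unfolding flat_def by (intro continuous_intros W G_continuous)

end

lemma continuous_N2:
  "continuous_on W a \<Longrightarrow> a ` W \<subseteq> Y \<Longrightarrow> continuous_on W \<mu> \<Longrightarrow> continuous_on W (\<lambda>x. N2 (\<mu> x) (a x))"
  unfolding N2_def
  by (intro continuous_intros continuous_on_pull[OF _ _ l_smooth] continuous_sharp continuous_on_pull[OF _ _ wvec_smooth])

context
  fixes W :: "'e::topological_space set" and a :: "'e \<Rightarrow> 'b" and p :: "'e \<Rightarrow> 'b" and \<mu> :: "'e \<Rightarrow> real"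
  assumes W: "continuous_on W a" "a ` W \<subseteq> Y" "continuous_on W p" "\<And>x. x \<in> W \<Longrightarrow> p x \<noteq> 0"
    "continuous_on W \<mu>" "\<And>x. x \<in> W \<Longrightarrow> \<mu> x \<ge> 0"
begin

lemma pos_W: "x \<in> W \<Longrightarrow> nrm2 (a x) (p x) > 0" "x \<in> W \<Longrightarrow> N2 (\<mu> x) (a x) > 0"
  using W nrm2_pos N2_pos by auto

text \<open>Here \<mu> varies too: the passage to the limit needs continuity jointly in parameter,
  point and momentum, including parameter 0.\<close>

lemma continuous_V1: "continuous_on W (\<lambda>x. V1 (\<mu> x) (a x) (p x))"
  unfolding V1_def
  by (intro continuous_intros continuous_sharp continuous_N2 continuous_nrm2 W continuous_on_pull[OF _ _ wvec_smooth])
    (use pos_W in force)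

lemma continuous_B1: "continuous_on W (\<lambda>x. B1 (\<mu> x) (a x) (p x))"
  unfolding B1_def
  by (intro continuous_intros continuous_bb continuous_V1 continuous_N2 continuous_nrm2 W)
    (use pos_W in force)

lemma continuous_Fs: "continuous_on W (\<lambda>x. Fs (\<mu> x) (a x) (p x))"
  unfolding Fs_def
  by (intro continuous_intros continuous_sharp continuous_N2 continuous_nrm2 W continuous_on_pull[OF _ _ wvec_smooth])

end

lemma bb_linear: "y \<in> Y \<Longrightarrow> linear (bb c y e)"
proof -
  assume y: "y \<in> Y"
  have *: "linear (frechet_derivative (\<lambda>y. w y j) (at y))" "linear (frechet_derivative (\<lambda>y. G y i j) (at y))"
    "linear (frechet_derivative l (at y))" for i j
    using smooth_onD(1)[OF w_smooth y] smooth_onD(1)[OF G_smooth y] smooth_onD(1)[OF l_smooth y] has_derivative_linear by blast+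
  show ?thesis
    unfolding bb_def Dw_def DG_def Dl_def
    by (rule linearI)
      (simp_all add: *[THEN linear_add] *[THEN linear_scale] sum.distrib algebra_simps sum_distrib_left add_divide_distrib diff_divide_distrib)
qed

lemma bb_scale: "bb c y (c *\<^sub>R e) v = c\<^sup>2 * bb 1 y e v"
  unfolding bb_def Dw_def DG_def by (simp add: sum_distrib_left algebra_simps power2_eq_square)

lemma bb_zero: "bb 0 y 0 v = 0"
  unfolding bb_def Dw_def DG_def by simp

lemma B1_inner: "y \<in> Y \<Longrightarrow> B1 \<mu> y p \<bullet> v = sqrt (nrm2 y p / N2 \<mu> y) * bb 1 y (V1 \<mu> y p) v"
  using linear_euclidean_sum[OF bb_linear[of y 1 "V1 \<mu> y p"], of v]
  unfolding B1_def by (simp add: inner_sum_left inner_commute[of v] mult.commute)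

text \<open>Expanding \<open>e\<close> in the basis separates the variables: each summand is a
  coordinate of \<open>e\<close> times a function of \<open>y\<close> alone.\<close>

lemma w_joint:
  assumes "y \<in> Y"
  shows "((\<lambda>z. w (fst z) (snd z)) has_derivative (\<lambda>d. Dw y e (fst d) + w y (snd d))) (at (y, e))"
proof -
  have D: "((\<lambda>z. w (fst z) j) has_derivative (\<lambda>d. frechet_derivative (\<lambda>y. w y j) (at y) (fst d))) (at (y, e))" for j
    by (rule has_derivative_compose[where g = "\<lambda>y. w y j", OF has_derivative_fst[OF has_derivative_ident]])
      (simp add: smooth_onD(1)[OF w_smooth] assms)
  have "((\<lambda>z. \<Sum>j\<in>Basis. (snd z \<bullet> j) * w (fst z) j) has_derivative
     (\<lambda>d. \<Sum>j\<in>Basis. (snd (y, e) \<bullet> j) * frechet_derivative (\<lambda>y. w y j) (at y) (fst d) + (snd d \<bullet> j) * w (fst (y, e)) j)) (at (y, e))"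
    by (intro has_derivative_sum has_derivative_mult D has_derivative_inner_left has_derivative_snd has_derivative_ident)
  also have "(\<lambda>d. \<Sum>j\<in>Basis. (snd (y, e) \<bullet> j) * frechet_derivative (\<lambda>y. w y j) (at y) (fst d) + (snd d \<bullet> j) * w (fst (y, e)) j)
    = (\<lambda>d. Dw y e (fst d) + w y (snd d))"
  proof
    fix d :: "'b \<times> 'b"
    show "(\<Sum>j\<in>Basis. (snd (y, e) \<bullet> j) * frechet_derivative (\<lambda>y. w y j) (at y) (fst d) + (snd d \<bullet> j) * w (fst (y, e)) j)
      = Dw y e (fst d) + w y (snd d)"
      unfolding w_expand[OF assms, of "snd d"] Dw_def by (simp add: sum.distrib)
  qed
  finally show ?thesis
    by (rule has_derivative_transform_within_open[OF _ open_Times[OF open_Y open_UNIV]])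
      (use assms open_Y in \<open>auto intro: open_Times w_expand[symmetric]\<close>)
qed

lemma G_joint:
  assumes "y \<in> Y"
  shows "((\<lambda>z. G (fst z) (snd z) (snd z)) has_derivative (\<lambda>d. DG y e (fst d) + 2 * G y e (snd d))) (at (y, e))"
proof -
  have D: "((\<lambda>z. G (fst z) i j) has_derivative (\<lambda>d. frechet_derivative (\<lambda>y. G y i j) (at y) (fst d))) (at (y, e))" for i j
    by (rule has_derivative_compose[where g = "\<lambda>y. G y i j", OF has_derivative_fst[OF has_derivative_ident]])
      (simp add: smooth_onD(1)[OF G_smooth] assms)
  have "((\<lambda>z. \<Sum>i\<in>Basis. \<Sum>j\<in>Basis. (snd z \<bullet> i) * (snd z \<bullet> j) * G (fst z) i j) has_derivative
     (\<lambda>d. \<Sum>i\<in>Basis. \<Sum>j\<in>Basis. (snd (y, e) \<bullet> i) * (snd (y, e) \<bullet> j) * frechet_derivative (\<lambda>y. G y i j) (at y) (fst d)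
        + ((snd (y, e) \<bullet> i) * (snd d \<bullet> j) + (snd d \<bullet> i) * (snd (y, e) \<bullet> j)) * G (fst (y, e)) i j)) (at (y, e))"
    by (intro has_derivative_sum has_derivative_mult D has_derivative_inner_left has_derivative_snd has_derivative_ident)
  also have "(\<lambda>d. \<Sum>i\<in>Basis. \<Sum>j\<in>Basis. (snd (y, e) \<bullet> i) * (snd (y, e) \<bullet> j) * frechet_derivative (\<lambda>y. G y i j) (at y) (fst d)
        + ((snd (y, e) \<bullet> i) * (snd d \<bullet> j) + (snd d \<bullet> i) * (snd (y, e) \<bullet> j)) * G (fst (y, e)) i j)
    = (\<lambda>d. DG y e (fst d) + 2 * G y e (snd d))"
  proof
    fix d :: "'b \<times> 'b"
    have "2 * G y e (snd d) = G y e (snd d) + G y (snd d) e" using G_sym[OF assms] by simp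
    also have "\<dots> = (\<Sum>i\<in>Basis. \<Sum>j\<in>Basis. ((e \<bullet> i) * (snd d \<bullet> j) + (snd d \<bullet> i) * (e \<bullet> j)) * G y i j)"
      unfolding G_expand[OF assms, of e "snd d"] G_expand[OF assms, of "snd d" e] by (simp add: sum.distrib algebra_simps)
    finally show "(\<Sum>i\<in>Basis. \<Sum>j\<in>Basis. (snd (y, e) \<bullet> i) * (snd (y, e) \<bullet> j) * frechet_derivative (\<lambda>y. G y i j) (at y) (fst d)
        + ((snd (y, e) \<bullet> i) * (snd d \<bullet> j) + (snd d \<bullet> i) * (snd (y, e) \<bullet> j)) * G (fst (y, e)) i j)
      = DG y e (fst d) + 2 * G y e (snd d)"
      unfolding DG_def by (simp add: sum.distrib)
  qed
  finally show ?thesis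
    by (rule has_derivative_transform_within_open[OF _ open_Times[OF open_Y open_UNIV]])
      (use assms open_Y in \<open>auto intro: open_Times G_expand[symmetric]\<close>)
qed

lemma l_joint:
  assumes "y \<in> Y"
  shows "((\<lambda>z. l (fst z)) has_derivative (\<lambda>d. Dl y (fst d))) (at (y, e))"
  unfolding Dl_def
  by (rule has_derivative_compose[where g = l, OF has_derivative_fst[OF has_derivative_ident]])
    (simp add: smooth_onD(1)[OF l_smooth] assms)

end

text \<open>The factorisation \<open>lam * g = (r - w) * (r + w)\<close> turns the quotient defining
  the Kropina form into the numerator \<open>r + w\<close> of the Randers form. The last hypothesis
  excludes exactly the case \<open>r = w\<close>.\<close>

lemma rk_algebra:
  fixes g w r lam :: real
  assumes "r\<^sup>2 = lam * g + w\<^sup>2" "r \<ge> 0" "lam \<ge> 0" "g > 0" "lam > 0 \<or> w < 0"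
  shows "r > 0" "r - w > 0" "lam * (g / (- w + r)) = r + w" "g / (- w + r) > 0"
    "g = g / (- w + r) * (r - w)"
proof -
  have "r\<^sup>2 \<ge> w\<^sup>2" using assms by simp
  then have rw: "\<bar>w\<bar> \<le> r" using assms(2) abs_le_square_iff[of w r] by simp
  show k: "r - w > 0"
  proof (rule ccontr)
    assume "\<not> ?thesis"
    then have "r = w" using rw by simp
    then show False using assms by auto
  qed
  then show "g / (- w + r) > 0" "g = g / (- w + r) * (r - w)" using assms(4) by auto
  have "lam * g = (r - w) * (r + w)" using assms(1) by (simp add: algebra_simps power2_eq_square)
  then show "lam * (g / (- w + r)) = r + w" using k by (simp add: field_simps)
  show "r > 0" using rw k by linarith
qed

text \<open>The quotient rule for g / (r - w) is rewritten into what implicit differentiation of lam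
  F^2 = g + 2 w F yields; no derivative of the square root survives.\<close>

lemma rk_algebra_derivative:
  fixes g w r lam F :: real
  assumes "r > 0" "r - w > 0" "lam * F = r + w" "g = F * (r - w)"
  shows "(dg * (r - w) - g * ((dl * g + lam * dg + 2 * w * dw) / (2 * r) - dw)) / (r - w)\<^sup>2
    = (F * dw + dg / 2 - F\<^sup>2 * dl / 2) / r"
proof -
  define k where "k = r - w"
  have "(dg * k - g * ((dl * g + lam * dg + 2 * w * dw) / (2 * r) - dw)) * (2 * r)
     = 2 * r * dg * k - F * k * (dl * F * k + lam * dg + 2 * w * dw - 2 * r * dw)"
    unfolding assms(4)[folded k_def] using assms(1) by (simp add: field_simps)
  also have "\<dots> = k * (2 * r * dg - F\<^sup>2 * k * dl - (lam * F) * dg - 2 * F * (w - r) * dw)"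
    by (simp add: algebra_simps power2_eq_square)
  also have "\<dots> = k * (2 * r * dg - F\<^sup>2 * k * dl - (r + w) * dg - 2 * F * (w - r) * dw)"
    using assms(3) by simp
  also have "\<dots> = (F * dw + dg / 2 - F\<^sup>2 * dl / 2) * (2 * k\<^sup>2)"
    by (simp add: k_def algebra_simps power2_eq_square)
  finally have *: "(dg * k - g * ((dl * g + lam * dg + 2 * w * dw) / (2 * r) - dw)) * (2 * r)
    = (F * dw + dg / 2 - F\<^sup>2 * dl / 2) * (2 * k\<^sup>2)" .
  have "k > 0" using assms(2) k_def by simp
  have ax: "X / k\<^sup>2 = Z / r" if "X * (2 * r) = Z * (2 * k\<^sup>2)" for X Z :: real
    using that \<open>k > 0\<close> assms(1) by (simp add: field_simps)
  show ?thesis unfolding k_def[symmetric] by (rule ax[OF *])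
qed

text \<open>Needed at the zero vector, where the square root in the metric is not differentiable but
  the squared metric is dominated by a function with zero derivative.\<close>

lemma has_derivative_zero_squeeze:
  fixes f g :: "'e::real_normed_vector \<Rightarrow> real"
  assumes "(g has_derivative (\<lambda>d. 0)) (at x)" "g x = 0" "f x = 0"
    "\<forall>\<^sub>F y in at x. \<bar>f y\<bar> \<le> g y"
  shows "(f has_derivative (\<lambda>d. 0)) (at x)"
proof -
  have "((\<lambda>y. norm (g y - g x - 0) / norm (y - x)) \<longlongrightarrow> 0) (at x)"
    using assms(1) unfolding has_derivative_iff_norm by simp
  then have "((\<lambda>y. norm (f y - f x - 0) / norm (y - x)) \<longlongrightarrow> 0) (at x)"
  proof (rule Lim_null_comparison[rotated])
    show "\<forall>\<^sub>F y in at x. norm (norm (f y - f x - 0) / norm (y - x)) \<le> norm (g y - g x - 0) / norm (y - x)"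
      using assms(4) by eventually_elim (auto simp: assms(2,3) intro!: divide_right_mono)
  qed
  then show ?thesis unfolding has_derivative_iff_norm by simp
qed

context rk_chart
begin

lemma Q_square: assumes "y \<in> Y" "\<mu> \<ge> 0"
  shows "Q \<mu> y e \<ge> 0" "(sqrt (Q \<mu> y e))\<^sup>2 = (l y + \<mu>) * G y e e + (w y e)\<^sup>2"
proof -
  show "Q \<mu> y e \<ge> 0" unfolding Q_def using l_nonneg[OF assms(1)] assms(2) G_nonneg[OF assms(1)] by simp
  then show "(sqrt (Q \<mu> y e))\<^sup>2 = (l y + \<mu>) * G y e e + (w y e)\<^sup>2" by (simp add: Q_def)
qed

lemma Omega_Y: "(y, e) \<in> Omega \<mu> \<Longrightarrow> y \<in> Y" by (simp add: Omega_def)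

lemma F_facts:
  assumes "(y, e) \<in> Omega \<mu>" "\<mu> \<ge> 0" "e \<noteq> 0"
  shows "sqrt (Q \<mu> y e) > 0" "sqrt (Q \<mu> y e) - w y e > 0" "(l y + \<mu>) * F \<mu> y e = sqrt (Q \<mu> y e) + w y e"
    "F \<mu> y e > 0" "G y e e = F \<mu> y e * (sqrt (Q \<mu> y e) - w y e)"
proof -
  have y: "y \<in> Y" using assms(1) Omega_Y by blast
  note * = rk_algebra[OF Q_square(2)[OF y assms(2)], of e]
  have a: "l y + \<mu> > 0 \<or> w y e < 0" "l y + \<mu> \<ge> 0" "sqrt (Q \<mu> y e) \<ge> 0"
    using assms l_nonneg[OF y] Q_square(1)[OF y assms(2), of e] by (auto simp: Omega_def)
  show "sqrt (Q \<mu> y e) > 0" "sqrt (Q \<mu> y e) - w y e > 0" "(l y + \<mu>) * F \<mu> y e = sqrt (Q \<mu> y e) + w y e"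
    "F \<mu> y e > 0" "G y e e = F \<mu> y e * (sqrt (Q \<mu> y e) - w y e)"
    unfolding F_def using *[OF a(3,2) G_pos[OF y assms(3)] a(1)] by auto
qed

lemma F_zero: "y \<in> Y \<Longrightarrow> F \<mu> y 0 = 0" "y \<in> Y \<Longrightarrow> Q \<mu> y 0 = 0" "y \<in> Y \<Longrightarrow> w y 0 = 0" "y \<in> Y \<Longrightarrow> G y u 0 = 0"
   "y \<in> Y \<Longrightarrow> G y 0 u = 0"
  unfolding F_def Q_def using linear_0[OF G_linear] linear_0[OF w_linear] linear_0[OF G_linear_left] by auto

lemma F_scale:
  assumes "y \<in> Y" "r \<ge> 0" shows "F \<mu> y (r *\<^sub>R e) = r * F \<mu> y e"
    "sqrt (Q \<mu> y (r *\<^sub>R e)) = r * sqrt (Q \<mu> y e)"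
proof -
  have "Q \<mu> y (r *\<^sub>R e) = r\<^sup>2 * Q \<mu> y e"
    unfolding Q_def by (simp add: linear_scale[OF G_linear] linear_scale[OF G_linear_left] linear_scale[OF w_linear]
      assms power2_eq_square algebra_simps)
  then show *: "sqrt (Q \<mu> y (r *\<^sub>R e)) = r * sqrt (Q \<mu> y e)" using assms(2) by (simp add: real_sqrt_mult)
  have "G y (r *\<^sub>R e) (r *\<^sub>R e) = r * (r * G y e e)" "- w y (r *\<^sub>R e) + sqrt (Q \<mu> y (r *\<^sub>R e)) = r * (- w y e + sqrt (Q \<mu> y e))"
    unfolding * by (simp_all add: linear_scale[OF G_linear] linear_scale[OF G_linear_left] linear_scale[OF w_linear] assms algebra_simps)
  then show "F \<mu> y (r *\<^sub>R e) = r * F \<mu> y e" unfolding F_def by simp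
qed

text \<open>The Legendre transform: \<open>V1\<close> and \<open>Fs\<close> invert
  \<open>mom\<close>. The computation rests on q = c wvec + flat e, whose dual square norm is c^2
  \<open>N2\<close>; this is the quadratic equation satisfied by c = F.\<close>

lemma mom_facts:
  assumes "(y, e) \<in> Omega \<mu>" "\<mu> \<ge> 0" "e \<noteq> 0"
  shows "mom \<mu> y e \<noteq> 0" "F \<mu> y e *\<^sub>R V1 \<mu> y (mom \<mu> y e) = e" "Fs \<mu> y (mom \<mu> y e) = F \<mu> y e"
    "mom \<mu> y e \<bullet> e = (F \<mu> y e)\<^sup>2"
    "F \<mu> y e / sqrt (Q \<mu> y e) * bb (F \<mu> y e) y e v = F \<mu> y e * (B1 \<mu> y (mom \<mu> y e) \<bullet> v)"
proof -
  define c R p where "c = F \<mu> y e" and "R = sqrt (Q \<mu> y e)" and "p = mom \<mu> y e"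
  have y: "y \<in> Y" using assms(1) Omega_Y by blast
  note F = F_facts[OF assms, folded c_def R_def]
  let ?q = "c *\<^sub>R wvec y + flat y e"
  let ?u = "sharp y (wvec y)"
  have p: "p = (c / R) *\<^sub>R ?q" unfolding p_def mom_def c_def R_def ..
  have sq: "sharp y ?q = c *\<^sub>R ?u + e"
    by (simp add: linear_add[OF sharp_linear[OF y]] linear_scale[OF sharp_linear[OF y]] sharp_flat y)
  have we: "wvec y \<bullet> e = w y e" "flat y e \<bullet> ?u = w y e" "flat y e \<bullet> e = G y e e"
    using inner_wvec[OF y] inner_flat[OF y] G_sym[OF y] G_sharp[OF y] by auto
  have qq: "?q \<bullet> sharp y ?q = c\<^sup>2 * N2 \<mu> y"
  proof -
    have "?q \<bullet> sharp y ?q = c\<^sup>2 * (wvec y \<bullet> ?u) + 2 * c * w y e + G y e e"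
      unfolding sq by (simp add: inner_add_left inner_add_right we power2_eq_square algebra_simps)
    moreover have "2 * c * w y e + G y e e = c\<^sup>2 * (l y + \<mu>)"
    proof -
      have "c\<^sup>2 * (l y + \<mu>) = c * ((l y + \<mu>) * c)" by (simp add: power2_eq_square)
      then show ?thesis unfolding F(3) using F(5) by (simp add: algebra_simps)
    qed
    ultimately show ?thesis by (simp add: N2_def algebra_simps)
  qed
  have N: "N2 \<mu> y > 0" using N2_pos y assms(2) by blast
  \<comment> \<open>Since this is a square times \<open>N2 \<mu> y\<close>, the three square roots
    below become free of radicals in \<open>c\<close> and \<open>R\<close>.\<close>
  have n2: "nrm2 y p = (c\<^sup>2 / R)\<^sup>2 * N2 \<mu> y"
    unfolding nrm2_def p by (simp add: linear_scale[OF sharp_linear[OF y]] qq power2_eq_square)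
  have s1: "sqrt (N2 \<mu> y / nrm2 y p) = R / c\<^sup>2"
  proof -
    have "N2 \<mu> y / nrm2 y p = (R / c\<^sup>2)\<^sup>2" unfolding n2 using N F by (simp add: field_simps)
    then show ?thesis using F by simp
  qed
  have s2: "sqrt (N2 \<mu> y * nrm2 y p) = N2 \<mu> y * c\<^sup>2 / R"
  proof -
    have "N2 \<mu> y * nrm2 y p = (N2 \<mu> y * c\<^sup>2 / R)\<^sup>2" unfolding n2 by (simp add: power2_eq_square)
    then show ?thesis using F N by simp
  qed
  have s3: "sqrt (nrm2 y p / N2 \<mu> y) = c\<^sup>2 / R"
  proof -
    have "nrm2 y p / N2 \<mu> y = (c\<^sup>2 / R)\<^sup>2" unfolding n2 using N by simp
    then show ?thesis using F by simp
  qed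
  have sp: "sharp y p = (c / R) *\<^sub>R (c *\<^sub>R ?u + e)"
    unfolding p using linear_scale[OF sharp_linear[OF y]] sq by simp
  show V: "F \<mu> y e *\<^sub>R V1 \<mu> y (mom \<mu> y e) = e"
    unfolding V1_def p_def[symmetric] c_def[symmetric] s1 sp using F
    by (simp add: scaleR_add_right scaleR_diff_right power2_eq_square)
  have "p \<bullet> ?u = (c / R) * (c * (wvec y \<bullet> ?u) + w y e)"
    unfolding p by (simp add: inner_add_left we algebra_simps)
  then have "Fs \<mu> y p = (c / R) * (c * (l y + \<mu>) - w y e)"
    unfolding Fs_def s2 by (simp add: N2_def algebra_simps power2_eq_square add_divide_distrib diff_divide_distrib)
  also have "\<dots> = c" using F by (simp add: algebra_simps)
  finally show "Fs \<mu> y (mom \<mu> y e) = F \<mu> y e" by (simp add: p_def c_def)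
  have "p \<bullet> e = (c / R) * (c * w y e + G y e e)" unfolding p by (simp add: inner_add_left we)
  also have "c * w y e + G y e e = c * R" using F(5) by (simp add: algebra_simps)
  finally show pe: "mom \<mu> y e \<bullet> e = (F \<mu> y e)\<^sup>2" using F(1) by (simp add: p_def c_def power2_eq_square)
  then show "mom \<mu> y e \<noteq> 0" using F(4) c_def by auto
  have "bb c y e v = c\<^sup>2 * bb 1 y (V1 \<mu> y p) v"
    using bb_scale[of c y "V1 \<mu> y p" v] V by (simp add: c_def p_def)
  then show "F \<mu> y e / sqrt (Q \<mu> y e) * bb (F \<mu> y e) y e v = F \<mu> y e * (B1 \<mu> y (mom \<mu> y e) \<bullet> v)"
    unfolding B1_inner[OF y] p_def[symmetric] c_def[symmetric] R_def[symmetric] s3 by simp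
qed

text \<open>In order: \<open>V1\<close> lies on the unit sphere; the value of sqrt Q at
  \<open>V1\<close>, in terms of the dual norm; and the normal to the sphere at \<open>V1\<close> is
  a positive multiple of \<open>p\<close>.\<close>

lemma V1_quadratic:
  assumes "y \<in> Y" "p \<noteq> 0" "\<mu> \<ge> 0"
  shows "G y (V1 \<mu> y p) (V1 \<mu> y p) + 2 * w y (V1 \<mu> y p) = l y + \<mu>"
    "l y + \<mu> - w y (V1 \<mu> y p) = sqrt (N2 \<mu> y / nrm2 y p) * Fs \<mu> y p"
    "flat y (V1 \<mu> y p) + wvec y = sqrt (N2 \<mu> y / nrm2 y p) *\<^sub>R p"
proof -
  let ?V = "V1 \<mu> y p" and ?u = "sharp y (wvec y)"
  define s where "s = sqrt (N2 \<mu> y / nrm2 y p)"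
  have N: "N2 \<mu> y > 0" "nrm2 y p > 0" using N2_pos nrm2_pos assms by auto
  have V: "?V = s *\<^sub>R sharp y p - ?u" by (simp add: V1_def s_def)
  have fl: "flat y ?V = s *\<^sub>R p - wvec y"
    unfolding V using assms(1) by (simp add: linear_diff[OF flat_linear] linear_scale[OF flat_linear] flat_sharp)
  then show "flat y ?V + wvec y = sqrt (N2 \<mu> y / nrm2 y p) *\<^sub>R p" by (simp add: s_def)
  have wV: "w y ?V = s * (p \<bullet> ?u) - wvec y \<bullet> ?u"
    using inner_wvec[OF assms(1), of ?V, symmetric] sharp_sym[OF assms(1), of "wvec y" p]
    unfolding V by (simp add: inner_diff_right)
  have "G y ?V ?V = s * s * nrm2 y p - 2 * s * (p \<bullet> ?u) + wvec y \<bullet> ?u"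
    using inner_flat[OF assms(1), of ?V ?V, symmetric] sharp_sym[OF assms(1), of "wvec y" p]
    unfolding fl by (simp add: V inner_diff_right inner_diff_left nrm2_def algebra_simps)
  moreover have "s * s * nrm2 y p = N2 \<mu> y" using N by (simp add: s_def)
  ultimately show "G y ?V ?V + 2 * w y ?V = l y + \<mu>" using wV by (simp add: N2_def)
  have "s * sqrt (N2 \<mu> y * nrm2 y p) = N2 \<mu> y"
    using N by (simp add: s_def real_sqrt_mult[symmetric])
  then show "l y + \<mu> - w y ?V = sqrt (N2 \<mu> y / nrm2 y p) * Fs \<mu> y p"
    unfolding wV Fs_def s_def[symmetric] by (simp add: right_diff_distrib N2_def)
qed

text \<open>If the dual norm vanishes, the two identities of \<open>V1_quadratic\<close> combine to
  G(V1,V1) = -(l + \<mu>), a nonnegative number equal to a nonpositive one. Geometrically the sphere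
  passes through the origin and \<open>p\<close> is its outer normal there.\<close>

lemma V1_zero:
  assumes "y \<in> Y" "p \<noteq> 0" "\<mu> \<ge> 0" "Fs \<mu> y p = 0"
  shows "V1 \<mu> y p = 0" "l y + \<mu> = 0"
proof -
  have "G y (V1 \<mu> y p) (V1 \<mu> y p) = - (l y + \<mu>)"
    using V1_quadratic(1,2)[OF assms(1-3)] assms(4) by simp
  then have "G y (V1 \<mu> y p) (V1 \<mu> y p) = 0" "l y + \<mu> = 0"
    using G_nonneg[OF assms(1), of "V1 \<mu> y p"] l_nonneg[OF assms(1)] assms(3) by linarith+
  then show "V1 \<mu> y p = 0" "l y + \<mu> = 0" using G_pos[OF assms(1)] by force+
qed

text \<open>The converse of \<open>mom_facts\<close>: a momentum of positive dual norm gives an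
  admissible velocity of any prescribed speed \<open>c > 0\<close>, with momentum a positive
  multiple of \<open>p\<close>.\<close>

lemma V1_Omega:
  assumes "y \<in> Y" "p \<noteq> 0" "\<mu> \<ge> 0" "Fs \<mu> y p > 0" "c > 0"
  shows "(y, c *\<^sub>R V1 \<mu> y p) \<in> Omega \<mu>" "F \<mu> y (c *\<^sub>R V1 \<mu> y p) = c"
    "mom \<mu> y (c *\<^sub>R V1 \<mu> y p) = (c / Fs \<mu> y p) *\<^sub>R p" "V1 \<mu> y p \<noteq> 0"
proof -
  let ?V = "V1 \<mu> y p"
  define s where "s = sqrt (N2 \<mu> y / nrm2 y p)"
  have N: "N2 \<mu> y > 0" "nrm2 y p > 0" using N2_pos nrm2_pos assms by auto
  then have s: "s > 0" by (simp add: s_def)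
  note q = V1_quadratic[OF assms(1-3), folded s_def]
  \<comment> \<open>This will be sqrt Q at \<open>?V\<close>: on the unit sphere F = 1, and (l +
    \<mu>) F - w = sqrt Q.\<close>
  define \<rho> where "\<rho> = l y + \<mu> - w y ?V"
  have rho: "\<rho> > 0" using q(2) s assms(4) by (simp add: \<rho>_def)
  show V0: "?V \<noteq> 0"
  proof
    assume "?V = 0"
    then show False using q(1) rho F_zero[OF assms(1)] by (simp add: \<rho>_def)
  qed
  have Gp: "G y ?V ?V > 0" using G_pos[OF assms(1) V0] .
  have lam: "l y + \<mu> \<ge> 0" using l_nonneg[OF assms(1)] assms(3) by simp
  have Om1: "l y + \<mu> > 0 \<or> w y ?V < 0" using rho lam by (auto simp: \<rho>_def)
  then show Om: "(y, c *\<^sub>R ?V) \<in> Omega \<mu>"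
    using assms(1,5) by (auto simp: Omega_def linear_scale[OF w_linear[OF assms(1)]] mult_pos_neg)
  have "Q \<mu> y ?V = \<rho>\<^sup>2"
  proof -
    have "Q \<mu> y ?V = (l y + \<mu>) * (l y + \<mu> - 2 * w y ?V) + (w y ?V)\<^sup>2"
      unfolding Q_def using q(1) by (metis add_diff_cancel_right')
    then show ?thesis by (simp add: \<rho>_def power2_eq_square algebra_simps)
  qed
  then have sQ: "sqrt (Q \<mu> y ?V) = \<rho>" using rho by simp
  have F1: "F \<mu> y ?V = 1"
    unfolding F_def sQ using q(1) Gp by (simp add: \<rho>_def field_simps)
  show Fc: "F \<mu> y (c *\<^sub>R ?V) = c" using F_scale(1)[OF assms(1), of c \<mu> ?V] F1 assms(5) by simp
  have "mom \<mu> y (c *\<^sub>R ?V) = (1 / \<rho>) *\<^sub>R (c *\<^sub>R wvec y + c *\<^sub>R flat y ?V)"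
    unfolding mom_def Fc using F_scale(2)[OF assms(1), of c \<mu> ?V] sQ assms(5)
    by (simp add: linear_scale[OF flat_linear[OF assms(1)]])
  also have "\<dots> = (c / \<rho>) *\<^sub>R (flat y ?V + wvec y)" by (simp add: algebra_simps)
  also have "\<dots> = (c / \<rho> * s) *\<^sub>R p" by (simp add: q(3))
  also have "c / \<rho> * s = c / Fs \<mu> y p"
    using q(2) s assms(4) by (simp add: \<rho>_def)
  finally show "mom \<mu> y (c *\<^sub>R ?V) = (c / Fs \<mu> y p) *\<^sub>R p" .
qed

lemma momentum_scale:
  assumes "y \<in> Y" "r > 0"
  shows "V1 \<mu> y (r *\<^sub>R p) = V1 \<mu> y p" "B1 \<mu> y (r *\<^sub>R p) = r *\<^sub>R B1 \<mu> y p" "Fs \<mu> y (r *\<^sub>R p) = r * Fs \<mu> y p"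
proof -
  have n: "nrm2 y (r *\<^sub>R p) = r\<^sup>2 * nrm2 y p" unfolding nrm2_def
    by (simp add: linear_scale[OF sharp_linear[OF assms(1)]] power2_eq_square)
  show V: "V1 \<mu> y (r *\<^sub>R p) = V1 \<mu> y p"
    unfolding V1_def n using assms by (simp add: linear_scale[OF sharp_linear] real_sqrt_divide real_sqrt_mult)
  show "B1 \<mu> y (r *\<^sub>R p) = r *\<^sub>R B1 \<mu> y p"
    unfolding B1_def n V using assms by (simp add: real_sqrt_divide real_sqrt_mult)
  show "Fs \<mu> y (r *\<^sub>R p) = r * Fs \<mu> y p"
    unfolding Fs_def n using assms by (simp add: real_sqrt_mult algebra_simps)
qed

lemma DLag_eq:
  assumes "y \<in> Y"
  shows "DLag \<mu> (y, e) (u, u') = F \<mu> y e / sqrt (Q \<mu> y e) *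
    (bb (F \<mu> y e) y e u + (F \<mu> y e *\<^sub>R wvec y + flat y e) \<bullet> u')"
  unfolding DLag_def mom_def by (simp add: algebra_simps)

lemma DLag_momentum:
  assumes "(y, e) \<in> Omega \<mu>" "\<mu> \<ge> 0" "e \<noteq> 0"
  shows "DLag \<mu> (y, e) (u, u') = F \<mu> y e * (B1 \<mu> y (mom \<mu> y e) \<bullet> u) + mom \<mu> y e \<bullet> u'"
  unfolding DLag_def using mom_facts(5)[OF assms] by simp

text \<open>Away from the zero vector this is the chain rule with
  \<open>rk_algebra_derivative\<close>. The zero vector lies in \<open>Omega\<close> only if l +
  \<mu> > 0; there the squared metric is bounded by a multiple of Q, and Q is quadratic in
  \<open>e\<close>.\<close>

lemma Lag_has_derivative:
  assumes "(y, e) \<in> Omega \<mu>" "\<mu> \<ge> 0"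
  shows "(Lag \<mu> has_derivative DLag \<mu> (y, e)) (at (y, e))"
proof -
  have y: "y \<in> Y" using assms(1) Omega_Y by blast
  let ?q = "\<lambda>z. Q \<mu> (fst z) (snd z)"
  let ?dw = "\<lambda>d. Dw y e (fst d) + w y (snd d)" and ?dg = "\<lambda>d. DG y e (fst d) + 2 * G y e (snd d)"
  let ?dl = "\<lambda>d. Dl y (fst d)"
  let ?lam = "l y + \<mu>"
  have dl: "((\<lambda>z. l (fst z) + \<mu>) has_derivative ?dl) (at (y, e))"
    using has_derivative_add[OF l_joint[OF y, of e] has_derivative_const] by simp
  have "(?q has_derivative (\<lambda>d. (?lam * ?dg d + ?dl d * G y e e) + (w y e * ?dw d + ?dw d * w y e))) (at (y, e))"
    unfolding Q_def power2_eq_square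
    using has_derivative_add[OF has_derivative_mult[OF dl G_joint[OF y, of e]] has_derivative_mult[OF w_joint[OF y, of e] w_joint[OF y, of e]]]
    by simp
  then have dq: "(?q has_derivative (\<lambda>d. ?dl d * G y e e + ?lam * ?dg d + 2 * w y e * ?dw d)) (at (y, e))"
    by (rule has_derivative_eq_rhs) (auto simp: algebra_simps)
  show ?thesis
  proof (cases "e = 0")
    case False
    note F = F_facts[OF assms False]
    let ?r = "sqrt (Q \<mu> y e)" and ?c = "F \<mu> y e"
    have Qp: "Q \<mu> y e > 0" using F(1) by simp
    have ds: "(sqrt has_derivative (*) (inverse ?r / 2)) (at (Q \<mu> (fst (y, e)) (snd (y, e))))"
      using DERIV_real_sqrt[OF Qp] by (simp add: has_field_derivative_def)
    have dr: "((\<lambda>z. sqrt (?q z)) has_derivative (\<lambda>d. (?dl d * G y e e + ?lam * ?dg d + 2 * w y e * ?dw d) / (2 * ?r))) (at (y, e))"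
      by (rule has_derivative_eq_rhs[OF has_derivative_compose[OF dq ds]])
        (simp add: fun_eq_iff field_simps)
    have dden: "((\<lambda>z. - w (fst z) (snd z) + sqrt (?q z)) has_derivative
       (\<lambda>d. - ?dw d + (?dl d * G y e e + ?lam * ?dg d + 2 * w y e * ?dw d) / (2 * ?r))) (at (y, e))"
      by (intro has_derivative_add has_derivative_minus dr w_joint y)
    have "((\<lambda>z. F \<mu> (fst z) (snd z)) has_derivative (\<lambda>d. (?dg d * (- w y e + ?r) - G y e e *
        (- ?dw d + (?dl d * G y e e + ?lam * ?dg d + 2 * w y e * ?dw d) / (2 * ?r))) / ((- w y e + ?r) * (- w y e + ?r)))) (at (y, e))"
      unfolding F_def using F(2) has_derivative_divide'[OF G_joint[OF y, of e] dden] by simp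
    then have dF: "((\<lambda>z. F \<mu> (fst z) (snd z)) has_derivative (\<lambda>d. (?c * ?dw d + ?dg d / 2 - ?c\<^sup>2 * ?dl d / 2) / ?r)) (at (y, e))"
      by (rule has_derivative_eq_rhs)
        (rule ext, subst rk_algebra_derivative[OF F(1,2,3,5), symmetric], simp add: power2_eq_square)
    have "((\<lambda>z. Lag \<mu> z) has_derivative (\<lambda>d. ?c * ((?c * ?dw d + ?dg d / 2 - ?c\<^sup>2 * ?dl d / 2) / ?r))) (at (y, e))"
    proof -
      have e: "Lag \<mu> = (\<lambda>z. 1 / 2 * (F \<mu> (fst z) (snd z) * F \<mu> (fst z) (snd z)))"
        by (auto simp: Lag_def power2_eq_square)
      show ?thesis unfolding e
        by (rule has_derivative_eq_rhs[OF has_derivative_mult_right[OF has_derivative_mult[OF dF dF], of "1 / 2"]]) auto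
    qed
    then show ?thesis
    proof (rule has_derivative_eq_rhs, intro ext)
      fix d :: "'b \<times> 'b"
      show "?c * ((?c * ?dw d + ?dg d / 2 - ?c\<^sup>2 * ?dl d / 2) / ?r) = DLag \<mu> (y, e) d"
        by (subst prod.collapse[of d, symmetric], subst DLag_eq[OF y])
          (simp add: bb_def inner_add_left inner_wvec inner_flat y field_simps)
    qed
  next
    case True
    then have lam: "?lam > 0" using assms(1) F_zero(3)[OF y] by (auto simp: Omega_def)
    have D0: "DLag \<mu> (y, e) = (\<lambda>d. 0)" unfolding DLag_def mom_def True by (auto simp: F_zero y)
    \<comment> \<open>The majorant comes from (l + \<mu>) F = sqrt Q + w \<le> 2 sqrt Q.\<close>
    let ?g = "\<lambda>z. 2 * ?q z / (l (fst z) + \<mu>)\<^sup>2"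
    have dq0: "(?q has_derivative (\<lambda>d. 0)) (at (y, e))"
      using dq by (rule has_derivative_eq_rhs) (auto simp: True F_zero y DG_def)
    have lsq: "((\<lambda>z. (l (fst z) + \<mu>)\<^sup>2) has_derivative (\<lambda>d. ?lam * ?dl d + ?dl d * ?lam)) (at (y, e))"
      unfolding power2_eq_square using has_derivative_mult[OF dl dl] by simp
    have dg: "(?g has_derivative (\<lambda>d. 0)) (at (y, e))"
      using has_derivative_divide'[OF has_derivative_mult_right[OF dq0, of 2] lsq] lam by (simp add: True F_zero y)
    have ev: "\<forall>\<^sub>F z in at (y, e). \<bar>Lag \<mu> z\<bar> \<le> ?g z"
    proof -
      have "isCont (\<lambda>z. l (fst z) + \<mu>) (y, e)" using has_derivative_continuous[OF dl] .
      then have "\<forall>\<^sub>F z in at (y, e). l (fst z) + \<mu> > 0"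
        unfolding isCont_def using lam order_tendstoD(1) by fastforce
      moreover have "\<forall>\<^sub>F z in at (y, e). z \<in> Y \<times> UNIV"
        using open_Times[OF open_Y open_UNIV] y by (auto intro!: eventually_at_in_open')
      ultimately show ?thesis
      proof eventually_elim
        fix z assume z: "l (fst z) + \<mu> > 0" "z \<in> Y \<times> (UNIV :: 'b set)"
        then have zY: "fst z \<in> Y" by auto
        let ?L = "l (fst z) + \<mu>"
        have "Lag \<mu> z \<le> ?g z"
        proof (cases "snd z = 0")
          case True then show ?thesis using zY by (simp add: Lag_def F_zero)
        next
          case False
          have Om: "(fst z, snd z) \<in> Omega \<mu>" using z by (auto simp: Omega_def)
          note Fz = F_facts[OF Om assms(2) False]
          have "?L * F \<mu> (fst z) (snd z) \<le> 2 * sqrt (?q z)"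
            using Fz(2,3) by linarith
          then have "(?L * F \<mu> (fst z) (snd z))\<^sup>2 \<le> (2 * sqrt (?q z))\<^sup>2"
            using Fz(4) z(1) by (intro power_mono) auto
          then have "?L\<^sup>2 * (F \<mu> (fst z) (snd z))\<^sup>2 \<le> 4 * ?q z"
            using Q_square(1)[OF zY assms(2)] by (simp add: power_mult_distrib)
          then show ?thesis using z(1) by (simp add: Lag_def field_simps)
        qed
        then show "\<bar>Lag \<mu> z\<bar> \<le> ?g z" by (simp add: Lag_def)
      qed
    qed
    show ?thesis unfolding D0
      by (rule has_derivative_zero_squeeze[OF dg _ _ ev]) (auto simp: True F_zero y Lag_def)
  qed
qed

end

section \<open>Differential equations on closed intervals and Gronwall bounds\<close>

text \<open>The fundamental theorem of calculus tolerates finitely many exceptions, and the integral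
  of the continuous \<open>g\<close> is differentiable everywhere. This removes the corners of a
  geodesic once its velocity is a continuous function of position and momentum.\<close>

lemma ode_from_finite_exceptions:
  fixes z :: "real \<Rightarrow> 'e::banach"
  assumes "finite B" "continuous_on {a..b} z" "continuous_on {a..b} g"
    and "\<And>s. s \<in> {a<..<b} - B \<Longrightarrow> (z has_vector_derivative g s) (at s)"
    and "s \<in> {a..b}"
  shows "(z has_vector_derivative g s) (at s within {a..b})"
proof -
  have int: "(g has_integral z t - z a) {a..t}" if "t \<in> {a..b}" for t
    by (rule fundamental_theorem_of_calculus_interior_strong[OF assms(1)])
      (use that assms(2,4) in \<open>auto intro: continuous_on_subset\<close>)
  have eq: "z t = z a + integral {a..t} g" if "t \<in> {a..b}" for t
    using integral_unique[OF int[OF that]] by simp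
  have "((\<lambda>t. z a + integral {a..t} g) has_vector_derivative 0 + g s) (at s within {a..b})"
    by (intro has_vector_derivative_add has_vector_derivative_const integral_has_vector_derivative assms(3,5))
  from has_vector_derivative_transform[OF assms(5) eq this] show ?thesis by (simp only: add_0_left)
qed

lemma ode_of_integral_equation:
  fixes z :: "real \<Rightarrow> 'e::banach"
  assumes "continuous_on {a..b} g" "\<And>t. t \<in> {a..b} \<Longrightarrow> z t = z a + integral {a..t} g" "s \<in> {a..b}"
  shows "(z has_vector_derivative g s) (at s within {a..b})"
proof -
  have "((\<lambda>t. z a + integral {a..t} g) has_vector_derivative 0 + g s) (at s within {a..b})"
    by (intro has_vector_derivative_add has_vector_derivative_const integral_has_vector_derivative assms(1,3))
  from has_vector_derivative_transform[OF assms(3) assms(2) this] show ?thesis by (simp only: add_0_left)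
qed

lemma has_vector_derivative_on_imp_continuous_on:
  assumes "\<And>s. s \<in> S \<Longrightarrow> (z has_vector_derivative g s) (at s within S)"
  shows "continuous_on S z"
  using assms has_vector_derivative_continuous continuous_on_eq_continuous_within by blast

text \<open>Multiplied by exp(2 A (s - a)), the squared norm of \<pi> increases; multiplied by
  exp(-2 A (s - a)), it decreases. The lower bound is what keeps limits of normalised momenta away
  from 0.\<close>

lemma gronwall_norm_bounds:
  fixes \<pi> :: "real \<Rightarrow> 'e::euclidean_space"
  assumes d: "\<And>s. s \<in> {a..b} \<Longrightarrow> (\<pi> has_vector_derivative \<pi>' s) (at s within {a..b})"
    and A: "\<And>s. s \<in> {a..b} \<Longrightarrow> norm (\<pi>' s) \<le> A * norm (\<pi> s)"
    and "norm (\<pi> a) = 1" "s \<in> {a..b}"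
  shows "exp (- A * (b - a)) \<le> norm (\<pi> s)" "norm (\<pi> s) \<le> exp (A * (b - a))"
proof -
  have A0: "A \<ge> 0" using A[of a] assms(3,4) order_trans[OF norm_ge_zero[of "\<pi>' a"]] by auto
  have cont: "continuous_on {a..b} \<pi>" using has_vector_derivative_on_imp_continuous_on d by blast
  have dd: "((\<lambda>s. exp (k * (s - a)) * (\<pi> s \<bullet> \<pi> s)) has_real_derivative
      exp (k * (x - a)) * (k * (\<pi> x \<bullet> \<pi> x) + 2 * (\<pi> x \<bullet> \<pi>' x))) (at x)" if "a < x" "x < b" for k x
  proof -
    have "(\<pi> has_vector_derivative \<pi>' x) (at x)" using d[of x] that by (simp add: at_within_Icc_at)
    then have "((\<lambda>s. \<pi> s \<bullet> \<pi> s) has_derivative (\<lambda>h. \<pi> x \<bullet> (h *\<^sub>R \<pi>' x) + (h *\<^sub>R \<pi>' x) \<bullet> \<pi> x)) (at x)"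
      unfolding has_vector_derivative_def by (intro has_derivative_inner)
    then have "((\<lambda>s. \<pi> s \<bullet> \<pi> s) has_real_derivative 2 * (\<pi> x \<bullet> \<pi>' x)) (at x)"
      unfolding has_field_derivative_def by (rule has_derivative_eq_rhs) (auto simp: inner_commute)
    then show ?thesis by (auto intro!: derivative_eq_intros simp: algebra_simps)
  qed
  have bnd: "\<bar>2 * (\<pi> x \<bullet> \<pi>' x)\<bar> \<le> 2 * A * (\<pi> x \<bullet> \<pi> x)" if "x \<in> {a..b}" for x
  proof -
    have "\<bar>\<pi> x \<bullet> \<pi>' x\<bar> \<le> norm (\<pi> x) * norm (\<pi>' x)" by (rule Cauchy_Schwarz_ineq2)
    also have "\<dots> \<le> norm (\<pi> x) * (A * norm (\<pi> x))" using A[OF that] by (intro mult_left_mono) auto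
    also have "\<dots> = A * (\<pi> x \<bullet> \<pi> x)" by (simp add: dot_square_norm power2_eq_square)
    finally show ?thesis by (simp add: abs_mult)
  qed
  have n1: "\<pi> a \<bullet> \<pi> a = 1" using assms(3) by (simp add: dot_square_norm)
  have lo: "1 \<le> exp (2 * A * (s - a)) * (\<pi> s \<bullet> \<pi> s)"
  proof -
    have "exp (2 * A * (a - a)) * (\<pi> a \<bullet> \<pi> a) \<le> exp (2 * A * (s - a)) * (\<pi> s \<bullet> \<pi> s)"
    proof (rule DERIV_nonneg_imp_increasing_open[where f = "\<lambda>s. exp (2 * A * (s - a)) * (\<pi> s \<bullet> \<pi> s)"])
      fix x assume "a < x" "x < s"
      then show "\<exists>y. ((\<lambda>s. exp (2 * A * (s - a)) * (\<pi> s \<bullet> \<pi> s)) has_real_derivative y) (at x) \<and> 0 \<le> y"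
        using dd[of x "2 * A"] bnd[of x] assms(4) by (intro exI conjI) auto
    qed (use assms(4) cont in \<open>auto intro!: continuous_intros intro: continuous_on_subset\<close>)
    then show ?thesis using n1 by simp
  qed
  have hi: "exp (-2 * A * (s - a)) * (\<pi> s \<bullet> \<pi> s) \<le> 1"
  proof -
    have "- (exp (-2 * A * (a - a)) * (\<pi> a \<bullet> \<pi> a)) \<le> - (exp (-2 * A * (s - a)) * (\<pi> s \<bullet> \<pi> s))"
    proof (rule DERIV_nonneg_imp_increasing_open[where f = "\<lambda>s. - (exp (-2 * A * (s - a)) * (\<pi> s \<bullet> \<pi> s))"])
      fix x assume x: "a < x" "x < s"
      then have "((\<lambda>s. - (exp (-2 * A * (s - a)) * (\<pi> s \<bullet> \<pi> s))) has_real_derivative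
         - (exp (-2 * A * (x - a)) * (-2 * A * (\<pi> x \<bullet> \<pi> x) + 2 * (\<pi> x \<bullet> \<pi>' x)))) (at x)"
        using dd[of x "-2 * A"] assms(4) by (intro DERIV_minus) auto
      moreover have "-2 * A * (\<pi> x \<bullet> \<pi> x) + 2 * (\<pi> x \<bullet> \<pi>' x) \<le> 0"
        using bnd[of x] assms(4) x by auto
      then have "0 \<le> - (exp (-2 * A * (x - a)) * (-2 * A * (\<pi> x \<bullet> \<pi> x) + 2 * (\<pi> x \<bullet> \<pi>' x)))"
        unfolding neg_0_le_iff_le by (rule mult_nonneg_nonpos[OF exp_ge_zero])
      ultimately show "\<exists>y. ((\<lambda>s. - (exp (-2 * A * (s - a)) * (\<pi> s \<bullet> \<pi> s))) has_real_derivative y) (at x) \<and> 0 \<le> y"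
        by blast
    qed (use assms(4) cont in \<open>auto intro!: continuous_intros intro: continuous_on_subset\<close>)
    then show ?thesis using n1 by simp
  qed
  have e1: "exp (- X) \<le> q" if "1 \<le> exp X * q" for X q :: real
    using that by (simp add: exp_minus divide_simps mult.commute)
  have e2: "q \<le> exp X" if "exp (- X) * q \<le> 1" for X q :: real
    using that by (simp add: exp_minus divide_simps mult.commute)
  have sq: "(exp x)\<^sup>2 = exp (2 * x)" for x :: real by (simp add: exp_double)
  have m: "A * (s - a) \<le> A * (b - a)" using assms(4) A0 by (intro mult_left_mono) auto
  have "exp (2 * (- A * (b - a))) \<le> exp (- (2 * A * (s - a)))" using m by simp
  also have "\<dots> \<le> \<pi> s \<bullet> \<pi> s" by (rule e1[OF lo])
  finally have "(exp (- A * (b - a)))\<^sup>2 \<le> (norm (\<pi> s))\<^sup>2" unfolding sq dot_square_norm .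
  from power2_le_imp_le[OF this norm_ge_zero] show "exp (- A * (b - a)) \<le> norm (\<pi> s)" .
  have "\<pi> s \<bullet> \<pi> s \<le> exp (2 * A * (s - a))" using hi by (intro e2) simp
  also have "\<dots> \<le> exp (2 * (A * (b - a)))" using m by simp
  finally have "(norm (\<pi> s))\<^sup>2 \<le> (exp (A * (b - a)))\<^sup>2" unfolding sq dot_square_norm .
  from power2_le_imp_le[OF this exp_ge_zero] show "norm (\<pi> s) \<le> exp (A * (b - a))" .
qed

section \<open>Variations and the Hamiltonian system\<close>

text \<open>Piecewise affine test functions: a chart curve displaced by a multiple of
  \<open>trap\<close> stays smooth on each piece, and \<open>trap'\<close> is a difference of two
  normalised indicator functions, so testing compares two averages. The derivatives are set to 0 at
  the corners.\<close>

definition ramp :: "real \<Rightarrow> real \<Rightarrow> real \<Rightarrow> real" where "ramp s h r = min 1 (max 0 ((r - s) / h))"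
definition ramp' :: "real \<Rightarrow> real \<Rightarrow> real \<Rightarrow> real" where "ramp' s h r = (if s < r \<and> r < s + h then 1 / h else 0)"
definition trap :: "real \<Rightarrow> real \<Rightarrow> real \<Rightarrow> real \<Rightarrow> real" where "trap s t h r = ramp s h r - ramp (t - h) h r"
definition trap' :: "real \<Rightarrow> real \<Rightarrow> real \<Rightarrow> real \<Rightarrow> real" where "trap' s t h r = ramp' s h r - ramp' (t - h) h r"

text \<open>The slope is read off at the midpoint because \<open>u\<close> and \<open>v\<close> may
  be corners, where \<open>ramp'\<close> is 0 by definition.\<close>

lemma ramp_affine:
  assumes "h > 0" "u < v" "s \<notin> {u<..<v}" "s + h \<notin> {u<..<v}" "r \<in> {u..v}"
  shows "ramp s h r = ramp s h u + (r - u) * ramp' s h ((u + v) / 2)"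
proof -
  consider "v \<le> s" | "s \<le> u" "v \<le> s + h" | "s + h \<le> u" using assms by fastforce
  then show ?thesis
  proof cases
    case 1
    then have "(r - s) / h \<le> 0" "(u - s) / h \<le> 0" "\<not> s < (u + v) / 2"
      using assms by (auto simp: divide_le_0_iff)
    then show ?thesis by (simp add: ramp_def ramp'_def)
  next
    case 2
    then have "0 \<le> (r - s) / h" "(r - s) / h \<le> 1" "0 \<le> (u - s) / h" "(u - s) / h \<le> 1"
      "s < (u + v) / 2 \<and> (u + v) / 2 < s + h"
      using assms by (auto simp: field_simps)
    then show ?thesis by (simp add: ramp_def ramp'_def diff_divide_distrib)
  next
    case 3
    then have "1 \<le> (r - s) / h" "1 \<le> (u - s) / h" "\<not> (u + v) / 2 < s + h"
      using assms by (auto simp: field_simps)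
    then show ?thesis by (simp add: ramp_def ramp'_def)
  qed
qed

lemma ramp'_const:
  assumes "h > 0" "s \<notin> {u<..<v}" "s + h \<notin> {u<..<v}" "r \<in> {u<..<v}"
  shows "ramp' s h r = ramp' s h ((u + v) / 2)"
proof -
  have "s \<le> u \<or> v \<le> s" "s + h \<le> u \<or> v \<le> s + h" "u < (u + v) / 2" "(u + v) / 2 < v" "u < r" "r < v"
    using assms by auto
  then show ?thesis unfolding ramp'_def by (elim disjE) auto
qed

lemma trap_affine:
  assumes "h > 0" "u < v" "{s, s + h, t - h, t} \<inter> {u<..<v} = {}" "r \<in> {u..v}"
  shows "trap s t h r = trap s t h u + (r - u) * trap' s t h ((u + v) / 2)"
  using ramp_affine[of h u v s r] ramp_affine[of h u v "t - h" r] assms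
  by (auto simp: trap_def trap'_def algebra_simps)

lemma trap'_const:
  assumes "h > 0" "{s, s + h, t - h, t} \<inter> {u<..<v} = {}" "r \<in> {u<..<v}"
  shows "trap' s t h r = trap' s t h ((u + v) / 2)"
  using ramp'_const[of h s u v r] ramp'_const[of h "t - h" u v r] assms by (auto simp: trap'_def)

lemma trap_zero:
  assumes "h > 0" "r \<le> s \<or> t \<le> r" "s + h \<le> t - h" shows "trap s t h r = 0"
proof -
  have "(r - s) / h \<le> 0 \<and> (r - (t - h)) / h \<le> 0" if "r \<le> s"
    using that assms by (auto simp: divide_le_0_iff)
  moreover have "(r - s) / h \<ge> 1 \<and> (r - (t - h)) / h \<ge> 1" if "t \<le> r"
    using that assms by (auto simp: field_simps)
  ultimately show ?thesis using assms(2) unfolding trap_def ramp_def by auto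
qed

lemma trap_continuous: "h > 0 \<Longrightarrow> continuous_on S (trap s t h)"
  unfolding trap_def[abs_def] ramp_def by (intro continuous_intros) auto

lemma trap_derivative:
  assumes "h > 0" "r \<notin> {s, s + h, t - h, t}"
  shows "(trap s t h has_real_derivative trap' s t h r) (at r)"
proof -
  have D: "(ramp s h has_real_derivative ramp' s h r) (at r)" if ne: "r \<noteq> s" "r \<noteq> s + h" for s
  proof -
    consider "r < s" | "s < r" "r < s + h" | "r > s + h" 
      using ne by (cases r s rule: linorder_cases; cases r "s + h" rule: linorder_cases) auto
    then show ?thesis
    proof cases
      case 1
      have "((\<lambda>r. 0) has_real_derivative ramp' s h r) (at r)" using 1 by (simp add: ramp'_def)
      then show ?thesis
        by (rule has_field_derivative_transform_within_open[OF _ open_lessThan[of s]])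
          (use 1 assms in \<open>auto simp: ramp_def max_def zero_le_divide_iff divide_le_0_iff\<close>)
    next
      case 2
      have "((\<lambda>r. (r - s) / h) has_real_derivative ramp' s h r) (at r)"
        using 2 assms(1) by (auto intro!: derivative_eq_intros simp: ramp'_def)
      then show ?thesis
        by (rule has_field_derivative_transform_within_open[OF _ open_greaterThanLessThan[of s "s + h"]])
          (use 2 assms in \<open>auto simp: ramp_def field_simps\<close>)
    next
      case 3
      have "((\<lambda>r. 1) has_real_derivative ramp' s h r) (at r)" using 3 by (simp add: ramp'_def)
      then show ?thesis
        by (rule has_field_derivative_transform_within_open[OF _ open_greaterThan[of "s + h"]])
          (use 3 assms in \<open>auto simp: ramp_def min_def max_def field_simps\<close>)
    qed
  qed
  show ?thesis unfolding trap_def[abs_def] trap'_def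
    by (intro DERIV_diff D) (use assms in auto)
qed

lemma ramp'_integral:
  assumes k: "k integrable_on {a..b}" and "a \<le> s" "s + h \<le> b" "h > 0"
  shows "((\<lambda>r. ramp' s h r * k r) has_integral (1 / h * integral {s..s + h} k)) {a..b}"
proof -
  have "k integrable_on {s..s+h}" using integrable_on_subinterval[OF k] assms by auto
  then have "((\<lambda>r. 1 / h * k r) has_integral (1 / h * integral {s..s + h} k)) {s..s + h}"
    by (intro has_integral_mult_right integrable_integral)
  then have "((\<lambda>r. if r \<in> {s..s + h} then 1 / h * k r else 0) has_integral (1 / h * integral {s..s + h} k)) {a..b}"
    by (subst has_integral_restrict) (use assms in auto)
  then show ?thesis
    by (rule has_integral_spike_finite[of "{s, s + h}", rotated 2]) (auto simp: ramp'_def)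
qed

text \<open>Integration by parts moves \<open>f\<close> into its primitive, so \<open>trap'\<close>
  integrates to 0 against k = p minus that primitive. Hence the averages of k over two intervals of
  equal length at the ends of the trapezoid agree, and shrinking them makes k constant.\<close>

lemma du_bois_reymond:
  fixes f p :: "real \<Rightarrow> real"
  assumes "a < b" "finite B" "f integrable_on {a..b}" "p integrable_on {a..b}"
    and fc: "\<And>s. s \<in> {a<..<b} - B \<Longrightarrow> isCont f s" and pc: "\<And>s. s \<in> {a<..<b} - B \<Longrightarrow> isCont p s"
    and test: "\<And>s t h. a \<le> s \<Longrightarrow> h > 0 \<Longrightarrow> s + h < t - h \<Longrightarrow> t \<le> b \<Longrightarrow>
      ((\<lambda>r. trap s t h r * f r + trap' s t h r * p r) has_integral 0) {a..b}"
  obtains C where "\<And>s. s \<in> {a<..<b} - B \<Longrightarrow> p s = C + integral {a..s} f"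
proof -
  define Fi where "Fi s = integral {a..s} f" for s
  define k where "k s = p s - Fi s" for s
  define K where "K s = integral {a..s} k" for s
  have Fic: "continuous_on {a..b} Fi" unfolding Fi_def by (rule indefinite_integral_continuous_1[OF assms(3)])
  have ki: "k integrable_on {a..b}" unfolding k_def
    by (intro integrable_diff assms(4) integrable_continuous_real Fic)
  have dFi: "(Fi has_real_derivative f s) (at s)" if "s \<in> {a<..<b} - B" for s
    using integral_has_vector_derivative_continuous_at[OF assms(3), of s "{}"] fc[OF that] that
    unfolding Fi_def has_real_derivative_iff_has_vector_derivative
    by (auto simp: at_within_Icc_at continuous_at_imp_continuous_at_within)
  have kc: "isCont k s" if "s \<in> {a<..<b} - B" for s
    unfolding k_def using pc[OF that] DERIV_isCont[OF dFi[OF that]] by (intro continuous_intros)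
  have dK: "(K has_real_derivative k s) (at s)" if "s \<in> {a<..<b} - B" for s
    using integral_has_vector_derivative_continuous_at[OF ki, of s "{}"] kc[OF that] that
    unfolding K_def has_real_derivative_iff_has_vector_derivative
    by (auto simp: at_within_Icc_at continuous_at_imp_continuous_at_within)
  \<comment> \<open>The primitive times the trapezoid vanishes at both ends, so its derivative
    integrates to 0; subtracting this from the hypothesis leaves only \<open>trap'\<close> times
    \<open>k\<close>.\<close>
  have avg: "K (s + h) - K s = K t - K (t - h)" if h: "a \<le> s" "h > 0" "s + h < t - h" "t \<le> b" for s t h
  proof -
    let ?T = "{s, s + h, t - h, t}"
    have "((\<lambda>r. trap s t h r * f r + trap' s t h r * Fi r) has_integral
        trap s t h b * Fi b - trap s t h a * Fi a) {a..b}"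
    proof (rule fundamental_theorem_of_calculus_interior_strong[of "B \<union> ?T"])
      fix r assume "r \<in> {a<..<b} - (B \<union> ?T)"
      then show "((\<lambda>r. trap s t h r * Fi r) has_vector_derivative trap s t h r * f r + trap' s t h r * Fi r) (at r)"
        unfolding has_real_derivative_iff_has_vector_derivative[symmetric]
        using DERIV_mult[OF trap_derivative[OF h(2)] dFi] by (auto simp: algebra_simps)
    qed (use assms(1,2) Fic trap_continuous[OF h(2)] in \<open>auto intro!: continuous_intros\<close>)
    moreover have "trap s t h b = 0" "trap s t h a = 0" using h by (auto intro!: trap_zero)
    ultimately have "((\<lambda>r. trap s t h r * f r + trap' s t h r * Fi r) has_integral 0) {a..b}" by simp
    from has_integral_diff[OF test[OF h] this]
    have z: "((\<lambda>r. trap' s t h r * k r) has_integral 0) {a..b}" by (simp add: k_def algebra_simps)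
    have "((\<lambda>r. ramp' s h r * k r - ramp' (t - h) h r * k r) has_integral
        1 / h * integral {s..s + h} k - 1 / h * integral {t - h..t - h + h} k) {a..b}"
      by (intro has_integral_diff ramp'_integral ki) (use h in auto)
    moreover have "((\<lambda>r. ramp' s h r * k r - ramp' (t - h) h r * k r) has_integral 0) {a..b}"
      using z by (simp add: trap'_def left_diff_distrib)
    ultimately have "1 / h * integral {s..s + h} k - 1 / h * integral {t - h..t - h + h} k = 0"
      by (rule has_integral_unique)
    then have "integral {s..s + h} k = integral {t - h..t} k" using h by (simp add: field_simps)
    moreover have "K (s + h) - K s = integral {s..s + h} k" "K t - K (t - h) = integral {t - h..t} k"
      unfolding K_def
      using Henstock_Kurzweil_Integration.integral_combine[where a = a and c = s and b = "s + h" and f = k]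
        Henstock_Kurzweil_Integration.integral_combine[where a = a and c = "t - h" and b = t and f = k] h
        integrable_on_subinterval[OF ki, of a "s + h"] integrable_on_subinterval[OF ki, of a t] by auto
    ultimately show ?thesis by simp
  qed
  have eq: "k s = k t" if st: "s \<in> {a<..<b} - B" "t \<in> {a<..<b} - B" "s < t" for s t
  proof -
    \<comment> \<open>Divided by \<open>h\<close>, the two sides of \<open>avg\<close> are a right
      difference quotient of \<open>K\<close> at \<open>s\<close> and a left one at
      \<open>t\<close>.\<close>
    have 1: "((\<lambda>h. (K (s + h) - K s) / h) \<longlongrightarrow> k s) (at_right 0)"
      using dK[OF st(1)] unfolding DERIV_def by (rule tendsto_within_subset) auto
    have "((\<lambda>h. (K (t + h) - K t) / h) \<longlongrightarrow> k t) (at_left 0)"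
      using dK[OF st(2)] unfolding DERIV_def by (rule tendsto_within_subset) auto
    then have "((\<lambda>h. (K (t + - h) - K t) / (- h)) \<longlongrightarrow> k t) (at_right 0)"
      unfolding at_left_minus[of 0] filterlim_filtermap by simp
    then have 2: "((\<lambda>h. (K t - K (t - h)) / h) \<longlongrightarrow> k t) (at_right 0)"
      by (rule tendsto_cong[THEN iffD1, rotated]) (auto intro!: always_eventually simp: divide_simps)
    have "\<forall>\<^sub>F h in at_right 0. (K (s + h) - K s) / h = (K t - K (t - h)) / h"
    proof (intro eventually_at_rightI[of 0 "(t - s) / 2"])
      fix h assume "h \<in> {0<..<(t - s) / 2}"
      then have "K (s + h) - K s = K t - K (t - h)" by (intro avg) (use st in \<open>auto simp: field_simps\<close>)
      then show "(K (s + h) - K s) / h = (K t - K (t - h)) / h" by simp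
    qed (use st in auto)
    then have "((\<lambda>h. (K t - K (t - h)) / h) \<longlongrightarrow> k s) (at_right 0)"
      by (rule tendsto_cong[THEN iffD1, OF _ 1])
    from tendsto_unique[OF trivial_limit_at_right_real this 2] show ?thesis .
  qed
  show ?thesis
  proof (cases "{a<..<b} - B = {}")
    case True then show ?thesis using that by blast
  next
    case False
    then obtain s0 where s0: "s0 \<in> {a<..<b} - B" by blast
    have ks: "k s = k s0" if "s \<in> {a<..<b} - B" for s
    proof (cases s s0 rule: linorder_cases)
      case less then show ?thesis by (rule eq[OF that s0])
    next
      case greater then show ?thesis by (rule eq[OF s0 that, symmetric])
    qed simp
    have "p s = k s0 + integral {a..s} f" if "s \<in> {a<..<b} - B" for s
      using ks[OF that] unfolding k_def Fi_def by linarith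
    then show ?thesis using that by blast
  qed
qed

section \<open>First variation of the energy in a chart\<close>

context rk_chart
begin

lemma open_Omega: "open (Omega \<mu>)"
proof -
  let ?W = "Y \<times> (UNIV :: 'b set)"
  have W: "open ?W" by (intro open_Times open_Y open_UNIV)
  have "continuous_on ?W (\<lambda>z. l (fst z) + \<mu>)"
    by (intro continuous_intros continuous_on_pull[OF _ _ l_smooth]) auto
  then have 1: "open (?W \<inter> (\<lambda>z. l (fst z) + \<mu>) -` {0<..})"
    by (rule continuous_open_preimage[OF _ W]) simp
  have "continuous_on ?W (\<lambda>z. w (fst z) (snd z))"
    by (intro continuous_intros continuous_w) auto
  then have 2: "open (?W \<inter> (\<lambda>z. w (fst z) (snd z)) -` {..<0})"
    by (rule continuous_open_preimage[OF _ W]) simp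
  have "Omega \<mu> = (?W \<inter> (\<lambda>z. l (fst z) + \<mu>) -` {0<..}) \<union> (?W \<inter> (\<lambda>z. w (fst z) (snd z)) -` {..<0})"
    by (auto simp: Omega_def)
  then show ?thesis using open_Un[OF 1 2] by simp
qed

lemma continuous_sqrt_Q:
  assumes "continuous_on S a" "a ` S \<subseteq> Y" "continuous_on S e"
  shows "continuous_on S (\<lambda>x. sqrt (Q \<mu> (a x) (e x)))"
  unfolding Q_def by (intro continuous_intros assms G_continuous continuous_w continuous_on_pull[OF _ _ l_smooth])

text \<open>Two open sets cover \<open>Omega\<close>. Where l + \<mu> > 0 the Randers formula is
  used, which is continuous at the zero vector; where w < 0 the denominator of the Kropina form is
  positive.\<close>

lemma continuous_F_Omega:
  assumes "\<mu> \<ge> 0" shows "continuous_on (Omega \<mu>) (\<lambda>z. F \<mu> (fst z) (snd z))"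
proof -
  let ?A = "Omega \<mu> \<inter> {z. l (fst z) + \<mu> > 0}" and ?B = "Omega \<mu> \<inter> {z. w (fst z) (snd z) < 0}"
  have sub: "fst ` Omega \<mu> \<subseteq> Y" by (auto simp: Omega_def)
  have cl: "continuous_on (Omega \<mu>) (\<lambda>z. l (fst z) + \<mu>)"
    by (intro continuous_intros continuous_on_pull[OF _ sub l_smooth])
  have cw: "continuous_on (Omega \<mu>) (\<lambda>z. w (fst z) (snd z))"
    by (intro continuous_intros continuous_w sub)
  have "?A = Omega \<mu> \<inter> (\<lambda>z. l (fst z) + \<mu>) -` {0<..}" "?B = Omega \<mu> \<inter> (\<lambda>z. w (fst z) (snd z)) -` {..<0}" by auto
  then have op: "open ?A" "open ?B"
    using continuous_open_preimage[OF cl open_Omega open_greaterThan[of 0]]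
      continuous_open_preimage[OF cw open_Omega open_lessThan[of 0]] by auto
  have subA: "fst ` ?A \<subseteq> Y" and subB: "fst ` ?B \<subseteq> Y" using sub by auto
  have "continuous_on ?A (\<lambda>z. (sqrt (Q \<mu> (fst z) (snd z)) + w (fst z) (snd z)) / (l (fst z) + \<mu>))"
    by (intro continuous_intros continuous_sqrt_Q continuous_w continuous_on_pull[OF _ _ l_smooth] subA) auto
  then have A: "continuous_on ?A (\<lambda>z. F \<mu> (fst z) (snd z))"
  proof (rule continuous_on_eq)
    fix z assume z: "z \<in> ?A"
    then have y: "fst z \<in> Y" "(fst z, snd z) \<in> Omega \<mu>" using subA by auto
    show "(sqrt (Q \<mu> (fst z) (snd z)) + w (fst z) (snd z)) / (l (fst z) + \<mu>) = F \<mu> (fst z) (snd z)"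
    proof (cases "snd z = 0")
      case True then show ?thesis by (simp add: F_zero y)
    next
      case False
      then show ?thesis using F_facts(3)[OF y(2) assms False] z by (simp add: field_simps)
    qed
  qed
  have nz: "- w (fst z) (snd z) + sqrt (Q \<mu> (fst z) (snd z)) \<noteq> 0" if "z \<in> ?B" for z
  proof -
    have "fst z \<in> Y" using that subB by auto
    then have "sqrt (Q \<mu> (fst z) (snd z)) \<ge> 0" using Q_square(1) assms by simp
    moreover have "w (fst z) (snd z) < 0" using that by simp
    ultimately show ?thesis by linarith
  qed
  have B: "continuous_on ?B (\<lambda>z. F \<mu> (fst z) (snd z))"
    unfolding F_def by (intro continuous_intros continuous_sqrt_Q continuous_w G_continuous subB ballI nz)
  have "Omega \<mu> = ?A \<union> ?B" by (auto simp: Omega_def)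
  then show ?thesis using continuous_on_open_Un[OF op A B] by simp
qed

text \<open>Controls the factor F / sqrt Q of \<open>mom\<close> and \<open>DLag\<close> near the
  zero vector, where both terms of the quotient tend to 0.\<close>

lemma F_le_sqrt_Q:
  assumes "y \<in> Y" "\<mu> \<ge> 0" "l y + \<mu> > 0"
  shows "0 \<le> F \<mu> y e / sqrt (Q \<mu> y e)" "F \<mu> y e / sqrt (Q \<mu> y e) \<le> 2 / (l y + \<mu>)"
proof -
  have "0 \<le> F \<mu> y e / sqrt (Q \<mu> y e) \<and> F \<mu> y e / sqrt (Q \<mu> y e) \<le> 2 / (l y + \<mu>)"
  proof (cases "e = 0")
    case True then show ?thesis using assms by (simp add: F_zero)
  next
    case False
    have "(y, e) \<in> Omega \<mu>" using assms by (simp add: Omega_def)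
    note F = F_facts[OF this assms(2) False]
    have "(l y + \<mu>) * F \<mu> y e \<le> 2 * sqrt (Q \<mu> y e)" using F(2,3) by linarith
    then show ?thesis using F(1,4) assms(3) by (simp add: field_simps)
  qed
  then show "0 \<le> F \<mu> y e / sqrt (Q \<mu> y e)" "F \<mu> y e / sqrt (Q \<mu> y e) \<le> 2 / (l y + \<mu>)" by auto
qed

lemma bb_expand: "y \<in> Y \<Longrightarrow> bb c y e v = (\<Sum>i\<in>Basis. (v \<bullet> i) * bb c y e i)"
  using linear_euclidean_sum[OF bb_linear[of y c e], of v] by (simp only: real_scaleR_def)

text \<open>At a zero vector the quotient F / sqrt Q is bounded nearby by
  \<open>F_le_sqrt_Q\<close>, while the other factor \<open>?X\<close> tends to 0; elsewhere the
  denominator is positive.\<close>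

lemma DLag_continuous_Omega:
  assumes "\<mu> \<ge> 0"
  shows "continuous_on (Omega \<mu> \<times> UNIV) (\<lambda>x. DLag \<mu> (fst x) (snd x))"
proof -
  let ?S = "Omega \<mu> \<times> (UNIV :: ('b \<times> 'b) set)"
  let ?y = "\<lambda>x :: ('b \<times> 'b) \<times> ('b \<times> 'b). fst (fst x)" and ?e = "\<lambda>x :: ('b \<times> 'b) \<times> ('b \<times> 'b). snd (fst x)"
  let ?c = "\<lambda>x. F \<mu> (?y x) (?e x)" and ?R = "\<lambda>x. sqrt (Q \<mu> (?y x) (?e x))"
  let ?X = "\<lambda>x. (\<Sum>i\<in>Basis. (fst (snd x) \<bullet> i) * bb (?c x) (?y x) (?e x) i) + (?c x *\<^sub>R wvec (?y x) + flat (?y x) (?e x)) \<bullet> snd (snd x)"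
  have sub: "?y ` ?S \<subseteq> Y" by (auto simp: Omega_def)
  have c: "continuous_on ?S ?c"
    by (rule continuous_on_compose2[OF continuous_F_Omega[OF assms]]) (auto intro: continuous_intros)
  have X: "continuous_on ?S ?X"
    by (intro continuous_intros continuous_bb continuous_flat continuous_on_pull[OF _ _ wvec_smooth] c sub)
  have R: "continuous_on ?S ?R"
    by (intro continuous_sqrt_Q continuous_intros sub)
  have lc: "continuous_on ?S (\<lambda>x. l (?y x) + \<mu>)"
    by (intro continuous_intros continuous_on_pull[OF _ _ l_smooth] sub)
  have eq: "DLag \<mu> (fst x) (snd x) = ?c x / ?R x * ?X x" if "x \<in> ?S" for x
  proof -
    have y: "?y x \<in> Y" using that sub by auto
    have "DLag \<mu> (fst x) (snd x) = DLag \<mu> (?y x, ?e x) (fst (snd x), snd (snd x))" by simp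
    then show ?thesis unfolding DLag_eq[OF y] bb_expand[OF y, of _ _ "fst (snd x)"] .
  qed
  have "continuous_on ?S (\<lambda>x. ?c x / ?R x * ?X x)"
    unfolding continuous_on_def
  proof
    fix x0 assume x0: "x0 \<in> ?S"
    have lim: "(?c \<longlongrightarrow> ?c x0) (at x0 within ?S)" "(?R \<longlongrightarrow> ?R x0) (at x0 within ?S)" "(?X \<longlongrightarrow> ?X x0) (at x0 within ?S)"
      "((\<lambda>x. l (?y x) + \<mu>) \<longlongrightarrow> l (?y x0) + \<mu>) (at x0 within ?S)"
      using c R X lc x0 unfolding continuous_on_def by blast+
    have Om: "(?y x0, ?e x0) \<in> Omega \<mu>" and y0: "?y x0 \<in> Y" using x0 sub by auto
    show "((\<lambda>x. ?c x / ?R x * ?X x) \<longlongrightarrow> ?c x0 / ?R x0 * ?X x0) (at x0 within ?S)"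
    proof (cases "?e x0 = 0")
      case False
      then have "?R x0 \<noteq> 0" using F_facts(1)[OF Om assms] by auto
      then show ?thesis by (intro tendsto_intros lim)
    next
      case True
      then have lam: "l (?y x0) + \<mu> > 0" using Om F_zero(3)[OF y0] by (auto simp: Omega_def)
      have X0: "?X x0 = 0" unfolding True F_zero(1)[OF y0] bb_zero using linear_0[OF flat_linear[OF y0]] by simp
      have "((\<lambda>x. 2 / (l (?y x) + \<mu>) * \<bar>?X x\<bar>) \<longlongrightarrow> 2 / (l (?y x0) + \<mu>) * \<bar>?X x0\<bar>) (at x0 within ?S)"
        by (intro tendsto_intros lim) (use lam in auto)
      then have lim0: "((\<lambda>x. 2 / (l (?y x) + \<mu>) * \<bar>?X x\<bar>) \<longlongrightarrow> 0) (at x0 within ?S)" unfolding X0 by simp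
      have ev: "\<forall>\<^sub>F x in at x0 within ?S. norm (?c x / ?R x * ?X x) \<le> 2 / (l (?y x) + \<mu>) * \<bar>?X x\<bar>"
      proof -
        have "\<forall>\<^sub>F x in at x0 within ?S. x \<in> ?S" by (auto simp: eventually_at_filter)
        moreover have "\<forall>\<^sub>F x in at x0 within ?S. l (?y x) + \<mu> > 0"
          using order_tendstoD(1)[OF lim(4) lam] .
        ultimately show ?thesis
        proof eventually_elim
          case (elim x)
          then have y: "?y x \<in> Y" using sub by auto
          note b = F_le_sqrt_Q[OF y assms elim(2), of "?e x"]
          have "norm (?c x / ?R x * ?X x) = (?c x / ?R x) * \<bar>?X x\<bar>"
            unfolding real_norm_def abs_mult using b(1) by (simp only: abs_of_nonneg)
          also have "\<dots> \<le> 2 / (l (?y x) + \<mu>) * \<bar>?X x\<bar>" by (rule mult_right_mono[OF b(2) abs_ge_zero])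
          finally show ?case .
        qed
      qed
      show ?thesis unfolding X0 mult_zero_right by (rule Lim_null_comparison[OF ev lim0])
    qed
  qed
  then show ?thesis by (rule continuous_on_eq) (rule eq[symmetric])
qed

lemma DLag_continuous:
  assumes "\<mu> \<ge> 0" "continuous_on S z" "continuous_on S d" "z ` S \<subseteq> Omega \<mu>"
  shows "continuous_on S (\<lambda>x. DLag \<mu> (z x) (d x))"
  using continuous_on_compose2[OF DLag_continuous_Omega[OF assms(1)] continuous_on_Pair[OF assms(2,3)]] assms(4)
  by auto

lemma Lag_continuous:
  assumes "\<mu> \<ge> 0" "continuous_on S z" "z ` S \<subseteq> Omega \<mu>"
  shows "continuous_on S (\<lambda>x. Lag \<mu> (z x))"
  unfolding Lag_def
  by (intro continuous_intros continuous_on_compose2[OF continuous_F_Omega[OF assms(1)] assms(2,3)]) auto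

lemma continuous_Fs_all:
  assumes "continuous_on W a" "a ` W \<subseteq> Y" "continuous_on W p"
  shows "continuous_on W (\<lambda>x. Fs \<mu> (a x) (p x))"
  unfolding Fs_def
  by (intro continuous_intros continuous_sharp continuous_N2 continuous_nrm2 assms continuous_on_pull[OF _ _ wvec_smooth])

lemma Fs_zero: "y \<in> Y \<Longrightarrow> Fs \<mu> y 0 = 0"
  unfolding Fs_def nrm2_def by (simp add: linear_0[OF sharp_linear])

text \<open>\<open>Omega\<close> is open and \<open>{0} \<times> {a..b}\<close> compact, so all
  neighbouring curves of the variation stay admissible on a strip, where the integral may be
  differentiated under its sign.\<close>

lemma first_variation:
  fixes h :: "real \<times> real \<Rightarrow> 'b"
  defines "hs \<equiv> \<lambda>z. frechet_derivative h (at z) (0, 1)" and "hw \<equiv> \<lambda>z. frechet_derivative h (at z) (1, 0)"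
  defines "hsw \<equiv> \<lambda>z. frechet_derivative (\<lambda>z. frechet_derivative h (at z) (0, 1)) (at z) (1, 0)"
  assumes "\<mu> \<ge> 0" "open W" "{0} \<times> {a..b} \<subseteq> W" "smooth_on W h"
    and Om: "\<And>s. s \<in> {a..b} \<Longrightarrow> (h (0, s), hs (0, s)) \<in> Omega \<mu>"
  obtains r where "r > 0" "{-r..r} \<times> {a..b} \<subseteq> W"
    "\<And>x s. x \<in> {-r..r} \<Longrightarrow> s \<in> {a..b} \<Longrightarrow> (h (x, s), hs (x, s)) \<in> Omega \<mu>"
    "\<And>x. x \<in> {-r..r} \<Longrightarrow> continuous_on {a..b} (\<lambda>s. Lag \<mu> (h (x, s), hs (x, s)))"
    "((\<lambda>x. integral {a..b} (\<lambda>s. Lag \<mu> (h (x, s), hs (x, s)))) has_real_derivative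
       integral {a..b} (\<lambda>s. DLag \<mu> (h (0, s), hs (0, s)) (hw (0, s), hsw (0, s)))) (at 0)"
    "continuous_on {a..b} (\<lambda>s. DLag \<mu> (h (0, s), hs (0, s)) (hw (0, s), hsw (0, s)))"
proof -
  have smooth: "smooth_on W hs" "smooth_on W hw" "smooth_on W hsw"
    unfolding hs_def hw_def hsw_def by (intro smooth_onD(2) assms)+
  note ch = smooth_on_continuous[OF assms(7)] smooth[THEN smooth_on_continuous]
  have c2: "continuous_on W (\<lambda>z. (h z, hs z))" by (intro continuous_intros ch)
  let ?Z = "W \<inter> (\<lambda>z. (h z, hs z)) -` Omega \<mu>"
  have oZ: "open ?Z" by (rule continuous_open_preimage[OF c2 assms(5) open_Omega])
  have KZ: "{0} \<times> {a..b} \<subseteq> ?Z" using assms(6) Om by auto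
  have "compact ({0::real} \<times> {a..b})" by (intro compact_Times) auto
  \<comment> \<open>A uniform radius about the compact segment; it is the width of the
    strip.\<close>
  then obtain r where r: "r > 0" "(\<Union>x\<in>{0} \<times> {a..b}. cball x r) \<subseteq> ?Z"
    using compact_subset_open_imp_cball_epsilon_subset[OF _ oZ KZ] by blast
  have inZ: "(x, s) \<in> ?Z" if "x \<in> {-r..r}" "s \<in> {a..b}" for x s
  proof -
    have "dist (0, s) (x, s) = \<bar>x\<bar>" by (simp add: dist_Pair_Pair dist_norm)
    then have "(x, s) \<in> cball (0, s) r" using that(1) by auto
    then show ?thesis using r(2) that(2) by blast
  qed
  have sub: "{-r..r} \<times> {a..b} \<subseteq> W" using inZ by auto
  have Omr: "(h (x, s), hs (x, s)) \<in> Omega \<mu>" if "x \<in> {-r..r}" "s \<in> {a..b}" for x s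
    using inZ[OF that] by auto
  have cL: "continuous_on {a..b} (\<lambda>s. Lag \<mu> (h (x, s), hs (x, s)))" if "x \<in> {-r..r}" for x
    by (rule Lag_continuous[OF assms(4)], rule continuous_on_compose2[OF c2])
      (use that sub Omr in \<open>auto intro!: continuous_intros\<close>)
  have cD: "continuous_on ({-r..r} \<times> {a..b}) (\<lambda>z. DLag \<mu> (h z, hs z) (hw z, hsw z))"
    by (rule DLag_continuous[OF assms(4)])
      (use Omr in \<open>auto intro!: continuous_on_subset[OF c2 sub] continuous_on_subset[OF continuous_on_Pair[OF ch(3,4)] sub]\<close>)
  have "((\<lambda>x. integral (cbox a b) (\<lambda>s. Lag \<mu> (h (x, s), hs (x, s)))) has_field_derivative
       integral (cbox a b) (\<lambda>s. DLag \<mu> (h (0, s), hs (0, s)) (hw (0, s), hsw (0, s)))) (at 0 within {-r<..<r})"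
  proof (rule leibniz_rule_field_derivative)
    fix x t assume xt: "x \<in> {-r<..<r}" "t \<in> cbox a b"
    then have z: "(x, t) \<in> W" "(h (x, t), hs (x, t)) \<in> Omega \<mu>" using sub Omr by auto
    have "((\<lambda>x. (x, t)) has_derivative (\<lambda>d. (d, 0))) (at x)"
      by (intro has_derivative_Pair has_derivative_ident has_derivative_const)
    note dc = has_derivative_compose[OF this]
    have "((\<lambda>x. (h (x, t), hs (x, t))) has_derivative (\<lambda>d. (frechet_derivative h (at (x, t)) (d, 0), frechet_derivative hs (at (x, t)) (d, 0)))) (at x)"
      by (intro has_derivative_Pair dc smooth_onD(1)[OF assms(7)] smooth_onD(1)[OF smooth(1)] z)
    from has_derivative_compose[OF this Lag_has_derivative[OF z(2) assms(4)]]
    have D: "((\<lambda>x. Lag \<mu> (h (x, t), hs (x, t))) has_derivative (\<lambda>d. DLag \<mu> (h (x, t), hs (x, t)) (frechet_derivative h (at (x, t)) (d, 0), frechet_derivative hs (at (x, t)) (d, 0)))) (at x)" .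
    have "(\<lambda>d. DLag \<mu> (h (x, t), hs (x, t)) (frechet_derivative h (at (x, t)) (d, 0), frechet_derivative hs (at (x, t)) (d, 0)))
       = (*) (DLag \<mu> (h (x, t), hs (x, t)) (hw (x, t), hsw (x, t)))"
    proof
      fix d :: real
      have "linear (\<lambda>d. DLag \<mu> (h (x, t), hs (x, t)) (frechet_derivative h (at (x, t)) (d, 0), frechet_derivative hs (at (x, t)) (d, 0)))"
        using has_derivative_linear[OF D] .
      from linear_scale[OF this, of d 1]
      show "DLag \<mu> (h (x, t), hs (x, t)) (frechet_derivative h (at (x, t)) (d, 0), frechet_derivative hs (at (x, t)) (d, 0))
        = DLag \<mu> (h (x, t), hs (x, t)) (hw (x, t), hsw (x, t)) * d"
        unfolding hw_def hsw_def hs_def by simp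
    qed
    then show "((\<lambda>x. Lag \<mu> (h (x, t), hs (x, t))) has_field_derivative DLag \<mu> (h (x, t), hs (x, t)) (hw (x, t), hsw (x, t))) (at x within {-r<..<r})"
      using D by (simp add: has_field_derivative_def has_derivative_at_withinI)
  next
    fix x assume "x \<in> {-r<..<r}"
    then show "(\<lambda>s. Lag \<mu> (h (x, s), hs (x, s))) integrable_on cbox a b"
      using cL[of x] by (simp add: integrable_continuous_real)
  next
    show "continuous_on ({-r<..<r} \<times> cbox a b) (\<lambda>(x, t). DLag \<mu> (h (x, t), hs (x, t)) (hw (x, t), hsw (x, t)))"
      using continuous_on_subset[OF cD, of "{-r<..<r} \<times> cbox a b"] by (force simp: case_prod_unfold)
  qed (use r in auto)
  then have der: "((\<lambda>x. integral {a..b} (\<lambda>s. Lag \<mu> (h (x, s), hs (x, s)))) has_real_derivative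
       integral {a..b} (\<lambda>s. DLag \<mu> (h (0, s), hs (0, s)) (hw (0, s), hsw (0, s)))) (at 0)"
    using at_within_open[of 0 "{-r<..<r}"] r(1) by simp
  have "continuous_on {a..b} (\<lambda>s. DLag \<mu> (h (0, s), hs (0, s)) (hw (0, s), hsw (0, s)))"
    by (rule continuous_on_compose2[OF cD, of _ "\<lambda>s. (0, s)"]) (use r in \<open>auto intro!: continuous_intros\<close>)
  from that[OF r(1) sub Omr cL der this] show ?thesis .
qed

end

text \<open>Differentiating \<open>x \<mapsto> \<integral> P' \<cdot> h + P \<cdot> \<partial>\<^sub>s h\<close> in two ways avoids the symmetry of second derivatives.\<close>

lemma variation_by_parts:
  fixes h :: "real \<times> real \<Rightarrow> 'b::euclidean_space" and P :: "real \<Rightarrow> 'b"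
  defines "hs \<equiv> \<lambda>z. frechet_derivative h (at z) (0, 1)" and "hw \<equiv> \<lambda>z. frechet_derivative h (at z) (1, 0)"
  defines "hsw \<equiv> \<lambda>z. frechet_derivative (\<lambda>z. frechet_derivative h (at z) (0, 1)) (at z) (1, 0)"
  assumes "a \<le> b" "open W" "r > 0" "{-r..r} \<times> {a..b} \<subseteq> W" "smooth_on W h"
    and P: "\<And>s. s \<in> {a..b} \<Longrightarrow> (P has_vector_derivative P' s) (at s within {a..b})" and cP': "continuous_on {a..b} P'"
  shows "integral {a..b} (\<lambda>s. P' s \<bullet> hw (0, s) + P s \<bullet> hsw (0, s)) = P b \<bullet> hw (0, b) - P a \<bullet> hw (0, a)"
proof -
  have smooth: "smooth_on W hs" "smooth_on W hw" "smooth_on W hsw"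
    unfolding hs_def hw_def hsw_def by (intro smooth_onD(2) assms)+
  note ch = smooth_on_continuous[OF assms(8)] smooth[THEN smooth_on_continuous]
  have cP: "continuous_on {a..b} P" using has_vector_derivative_on_imp_continuous_on P by blast
  have cc: "continuous_on {a..b} (\<lambda>s. g (x, s))" if "continuous_on W g" "x \<in> {-r..r}" for g :: "real \<times> real \<Rightarrow> 'b" and x
    by (rule continuous_on_compose2[OF that(1)]) (use that(2) assms(7) in \<open>auto intro!: continuous_intros\<close>)
  have dx: "((\<lambda>x. g (x, t)) has_vector_derivative frechet_derivative g (at (x, t)) (1, 0)) (at x)"
    if "smooth_on W g" "(x, t) \<in> W" for g :: "real \<times> real \<Rightarrow> 'b" and x t
  proof -
    have i: "((\<lambda>x. (x, t)) has_derivative (\<lambda>d. (d, 0))) (at x)"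
      by (intro has_derivative_Pair has_derivative_ident has_derivative_const)
    have D: "((\<lambda>x. g (x, t)) has_derivative (\<lambda>d. frechet_derivative g (at (x, t)) (d, 0))) (at x)"
      by (rule has_derivative_compose[OF i smooth_onD(1)[OF that]])
    have eq: "(\<lambda>d. frechet_derivative g (at (x, t)) (d, 0)) = (\<lambda>d. d *\<^sub>R frechet_derivative g (at (x, t)) (1, 0))"
    proof
      fix d :: real
      have "linear (\<lambda>d. frechet_derivative g (at (x, t)) (d, 0))" using has_derivative_linear[OF D] .
      from linear_scale[OF this, of d 1]
      show "frechet_derivative g (at (x, t)) (d, 0) = d *\<^sub>R frechet_derivative g (at (x, t)) (1, 0)"
        by (simp only: real_scaleR_def mult_1_right)
    qed
    show ?thesis using D unfolding has_vector_derivative_def eq .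
  qed
  have dt: "((\<lambda>t. h (x, t)) has_vector_derivative hs (x, t)) (at t)" if "(x, t) \<in> W" for x t
  proof -
    have i: "((\<lambda>t. (x, t)) has_derivative (\<lambda>d. (0, d))) (at t)"
      by (intro has_derivative_Pair has_derivative_ident has_derivative_const)
    have D: "((\<lambda>t. h (x, t)) has_derivative (\<lambda>d. frechet_derivative h (at (x, t)) (0, d))) (at t)"
      by (rule has_derivative_compose[OF i smooth_onD(1)[OF assms(8) that]])
    have eq: "(\<lambda>d. frechet_derivative h (at (x, t)) (0, d)) = (\<lambda>d. d *\<^sub>R frechet_derivative h (at (x, t)) (0, 1))"
    proof
      fix d :: real
      have "linear (\<lambda>d. frechet_derivative h (at (x, t)) (0, d))" using has_derivative_linear[OF D] .
      from linear_scale[OF this, of d 1]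
      show "frechet_derivative h (at (x, t)) (0, d) = d *\<^sub>R frechet_derivative h (at (x, t)) (0, 1)"
        by (simp only: real_scaleR_def mult_1_right)
    qed
    show ?thesis using D unfolding has_vector_derivative_def hs_def eq .
  qed
  let ?k = "\<lambda>x s. P' s \<bullet> h (x, s) + P s \<bullet> hs (x, s)"
  have K: "integral {a..b} (?k x) = P b \<bullet> h (x, b) - P a \<bullet> h (x, a)" if "x \<in> {-r..r}" for x
  proof -
    have "(?k x has_integral (P b \<bullet> h (x, b) - P a \<bullet> h (x, a))) {a..b}"
    proof (rule fundamental_theorem_of_calculus[OF assms(4)])
      fix s assume s: "s \<in> {a..b}"
      have "((\<lambda>s. P s \<bullet> h (x, s)) has_derivative (\<lambda>d. P s \<bullet> (d *\<^sub>R hs (x, s)) + (d *\<^sub>R P' s) \<bullet> h (x, s))) (at s within {a..b})"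
        by (rule has_derivative_inner[OF P[OF s, unfolded has_vector_derivative_def]
          has_derivative_at_withinI[OF dt[unfolded has_vector_derivative_def]]]) (use s that assms(7) in auto)
      then show "((\<lambda>s. P s \<bullet> h (x, s)) has_vector_derivative ?k x s) (at s within {a..b})"
        unfolding has_vector_derivative_def by (rule has_derivative_eq_rhs) (auto simp: algebra_simps)
    qed
    then show ?thesis by (rule integral_unique)
  qed
  have z0: "(0, s) \<in> W" if "s \<in> {a..b}" for s using that assms(6,7) by auto
  have "((\<lambda>x. integral (cbox a b) (?k x)) has_field_derivative
      integral (cbox a b) (\<lambda>s. P' s \<bullet> hw (0, s) + P s \<bullet> hsw (0, s))) (at 0 within {-r<..<r})"
  proof (rule leibniz_rule_field_derivative)
    fix x t assume xt: "x \<in> {-r<..<r}" "t \<in> cbox a b"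
    then have z: "(x, t) \<in> W" using assms(7) by auto
    have "((\<lambda>x. P' t \<bullet> h (x, t) + P t \<bullet> hs (x, t)) has_derivative (\<lambda>d. P' t \<bullet> (d *\<^sub>R hw (x, t)) + P t \<bullet> (d *\<^sub>R hsw (x, t)))) (at x)"
      using dx[OF assms(8) z] dx[OF smooth(1) z] unfolding has_vector_derivative_def hw_def hsw_def hs_def
      by (intro has_derivative_add has_derivative_inner_right)
    then have "((\<lambda>x. ?k x t) has_derivative (*) (P' t \<bullet> hw (x, t) + P t \<bullet> hsw (x, t))) (at x)"
      by (rule has_derivative_eq_rhs) (simp add: fun_eq_iff algebra_simps)
    then show "((\<lambda>x. ?k x t) has_field_derivative P' t \<bullet> hw (x, t) + P t \<bullet> hsw (x, t)) (at x within {-r<..<r})"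
      unfolding has_field_derivative_def by (rule has_derivative_at_withinI)
  next
    fix x assume "x \<in> {-r<..<r}"
    then show "?k x integrable_on cbox a b"
      unfolding cbox_interval
      by (intro integrable_continuous_real continuous_intros cP cP' cc[OF ch(1)] cc[OF ch(2)]) auto
  next
    have "continuous_on ({-r<..<r} \<times> cbox a b) (\<lambda>z. P' (snd z) \<bullet> hw z + P (snd z) \<bullet> hsw z)"
      by (intro continuous_intros continuous_on_compose2[OF cP] continuous_on_compose2[OF cP'] continuous_on_subset[OF ch(3)] continuous_on_subset[OF ch(4)])
        (use assms(7) in auto)
    then show "continuous_on ({-r<..<r} \<times> cbox a b) (\<lambda>(x, t). P' t \<bullet> hw (x, t) + P t \<bullet> hsw (x, t))"
      by (simp add: case_prod_unfold)
  qed (use assms(6) in auto)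
  then have "((\<lambda>x. integral {a..b} (?k x)) has_real_derivative integral {a..b} (\<lambda>s. P' s \<bullet> hw (0, s) + P s \<bullet> hsw (0, s))) (at 0)"
    using at_within_open[of 0 "{-r<..<r}"] assms(6) by simp
  then have 1: "((\<lambda>x. P b \<bullet> h (x, b) - P a \<bullet> h (x, a)) has_real_derivative integral {a..b} (\<lambda>s. P' s \<bullet> hw (0, s) + P s \<bullet> hsw (0, s))) (at 0)"
    by (rule has_field_derivative_transform_within_open[OF _ open_greaterThanLessThan[of "-r" r]]) (use assms(6) K in auto)
  have e: "((\<lambda>x. P s \<bullet> h (x, s)) has_real_derivative P s \<bullet> hw (0, s)) (at 0)" if "s \<in> {a..b}" for s
    using dx[OF assms(8) z0[OF that]] unfolding has_vector_derivative_def has_field_derivative_def hw_def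
    by (rule has_derivative_eq_rhs[OF has_derivative_inner_right]) (auto simp: algebra_simps)
  have "((\<lambda>x. P b \<bullet> h (x, b) - P a \<bullet> h (x, a)) has_real_derivative P b \<bullet> hw (0, b) - P a \<bullet> hw (0, a)) (at 0)"
    by (intro DERIV_diff e) (use assms(4) in auto)
  from DERIV_unique[OF 1 this] show ?thesis .
qed

section \<open>Lipschitz bounds and local solvability of smooth differential equations\<close>

lemma vector_derivative_lipschitz:
  fixes z :: "real \<Rightarrow> 'e::real_normed_vector"
  assumes "\<And>s. s \<in> {a..b} \<Longrightarrow> (z has_vector_derivative z' s) (at s within {a..b})"
    and "\<And>s. s \<in> {a..b} \<Longrightarrow> norm (z' s) \<le> L" and "s \<in> {a..b}" "t \<in> {a..b}"
  shows "norm (z s - z t) \<le> L * \<bar>s - t\<bar>"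
proof -
  have "norm (z s - z t) \<le> L * norm (s - t)"
  proof (rule differentiable_bound[of "{a..b}" z "\<lambda>x h. h *\<^sub>R z' x"])
    fix x assume x: "x \<in> {a..b}"
    show "(z has_derivative (\<lambda>h. h *\<^sub>R z' x)) (at x within {a..b})"
      using assms(1)[OF x] by (simp add: has_vector_derivative_def)
    show "onorm (\<lambda>h. h *\<^sub>R z' x) \<le> L"
    proof (rule onorm_le)
      fix h :: real
      have "\<bar>h\<bar> * norm (z' x) \<le> \<bar>h\<bar> * L" using assms(2)[OF x] by (intro mult_left_mono) auto
      then show "norm (h *\<^sub>R z' x) \<le> L * norm h" by (simp add: mult.commute)
    qed
  qed (use assms in auto)
  then show ?thesis by simp
qed

text \<open>The derivative is bounded on the compact set of pairs of a point of the ball and a unit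
  vector, and the ball is convex.\<close>

lemma smooth_on_lipschitz_cball:
  fixes f :: "'e::euclidean_space \<Rightarrow> 'g::real_normed_vector"
  assumes "smooth_on W f" "cball z d \<subseteq> W"
  obtains L where "L \<ge> 0" "\<And>x y. x \<in> cball z d \<Longrightarrow> y \<in> cball z d \<Longrightarrow> norm (f x - f y) \<le> L * norm (x - y)"
proof -
  let ?S = "cball z d \<times> sphere (0::'e) 1"
  have "continuous_on ?S (\<lambda>x. frechet_derivative f (at (fst x)) (snd x))"
    by (intro continuous_on_frechet[OF assms(1)] continuous_intros) (use assms(2) in auto)
  then have "compact ((\<lambda>x. frechet_derivative f (at (fst x)) (snd x)) ` ?S)"
    by (intro compact_continuous_image compact_Times) auto
  then obtain L where L: "\<And>x. x \<in> ?S \<Longrightarrow> norm (frechet_derivative f (at (fst x)) (snd x)) \<le> L" "L > 0"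
    using compact_imp_bounded bounded_pos by (metis (no_types, lifting) image_eqI)
  have on: "onorm (frechet_derivative f (at x)) \<le> L" if "x \<in> cball z d" for x
  proof (rule onorm_le)
    fix v
    have lin: "linear (frechet_derivative f (at x))"
      using has_derivative_linear[OF smooth_onD(1)[OF assms(1)]] that assms(2) by blast
    show "norm (frechet_derivative f (at x) v) \<le> L * norm v"
    proof (cases "v = 0")
      case True then show ?thesis by (simp add: linear_0[OF lin])
    next
      case False
      have "norm (frechet_derivative f (at x) (v /\<^sub>R norm v)) \<le> L"
        using L(1)[of "(x, v /\<^sub>R norm v)"] that False by simp
      then have "inverse (norm v) * norm (frechet_derivative f (at x) v) \<le> L"
        by (simp add: linear_scale[OF lin])
      then show ?thesis using False by (simp add: field_simps)
    qed
  qed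
  have "norm (f x - f y) \<le> L * norm (x - y)" if "x \<in> cball z d" "y \<in> cball z d" for x y
    by (rule differentiable_bound[OF convex_cball _ on that(1) that(2)])
      (use smooth_onD(1)[OF assms(1)] assms(2) has_derivative_at_withinI in blast)
  then show ?thesis using that[of L] L(2) by simp
qed

text \<open>Picard iteration as a fixed point in the complete space of bounded continuous functions.
  It is used to continue limit curves beyond the ends of [0,1].\<close>

lemma local_ode_solution:
  fixes f :: "'e::euclidean_space \<Rightarrow> 'e"
  assumes "open W" "smooth_on W f" "z0 \<in> W"
  obtains r z where "r > 0" "z 0 = z0" "\<And>t. t \<in> {0..r} \<Longrightarrow> z t \<in> W"
    "\<And>t. t \<in> {0..r} \<Longrightarrow> (z has_vector_derivative f (z t)) (at t within {0..r})"
proof -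
  obtain d where d: "d > 0" "cball z0 d \<subseteq> W" using assms open_contains_cball by blast
  obtain L where L: "L \<ge> 0" "\<And>x y. x \<in> cball z0 d \<Longrightarrow> y \<in> cball z0 d \<Longrightarrow> norm (f x - f y) \<le> L * norm (x - y)"
    using smooth_on_lipschitz_cball[OF assms(2) d(2)] by blast
  have cf: "continuous_on (cball z0 d) f" using continuous_on_subset[OF smooth_on_continuous[OF assms(2)] d(2)] .
  obtain B where B: "B > 0" "\<And>x. x \<in> cball z0 d \<Longrightarrow> norm (f x) \<le> B"
    using compact_imp_bounded[OF compact_continuous_image[OF cf compact_cball]] bounded_pos by (metis image_eqI)
  \<comment> \<open>Nearest-point projection does not increase distances, so composing with it makes
    the field bounded and Lipschitz everywhere without changing it on the ball.\<close>
  define pr where "pr = closest_point (cball z0 d)"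
  define ff where "ff x = f (pr x)" for x
  have prin: "pr x \<in> cball z0 d" for x
    unfolding pr_def by (rule closest_point_in_set) (use d(1) in auto)
  have prid: "pr x = x" if "x \<in> cball z0 d" for x unfolding pr_def by (rule closest_point_self[OF that])
  have prlip: "dist (pr x) (pr y) \<le> dist x y" for x y
    unfolding pr_def by (rule closest_point_lipschitz) (use d(1) in auto)
  have flip: "norm (ff x - ff y) \<le> L * norm (x - y)" for x y
    unfolding ff_def using L(2)[OF prin prin, of x y] mult_left_mono[OF prlip[of x y] L(1)] by (simp add: dist_norm)
  have fB: "norm (ff x) \<le> B" for x unfolding ff_def by (rule B(2)[OF prin])
  have cpr: "continuous_on UNIV pr" unfolding pr_def
    by (rule continuous_on_closest_point) (use d(1) in auto)
  have cff: "continuous_on UNIV ff" unfolding ff_def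
    by (rule continuous_on_compose2[OF cf cpr]) (use prin in auto)
  \<comment> \<open>The first bound makes the integral operator a contraction with factor 1/2, also
    when \<open>L = 0\<close>; the second keeps its values in the ball, where the modified field
    equals \<open>f\<close>.\<close>
  define r where "r = min (1 / (2 * (L + 1))) (d / B)"
  have r: "r > 0" "r * L \<le> 1 / 2" "r * B \<le> d"
  proof -
    show "r > 0" using L(1) B(1) d(1) by (simp add: r_def)
    have "r * L \<le> 1 / (2 * (L + 1)) * L" using L(1) by (intro mult_right_mono) (auto simp: r_def)
    also have "\<dots> \<le> 1 / 2" using L(1) by (simp add: field_simps)
    finally show "r * L \<le> 1 / 2" .
    have "r * B \<le> d / B * B" using B(1) by (intro mult_right_mono) (auto simp: r_def)
    then show "r * B \<le> d" using B(1) by simp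
  qed
  \<comment> \<open>Clamping the time to \<open>{0..r}\<close> lets the iteration act on functions
    on the whole real line.\<close>
  define cl where "cl t = max 0 (min r t)" for t :: real
  have cl: "cl t \<in> {0..r}" for t using r(1) by (auto simp: cl_def)
  have ccl: "continuous_on UNIV cl" unfolding cl_def by (intro continuous_intros)
  define T where "T u t = z0 + integral {0..cl t} (\<lambda>s. ff (apply_bcontfun u s))" for u :: "(real, 'e) bcontfun" and t
  have cu: "continuous_on S (\<lambda>s. ff (apply_bcontfun u s))" for u :: "(real, 'e) bcontfun" and S
    by (rule continuous_on_compose2[OF cff continuous_on_subset[OF continuous_on_apply_bcontfun]]) auto
  have iu: "(\<lambda>s. ff (apply_bcontfun u s)) integrable_on {a..b}" for u :: "(real, 'e) bcontfun" and a b
    by (rule integrable_continuous_real[OF cu])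
  have Tb: "norm (T u t - z0) \<le> r * B" for u t
  proof -
    have "norm (integral {0..cl t} (\<lambda>s. ff (apply_bcontfun u s))) \<le> B * (cl t - 0)"
      by (rule integral_bound) (use cl[of t] cu fB in auto)
    also have "\<dots> \<le> B * r" using cl[of t] B(1) by (intro mult_left_mono) auto
    finally show ?thesis by (simp add: T_def mult.commute)
  qed
  have Tin: "T u \<in> bcontfun" for u
  proof -
    have "continuous_on {0..r} (\<lambda>t. integral {0..t} (\<lambda>s. ff (apply_bcontfun u s)))"
      by (rule indefinite_integral_continuous_1[OF iu])
    then have "continuous_on UNIV (T u)"
      unfolding T_def[abs_def] by (intro continuous_intros continuous_on_compose2[OF _ ccl]) (use cl in auto)
    moreover have "bounded (range (T u))"
      using Tb[of u] by (intro bounded_subset[OF bounded_cball[of z0 "r * B"]]) (auto simp: dist_norm norm_minus_commute)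
    ultimately show ?thesis by (simp add: bcontfun_def)
  qed
  have app: "apply_bcontfun (Bcontfun (T u)) = T u" for u using Bcontfun_inverse[OF Tin] .
  have "\<exists>!u. Bcontfun (T u) = u"
  proof (rule banach_fix_type[of "1 / 2"])
    show "\<forall>u v. dist (Bcontfun (T u)) (Bcontfun (T v)) \<le> 1 / 2 * dist u v"
    proof (intro allI dist_bound)
      fix u v t
      have "T u t - T v t = integral {0..cl t} (\<lambda>s. ff (apply_bcontfun u s) - ff (apply_bcontfun v s))"
        unfolding T_def by (simp add: integral_diff[OF iu iu])
      also have "norm \<dots> \<le> (L * dist u v) * (cl t - 0)"
      proof (rule integral_bound)
        fix s
        have "norm (ff (apply_bcontfun u s) - ff (apply_bcontfun v s)) \<le> L * norm (apply_bcontfun u s - apply_bcontfun v s)"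
          by (rule flip)
        also have "\<dots> \<le> L * dist u v" using dist_bounded[of u s v] L(1) by (intro mult_left_mono) (auto simp: dist_norm)
        finally show "norm (ff (apply_bcontfun u s) - ff (apply_bcontfun v s)) \<le> L * dist u v" .
      qed (use cl[of t] in \<open>auto intro!: continuous_intros cu\<close>)
      also have "\<dots> \<le> (L * dist u v) * r" using cl[of t] L(1) by (intro mult_left_mono) auto
      also have "\<dots> \<le> 1 / 2 * dist u v" using mult_right_mono[OF r(2) zero_le_dist[of u v]] by (simp add: algebra_simps)
      finally show "dist (apply_bcontfun (Bcontfun (T u)) t) (apply_bcontfun (Bcontfun (T v)) t) \<le> 1 / 2 * dist u v"
        unfolding app dist_norm .
    qed
  qed auto
  then obtain u where u: "Bcontfun (T u) = u" by blast
  define z where "z = apply_bcontfun u"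
  have zT: "z = T u" unfolding z_def using app[of u] u by simp
  have zin: "z t \<in> cball z0 d" for t
    using Tb[of u t] r(3) unfolding zT by (simp add: dist_norm norm_minus_commute)
  have fz: "ff (z t) = f (z t)" for t unfolding ff_def prid[OF zin] ..
  have z0: "z 0 = z0" unfolding zT T_def cl_def using r(1) by simp
  have eq: "z t = z 0 + integral {0..t} (\<lambda>s. f (z s))" if "t \<in> {0..r}" for t
  proof -
    have "cl t = t" using that by (simp add: cl_def)
    then show ?thesis unfolding z0 using fun_cong[OF zT, of t] unfolding T_def z_def[symmetric] fz by simp
  qed
  have cz: "continuous_on {0..r} (\<lambda>s. f (z s))"
    using cu[of "{0..r}" u] unfolding z_def[symmetric] fz .
  have zW: "z t \<in> W" for t using zin d(2) by blast
  show ?thesis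
    by (rule that[OF r(1) z0 zW ode_of_integral_equation[OF cz eq]])
qed

section \<open>The Hamiltonian system: bounds, derivation and limits\<close>

context rk_chart
begin

text \<open>Homogeneity reduces the claim to unit momenta; these, the points of \<open>C\<close> and
  the parameters in [0,1] form a compact set. Including parameter 0 makes the bounds uniform as the
  parameter tends to 0.\<close>

lemma momentum_field_bounds:
  assumes "compact C" "C \<subseteq> Y"
  obtains M where "M > 0"
    "\<And>\<mu> y p. \<mu> \<in> {0..1} \<Longrightarrow> y \<in> C \<Longrightarrow> p \<noteq> 0 \<Longrightarrow> norm (V1 \<mu> y p) \<le> M"
    "\<And>\<mu> y p. \<mu> \<in> {0..1} \<Longrightarrow> y \<in> C \<Longrightarrow> p \<noteq> 0 \<Longrightarrow> norm (B1 \<mu> y p) \<le> M * norm p"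
proof -
  let ?S = "{0..1::real} \<times> C \<times> sphere (0::'b) 1"
  have cS: "compact ?S" by (intro compact_Times assms) auto
  have sub: "(\<lambda>x. fst (snd x)) ` ?S \<subseteq> Y" using assms(2) by auto
  have cV: "continuous_on ?S (\<lambda>x. V1 (fst x) (fst (snd x)) (snd (snd x)))"
    by (intro continuous_V1 continuous_intros sub) auto
  have cB: "continuous_on ?S (\<lambda>x. B1 (fst x) (fst (snd x)) (snd (snd x)))"
    by (intro continuous_B1 continuous_intros sub) auto
  obtain K1 where K1: "K1 > 0" "\<And>x. x \<in> ?S \<Longrightarrow> norm (V1 (fst x) (fst (snd x)) (snd (snd x))) \<le> K1"
    using compact_imp_bounded[OF compact_continuous_image[OF cV cS]] unfolding bounded_pos by auto
  obtain K2 where K2: "K2 > 0" "\<And>x. x \<in> ?S \<Longrightarrow> norm (B1 (fst x) (fst (snd x)) (snd (snd x))) \<le> K2"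
    using compact_imp_bounded[OF compact_continuous_image[OF cB cS]] unfolding bounded_pos by auto
  have *: "norm (V1 \<mu> y p) \<le> K1 \<and> norm (B1 \<mu> y p) \<le> K2 * norm p"
    if "\<mu> \<in> {0..1}" "y \<in> C" "p \<noteq> 0" for \<mu> y p
  proof -
    define q where "q = p /\<^sub>R norm p"
    have y: "y \<in> Y" using that assms(2) by auto
    have np: "norm p > 0" using that(3) by simp
    have q: "(\<mu>, y, q) \<in> ?S" using that by (simp add: q_def)
    have p: "p = norm p *\<^sub>R q" using np by (simp add: q_def)
    have "V1 \<mu> y p = V1 \<mu> y q" "B1 \<mu> y p = norm p *\<^sub>R B1 \<mu> y q"
      using momentum_scale(1,2)[OF y np, of \<mu> q] p by simp_all
    then show ?thesis using K1(2)[OF q] K2(2)[OF q] np by (simp add: mult.commute)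
  qed
  show ?thesis
  proof (rule that[of "max K1 K2"])
    fix \<mu> :: real and y p :: 'b assume a: "\<mu> \<in> {0..1}" "y \<in> C" "p \<noteq> 0"
    show "norm (V1 \<mu> y p) \<le> max K1 K2" by (rule order_trans[OF conjunct1[OF *[OF a]]]) simp
    have "K2 * norm p \<le> max K1 K2 * norm p" by (intro mult_right_mono) auto
    then show "norm (B1 \<mu> y p) \<le> max K1 K2 * norm p" by (rule order_trans[OF conjunct2[OF *[OF a]]])
  qed (use K1(1) in auto)
qed

text \<open>The origin lies in the closed ball bounded by the unit sphere, so the support function
  is nonnegative; algebraically, \<open>V1_quadratic\<close> makes a positive multiple of
  \<open>Fs\<close> equal to half the sum of G(V1,V1) and l + \<mu>.\<close>

lemma Fs_nonneg:
  assumes "y \<in> Y" "\<mu> \<ge> 0" shows "Fs \<mu> y p \<ge> 0"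
proof (cases "p = 0")
  case True then show ?thesis by (simp add: Fs_zero assms)
next
  case False
  have "2 * (l y + \<mu> - w y (V1 \<mu> y p)) = G y (V1 \<mu> y p) (V1 \<mu> y p) + (l y + \<mu>)"
    using V1_quadratic(1)[OF assms(1) False assms(2)] by simp
  then have "0 \<le> l y + \<mu> - w y (V1 \<mu> y p)"
    using G_nonneg[OF assms(1), of "V1 \<mu> y p"] l_nonneg[OF assms(1)] assms(2) by simp
  then have "0 \<le> sqrt (N2 \<mu> y / nrm2 y p) * Fs \<mu> y p"
    unfolding V1_quadratic(2)[OF assms(1) False assms(2)] .
  moreover have "sqrt (N2 \<mu> y / nrm2 y p) > 0" using N2_pos[OF assms] nrm2_pos[OF assms(1) False] by simp
  ultimately show ?thesis by (simp add: zero_le_mult_iff)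
qed

lemma mom_zero: "y \<in> Y \<Longrightarrow> mom \<mu> y 0 = 0"
  by (simp add: mom_def F_zero)

lemma mom_Fs:
  assumes "(y, e) \<in> Omega \<mu>" "\<mu> \<ge> 0"
  shows "Fs \<mu> y (mom \<mu> y e) = F \<mu> y e" "mom \<mu> y e \<bullet> e = (F \<mu> y e)\<^sup>2"
  using mom_facts(3,4)[OF assms] Omega_Y[OF assms(1)] by (cases "e = 0"; simp add: mom_zero Fs_zero F_zero)+

text \<open>Speed is conserved because the Lagrangian is homogeneous of degree 2. It is written as
  the dual norm of \<open>P\<close>, which is continuous across the exceptional set even though the
  velocity is not known to be; thus all pieces have the same speed. If it is positive, the inverse
  Legendre transform expresses the velocity continuously and the corners disappear.\<close>

lemma euler_lagrange_ode:
  fixes y v v' P P' :: "real \<Rightarrow> 'b"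
  assumes eps: "\<mu> \<ge> 0" and ab: "a < b" and B: "finite B" and cy: "continuous_on {a..b} y" and yY: "y ` {a..b} \<subseteq> Y"
    and Om: "\<And>s. s \<in> {a<..<b} - B \<Longrightarrow> (y s, v s) \<in> Omega \<mu>"
    and dy: "\<And>s. s \<in> {a<..<b} - B \<Longrightarrow> (y has_vector_derivative v s) (at s)"
    and dv: "\<And>s. s \<in> {a<..<b} - B \<Longrightarrow> (v has_vector_derivative v' s) (at s)"
    and cP: "continuous_on {a..b} P"
    and P: "\<And>s. s \<in> {a<..<b} - B \<Longrightarrow> P s = mom \<mu> (y s) (v s)"
    and dP: "\<And>s. s \<in> {a<..<b} - B \<Longrightarrow> (P has_vector_derivative P' s) (at s)"
    and P': "\<And>s e. s \<in> {a<..<b} - B \<Longrightarrow> P' s \<bullet> e = DLag \<mu> (y s, v s) (e, 0)"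
  obtains c where "c \<ge> 0" "\<And>s. s \<in> {a<..<b} - B \<Longrightarrow> F \<mu> (y s) (v s) = c"
    "c > 0 \<Longrightarrow> \<forall>s\<in>{a..b}. P s \<noteq> 0 \<and> Fs \<mu> (y s) (P s) = c \<and>
       (y has_vector_derivative c *\<^sub>R V1 \<mu> (y s) (P s)) (at s within {a..b}) \<and>
       (P has_vector_derivative c *\<^sub>R B1 \<mu> (y s) (P s)) (at s within {a..b})"
    "c = 0 \<Longrightarrow> \<forall>s\<in>{a..b}. y s = y a"
proof -
  let ?I = "{a<..<b} - B"
  let ?\<phi> = "\<lambda>s. Fs \<mu> (y s) (P s)"
  have oI: "open ?I" using B by (intro open_Diff finite_imp_closed) auto
  have FsF: "?\<phi> s = F \<mu> (y s) (v s)" "P s \<bullet> v s = (?\<phi> s)\<^sup>2" if "s \<in> ?I" for s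
    using mom_Fs[OF Om[OF that] eps] P[OF that] by simp_all
  have yYs: "y s \<in> Y" if "s \<in> {a..b}" for s using yY that by auto
  have c\<phi>: "continuous_on {a..b} ?\<phi>" by (rule continuous_Fs_all[OF cy yY cP])
  \<comment> \<open>P \<bullet> v equals twice the Lagrangian. The product rule gives it the
    derivative A, while the Euler-Lagrange equation gives the Lagrangian itself the derivative A;
    hence A = 2 A.\<close>
  have d0: "((\<lambda>s. (?\<phi> s)\<^sup>2) has_derivative (\<lambda>h. 0)) (at s)" if s: "s \<in> ?I" for s
  proof -
    define A where "A = P' s \<bullet> v s + P s \<bullet> v' s"
    have "((\<lambda>s. P s \<bullet> v s) has_derivative (\<lambda>h. P s \<bullet> (h *\<^sub>R v' s) + (h *\<^sub>R P' s) \<bullet> v s)) (at s)"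
      by (rule has_derivative_inner[OF dP[OF s, unfolded has_vector_derivative_def] dv[OF s, unfolded has_vector_derivative_def]])
    then have 1: "((\<lambda>s. P s \<bullet> v s) has_real_derivative A) (at s)"
      unfolding has_field_derivative_def by (rule has_derivative_eq_rhs) (simp add: fun_eq_iff A_def algebra_simps)
    have "((\<lambda>s. (y s, v s)) has_derivative (\<lambda>h. (h *\<^sub>R v s, h *\<^sub>R v' s))) (at s)"
      by (rule has_derivative_Pair[OF dy[OF s, unfolded has_vector_derivative_def] dv[OF s, unfolded has_vector_derivative_def]])
    from has_derivative_compose[OF this Lag_has_derivative[OF Om[OF s] eps]]
    have D: "((\<lambda>s. Lag \<mu> (y s, v s)) has_derivative (\<lambda>h. DLag \<mu> (y s, v s) (h *\<^sub>R v s, h *\<^sub>R v' s))) (at s)" .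
    have DA: "DLag \<mu> (y s, v s) (h *\<^sub>R v s, h *\<^sub>R v' s) = A * h" for h
    proof -
      have "DLag \<mu> (y s, v s) (h *\<^sub>R v s, h *\<^sub>R v' s) = DLag \<mu> (y s, v s) (h *\<^sub>R v s, 0) + mom \<mu> (y s) (v s) \<bullet> (h *\<^sub>R v' s)"
        by (simp add: DLag_def)
      also have "\<dots> = P' s \<bullet> (h *\<^sub>R v s) + P s \<bullet> (h *\<^sub>R v' s)" unfolding P'[OF s] P[OF s] ..
      finally show ?thesis by (simp add: A_def algebra_simps)
    qed
    have "((\<lambda>s. Lag \<mu> (y s, v s)) has_real_derivative A) (at s)"
      using D unfolding has_field_derivative_def DA .
    then have "((\<lambda>s. 2 * Lag \<mu> (y s, v s)) has_real_derivative 2 * A) (at s)" by (rule DERIV_cmult)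
    then have 2: "((\<lambda>s. P s \<bullet> v s) has_real_derivative 2 * A) (at s)"
      by (rule has_field_derivative_transform_within_open[OF _ oI s]) (simp add: Lag_def FsF)
    have "A = 0" using DERIV_unique[OF 1 2] by simp
    then have "((\<lambda>s. P s \<bullet> v s) has_real_derivative 0) (at s)" using 1 by simp
    then have "((\<lambda>s. (?\<phi> s)\<^sup>2) has_real_derivative 0) (at s)"
      by (rule has_field_derivative_transform_within_open[OF _ oI s]) (simp add: FsF(2))
    then show ?thesis unfolding has_field_derivative_def by (rule has_derivative_eq_rhs) auto
  qed
  define c where "c = ?\<phi> a"
  have c0: "c \<ge> 0" unfolding c_def using Fs_nonneg yYs eps ab by simp
  have \<phi>c: "?\<phi> s = c" if s: "s \<in> {a..b}" for s
  proof -
    have "(?\<phi> s)\<^sup>2 = c\<^sup>2"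
    proof (rule has_derivative_zero_unique_strong_interval[of "B \<union> {a, b}" a b "\<lambda>s. (?\<phi> s)\<^sup>2"])
      fix x assume "x \<in> {a..b} - (B \<union> {a, b})"
      then have "x \<in> ?I" by auto
      then show "((\<lambda>s. (?\<phi> s)\<^sup>2) has_derivative (\<lambda>h. 0)) (at x within {a..b})"
        using d0 has_derivative_at_withinI by blast
    qed (use B s c\<phi> in \<open>auto intro!: continuous_intros simp: c_def\<close>)
    then show ?thesis using c0 Fs_nonneg[OF yYs[OF s] eps, of "P s"] by simp
  qed
  have Fc: "F \<mu> (y s) (v s) = c" if "s \<in> ?I" for s using FsF(1)[OF that] \<phi>c[of s] that by simp
  show ?thesis
  proof (rule that[OF c0 Fc])
    assume c: "c > 0"
    have Pn: "P s \<noteq> 0" if "s \<in> {a..b}" for s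
      using \<phi>c[OF that] Fs_zero[OF yYs[OF that]] c by auto
    have vn: "v s \<noteq> 0" if "s \<in> ?I" for s
      using Fc[OF that] F_zero(1)[OF Omega_Y[OF Om[OF that]]] c by auto
    have cV: "continuous_on {a..b} (\<lambda>s. c *\<^sub>R V1 \<mu> (y s) (P s))" and cB: "continuous_on {a..b} (\<lambda>s. c *\<^sub>R B1 \<mu> (y s) (P s))"
      by (intro continuous_intros continuous_V1 continuous_B1 cy yY cP Pn eps; assumption)+
    have y': "(y has_vector_derivative c *\<^sub>R V1 \<mu> (y s) (P s)) (at s)" if "s \<in> ?I" for s
      using dy[OF that] mom_facts(2)[OF Om[OF that] eps vn[OF that]] Fc[OF that] P[OF that] by simp
    have P'': "(P has_vector_derivative c *\<^sub>R B1 \<mu> (y s) (P s)) (at s)" if "s \<in> ?I" for s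
    proof -
      have "P' s = c *\<^sub>R B1 \<mu> (y s) (P s)"
      proof (rule vector_eq_rdot[THEN iffD1], rule allI)
        fix e
        show "P' s \<bullet> e = (c *\<^sub>R B1 \<mu> (y s) (P s)) \<bullet> e"
          using P'[OF that, of e] DLag_momentum[OF Om[OF that] eps vn[OF that], of e 0] Fc[OF that] P[OF that] by simp
      qed
      then show ?thesis using dP[OF that] by simp
    qed
    show "\<forall>s\<in>{a..b}. P s \<noteq> 0 \<and> Fs \<mu> (y s) (P s) = c \<and>
       (y has_vector_derivative c *\<^sub>R V1 \<mu> (y s) (P s)) (at s within {a..b}) \<and>
       (P has_vector_derivative c *\<^sub>R B1 \<mu> (y s) (P s)) (at s within {a..b})"
      using Pn \<phi>c ode_from_finite_exceptions[OF B cy cV y'] ode_from_finite_exceptions[OF B cP cB P''] by blast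
  next
    assume c: "c = 0"
    have v0: "v s = 0" if "s \<in> ?I" for s
      using F_facts(4)[OF Om[OF that] eps] Fc[OF that] c by (cases "v s = 0") auto
    show "\<forall>s\<in>{a..b}. y s = y a"
    proof
      fix s assume s: "s \<in> {a..b}"
      show "y s = y a"
      proof (rule has_derivative_zero_unique_strong_interval[of "B \<union> {a, b}" a b y])
        fix x assume "x \<in> {a..b} - (B \<union> {a, b})"
        then have x: "x \<in> ?I" by auto
        show "(y has_derivative (\<lambda>h. 0)) (at x within {a..b})"
          using dy[OF x] v0[OF x] has_derivative_at_withinI by (simp add: has_vector_derivative_def)
      qed (use B s cy in auto)
    qed
  qed
qed

text \<open>By homogeneity the normalised momenta solve the same system, and Gronwall pinches them
  between positive constants. Arzela-Ascoli gives a limit, and dominated convergence carries the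
  integral form of the equations over. The speed \<open>c0\<close> and the dual norm
  \<open>k\<close> of the limit momentum need not agree, since only the momenta were
  rescaled.\<close>

lemma ode_limit:
  fixes y P :: "nat \<Rightarrow> real \<Rightarrow> 'b" and y0 :: "real \<Rightarrow> 'b"
  assumes ab: "a < b" and C: "compact C" "C \<subseteq> Y"
    and yC: "\<And>n s. s \<in> {a..b} \<Longrightarrow> y n s \<in> C" and Pn: "\<And>n s. s \<in> {a..b} \<Longrightarrow> P n s \<noteq> 0"
    and eps: "\<And>n. \<mu> n \<in> {0..1}" "\<mu> \<longlonglongrightarrow> 0" and c: "c \<longlonglongrightarrow> c0" "\<And>n. c n \<ge> 0"
    and Fsc: "\<And>n s. s \<in> {a..b} \<Longrightarrow> Fs (\<mu> n) (y n s) (P n s) = c n"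
    and dy: "\<And>n s. s \<in> {a..b} \<Longrightarrow> (y n has_vector_derivative c n *\<^sub>R V1 (\<mu> n) (y n s) (P n s)) (at s within {a..b})"
    and dP: "\<And>n s. s \<in> {a..b} \<Longrightarrow> (P n has_vector_derivative c n *\<^sub>R B1 (\<mu> n) (y n s) (P n s)) (at s within {a..b})"
    and lim: "\<And>s. s \<in> {a..b} \<Longrightarrow> (\<lambda>n. y n s) \<longlonglongrightarrow> y0 s"
  obtains \<pi> k where "k \<ge> 0"
    "\<And>s. s \<in> {a..b} \<Longrightarrow> y0 s \<in> C \<and> \<pi> s \<noteq> 0 \<and> Fs 0 (y0 s) (\<pi> s) = k \<and>
       (y0 has_vector_derivative c0 *\<^sub>R V1 0 (y0 s) (\<pi> s)) (at s within {a..b}) \<and>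
       (\<pi> has_vector_derivative c0 *\<^sub>R B1 0 (y0 s) (\<pi> s)) (at s within {a..b})"
proof -
  obtain M where M: "M > 0"
    "\<And>\<mu> y p. \<mu> \<in> {0..1} \<Longrightarrow> y \<in> C \<Longrightarrow> p \<noteq> 0 \<Longrightarrow> norm (V1 \<mu> y p) \<le> M"
    "\<And>\<mu> y p. \<mu> \<in> {0..1} \<Longrightarrow> y \<in> C \<Longrightarrow> p \<noteq> 0 \<Longrightarrow> norm (B1 \<mu> y p) \<le> M * norm p"
    using momentum_field_bounds[OF C] by blast
  obtain D where D: "D > 0" "\<And>n. norm (c n) \<le> D"
    using convergent_imp_Bseq[of c] c(1) unfolding convergent_def Bseq_def by blast
  have cD: "\<bar>c n\<bar> \<le> D" for n using D(2)[of n] by simp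
  have aab: "a \<in> {a..b}" using ab by simp
  \<comment> \<open>No bound on \<open>P n\<close> is available: its dual norm is
    \<open>c n\<close>, but the dual norm degenerates in one direction as the parameter tends to 0
    where \<open>l\<close> vanishes. Hence the scaling at the left end.\<close>
  define \<kappa> where "\<kappa> n = norm (P n a)" for n
  have \<kappa>: "\<kappa> n > 0" for n unfolding \<kappa>_def using Pn[OF aab] by simp
  define \<pi>n where "\<pi>n n s = (1 / \<kappa> n) *\<^sub>R P n s" for n s
  have yY: "y n s \<in> Y" if "s \<in> {a..b}" for n s using yC[OF that] C(2) by auto
  have \<pi>nz: "\<pi>n n s \<noteq> 0" if "s \<in> {a..b}" for n s using Pn[OF that] \<kappa>[of n] by (simp add: \<pi>n_def)
  have r\<kappa>: "1 / \<kappa> n > 0" for n using \<kappa> by simp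
  have sc: "V1 (\<mu> n) (y n s) (\<pi>n n s) = V1 (\<mu> n) (y n s) (P n s)"
      "B1 (\<mu> n) (y n s) (\<pi>n n s) = (1 / \<kappa> n) *\<^sub>R B1 (\<mu> n) (y n s) (P n s)"
      "Fs (\<mu> n) (y n s) (\<pi>n n s) = c n / \<kappa> n" if "s \<in> {a..b}" for n s
    unfolding \<pi>n_def using momentum_scale[OF yY[OF that] r\<kappa>] Fsc[OF that] by simp_all
  have d\<pi>: "(\<pi>n n has_vector_derivative c n *\<^sub>R B1 (\<mu> n) (y n s) (\<pi>n n s)) (at s within {a..b})" if s: "s \<in> {a..b}" for n s
  proof -
    have "(\<pi>n n has_vector_derivative (1 / \<kappa> n) *\<^sub>R (c n *\<^sub>R B1 (\<mu> n) (y n s) (P n s))) (at s within {a..b})"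
      unfolding \<pi>n_def[abs_def] by (rule bounded_linear.has_vector_derivative[OF bounded_linear_scaleR_right dP[OF s]])
    then show ?thesis by (simp add: sc(2)[OF s] mult.commute)
  qed
  have dy2: "(y n has_vector_derivative c n *\<^sub>R V1 (\<mu> n) (y n s) (\<pi>n n s)) (at s within {a..b})" if s: "s \<in> {a..b}" for n s
    using dy[OF s] unfolding sc(1)[OF s] .
  define A where "A = D * M"
  have A: "A > 0" using D(1) M(1) by (simp add: A_def)
  have B\<pi>: "norm (c n *\<^sub>R B1 (\<mu> n) (y n s) (\<pi>n n s)) \<le> A * norm (\<pi>n n s)" if s: "s \<in> {a..b}" for n s
  proof -
    have "norm (c n *\<^sub>R B1 (\<mu> n) (y n s) (\<pi>n n s)) = \<bar>c n\<bar> * norm (B1 (\<mu> n) (y n s) (\<pi>n n s))" by simp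
    also have "\<dots> \<le> D * (M * norm (\<pi>n n s))"
      using cD D(1) M(3)[OF eps(1) yC[OF s] \<pi>nz[OF s]] by (intro mult_mono) auto
    finally show ?thesis by (simp add: A_def mult.assoc)
  qed
  have Vb: "norm (c n *\<^sub>R V1 (\<mu> n) (y n s) (\<pi>n n s)) \<le> A" if s: "s \<in> {a..b}" for n s
  proof -
    have "norm (c n *\<^sub>R V1 (\<mu> n) (y n s) (\<pi>n n s)) = \<bar>c n\<bar> * norm (V1 (\<mu> n) (y n s) (\<pi>n n s))" by simp
    also have "\<dots> \<le> D * M"
      using cD D(1) M(2)[OF eps(1) yC[OF s] \<pi>nz[OF s]] by (intro mult_mono) auto
    finally show ?thesis by (simp add: A_def)
  qed
  have n1: "norm (\<pi>n n a) = 1" for n unfolding \<pi>n_def using \<kappa>[of n] by (simp add: \<kappa>_def)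
  define lo hi where "lo = exp (- A * (b - a))" and "hi = exp (A * (b - a))"
  have bounds: "lo \<le> norm (\<pi>n n s)" "norm (\<pi>n n s) \<le> hi" if s: "s \<in> {a..b}" for n s
    unfolding lo_def hi_def
    using gronwall_norm_bounds[of a b "\<pi>n n" "\<lambda>s. c n *\<^sub>R B1 (\<mu> n) (y n s) (\<pi>n n s)" A s, OF d\<pi> B\<pi> n1 s] by blast+
  have lohi: "lo > 0" "hi > 0" by (simp_all add: lo_def hi_def)
  define z where "z n s = (y n s, \<pi>n n s)" for n s
  define f where "f n s = c n *\<^sub>R (V1 (\<mu> n) (y n s) (\<pi>n n s), B1 (\<mu> n) (y n s) (\<pi>n n s))" for n s
  have dz: "(z n has_vector_derivative f n s) (at s within {a..b})" if s: "s \<in> {a..b}" for n s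
    unfolding z_def[abs_def] f_def scaleR_Pair by (rule has_vector_derivative_Pair[OF dy2[OF s] d\<pi>[OF s]])
  have fb: "norm (f n s) \<le> A + A * hi" if s: "s \<in> {a..b}" for n s
  proof -
    have "norm (f n s) \<le> norm (c n *\<^sub>R V1 (\<mu> n) (y n s) (\<pi>n n s)) + norm (c n *\<^sub>R B1 (\<mu> n) (y n s) (\<pi>n n s))"
      unfolding f_def scaleR_Pair by (rule norm_Pair_le)
    moreover have "A * norm (\<pi>n n s) \<le> A * hi" using bounds(2)[OF s] A by (intro mult_left_mono) auto
    ultimately show ?thesis using Vb[OF s, of n] B\<pi>[OF s, of n] by linarith
  qed
  obtain Kc where Kc: "\<And>x. x \<in> C \<Longrightarrow> norm x \<le> Kc" using compact_imp_bounded[OF C(1)] bounded_iff by blast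
  have zb: "norm (z n s) \<le> Kc + hi" if "s \<in> {a..b}" for n s
    using norm_Pair_le[of "y n s" "\<pi>n n s"] Kc[OF yC[OF that, of n]] bounds(2)[OF that, of n] unfolding z_def by linarith
  have equi: "\<exists>d. 0 < d \<and> (\<forall>n t. t \<in> {a..b} \<and> norm (s - t) < d \<longrightarrow> norm (z n s - z n t) < e)"
    if "s \<in> {a..b}" "0 < e" for s e
  proof (intro exI conjI allI impI)
    let ?L = "A + A * hi"
    have L: "?L > 0" using A lohi by (simp add: add_pos_pos)
    show "0 < e / ?L" using that(2) L by simp
    fix n t assume t: "t \<in> {a..b} \<and> norm (s - t) < e / ?L"
    then have "?L * \<bar>s - t\<bar> < e" using L by (simp add: field_simps)
    moreover have "norm (z n s - z n t) \<le> ?L * \<bar>s - t\<bar>"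
      using vector_derivative_lipschitz[OF dz fb that(1)] t by blast
    ultimately show "norm (z n s - z n t) < e" by linarith
  qed
  obtain g k where cg: "continuous_on {a..b} g" and k: "strict_mono (k :: nat \<Rightarrow> nat)"
    and gk: "\<And>e. 0 < e \<Longrightarrow> \<exists>N. \<forall>n x. n \<ge> N \<and> x \<in> {a..b} \<longrightarrow> norm (z (k n) x - g x) < e"
    using Arzela_Ascoli[of "{a..b}" z "Kc + hi", OF compact_Icc zb equi] by blast
  have zg: "(\<lambda>n. z (k n) s) \<longlonglongrightarrow> g s" if "s \<in> {a..b}" for s
    unfolding LIMSEQ_def dist_norm using gk that by blast
  have gy: "fst (g s) = y0 s" if "s \<in> {a..b}" for s
  proof (rule LIMSEQ_unique)
    show "(\<lambda>n. y (k n) s) \<longlonglongrightarrow> fst (g s)" using tendsto_fst[OF zg[OF that]] by (simp add: z_def)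
    show "(\<lambda>n. y (k n) s) \<longlonglongrightarrow> y0 s" using LIMSEQ_subseq_LIMSEQ[OF lim[OF that] k] by (simp add: o_def)
  qed
  define \<pi> where "\<pi> s = snd (g s)" for s
  have g\<pi>: "g s = (y0 s, \<pi> s)" if "s \<in> {a..b}" for s using gy[OF that] by (simp add: \<pi>_def prod_eq_iff)
  have lim\<pi>: "(\<lambda>n. \<pi>n (k n) s) \<longlonglongrightarrow> \<pi> s" if "s \<in> {a..b}" for s
    using tendsto_snd[OF zg[OF that]] by (simp add: z_def \<pi>_def)
  have limy: "(\<lambda>n. y (k n) s) \<longlonglongrightarrow> y0 s" if "s \<in> {a..b}" for s
    using LIMSEQ_subseq_LIMSEQ[OF lim[OF that] k] by (simp add: o_def)
  have lime: "(\<lambda>n. \<mu> (k n)) \<longlonglongrightarrow> 0" using LIMSEQ_subseq_LIMSEQ[OF eps(2) k] by (simp add: o_def)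
  have limc: "(\<lambda>n. c (k n)) \<longlonglongrightarrow> c0" using LIMSEQ_subseq_LIMSEQ[OF c(1) k] by (simp add: o_def)
  have y0C: "y0 s \<in> C" if "s \<in> {a..b}" for s
    using closed_sequentially[OF compact_imp_closed[OF C(1)] _ lim[OF that]] yC[OF that] by blast
  have \<pi>0: "\<pi> s \<noteq> 0" if s: "s \<in> {a..b}" for s
  proof -
    have "lo \<le> norm (\<pi> s)"
      using tendsto_lowerbound[OF tendsto_norm[OF lim\<pi>[OF s]]] bounds(1)[OF s] by (simp add: eventually_sequentially)
    then show ?thesis using lohi by auto
  qed
  let ?W = "{0::real..} \<times> Y \<times> (- {0::'b})"
  have sub: "(\<lambda>x. fst (snd x)) ` ?W \<subseteq> Y" by auto
  have trip: "(\<lambda>n. (\<mu> (k n), y (k n) s, \<pi>n (k n) s)) \<longlonglongrightarrow> (0, y0 s, \<pi> s)" if "s \<in> {a..b}" for s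
    by (intro tendsto_Pair lime limy lim\<pi> that)
  have tin: "(0, y0 s, \<pi> s) \<in> ?W" "\<forall>\<^sub>F n in sequentially. (\<mu> (k n), y (k n) s, \<pi>n (k n) s) \<in> ?W" if "s \<in> {a..b}" for s
    using y0C[OF that] C(2) \<pi>0[OF that] yY[OF that] \<pi>nz[OF that] eps(1) by (auto intro!: always_eventually)
  have cV: "continuous_on ?W (\<lambda>x. V1 (fst x) (fst (snd x)) (snd (snd x)))"
    and cB: "continuous_on ?W (\<lambda>x. B1 (fst x) (fst (snd x)) (snd (snd x)))"
    by (intro continuous_V1 continuous_B1 continuous_intros sub; auto)+
  have cF: "continuous_on ?W (\<lambda>x. Fs (fst x) (fst (snd x)) (snd (snd x)))"
    by (intro continuous_Fs continuous_intros sub) auto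
  have limV: "(\<lambda>n. V1 (\<mu> (k n)) (y (k n) s) (\<pi>n (k n) s)) \<longlonglongrightarrow> V1 0 (y0 s) (\<pi> s)" if "s \<in> {a..b}" for s
    using continuous_on_tendsto_compose[OF cV trip[OF that] tin[OF that]] by simp
  have limB: "(\<lambda>n. B1 (\<mu> (k n)) (y (k n) s) (\<pi>n (k n) s)) \<longlonglongrightarrow> B1 0 (y0 s) (\<pi> s)" if "s \<in> {a..b}" for s
    using continuous_on_tendsto_compose[OF cB trip[OF that] tin[OF that]] by simp
  \<comment> \<open>The sequence does not involve \<open>s\<close>; this makes the dual norm of the
    limit momentum constant in \<open>s\<close>.\<close>
  have limF: "(\<lambda>n. c (k n) / \<kappa> (k n)) \<longlonglongrightarrow> Fs 0 (y0 s) (\<pi> s)" if "s \<in> {a..b}" for s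
    using continuous_on_tendsto_compose[OF cF trip[OF that] tin[OF that]] sc(3)[OF that] by simp
  define f0 where "f0 s = c0 *\<^sub>R (V1 0 (y0 s) (\<pi> s), B1 0 (y0 s) (\<pi> s))" for s
  have limf: "(\<lambda>n. f (k n) s) \<longlonglongrightarrow> f0 s" if "s \<in> {a..b}" for s
    unfolding f_def f0_def by (intro tendsto_intros limc limV limB that)
  have inteq: "g t = g a + integral {a..t} f0" if t: "t \<in> {a..b}" for t
  proof -
    have hi: "(f n has_integral z n t - z n a) {a..t}" for n
      by (rule fundamental_theorem_of_calculus[OF _ has_vector_derivative_within_subset[OF dz]]) (use t in auto)
    have "(\<lambda>n. integral {a..t} (f (k n))) \<longlonglongrightarrow> integral {a..t} f0"
    proof (rule dominated_convergence(2)[where h = "\<lambda>s. A + A * hi"])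
      show "f (k n) integrable_on {a..t}" for n using hi by (rule has_integral_integrable)
      show "(\<lambda>n. f (k n) x) \<longlonglongrightarrow> f0 x" if "x \<in> {a..t}" for x using limf that t by simp
      show "norm (f (k n) x) \<le> A + A * hi" if "x \<in> {a..t}" for n x using fb that t by simp
    qed auto
    moreover have "integral {a..t} (f n) = z n t - z n a" for n by (rule integral_unique[OF hi])
    moreover have "(\<lambda>n. z (k n) t - z (k n) a) \<longlonglongrightarrow> g t - g a" by (intro tendsto_diff zg t aab)
    ultimately have "integral {a..t} f0 = g t - g a" using LIMSEQ_unique by auto
    then show ?thesis by simp
  qed
  have cy0: "continuous_on {a..b} y0"
    by (rule continuous_on_eq[OF continuous_on_fst[OF cg]]) (rule gy)
  have c\<pi>: "continuous_on {a..b} \<pi>" unfolding \<pi>_def by (rule continuous_on_snd[OF cg])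
  have cf0: "continuous_on {a..b} f0"
    unfolding f0_def using y0C C(2) \<pi>0
    by (intro continuous_intros continuous_V1 continuous_B1 cy0 c\<pi>) auto
  have dg: "(g has_vector_derivative f0 s) (at s within {a..b})" if "s \<in> {a..b}" for s
    by (rule ode_of_integral_equation[OF cf0 inteq that])
  have dy0: "(y0 has_vector_derivative c0 *\<^sub>R V1 0 (y0 s) (\<pi> s)) (at s within {a..b})" if s: "s \<in> {a..b}" for s
  proof -
    have "((\<lambda>s. fst (g s)) has_vector_derivative fst (f0 s)) (at s within {a..b})"
      by (rule bounded_linear.has_vector_derivative[OF bounded_linear_fst dg[OF s]])
    from has_vector_derivative_transform[OF s gy[symmetric] this] show ?thesis by (simp add: f0_def)
  qed
  have d\<pi>0: "(\<pi> has_vector_derivative c0 *\<^sub>R B1 0 (y0 s) (\<pi> s)) (at s within {a..b})" if s: "s \<in> {a..b}" for s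
    using bounded_linear.has_vector_derivative[OF bounded_linear_snd dg[OF s]] by (simp add: f0_def \<pi>_def[abs_def])
  define kk where "kk = Fs 0 (y0 a) (\<pi> a)"
  have "kk \<ge> 0" unfolding kk_def using Fs_nonneg y0C[OF aab] C(2) by auto
  moreover have "Fs 0 (y0 s) (\<pi> s) = kk" if "s \<in> {a..b}" for s
    unfolding kk_def using LIMSEQ_unique[OF limF[OF that] limF[OF aab]] .
  ultimately show ?thesis using that y0C \<pi>0 dy0 d\<pi>0 by blast
qed

end

section \<open>Partitions of the unit interval\<close>

text \<open>The piece that contains \<open>[u, v]\<close> starts at the last partition point not
  beyond \<open>u\<close>; its other end cannot lie before \<open>v\<close>, because no partition
  point lies strictly between.\<close>

lemma partition01_refine:
  assumes "partition01 n t" "\<And>i. i < n \<Longrightarrow> P (t i) (t (Suc i))"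
    and mono: "\<And>u v u' v'. P u v \<Longrightarrow> u \<le> u' \<Longrightarrow> u' < v' \<Longrightarrow> v' \<le> v \<Longrightarrow> P u' v'"
    and uv: "0 \<le> u" "u < v" "v \<le> 1" "{u<..<v} \<inter> t ` {..n} = {}"
  shows "P u v"
proof -
  let ?I = "{i. i \<le> n \<and> t i \<le> u}"
  have fin: "finite ?I" "0 \<in> ?I" using assms(1) uv by (auto simp: partition01_def)
  define i where "i = Max ?I"
  have "?I \<noteq> {}" using fin(2) by blast
  then have i: "i \<in> ?I" unfolding i_def by (rule Max_in[OF fin(1)])
  have "i \<noteq> n" using i assms(1) uv by (auto simp: partition01_def)
  then have lt: "i < n" using i by auto
  have "Suc i \<notin> ?I"
  proof
    assume "Suc i \<in> ?I"
    then have "Suc i \<le> i" unfolding i_def by (rule Max_ge[OF fin(1)])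
    then show False by simp
  qed
  then have "u < t (Suc i)" using lt by auto
  moreover have "t (Suc i) \<notin> {u<..<v}" using uv(4) lt by auto
  ultimately have "v \<le> t (Suc i)" by auto
  then show ?thesis using mono[OF assms(2)[OF lt], of u v] i uv(2) by auto
qed

text \<open>The points of \<open>S\<close> in [0,1], together with 0 and 1, are sorted.\<close>

lemma partition01_exists:
  assumes "finite S"
  obtains n t where "partition01 n t" "\<And>i. i < n \<Longrightarrow> {t i<..<t (Suc i)} \<inter> S = {}"
    "\<And>i. i \<le> n \<Longrightarrow> t i \<in> {0..1}"
proof -
  define A where "A = (S \<inter> {0..1}) \<union> {0, 1::real}"
  define xs where "xs = sorted_list_of_set A"
  have fA: "finite A" using assms by (simp add: A_def)
  have xs: "set xs = A" "sorted_wrt (<) xs" using fA by (auto simp: xs_def)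
  define n where "n = length xs - 1"
  have "card A \<ge> 2" using card_mono[OF fA, of "{0, 1}"] by (simp add: A_def)
  then have len: "length xs = Suc n" "n \<ge> 1" using fA by (auto simp: n_def xs_def)
  have mono: "xs ! i < xs ! j" if "i < j" "j \<le> n" for i j
    using sorted_wrt_nth_less[OF xs(2), of i j] that len by simp
  have inA: "xs ! i \<in> A" if "i \<le> n" for i using that len nth_mem[of i xs] xs(1) by simp
  have A01: "A \<subseteq> {0..1}" by (auto simp: A_def)
  obtain j where j: "j \<le> n" "xs ! j = 0" using xs(1) len in_set_conv_nth[of 0 xs] by (auto simp: A_def less_Suc_eq_le)
  obtain k where k: "k \<le> n" "xs ! k = 1" using xs(1) len in_set_conv_nth[of 1 xs] by (auto simp: A_def less_Suc_eq_le)
  have x0: "xs ! 0 = 0" using mono[of 0 j] j inA[of 0] A01 by (cases "j = 0") force+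
  have xn: "xs ! n = 1" using mono[of k n] k inA[of n] A01 by (cases "k = n") force+
  have p: "partition01 n (\<lambda>i. xs ! i)" unfolding partition01_def using x0 xn mono by simp
  show ?thesis
  proof (rule that[OF p])
    fix i assume i: "i < n"
    show "{xs ! i<..<xs ! Suc i} \<inter> S = {}"
    proof (rule ccontr)
      assume "\<not> ?thesis"
      then obtain x where x: "xs ! i < x" "x < xs ! Suc i" "x \<in> S" by auto
      have "x \<in> {0..1}" using x A01 inA[of i] inA[of "Suc i"] i by force
      then obtain m where m: "m \<le> n" "xs ! m = x" using x xs(1) len in_set_conv_nth[of x xs] by (auto simp: A_def less_Suc_eq_le)
      have "m \<le> i \<or> Suc i \<le> m" by auto
      then show False
        using mono[of m i] mono[of "Suc i" m] x m i by (cases "m = i"; cases "m = Suc i") auto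
    qed
  next
    fix i assume "i \<le> n" then show "xs ! i \<in> {0..1}" using inA A01 by blast
  qed
qed

section \<open>Geodesics on the manifold\<close>

definition cinv :: "('a, 'b) chart \<Rightarrow> 'b \<Rightarrow> 'a" where "cinv c = inv_into (fst c) (snd c)"

lemma smooth_on_has_vector_derivative:
  fixes h :: "real \<Rightarrow> 'e::real_normed_vector"
  assumes "smooth_on W h" "q \<in> W"
  shows "(h has_vector_derivative frechet_derivative h (at q) 1) (at q)"
proof -
  note d = smooth_onD(1)[OF assms]
  have "frechet_derivative h (at q) r = r *\<^sub>R frechet_derivative h (at q) 1" for r
    using linear_scale[OF has_derivative_linear[OF d], of r 1] by simp
  from has_derivative_eq_rhs[OF d ext[OF this]] show ?thesis unfolding has_vector_derivative_def .
qed

locale manifold_atlas =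
  fixes At :: "('a::{t2_space, second_countable_topology}, 'b::euclidean_space) chart set"
  assumes atlas: "smooth_atlas At"
begin

abbreviation img :: "('a, 'b) chart \<Rightarrow> 'b set" where "img c \<equiv> snd c ` fst c"

lemma chart_exists: obtains c where "c \<in> charts_at At x"
  using atlas unfolding smooth_atlas_def charts_at_def by blast

lemma charts_atD: "c \<in> charts_at At x \<Longrightarrow> c \<in> At \<and> x \<in> fst c"
  by (simp add: charts_at_def)

lemma chart_props:
  assumes "c \<in> At"
  shows "open (fst c)" "open (img c)" "homeomorphism (fst c) (img c) (snd c) (cinv c)"
  using assms atlas unfolding smooth_atlas_def cinv_def by (auto simp: case_prod_unfold)

lemma cinv_chart: "c \<in> At \<Longrightarrow> x \<in> fst c \<Longrightarrow> cinv c (snd c x) = x"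
  using chart_props(3) unfolding homeomorphism_def by blast

lemma chart_cinv: "c \<in> At \<Longrightarrow> y \<in> img c \<Longrightarrow> snd c (cinv c y) = y"
  and cinv_in: "c \<in> At \<Longrightarrow> y \<in> img c \<Longrightarrow> cinv c y \<in> fst c"
  using chart_props(3) unfolding homeomorphism_def by blast+

lemma chart_continuous: "c \<in> At \<Longrightarrow> continuous_on (fst c) (snd c)"
  and cinv_continuous: "c \<in> At \<Longrightarrow> continuous_on (img c) (cinv c)"
  using chart_props(3) unfolding homeomorphism_def by blast+

lemma open_chart_image:
  assumes "c \<in> At" "open V" shows "open (snd c ` (fst c \<inter> V))"
proof -
  have "snd c ` (fst c \<inter> V) = img c \<inter> cinv c -` V"
    using cinv_chart[OF assms(1)] chart_cinv[OF assms(1)] cinv_in[OF assms(1)] by force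
  then show ?thesis
    using continuous_open_preimage[OF cinv_continuous[OF assms(1)] chart_props(2)[OF assms(1)] assms(2)] by simp
qed

lemma open_cinv_image:
  assumes "c \<in> At" "open V" "V \<subseteq> img c" shows "open (cinv c ` V)"
proof -
  have "cinv c ` V = fst c \<inter> snd c -` V"
    using cinv_chart[OF assms(1)] chart_cinv[OF assms(1)] cinv_in[OF assms(1)] assms(3) by force
  then show ?thesis
    using continuous_open_preimage[OF chart_continuous[OF assms(1)] chart_props(1)[OF assms(1)] assms(2)] by simp
qed

lemma compact_cinv_image: "c \<in> At \<Longrightarrow> compact C \<Longrightarrow> C \<subseteq> img c \<Longrightarrow> compact (cinv c ` C)"
  by (intro compact_continuous_image continuous_on_subset[OF cinv_continuous])

lemma transition_smooth: "c \<in> At \<Longrightarrow> c' \<in> At \<Longrightarrow> smooth_on (snd c ` (fst c \<inter> fst c')) (transition c c')"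
  using atlas unfolding smooth_atlas_def by blast

lemma transition_apply: "c \<in> At \<Longrightarrow> x \<in> fst c \<Longrightarrow> transition c c' (snd c x) = snd c' x"
  unfolding transition_def using cinv_chart unfolding cinv_def by simp

abbreviation dtr :: "('a, 'b) chart \<Rightarrow> ('a, 'b) chart \<Rightarrow> 'a \<Rightarrow> 'b \<Rightarrow> 'b" where
  "dtr c c' x \<equiv> frechet_derivative (transition c c') (at (snd c x))"

lemma transition_derivative:
  assumes "c \<in> charts_at At x" "c' \<in> charts_at At x"
  shows "(transition c c' has_derivative dtr c c' x) (at (snd c x))"
  using smooth_onD(1)[OF transition_smooth] assms charts_atD by blast

lemma dtr_linear: "c \<in> charts_at At x \<Longrightarrow> c' \<in> charts_at At x \<Longrightarrow> linear (dtr c c' x)"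
  using has_derivative_linear[OF transition_derivative] .

lemma dtr_self:
  assumes "c \<in> charts_at At x" shows "dtr c c x e = e"
proof -
  have c: "c \<in> At" "x \<in> fst c" using charts_atD[OF assms] by auto
  have "((\<lambda>y. y) has_derivative (\<lambda>e. e)) (at (snd c x))" by (rule has_derivative_ident)
  then have "(transition c c has_derivative (\<lambda>e. e)) (at (snd c x))"
    by (rule has_derivative_transform_within_open[OF _ chart_props(2)[OF c(1)]])
      (use c transition_apply[OF c(1), of _ c] in auto)
  from fun_cong[OF frechet_derivative_at[OF this], of e] show ?thesis by simp
qed

lemma dtr_compose:
  assumes "c \<in> charts_at At x" "c' \<in> charts_at At x" "c'' \<in> charts_at At x"
  shows "dtr c' c'' x (dtr c c' x e) = dtr c c'' x e"
proof -
  have c: "c \<in> At" "x \<in> fst c" and c': "c' \<in> At" "x \<in> fst c'" using charts_atD assms by auto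
  have "(transition c' c'' has_derivative dtr c' c'' x) (at (transition c c' (snd c x)))"
    using transition_derivative[OF assms(2,3)] by (simp add: transition_apply c)
  from has_derivative_compose[OF transition_derivative[OF assms(1,2)] this]
  have "(transition c c'' has_derivative (\<lambda>e. dtr c' c'' x (dtr c c' x e))) (at (snd c x))"
    by (rule has_derivative_transform_within_open[OF _ open_chart_image[OF c(1) chart_props(1)[OF c'(1)]]])
      (use c c' transition_apply[OF c(1), of _ c'] transition_apply[OF c(1), of _ c''] transition_apply[OF c'(1), of _ c''] in auto)
  from fun_cong[OF frechet_derivative_at[OF this], of e] show ?thesis .
qed

lemma coord_vec_self: "c \<in> charts_at At x \<Longrightarrow> coord_vec At c x e c = e"
  by (simp add: coord_vec_def dtr_self)

lemma coord_vec_tangent: "c \<in> charts_at At x \<Longrightarrow> coord_vec At c x e \<in> tangent_space At x"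
  by (auto simp: tangent_space_def coord_vec_def dtr_compose)

lemma tangent_coord_vec:
  assumes "v \<in> tangent_space At x" "c \<in> charts_at At x"
  shows "v = coord_vec At c x (v c)"
proof
  fix c' show "v c' = coord_vec At c x (v c) c'"
  proof (cases "c' \<in> charts_at At x")
    case True
    then have "v c' = dtr c c' x (v c)" using assms unfolding tangent_space_def by blast
    then show ?thesis unfolding coord_vec_def using True by (simp only: if_True)
  next
    case False
    then have "v c' = 0" using assms unfolding tangent_space_def by blast
    then show ?thesis unfolding coord_vec_def using False by (simp only: if_False)
  qed
qed

lemma coord_vec_linear:
  assumes "c \<in> charts_at At x"
  shows "coord_vec At c x (a *\<^sub>R e + b *\<^sub>R e') = (\<lambda>c'. a *\<^sub>R coord_vec At c x e c' + b *\<^sub>R coord_vec At c x e' c')"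
  using linear_add[OF dtr_linear[OF assms]] linear_scale[OF dtr_linear[OF assms]]
  by (auto simp: coord_vec_def fun_eq_iff)

text \<open>In any other chart the curve is the transition map composed with \<open>h\<close>, so
  the chain rule yields the remaining components. Nontriviality of the filter makes the one-sided
  derivative unique.\<close>

lemma velocity_within_eq:
  assumes c: "c \<in> At" and W: "open W" "s \<in> W" and sI: "s \<in> I" and nt: "at s within I \<noteq> bot"
    and h: "\<And>q. q \<in> I \<inter> W \<Longrightarrow> \<gamma> q \<in> fst c \<and> snd c (\<gamma> q) = h q"
    and d: "(h has_vector_derivative e) (at s within I)"
  shows "velocity_within At \<gamma> I s = coord_vec At c (\<gamma> s) e"
proof
  fix c'
  have cx: "c \<in> charts_at At (\<gamma> s)" using h[of s] sI W(2) c by (simp add: charts_at_def)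
  show "velocity_within At \<gamma> I s c' = coord_vec At c (\<gamma> s) e c'"
  proof (cases "c' \<in> charts_at At (\<gamma> s)")
    case False then show ?thesis by (simp add: velocity_within_def coord_vec_def)
  next
    case True
    let ?V = "snd c ` (fst c \<inter> fst c')"
    have c': "c' \<in> At" "\<gamma> s \<in> fst c'" using charts_atD[OF True] by auto
    have oV: "open ?V" by (rule open_chart_image[OF c chart_props(1)[OF c'(1)]])
    have hs1: "\<gamma> s \<in> fst c" "h s = snd c (\<gamma> s)" using h[of s] sI W(2) by auto
    then have "h s \<in> ?V" using c'(2) by blast
    note hs = hs1(2) this
    have cont: "continuous (at s within I) h" using has_vector_derivative_continuous[OF d] .
    then have ev1: "\<forall>\<^sub>F q in at s within I. h q \<in> ?V"
      by (intro topological_tendstoD[OF _ oV hs(2)]) (simp add: continuous_within)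
    have ev2: "\<forall>\<^sub>F q in at s within I. q \<in> W \<and> q \<in> I"
      using W unfolding eventually_at_topological by blast
    have ev: "\<forall>\<^sub>F q in at s within I. transition c c' (h q) = (snd c' \<circ> \<gamma>) q"
      using ev1 ev2
    proof eventually_elim
      case (elim q)
      then have "\<gamma> q \<in> fst c" "snd c (\<gamma> q) = h q" using h by auto
      then show ?case using transition_apply[OF c, of "\<gamma> q" c'] by simp
    qed
    have "(h has_derivative (\<lambda>r. r *\<^sub>R e)) (at s within I)" using d by (simp add: has_vector_derivative_def)
    from has_derivative_compose[OF this, of "transition c c'" "dtr c c' (\<gamma> s)"]
    have "((\<lambda>q. transition c c' (h q)) has_derivative (\<lambda>r. dtr c c' (\<gamma> s) (r *\<^sub>R e))) (at s within I)"
      using transition_derivative[OF cx True] unfolding hs(1) by simp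
    then have D: "((\<lambda>q. transition c c' (h q)) has_derivative (\<lambda>r. r *\<^sub>R dtr c c' (\<gamma> s) e)) (at s within I)"
      by (simp add: linear_scale[OF dtr_linear[OF cx True]])
    have "(snd c' \<circ> \<gamma> has_derivative (\<lambda>r. r *\<^sub>R dtr c c' (\<gamma> s) e)) (at s within I)"
      by (rule has_derivative_transform_eventually[OF D ev])
        (use transition_apply[OF c, of "\<gamma> s" c'] h[of s] sI W(2) in auto)
    then have "vector_derivative (snd c' \<circ> \<gamma>) (at s within I) = dtr c c' (\<gamma> s) e"
      by (intro vector_derivative_within[OF nt]) (simp add: has_vector_derivative_def)
    then show ?thesis using True by (simp add: velocity_within_def coord_vec_def)
  qed
qed

lemma smooth_map_subset: "smooth_map At D f \<Longrightarrow> D' \<subseteq> D \<Longrightarrow> smooth_map At D' f"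
  unfolding smooth_map_def by (meson continuous_on_subset in_mono inf_mono order_refl)

text \<open>One chart per point is enough: a smooth extension of its coordinates is carried to any
  other chart by the smooth transition map, after shrinking the neighbourhood.\<close>

lemma smooth_mapI:
  fixes f :: "'e::euclidean_space \<Rightarrow> 'a"
  assumes "continuous_on D f"
    and "\<And>p. p \<in> D \<Longrightarrow> \<exists>c\<in>charts_at At (f p). \<exists>W h. open W \<and> p \<in> W \<and> smooth_on W h \<and>
           (\<forall>q\<in>D \<inter> W. f q \<in> fst c \<and> h q = snd c (f q))"
  shows "smooth_map At D f"
  unfolding smooth_map_def
proof (intro conjI ballI assms(1))
  fix p c' assume p: "p \<in> D" and c': "c' \<in> charts_at At (f p)"
  obtain c W h where c: "c \<in> charts_at At (f p)" and W: "open W" "p \<in> W" "smooth_on W h"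
    and h: "\<And>q. q \<in> D \<inter> W \<Longrightarrow> f q \<in> fst c \<and> h q = snd c (f q)"
    using assms(2)[OF p] by blast
  have cA: "c \<in> At" "c' \<in> At" "f p \<in> fst c'" using charts_atD c c' by auto
  let ?V = "snd c ` (fst c \<inter> fst c')"
  have oV: "open ?V" by (rule open_chart_image[OF cA(1) chart_props(1)[OF cA(2)]])
  let ?W = "W \<inter> h -` ?V"
  have oW: "open ?W" by (rule continuous_open_preimage[OF smooth_on_continuous[OF W(3)] W(1) oV])
  have "smooth_on ?W (\<lambda>q. transition c c' (h q))"
    by (rule smooth_on_compose[OF oW oV _ smooth_on_subset[OF W(3)] transition_smooth[OF cA(1,2)]]) auto
  moreover have "p \<in> ?W" using h[of p] p W(2) cA(3) by auto
  moreover have "f q \<in> fst c' \<and> transition c c' (h q) = snd c' (f q)" if q: "q \<in> D \<inter> ?W" for q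
  proof -
    have fq: "f q \<in> fst c" "h q = snd c (f q)" using h[of q] q by auto
    obtain x where x: "x \<in> fst c \<inter> fst c'" "h q = snd c x" using q by auto
    have "x = f q" using cinv_chart[OF cA(1), of x] cinv_chart[OF cA(1) fq(1)] x fq(2) by auto
    then show ?thesis using x transition_apply[OF cA(1) fq(1)] fq(2) by simp
  qed
  ultimately show "\<exists>W h. open W \<and> p \<in> W \<and> smooth_on W h \<and> (\<forall>q\<in>D \<inter> W. f q \<in> fst c' \<and> h q = snd c' (f q))"
    using oW by blast
qed

lemma smooth_mapD:
  assumes "smooth_map At D f" "p \<in> D" "c \<in> charts_at At (f p)"
  obtains W h where "open W" "p \<in> W" "smooth_on W h" "\<And>q. q \<in> D \<Longrightarrow> q \<in> W \<Longrightarrow> f q \<in> fst c \<and> h q = snd c (f q)"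
  using assms unfolding smooth_map_def by (metis IntI)

text \<open>Trades a partition for a finite exceptional set, which can be enlarged and united with
  others. The projection \<open>pr\<close> serves curves and variations alike.\<close>

lemma piecewise_intervals:
  fixes f :: "'e::euclidean_space \<Rightarrow> 'a"
  assumes "partition01 n t" "\<And>i. i < n \<Longrightarrow> smooth_map At (Z \<inter> pr -` {t i..t (Suc i)}) f"
  obtains S where "finite S" "\<And>u v. 0 \<le> u \<Longrightarrow> u < v \<Longrightarrow> v \<le> 1 \<Longrightarrow> {u<..<v} \<inter> S = {} \<Longrightarrow> smooth_map At (Z \<inter> pr -` {u..v::real}) f"
proof (rule that[of "t ` {..n}"])
  fix u v :: real assume uv: "0 \<le> u" "u < v" "v \<le> 1" "{u<..<v} \<inter> t ` {..n} = {}"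
  show "smooth_map At (Z \<inter> pr -` {u..v}) f"
    by (rule partition01_refine[OF assms(1), where P = "\<lambda>u v. smooth_map At (Z \<inter> pr -` {u..v}) f"])
      (use assms(2) uv in \<open>auto elim: smooth_map_subset\<close>)
qed simp

lemma piecewise_smooth_curveE:
  assumes "piecewise_smooth_curve At \<gamma>"
  obtains S where "finite S" "continuous_on {0..1} \<gamma>"
    "\<And>u v. 0 \<le> u \<Longrightarrow> u < v \<Longrightarrow> v \<le> 1 \<Longrightarrow> {u<..<v} \<inter> S = {} \<Longrightarrow> smooth_map At {u..v} \<gamma>"
proof -
  obtain n t where p: "partition01 n t" "\<And>i. i < n \<Longrightarrow> smooth_map At {t i..t (Suc i)} \<gamma>" "continuous_on {0..1} \<gamma>"
    using assms unfolding piecewise_smooth_curve_def by blast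
  obtain S where "finite S" "\<And>u v. 0 \<le> u \<Longrightarrow> u < v \<Longrightarrow> v \<le> 1 \<Longrightarrow> {u<..<v} \<inter> S = {} \<Longrightarrow> smooth_map At (UNIV \<inter> (\<lambda>s. s) -` {u..v}) \<gamma>"
    using piecewise_intervals[OF p(1), of UNIV "\<lambda>s. s" \<gamma>] p(2) by (simp add: vimage_def) blast
  then show ?thesis using that[of S] p(3) by (simp add: vimage_def)
qed

lemma piecewise_smooth_curveI:
  assumes "finite S" "continuous_on {0..1} \<gamma>"
    "\<And>u v. 0 \<le> u \<Longrightarrow> u < v \<Longrightarrow> v \<le> 1 \<Longrightarrow> {u<..<v} \<inter> S = {} \<Longrightarrow> smooth_map At {u..v} \<gamma>"
  shows "piecewise_smooth_curve At \<gamma>"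
proof -
  obtain n t where p: "partition01 n t" "\<And>i. i < n \<Longrightarrow> {t i<..<t (Suc i)} \<inter> S = {}" "\<And>i. i \<le> n \<Longrightarrow> t i \<in> {0..1}"
    using partition01_exists[OF assms(1)] by blast
  have "smooth_map At {t i..t (Suc i)} \<gamma>" if "i < n" for i
    using assms(3)[OF _ _ _ p(2)[OF that]] p(1) p(3)[of i] p(3)[of "Suc i"] that by (auto simp: partition01_def)
  then show ?thesis unfolding piecewise_smooth_curve_def using p(1) assms(2) by blast
qed

lemma finite_gap:
  assumes "finite (S :: real set)"
  obtains d where "d > 0" "{s - d<..<s} \<inter> S = {}" "{s<..<s + d} \<inter> S = {}"
proof -
  have "closed (S - {s})" using assms by (simp add: finite_imp_closed)
  then have "open (- (S - {s}))" by (rule open_Compl)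
  then obtain d where d: "d > 0" "ball s d \<subseteq> - (S - {s})" using open_contains_ball by (metis ComplI DiffE insertI1)
  show ?thesis by (rule that[OF d(1)]) (use d(2) in \<open>force simp: subset_iff dist_real_def\<close>)+
qed

text \<open>The point \<open>s0\<close> may itself be exceptional, so smoothness may fail on every
  two-sided neighbourhood. A finite set leaves a gap on each side of \<open>s0\<close>, and
  \<open>R\<close> is therefore asked only for intervals that end at \<open>s0\<close>.\<close>

lemma two_sided_intervals:
  fixes R :: "real \<Rightarrow> real \<Rightarrow> bool"
  assumes S: "finite S" and s0: "s0 \<in> {0..1}"
    and R: "\<And>lo hi. 0 \<le> lo \<Longrightarrow> lo < hi \<Longrightarrow> hi \<le> 1 \<Longrightarrow> {lo<..<hi} \<inter> S = {} \<Longrightarrow> s0 = lo \<or> s0 = hi \<Longrightarrow>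
      \<exists>e>0. \<forall>p q. lo \<le> p \<and> p < q \<and> q \<le> hi \<and> (s0 = p \<or> s0 = q) \<and> q - p < e \<longrightarrow> R p q"
  shows "\<exists>d>0. \<forall>p q. 0 \<le> p \<and> p < q \<and> q \<le> 1 \<and> (s0 = p \<or> s0 = q) \<and> q - p < d \<longrightarrow> {p<..<q} \<inter> S = {} \<and> R p q"
proof -
  obtain d where d: "d > 0" "{s0 - d<..<s0} \<inter> S = {}" "{s0<..<s0 + d} \<inter> S = {}" using finite_gap[OF S] by blast
  have right: "\<exists>e>0. \<forall>q. s0 < q \<and> q \<le> 1 \<and> q - s0 < e \<longrightarrow> {s0<..<q} \<inter> S = {} \<and> R s0 q"
  proof (cases "s0 < 1")
    case True
    define hi where "hi = min 1 (s0 + d)"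
    have hi: "s0 < hi" "hi \<le> 1" "{s0<..<hi} \<inter> S = {}" using True d by (auto simp: hi_def)
    obtain e where e: "e > 0" "\<forall>p q. s0 \<le> p \<and> p < q \<and> q \<le> hi \<and> (s0 = p \<or> s0 = q) \<and> q - p < e \<longrightarrow> R p q"
      using R[OF _ hi] s0 by auto
    have "{s0<..<q} \<inter> S = {} \<and> R s0 q" if q: "s0 < q" "q - s0 < min e (hi - s0)" for q
      using hi(3) e(2) q by (auto simp: disjoint_iff)
    then show ?thesis using e(1) hi(1) by (intro exI[of _ "min e (hi - s0)"]) auto
  next
    case False then show ?thesis using s0 by (intro exI[of _ 1]) auto
  qed
  have left: "\<exists>e>0. \<forall>p. 0 \<le> p \<and> p < s0 \<and> s0 - p < e \<longrightarrow> {p<..<s0} \<inter> S = {} \<and> R p s0"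
  proof (cases "0 < s0")
    case True
    define lo where "lo = max 0 (s0 - d)"
    have lo: "0 \<le> lo" "lo < s0" "{lo<..<s0} \<inter> S = {}" using True d by (auto simp: lo_def)
    obtain e where e: "e > 0" "\<forall>p q. lo \<le> p \<and> p < q \<and> q \<le> s0 \<and> (s0 = p \<or> s0 = q) \<and> q - p < e \<longrightarrow> R p q"
      using R[OF lo(1,2) _ lo(3)] s0 by auto
    have "{p<..<s0} \<inter> S = {} \<and> R p s0" if p: "p < s0" "s0 - p < min e (s0 - lo)" for p
      using lo(3) e(2) p by (auto simp: disjoint_iff)
    then show ?thesis using e(1) lo(2) by (intro exI[of _ "min e (s0 - lo)"]) auto
  next
    case False then show ?thesis using s0 by (intro exI[of _ 1]) auto
  qed
  obtain e1 e2 where e1: "e1 > 0" "\<forall>q. s0 < q \<and> q \<le> 1 \<and> q - s0 < e1 \<longrightarrow> {s0<..<q} \<inter> S = {} \<and> R s0 q"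
    and e2: "e2 > 0" "\<forall>p. 0 \<le> p \<and> p < s0 \<and> s0 - p < e2 \<longrightarrow> {p<..<s0} \<inter> S = {} \<and> R p s0" using left right by blast
  show ?thesis
  proof (intro exI[of _ "min e1 e2"] conjI[of "0 < min e1 e2"] allI impI)
    show "0 < min e1 e2" using e1 e2 by simp
    fix p q assume "0 \<le> p \<and> p < q \<and> q \<le> 1 \<and> (s0 = p \<or> s0 = q) \<and> q - p < min e1 e2"
    then show "{p<..<q} \<inter> S = {} \<and> R p q" using e1(2) e2(2) by (elim conjE disjE) simp_all
  qed
qed

lemma at_within_nontrivial:
  fixes u v s :: real assumes "u < v" "s \<in> {u..v}" shows "at s within {u..v} \<noteq> bot"
  using assms by (simp add: trivial_limit_within islimpt_Icc)

lemma smooth_curve_velocity: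
  assumes "smooth_map At {u..v} \<gamma>" "u < v" "s \<in> {u..v}" "c \<in> charts_at At (\<gamma> s)"
  obtains e where "velocity_within At \<gamma> {u..v} s = coord_vec At c (\<gamma> s) e"
    "(snd c \<circ> \<gamma> has_vector_derivative e) (at s within {u..v})"
proof -
  obtain W h where W: "open W" "s \<in> W" "smooth_on W h" and h: "\<And>q. q \<in> {u..v} \<Longrightarrow> q \<in> W \<Longrightarrow> \<gamma> q \<in> fst c \<and> h q = snd c (\<gamma> q)"
    using smooth_mapD[OF assms(1,3,4)] by blast
  note d = smooth_on_has_vector_derivative[OF W(3,2)]
  have v: "velocity_within At \<gamma> {u..v} s = coord_vec At c (\<gamma> s) (frechet_derivative h (at s) 1)"
    by (rule velocity_within_eq[OF _ W(1,2) assms(3) at_within_nontrivial[OF assms(2,3)] _ has_vector_derivative_at_within[OF d]])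
      (use h assms(4) charts_atD in auto)
  obtain r where r: "r > 0" "ball s r \<subseteq> W" using W(1,2) open_contains_ball by blast
  have "(snd c \<circ> \<gamma> has_vector_derivative frechet_derivative h (at s) 1) (at s within {u..v})"
    by (rule has_vector_derivative_transform_within[OF has_vector_derivative_at_within[OF d] r(1) assms(3)])
      (use h r(2) in \<open>auto simp: dist_commute subset_iff\<close>)
  then show ?thesis using that v by blast
qed

lemma velocity_within_local:
  assumes "s \<in> I" "s \<in> J" "open W" "s \<in> W" "I \<inter> W = J \<inter> W"
  shows "velocity_within At \<gamma> I s = velocity_within At \<gamma> J s"
proof -
  have "at s within I = at s within J"
    by (rule at_within_nhd[OF assms(4,3)]) (use assms(5) in auto)
  then show ?thesis by (simp only: velocity_within_def)
qed

lemma one_sided_velocity_tangent: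
  assumes "piecewise_smooth_curve At \<gamma>" "s \<in> {0<..<1}"
  shows "velocity_within At \<gamma> {0..s} s \<in> tangent_space At (\<gamma> s)"
    "velocity_within At \<gamma> {s..1} s \<in> tangent_space At (\<gamma> s)"
proof -
  obtain S where S: "finite S" "\<And>u v. 0 \<le> u \<Longrightarrow> u < v \<Longrightarrow> v \<le> 1 \<Longrightarrow> {u<..<v} \<inter> S = {} \<Longrightarrow> smooth_map At {u..v} \<gamma>"
    using piecewise_smooth_curveE[OF assms(1)] by metis
  obtain d where d: "d > 0" "{s - d<..<s} \<inter> S = {}" "{s<..<s + d} \<inter> S = {}" using finite_gap[OF S(1)] by blast
  obtain c where c: "c \<in> charts_at At (\<gamma> s)" using chart_exists by blast
  have s0: "0 < s" and s1: "s < 1" using assms(2) by auto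
  define u v where "u = max 0 (s - d)" and "v = min 1 (s + d)"
  have uv: "0 \<le> u" "u < s" "s < v" "v \<le> 1" "{u<..<s} \<inter> S = {}" "{s<..<v} \<inter> S = {}"
    using d assms(2) by (auto simp: u_def v_def)
  have "velocity_within At \<gamma> {0..s} s = velocity_within At \<gamma> {u..s} s"
    by (rule velocity_within_local[where W = "{u<..}"]) (use uv assms(2) in auto)
  moreover obtain e where "velocity_within At \<gamma> {u..s} s = coord_vec At c (\<gamma> s) e"
    using smooth_curve_velocity[OF S(2)[OF uv(1,2) less_imp_le[OF s1] uv(5)] uv(2) _ c] uv by (metis atLeastAtMost_iff less_imp_le order_refl)
  ultimately show "velocity_within At \<gamma> {0..s} s \<in> tangent_space At (\<gamma> s)" using coord_vec_tangent[OF c] by simp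
  have "velocity_within At \<gamma> {s..1} s = velocity_within At \<gamma> {s..v} s"
    by (rule velocity_within_local[where W = "{..<v}"]) (use uv assms(2) in auto)
  moreover obtain e where "velocity_within At \<gamma> {s..v} s = coord_vec At c (\<gamma> s) e"
    using smooth_curve_velocity[OF S(2)[OF less_imp_le[OF s0] uv(3,4,6)] uv(3) _ c] uv by (metis atLeastAtMost_iff less_imp_le order_refl)
  ultimately show "velocity_within At \<gamma> {s..1} s \<in> tangent_space At (\<gamma> s)" using coord_vec_tangent[OF c] by simp
qed

lemma curves_between_tangent:
  "\<gamma> \<in> curves_between At (tangent_bundle At) x y \<longleftrightarrow> piecewise_smooth_curve At \<gamma> \<and> \<gamma> 0 = x \<and> \<gamma> 1 = y"
  using one_sided_velocity_tangent unfolding curves_between_def tangent_bundle_def by auto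

lemma zero_tangent: "(\<lambda>c. 0) \<in> tangent_space At x"
  unfolding tangent_space_def using linear_0[OF dtr_linear] by auto

end

section \<open>The metrics on the manifold and their coordinate expressions\<close>

locale rk_manifold = manifold_atlas At
  for At :: "('a::{t2_space, second_countable_topology}, 'b::euclidean_space) chart set" +
  fixes g0 :: "'a \<Rightarrow> ('a, 'b) tvec \<Rightarrow> ('a, 'b) tvec \<Rightarrow> real"
    and \<omega> :: "'a \<Rightarrow> ('a, 'b) tvec \<Rightarrow> real"
    and \<Lambda> :: "'a \<Rightarrow> real"
  assumes g0: "riemannian_metric At g0" and \<omega>: "smooth_one_form At \<omega>"
    and \<omega>_nonzero: "\<And>x. \<exists>v\<in>tangent_space At x. \<omega> x v \<noteq> 0"
    and \<Lambda>: "smooth_fun At \<Lambda>" and \<Lambda>_nonneg: "\<And>x. \<Lambda> x \<ge> 0"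
begin

definition Gc where "Gc c y e e' = g0 (cinv c y) (coord_vec At c (cinv c y) e) (coord_vec At c (cinv c y) e')"
definition wc where "wc c y e = \<omega> (cinv c y) (coord_vec At c (cinv c y) e)"
definition lc where "lc c y = \<Lambda> (cinv c y)"

lemma cinv_charts_at: "c \<in> At \<Longrightarrow> y \<in> img c \<Longrightarrow> c \<in> charts_at At (cinv c y)"
  using cinv_in by (simp add: charts_at_def)

lemma g0_linear: "u \<in> tangent_space At x \<Longrightarrow> linear_on_tangent At x (g0 x u)"
  and g0_sym: "u \<in> tangent_space At x \<Longrightarrow> v \<in> tangent_space At x \<Longrightarrow> g0 x u v = g0 x v u"
  and g0_pos: "u \<in> tangent_space At x \<Longrightarrow> u \<noteq> (\<lambda>c. 0) \<Longrightarrow> g0 x u u > 0"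
  using g0 unfolding riemannian_metric_def by blast+

lemma linear_on_tangent_coord:
  assumes "linear_on_tangent At x f" "c \<in> charts_at At x"
  shows "linear (\<lambda>e. f (coord_vec At c x e))"
proof (rule linearI)
  have key: "f (coord_vec At c x (a *\<^sub>R e + b *\<^sub>R e')) = a * f (coord_vec At c x e) + b * f (coord_vec At c x e')" for a b e e'
    unfolding coord_vec_linear[OF assms(2)]
    using assms(1) coord_vec_tangent[OF assms(2)] unfolding linear_on_tangent_def by blast
  fix e e' r
  show "f (coord_vec At c x (e + e')) = f (coord_vec At c x e) + f (coord_vec At c x e')"
    using key[of 1 e 1 e'] by simp
  show "f (coord_vec At c x (r *\<^sub>R e)) = r *\<^sub>R f (coord_vec At c x e)"
    using key[of r e 0 e] by simp
qed

lemma chart_rk: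
  assumes c: "c \<in> At" shows "rk_chart (img c) (Gc c) (wc c) (lc c)"
proof (rule rk_chart.intro)
  fix y e e'
  show "open (img c)" by (rule chart_props(2)[OF c])
  show "smooth_on (img c) (\<lambda>y. Gc c y e e')" "smooth_on (img c) (\<lambda>y. wc c y e)"
    using g0 \<omega> c unfolding riemannian_metric_def smooth_one_form_def Gc_def wc_def cinv_def Let_def by blast+
  have "smooth_on (snd c ` fst c) (\<Lambda> \<circ> inv_into (fst c) (snd c))"
    using \<Lambda> c unfolding smooth_fun_def by (cases c) auto
  then show "smooth_on (img c) (lc c)" unfolding lc_def[abs_def] cinv_def o_def .
  assume y: "y \<in> img c"
  note cy = cinv_charts_at[OF c y] and ct = coord_vec_tangent[OF cinv_charts_at[OF c y]]
  show "linear (Gc c y e)" unfolding Gc_def[abs_def] by (rule linear_on_tangent_coord[OF g0_linear[OF ct] cy])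
  show "linear (wc c y)" unfolding wc_def[abs_def]
    by (rule linear_on_tangent_coord[OF _ cy]) (use \<omega> in \<open>simp add: smooth_one_form_def\<close>)
  show "Gc c y e e' = Gc c y e' e" unfolding Gc_def by (rule g0_sym[OF ct ct])
  show "e \<noteq> 0 \<Longrightarrow> 0 < Gc c y e e"
    unfolding Gc_def using g0_pos[OF ct] coord_vec_self[OF cy, of e] by metis
  show "\<exists>e. wc c y e \<noteq> 0"
    unfolding wc_def using \<omega>_nonzero[of "cinv c y"] tangent_coord_vec[OF _ cy] by metis
  show "0 \<le> lc c y" unfolding lc_def by (rule \<Lambda>_nonneg)
qed

lemma metric_coord:
  assumes "c \<in> charts_at At x" "u \<in> tangent_space At x" "v \<in> tangent_space At x"
  shows "g0 x u v = Gc c (snd c x) (u c) (v c)" "\<omega> x u = wc c (snd c x) (u c)" "\<Lambda> x = lc c (snd c x)"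
proof -
  have "cinv c (snd c x) = x" using cinv_chart charts_atD[OF assms(1)] by blast
  then show "g0 x u v = Gc c (snd c x) (u c) (v c)" "\<omega> x u = wc c (snd c x) (u c)" "\<Lambda> x = lc c (snd c x)"
    using tangent_coord_vec[OF assms(2,1)] tangent_coord_vec[OF assms(3,1)]
    unfolding Gc_def wc_def lc_def by simp_all
qed

abbreviation Fc where "Fc c \<equiv> rk_chart.F (Gc c) (wc c) (lc c)"
abbreviation Omc where "Omc c \<equiv> rk_chart.Omega (img c) (wc c) (lc c)"

abbreviation rk_fun where "rk_fun \<mu> \<equiv> rk_metric g0 \<omega> (\<lambda>x. \<Lambda> x + \<mu>)"
abbreviation rk_dom where "rk_dom \<mu> \<equiv> rk_domain At \<omega> (\<lambda>x. \<Lambda> x + \<mu>)"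

lemma rk_metric_coord:
  assumes "c \<in> charts_at At x" "v \<in> tangent_space At x"
  shows "rk_fun \<mu> x v = Fc c \<mu> (snd c x) (v c)"
proof -
  interpret C: rk_chart "img c" "Gc c" "wc c" "lc c" using chart_rk charts_atD[OF assms(1)] by blast
  show ?thesis unfolding rk_metric_def C.F_def C.Q_def
    using metric_coord[OF assms(1,2,2)] by simp
qed

lemma rk_domain_coord:
  assumes "c \<in> charts_at At x" "v \<in> tangent_space At x" "\<mu> \<ge> 0"
  shows "(x, v) \<in> rk_dom \<mu> \<longleftrightarrow> (snd c x, v c) \<in> Omc c \<mu>"
proof -
  interpret C: rk_chart "img c" "Gc c" "wc c" "lc c" using chart_rk charts_atD[OF assms(1)] by blast
  show ?thesis unfolding rk_domain_def C.Omega_def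
    using metric_coord[OF assms(1,2,2)] assms(2,3) charts_atD[OF assms(1)] \<Lambda>_nonneg[of x] by auto
qed

lemma linear_on_tangent_zero:
  assumes "linear_on_tangent At x f" shows "f (\<lambda>c. 0) = 0"
  using bspec[OF bspec[OF assms[unfolded linear_on_tangent_def] zero_tangent] zero_tangent, THEN spec, THEN spec, of 0 0]
  by simp

text \<open>For a nonzero vector this is \<open>rk_algebra\<close> divided by \<Lambda> + \<mu>; at
  the zero vector both sides are 0, the quotient by the convention on division by 0.\<close>

lemma randers_eq_rk:
  assumes "\<mu> > 0" "v \<in> tangent_space At x"
  shows "randers_metric g0 \<omega> \<Lambda> \<mu> x v = rk_fun \<mu> x v"
proof (cases "v = (\<lambda>c. 0)")
  case True
  have lin: "linear_on_tangent At x (\<omega> x)" "linear_on_tangent At x (g0 x v)"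
    using \<omega> g0_linear[OF assms(2)] by (auto simp: smooth_one_form_def)
  then have "\<omega> x v = 0" "g0 x v v = 0"
    using linear_on_tangent_zero unfolding True by blast+
  then show ?thesis by (simp add: randers_metric_def rk_metric_def)
next
  case False
  let ?L = "\<Lambda> x + \<mu>" and ?r = "sqrt ((\<Lambda> x + \<mu>) * g0 x v v + (\<omega> x v)\<^sup>2)"
  have L: "?L > 0" using \<Lambda>_nonneg[of x] assms(1) by simp
  have g: "g0 x v v > 0" by (rule g0_pos[OF assms(2) False])
  then have "?r\<^sup>2 = ?L * g0 x v v + (\<omega> x v)\<^sup>2" using L by simp
  note a = rk_algebra(3)[OF this _ _ g]
  have "?L * (g0 x v v / (- \<omega> x v + ?r)) = ?r + \<omega> x v" using a L g by simp
  then show ?thesis using L by (simp add: randers_metric_def rk_metric_def field_simps)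
qed

end

section \<open>Gluing integrals and their derivatives over subintervals\<close>

text \<open>Integrability near parameter 0 and the value of the derivative are both additive over
  adjacent intervals, so bisection applies. Only intervals with one end at the given point need to
  be treated locally, which allows a corner there.\<close>

lemma integral_derivative_glue:
  fixes f :: "real \<Rightarrow> real \<Rightarrow> real" and J :: "real \<Rightarrow> real \<Rightarrow> real"
  defines "Q \<equiv> \<lambda>u v. (\<forall>\<^sub>F x in nhds 0. f x integrable_on {u..v}) \<and>
    ((\<lambda>x. integral {u..v} (f x)) has_real_derivative J u v) (at 0)"
  assumes ab: "a \<le> b" and add: "\<And>u v w. a \<le> u \<Longrightarrow> u \<le> v \<Longrightarrow> v \<le> w \<Longrightarrow> w \<le> b \<Longrightarrow> J u w = J u v + J v w"
    and local: "\<And>s. s \<in> {a..b} \<Longrightarrow> \<exists>d>0. \<forall>p q. a \<le> p \<and> p < q \<and> q \<le> b \<and> (s = p \<or> s = q) \<and> q - p < d \<longrightarrow> Q p q"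
  shows "Q a b"
proof -
  \<comment> \<open>Additivity at three equal points forces this; it covers the degenerate intervals
    that bisection may produce.\<close>
  have J0: "J u u = 0" if "a \<le> u" "u \<le> b" for u using add[of u u u] that by simp
  have Q0: "Q u u" if "a \<le> u" "u \<le> b" for u unfolding Q_def
    using J0[OF that] by (simp add: has_integral_integrable[OF has_integral_refl(2)])
  have trans: "Q u w" if Q: "Q u v" "Q v w" and uvw: "a \<le> u" "u \<le> v" "v \<le> w" "w \<le> b" for u v w
  proof -
    have e: "\<forall>\<^sub>F x in nhds 0. f x integrable_on {u..v}" "\<forall>\<^sub>F x in nhds 0. f x integrable_on {v..w}"
      using Q unfolding Q_def by auto
    have e1: "\<forall>\<^sub>F x in nhds 0. f x integrable_on {u..w}"
      using e
    proof eventually_elim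
      case (elim x) then show ?case using Henstock_Kurzweil_Integration.integrable_combine[OF uvw(2,3)] by blast
    qed
    have e2: "\<forall>\<^sub>F x in nhds 0. integral {u..w} (f x) = integral {u..v} (f x) + integral {v..w} (f x)"
      using e1
    proof eventually_elim
      case (elim x) then show ?case using Henstock_Kurzweil_Integration.integral_combine[OF uvw(2,3)] by metis
    qed
    have "((\<lambda>x. integral {u..v} (f x) + integral {v..w} (f x)) has_real_derivative J u v + J v w) (at 0)"
      using Q unfolding Q_def by (intro DERIV_add) auto
    then have "((\<lambda>x. integral {u..w} (f x)) has_real_derivative J u v + J v w) (at 0)"
      using DERIV_cong_ev[OF refl e2 refl] by blast
    then show ?thesis unfolding Q_def using e1 add[OF uvw] by simp
  qed
  show ?thesis
  proof (rule Bolzano_within[OF ab, of Q])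
    fix u v w assume "Q u v" "Q v w" "a \<le> u" "u \<le> v" "v \<le> w" "w \<le> b"
    then show "Q u w" by (rule trans)
  next
    fix s assume s: "a \<le> s" "s \<le> b"
    then obtain d where d: "d > 0" "\<And>p q. a \<le> p \<Longrightarrow> p < q \<Longrightarrow> q \<le> b \<Longrightarrow> s = p \<or> s = q \<Longrightarrow> q - p < d \<Longrightarrow> Q p q"
      using local[of s] by auto
    have "Q u v" if uv: "a \<le> u" "u \<le> s" "s \<le> v" "v \<le> b" "v - u < d" for u v
    proof -
      have "Q u s"
      proof (cases "u = s")
        case True then show ?thesis using Q0 s by simp
      next
        case False then show ?thesis using d(2)[of u s] uv by simp
      qed
      moreover have "Q s v"
      proof (cases "s = v")
        case True then show ?thesis using Q0 s by simp
      next
        case False then show ?thesis using d(2)[of s v] uv by simp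
      qed
      ultimately show ?thesis by (rule trans) (use uv in auto)
    qed
    then show "\<exists>d>0. \<forall>u v. a \<le> u \<and> u \<le> s \<and> s \<le> v \<and> v \<le> b \<and> v - u < d \<longrightarrow> Q u v"
      using d(1) by blast
  qed
qed

lemma piecewise_continuous_integrable:
  fixes D :: "real \<Rightarrow> real"
  assumes ab: "a \<le> b"
    and local: "\<And>s. s \<in> {a..b} \<Longrightarrow> \<exists>d>0. \<forall>p q. a \<le> p \<and> p < q \<and> q \<le> b \<and> (s = p \<or> s = q) \<and> q - p < d \<longrightarrow>
       (\<exists>g. continuous_on {p..q} g \<and> (\<forall>r\<in>{p<..<q}. D r = g r))"
  shows "D integrable_on {a..b}"
proof (rule Bolzano_within[OF ab, of "\<lambda>u v. D integrable_on {u..v}"])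
  fix u v w assume "D integrable_on {u..v}" "D integrable_on {v..w}" "u \<le> v" "v \<le> w"
  then show "D integrable_on {u..w}" using Henstock_Kurzweil_Integration.integrable_combine by blast
next
  fix s assume s: "a \<le> s" "s \<le> b"
  then obtain d where d: "d > 0" "\<And>p q. a \<le> p \<Longrightarrow> p < q \<Longrightarrow> q \<le> b \<Longrightarrow> s = p \<or> s = q \<Longrightarrow> q - p < d \<Longrightarrow>
      \<exists>g. continuous_on {p..q} g \<and> (\<forall>r\<in>{p<..<q}. D r = g r)"
    using local[of s] by auto
  have i: "D integrable_on {p..q}" if pq: "a \<le> p" "p \<le> q" "q \<le> b" "s = p \<or> s = q" "q - p < d" for p q
  proof (cases "p = q")
    case True then show ?thesis using has_integral_integrable[OF has_integral_refl(2)] by simp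
  next
    case False
    then obtain g where g: "continuous_on {p..q} g" "\<And>r. r \<in> {p<..<q} \<Longrightarrow> D r = g r"
      using d(2)[of p q] pq by auto
    show ?thesis
      by (rule integrable_spike_finite[of "{p, q}", OF _ _ integrable_continuous_real[OF g(1)]]) (use g(2) in auto)
  qed
  have "D integrable_on {u..v}" if uv: "a \<le> u" "u \<le> s" "s \<le> v" "v \<le> b" "v - u < d" for u v
    using Henstock_Kurzweil_Integration.integrable_combine[OF uv(2,3) i[of u s] i[of s v]] uv by auto
  then show "\<exists>d>0. \<forall>u v. a \<le> u \<and> u \<le> s \<and> s \<le> v \<and> v \<le> b \<and> v - u < d \<longrightarrow> D integrable_on {u..v}"
    using d(1) by blast
qed

lemma smooth_on_slice_derivative:
  fixes h :: "real \<times> real \<Rightarrow> 'b::euclidean_space"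
  assumes "smooth_on W h" "(x, s) \<in> W"
  shows "((\<lambda>t. h (x, t)) has_vector_derivative frechet_derivative h (at (x, s)) (0, 1)) (at s)"
    "((\<lambda>y. h (y, s)) has_vector_derivative frechet_derivative h (at (x, s)) (1, 0)) (at x)"
proof -
  note D = smooth_onD(1)[OF assms]
  have i: "((\<lambda>t. (x, t)) has_derivative (\<lambda>d. (0, d))) (at s)" "((\<lambda>y. (y, s)) has_derivative (\<lambda>d. (d, 0))) (at x)"
    by (intro has_derivative_Pair has_derivative_ident has_derivative_const)+
  have lin: "linear (frechet_derivative h (at (x, s)))" by (rule has_derivative_linear[OF D])
  have "frechet_derivative h (at (x, s)) (0, d) = d *\<^sub>R frechet_derivative h (at (x, s)) (0, 1)"
    "frechet_derivative h (at (x, s)) (d, 0) = d *\<^sub>R frechet_derivative h (at (x, s)) (1, 0)" for d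
    using linear_scale[OF lin, of d "(0, 1)"] linear_scale[OF lin, of d "(1, 0)"] by simp_all
  then have eq: "(\<lambda>d. frechet_derivative h (at (x, s)) (0, d)) = (\<lambda>d. d *\<^sub>R frechet_derivative h (at (x, s)) (0, 1))"
    "(\<lambda>d. frechet_derivative h (at (x, s)) (d, 0)) = (\<lambda>d. d *\<^sub>R frechet_derivative h (at (x, s)) (1, 0))"
    by (blast intro: ext)+
  show "((\<lambda>t. h (x, t)) has_vector_derivative frechet_derivative h (at (x, s)) (0, 1)) (at s)"
    using has_derivative_compose[OF i(1) D] unfolding has_vector_derivative_def eq .
  show "((\<lambda>y. h (y, s)) has_vector_derivative frechet_derivative h (at (x, s)) (1, 0)) (at x)"
    using has_derivative_compose[OF i(2) D] unfolding has_vector_derivative_def eq .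
qed

context manifold_atlas
begin

lemma variation_pieces:
  assumes "variation_of At Dom x0 x1 \<gamma> \<delta> H"
  obtains S where "finite S"
    "\<And>u v. 0 \<le> u \<Longrightarrow> u < v \<Longrightarrow> v \<le> 1 \<Longrightarrow> {u<..<v} \<inter> S = {} \<Longrightarrow> smooth_map At ({-\<delta><..<\<delta>} \<times> {u..v}) H"
proof -
  obtain n t where p: "partition01 n t" "\<And>i. i < n \<Longrightarrow> smooth_map At ({-\<delta><..<\<delta>} \<times> {t i..t (Suc i)}) H"
    using assms unfolding variation_of_def by blast
  have e: "({-\<delta><..<\<delta>} \<times> UNIV) \<inter> snd -` {u..v} = {-\<delta><..<\<delta>} \<times> {u..v}" for u v :: real by auto
  show ?thesis
    using piecewise_intervals[OF p(1), of "{-\<delta><..<\<delta>} \<times> UNIV" snd H] p(2) that unfolding e by blast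
qed

end

section \<open>Derivative of the energy along a variation\<close>

context rk_manifold
begin

text \<open>Transfers \<open>first_variation\<close> from coordinates to the energy on a piece lying
  in one chart. The factor 2 appears because the integrand is F^2, twice the Lagrangian.\<close>

lemma energy_piece:
  fixes h :: "real \<times> real \<Rightarrow> 'b"
  defines "hs \<equiv> \<lambda>z. frechet_derivative h (at z) (0, 1)" and "hw \<equiv> \<lambda>z. frechet_derivative h (at z) (1, 0)"
  defines "hsw \<equiv> \<lambda>z. frechet_derivative (\<lambda>z. frechet_derivative h (at z) (0, 1)) (at z) (1, 0)"
  assumes c: "c \<in> At" and eps: "\<mu> \<ge> 0" and uv: "0 \<le> u" "u < v" "v \<le> 1"
    and W: "open W" "smooth_on W h" "{0} \<times> {u..v} \<subseteq> W" and "\<delta> > 0"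
    and H: "\<And>x s. x \<in> {-\<delta><..<\<delta>} \<Longrightarrow> s \<in> {u..v} \<Longrightarrow> (x, s) \<in> W \<Longrightarrow> H (x, s) \<in> fst c \<and> h (x, s) = snd c (H (x, s))"
    and Om: "\<And>s. s \<in> {u..v} \<Longrightarrow> (h (0, s), hs (0, s)) \<in> Omc c \<mu>"
  obtains r where "r > 0" "{-r..r} \<times> {u..v} \<subseteq> W"
    "\<forall>\<^sub>F x in nhds 0. (\<lambda>s. (rk_fun \<mu> (H (x, s)) (velocity At (\<lambda>s. H (x, s)) s))\<^sup>2) integrable_on {u..v}"
    "((\<lambda>x. integral {u..v} (\<lambda>s. (rk_fun \<mu> (H (x, s)) (velocity At (\<lambda>s. H (x, s)) s))\<^sup>2)) has_real_derivative
      2 * integral {u..v} (\<lambda>s. rk_chart.DLag (Gc c) (wc c) (lc c) \<mu> (h (0, s), hs (0, s)) (hw (0, s), hsw (0, s)))) (at 0)"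
proof -
  interpret C: rk_chart "img c" "Gc c" "wc c" "lc c" by (rule chart_rk[OF c])
  obtain r where r: "r > 0" "{-r..r} \<times> {u..v} \<subseteq> W"
    "\<And>x s. x \<in> {-r..r} \<Longrightarrow> s \<in> {u..v} \<Longrightarrow> (h (x, s), hs (x, s)) \<in> C.Omega \<mu>"
    "\<And>x. x \<in> {-r..r} \<Longrightarrow> continuous_on {u..v} (\<lambda>s. C.Lag \<mu> (h (x, s), hs (x, s)))"
    "((\<lambda>x. integral {u..v} (\<lambda>s. C.Lag \<mu> (h (x, s), hs (x, s)))) has_real_derivative
       integral {u..v} (\<lambda>s. C.DLag \<mu> (h (0, s), hs (0, s)) (hw (0, s), hsw (0, s)))) (at 0)"
  proof (rule C.first_variation[OF eps W(1,3,2) Om[unfolded hs_def]])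
    let ?hs = "\<lambda>z. frechet_derivative h (at z) (0, 1)" and ?hw = "\<lambda>z. frechet_derivative h (at z) (1, 0)"
    let ?hsw = "\<lambda>z. frechet_derivative (\<lambda>z. frechet_derivative h (at z) (0, 1)) (at z) (1, 0)"
    fix r assume r: "0 < r" "{-r..r} \<times> {u..v} \<subseteq> W"
      "\<And>x s. x \<in> {-r..r} \<Longrightarrow> s \<in> {u..v} \<Longrightarrow> (h (x, s), ?hs (x, s)) \<in> C.Omega \<mu>"
      "\<And>x. x \<in> {-r..r} \<Longrightarrow> continuous_on {u..v} (\<lambda>s. C.Lag \<mu> (h (x, s), ?hs (x, s)))"
      "((\<lambda>x. integral {u..v} (\<lambda>s. C.Lag \<mu> (h (x, s), ?hs (x, s)))) has_real_derivative
         integral {u..v} (\<lambda>s. C.DLag \<mu> (h (0, s), ?hs (0, s)) (?hw (0, s), ?hsw (0, s)))) (at 0)"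
    show thesis by (rule that[unfolded hs_def hw_def hsw_def, OF r])
  qed
  let ?f = "\<lambda>x s. (rk_fun \<mu> (H (x, s)) (velocity At (\<lambda>s. H (x, s)) s))\<^sup>2"
  define \<rho> where "\<rho> = min r \<delta>"
  have \<rho>: "\<rho> > 0" using r(1) \<open>\<delta> > 0\<close> by (simp add: \<rho>_def)
  \<comment> \<open>Restricted to interior times: at \<open>u\<close> and \<open>v\<close> the
    velocity also depends on the neighbouring pieces. Two points do not affect the
    integrals.\<close>
  have eq: "?f x s = 2 * C.Lag \<mu> (h (x, s), hs (x, s))" if x: "x \<in> {-\<rho><..<\<rho>}" and s: "s \<in> {u<..<v}" for x s
  proof -
    have inW: "(x, q) \<in> W" if "q \<in> {u..v}" for q using r(2) x that by (auto simp: \<rho>_def)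
    have Hq: "H (x, q) \<in> fst c \<and> snd c (H (x, q)) = h (x, q)" if "q \<in> {u..v}" for q
      using H[of x q] x that inW[OF that] by (auto simp: \<rho>_def)
    have "velocity_within At (\<lambda>s. H (x, s)) {0..1} s = coord_vec At c (H (x, s)) (hs (x, s))"
    proof (rule velocity_within_eq[OF c open_greaterThanLessThan[of u v]])
      show "((\<lambda>t. h (x, t)) has_vector_derivative hs (x, s)) (at s within {0..1})"
        unfolding hs_def by (rule has_vector_derivative_at_within[OF smooth_on_slice_derivative(1)[OF W(2) inW]]) (use s in auto)
      show "at s within {0..1} \<noteq> bot" by (rule at_within_nontrivial) (use s uv in auto)
    qed (use s uv Hq in auto)
    then have vel: "velocity At (\<lambda>s. H (x, s)) s = coord_vec At c (H (x, s)) (hs (x, s))" by (simp add: velocity_def)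
    have cx: "c \<in> charts_at At (H (x, s))" using Hq[of s] s c by (auto simp: charts_at_def)
    have "rk_fun \<mu> (H (x, s)) (velocity At (\<lambda>s. H (x, s)) s) = C.F \<mu> (h (x, s)) (hs (x, s))"
      unfolding vel rk_metric_coord[OF cx coord_vec_tangent[OF cx]] coord_vec_self[OF cx] using Hq[of s] s by simp
    then show ?thesis by (simp add: C.Lag_def)
  qed
  have cont: "(\<lambda>s. 2 * C.Lag \<mu> (h (x, s), hs (x, s))) integrable_on {u..v}" if "x \<in> {-\<rho><..<\<rho>}" for x
    by (intro integrable_continuous_real continuous_intros r(4)) (use that in \<open>auto simp: \<rho>_def\<close>)
  have int: "?f x integrable_on {u..v}" if "x \<in> {-\<rho><..<\<rho>}" for x
    by (rule integrable_spike_finite[of "{u, v}", OF _ _ cont[OF that]]) (use eq[OF that] in auto)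
  have inteq: "2 * integral {u..v} (\<lambda>s. C.Lag \<mu> (h (x, s), hs (x, s))) = integral {u..v} (?f x)" if "x \<in> {-\<rho><..<\<rho>}" for x
  proof -
    have "integral {u..v} (?f x) = integral {u..v} (\<lambda>s. 2 * C.Lag \<mu> (h (x, s), hs (x, s)))"
      by (rule integral_spike[of "{u, v}"]) (use eq[OF that] in auto)
    then show ?thesis by simp
  qed
  have nb: "\<forall>\<^sub>F x in nhds 0. x \<in> {-\<rho><..<\<rho>}" using \<rho> by (intro eventually_nhds_in_open) auto
  have "((\<lambda>x. 2 * integral {u..v} (\<lambda>s. C.Lag \<mu> (h (x, s), hs (x, s)))) has_real_derivative
      2 * integral {u..v} (\<lambda>s. C.DLag \<mu> (h (0, s), hs (0, s)) (hw (0, s), hsw (0, s)))) (at 0)"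
    by (rule DERIV_cmult[OF r(5)])
  then have der: "((\<lambda>x. integral {u..v} (?f x)) has_real_derivative
      2 * integral {u..v} (\<lambda>s. C.DLag \<mu> (h (0, s), hs (0, s)) (hw (0, s), hsw (0, s)))) (at 0)"
    by (rule has_field_derivative_transform_within_open[OF _ open_greaterThanLessThan[of "-\<rho>" \<rho>]]) (use \<rho> inteq in auto)
  from nb have "\<forall>\<^sub>F x in nhds 0. ?f x integrable_on {u..v}" by (rule eventually_mono) (rule int)
  from that[OF r(1,2) this der] show ?thesis .
qed

text \<open>The fibre derivative of F^2 / 2 applied to \<xi>, in chart-free form, so that boundary
  terms computed in different charts cancel.\<close>

definition momentum :: "real \<Rightarrow> 'a \<Rightarrow> ('a, 'b) tvec \<Rightarrow> ('a, 'b) tvec \<Rightarrow> real" where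
  "momentum \<mu> x v \<xi> = rk_fun \<mu> x v / sqrt ((\<Lambda> x + \<mu>) * g0 x v v + (\<omega> x v)\<^sup>2) * (rk_fun \<mu> x v * \<omega> x \<xi> + g0 x v \<xi>)"

lemma momentum_coord:
  assumes "c \<in> charts_at At x" "v \<in> tangent_space At x" "\<xi> \<in> tangent_space At x"
  shows "momentum \<mu> x v \<xi> = rk_chart.mom (Gc c) (wc c) (lc c) \<mu> (snd c x) (v c) \<bullet> \<xi> c"
proof -
  have c: "c \<in> At" "x \<in> fst c" using charts_atD[OF assms(1)] by auto
  interpret C: rk_chart "img c" "Gc c" "wc c" "lc c" by (rule chart_rk[OF c(1)])
  have y: "snd c x \<in> img c" using c(2) by auto
  show ?thesis
    unfolding momentum_def C.mom_def rk_metric_coord[OF assms(1,2)] C.Q_def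
    using metric_coord[OF assms(1,2,2)] metric_coord(1)[OF assms(1,2,3)] metric_coord(2)[OF assms(1,3,3)]
    by (simp add: inner_add_left C.inner_wvec[OF y] C.inner_flat[OF y])
qed

text \<open>The Euler-Lagrange equation in first-order form: the momentum \<open>P\<close> along the
  curve has the base derivative of the Lagrangian as its derivative. Second derivatives of the curve
  do not occur; continuity of \<open>P'\<close> is what integration by parts needs.\<close>

definition chart_critical :: "real \<Rightarrow> (real \<Rightarrow> 'a) \<Rightarrow> real \<Rightarrow> bool" where
  "chart_critical \<mu> \<gamma> s0 \<longleftrightarrow> (\<exists>c\<in>charts_at At (\<gamma> s0). \<exists>d>0. \<exists>v P P'.
     \<forall>s\<in>{0..1}. \<bar>s - s0\<bar> < d \<longrightarrow> \<gamma> s \<in> fst c \<and>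
       (snd c \<circ> \<gamma> has_vector_derivative v s) (at s within {0..1}) \<and>
       (snd c (\<gamma> s), v s) \<in> Omc c \<mu> \<and>
       (P has_vector_derivative P' s) (at s within {0..1}) \<and> continuous (at s within {0..1}) P' \<and>
       P s = rk_chart.mom (Gc c) (wc c) (lc c) \<mu> (snd c (\<gamma> s)) (v s) \<and>
       (\<forall>e. P' s \<bullet> e = rk_chart.DLag (Gc c) (wc c) (lc c) \<mu> (snd c (\<gamma> s), v s) (e, 0)))"

text \<open>On a short piece in one chart, integration by parts reduces the derivative of the energy
  to the momentum applied to the variation field at the two ends. These boundary terms do not depend
  on the chart, hence telescope over [0,1], and at 0 and 1 the variation field vanishes.\<close>

lemma critical_curve:
  assumes eps: "\<mu> \<ge> 0" and curve: "\<gamma> \<in> curves_between At (rk_dom \<mu>) x0 x1"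
    and crit: "\<And>s. s \<in> {0..1} \<Longrightarrow> chart_critical \<mu> \<gamma> s"
  shows "geodesic_between At (rk_dom \<mu>) (rk_fun \<mu>) x0 x1 \<gamma>"
  unfolding geodesic_between_def
proof (intro conjI allI impI curve)
  fix \<delta> H assume var: "variation_of At (rk_dom \<mu>) x0 x1 \<gamma> \<delta> H"
  obtain S where S: "finite S" "\<And>u v. 0 \<le> u \<Longrightarrow> u < v \<Longrightarrow> v \<le> 1 \<Longrightarrow> {u<..<v} \<inter> S = {} \<Longrightarrow> smooth_map At ({-\<delta><..<\<delta>} \<times> {u..v}) H"
    using variation_pieces[OF var] by metis
  have \<delta>: "\<delta> > 0" and H0: "\<And>s. s \<in> {0..1} \<Longrightarrow> H (0, s) = \<gamma> s"
    and Hc: "\<And>x. x \<in> {-\<delta><..<\<delta>} \<Longrightarrow> (\<lambda>s. H (x, s)) \<in> curves_between At (rk_dom \<mu>) x0 x1"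
    using var unfolding variation_of_def by auto
  \<comment> \<open>The variation field: the velocity at parameter 0 of the transversal curve
    through \<gamma>(s).\<close>
  define \<xi> where "\<xi> s = velocity_within At (\<lambda>x. H (x, s)) UNIV 0" for s
  define \<Psi> where "\<Psi> s = momentum \<mu> (\<gamma> s) (velocity At \<gamma> s) (\<xi> s)" for s
  let ?f = "\<lambda>x s. (rk_fun \<mu> (H (x, s)) (velocity At (\<lambda>s. H (x, s)) s))\<^sup>2"
  let ?Q = "\<lambda>u v. (\<forall>\<^sub>F x in nhds 0. ?f x integrable_on {u..v}) \<and>
     ((\<lambda>x. integral {u..v} (?f x)) has_real_derivative 2 * (\<Psi> v - \<Psi> u)) (at 0)"
  have loc: "\<exists>d>0. \<forall>p q. 0 \<le> p \<and> p < q \<and> q \<le> 1 \<and> (s0 = p \<or> s0 = q) \<and> q - p < d \<longrightarrow> ?Q p q" if s0: "s0 \<in> {0..1}" for s0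
  proof -
    obtain c d v P P' where c: "c \<in> charts_at At (\<gamma> s0)" and d: "d > 0"
      and *: "\<forall>s\<in>{0..1}. \<bar>s - s0\<bar> < d \<longrightarrow> \<gamma> s \<in> fst c \<and>
       (snd c \<circ> \<gamma> has_vector_derivative v s) (at s within {0..1}) \<and>
       (snd c (\<gamma> s), v s) \<in> Omc c \<mu> \<and>
       (P has_vector_derivative P' s) (at s within {0..1}) \<and> continuous (at s within {0..1}) P' \<and>
       P s = rk_chart.mom (Gc c) (wc c) (lc c) \<mu> (snd c (\<gamma> s)) (v s) \<and>
       (\<forall>e. P' s \<bullet> e = rk_chart.DLag (Gc c) (wc c) (lc c) \<mu> (snd c (\<gamma> s), v s) (e, 0))"
      using crit[OF s0] unfolding chart_critical_def by blast
    have cA: "c \<in> At" using charts_atD[OF c] by simp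
    interpret C: rk_chart "img c" "Gc c" "wc c" "lc c" by (rule chart_rk[OF cA])
    have piece: "\<exists>e>0. \<forall>p q. lo \<le> p \<and> p < q \<and> q \<le> hi \<and> (s0 = p \<or> s0 = q) \<and> q - p < e \<longrightarrow> ?Q p q"
      if lohi: "0 \<le> lo" "lo < hi" "hi \<le> 1" "{lo<..<hi} \<inter> S = {}" "s0 = lo \<or> s0 = hi" for lo hi
    proof -
      have "H (0, s0) = \<gamma> s0" using H0 s0 by simp
      then have c0: "c \<in> charts_at At (H (0, s0))" using c by simp
      have "(0, s0) \<in> {-\<delta><..<\<delta>} \<times> {lo..hi}" using \<delta> lohi by auto
      then obtain W h where W: "open W" "(0, s0) \<in> W" "smooth_on W h"
        and h: "\<And>q. q \<in> {-\<delta><..<\<delta>} \<times> {lo..hi} \<Longrightarrow> q \<in> W \<Longrightarrow> H q \<in> fst c \<and> h q = snd c (H q)"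
        using smooth_mapD[OF S(2)[OF lohi(1-4)] _ c0] by blast
      obtain r where r: "r > 0" "ball (0, s0) r \<subseteq> W" using W(1,2) open_contains_ball by blast
      have "?Q p q" if pq: "p < q" "lo \<le> p" "q \<le> hi" "s0 = p \<or> s0 = q" "q - p < min d r" for p q
      proof -
        have near: "\<bar>s - s0\<bar> < d" "(0, s) \<in> W" "s \<in> {0..1}" if "s \<in> {p..q}" for s
        proof -
          show "\<bar>s - s0\<bar> < d" using pq that by auto
          have "dist (0, s0) (0::real, s) < r" using pq that by (auto simp: dist_Pair_Pair dist_real_def)
          then show "(0, s) \<in> W" using r(2) by auto
          show "s \<in> {0..1}" using pq lohi that by auto
        qed
        have K: "\<gamma> s \<in> fst c" "(snd c \<circ> \<gamma> has_vector_derivative v s) (at s within {0..1})"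
          "(snd c (\<gamma> s), v s) \<in> Omc c \<mu>" "(P has_vector_derivative P' s) (at s within {0..1})" "continuous (at s within {0..1}) P'"
          "P s = C.mom \<mu> (snd c (\<gamma> s)) (v s)" "P' s \<bullet> e = C.DLag \<mu> (snd c (\<gamma> s), v s) (e, 0)" if "s \<in> {p..q}" for s e
          using * near(1,3)[OF that] by blast+
        have h0: "h (0, s) = snd c (\<gamma> s)" if "s \<in> {p..q}" for s
          using h[of "(0, s)"] near(2,3)[OF that] H0 that pq \<delta> by auto
        let ?hs = "\<lambda>z. frechet_derivative h (at z) (0, 1)" and ?hw = "\<lambda>z. frechet_derivative h (at z) (1, 0)"
        let ?hsw = "\<lambda>z. frechet_derivative (\<lambda>z. frechet_derivative h (at z) (0, 1)) (at z) (1, 0)"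
        have sub01: "{p..q} \<subseteq> {0..1}" using pq lohi by auto
        have hsv: "?hs (0, s) = v s" if s: "s \<in> {p..q}" for s
        proof -
          have "((\<lambda>t. h (0, t)) has_vector_derivative ?hs (0, s)) (at s within {p..q})"
            by (rule has_vector_derivative_at_within[OF smooth_on_slice_derivative(1)[OF W(3) near(2)[OF s]]])
          then have 1: "(snd c \<circ> \<gamma> has_vector_derivative ?hs (0, s)) (at s within {p..q})"
            by (rule has_vector_derivative_transform[OF s, rotated]) (simp add: h0)
          have 2: "(snd c \<circ> \<gamma> has_vector_derivative v s) (at s within {p..q})"
            by (rule has_vector_derivative_within_subset[OF K(2)[OF s] sub01])
          show ?thesis
            using vector_derivative_within[OF at_within_nontrivial[OF pq(1) s] 1] vector_derivative_within[OF at_within_nontrivial[OF pq(1) s] 2] by simp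
        qed
        have "(0::real) \<le> p" "q \<le> 1" using pq lohi by auto
        have OmP: "(h (0, s), ?hs (0, s)) \<in> Omc c \<mu>" if "s \<in> {p..q}" for s
          unfolding hsv[OF that] h0[OF that] by (rule K(3)[OF that])
        have W0: "{0} \<times> {p..q} \<subseteq> W" using near(2) by auto
        have Hh: "H (x, s) \<in> fst c \<and> h (x, s) = snd c (H (x, s))" if "x \<in> {-\<delta><..<\<delta>}" "s \<in> {p..q}" "(x, s) \<in> W" for x s
          using h[of "(x, s)"] that pq by auto
        obtain \<rho> where \<rho>: "\<rho> > 0" "{-\<rho>..\<rho>} \<times> {p..q} \<subseteq> W" "\<forall>\<^sub>F x in nhds 0. ?f x integrable_on {p..q}"
          "((\<lambda>x. integral {p..q} (?f x)) has_real_derivative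
            2 * integral {p..q} (\<lambda>s. C.DLag \<mu> (h (0, s), ?hs (0, s)) (?hw (0, s), ?hsw (0, s)))) (at 0)"
          using energy_piece[OF cA eps \<open>0 \<le> p\<close> pq(1) \<open>q \<le> 1\<close> W(1,3) W0 \<delta> Hh OmP] by blast
        \<comment> \<open>The integrand now has the form treated by
          \<open>variation_by_parts\<close>, with the momentum \<open>P\<close> and its derivative
          as coefficients.\<close>
        have split: "C.DLag \<mu> (h (0, s), ?hs (0, s)) (?hw (0, s), ?hsw (0, s)) = P' s \<bullet> ?hw (0, s) + P s \<bullet> ?hsw (0, s)" if s: "s \<in> {p..q}" for s
          unfolding hsv[OF s] h0[OF s] K(7)[OF s] K(6)[OF s] by (simp add: C.DLag_def)
        have cP': "continuous_on {p..q} P'"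
          unfolding continuous_on_eq_continuous_within using K(5) continuous_within_subset[OF _ sub01] by blast
        have "integral {p..q} (\<lambda>s. C.DLag \<mu> (h (0, s), ?hs (0, s)) (?hw (0, s), ?hsw (0, s))) = integral {p..q} (\<lambda>s. P' s \<bullet> ?hw (0, s) + P s \<bullet> ?hsw (0, s))"
          by (rule integral_cong) (rule split)
        also have "\<dots> = P q \<bullet> ?hw (0, q) - P p \<bullet> ?hw (0, p)"
          by (rule variation_by_parts[OF less_imp_le[OF pq(1)] W(1) \<rho>(1,2) W(3) has_vector_derivative_within_subset[OF K(4) sub01] cP'])
        also have "\<dots> = \<Psi> q - \<Psi> p"
        proof -
          have "P s \<bullet> ?hw (0, s) = \<Psi> s" if s: "s \<in> {p..q}" for s
          proof -
            have cs: "c \<in> charts_at At (\<gamma> s)" using K(1)[OF s] cA by (simp add: charts_at_def)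
            have vel: "velocity At \<gamma> s = coord_vec At c (\<gamma> s) (v s)"
            proof -
              define W' where "W' = {s0 - d<..<s0 + d}"
              have "velocity_within At \<gamma> {0..1} s = coord_vec At c (\<gamma> s) (v s)"
                by (rule velocity_within_eq[OF cA open_greaterThanLessThan[of "s0 - d" "s0 + d"] _ _ at_within_nontrivial _ K(2)[OF s]])
                  (use near[OF s] * in \<open>auto simp: abs_less_iff\<close>)
              then show ?thesis by (simp add: velocity_def)
            qed
            define W' where "W' = {-\<delta><..<\<delta>} \<inter> (\<lambda>x. (x, s)) -` W"
            have "open ((\<lambda>x. (x, s)) -` W)" by (rule open_vimage[OF W(1)]) (intro continuous_intros)
            then have oW': "open W'" unfolding W'_def by (intro open_Int) auto
            have W'0: "0 \<in> W'" using near(2)[OF s] \<delta> by (simp add: W'_def)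
            have "velocity_within At (\<lambda>x. H (x, s)) UNIV 0 = coord_vec At c (H (0, s)) (?hw (0, s))"
              by (rule velocity_within_eq[OF cA oW' W'0 UNIV_I _ _ smooth_on_slice_derivative(2)[OF W(3) near(2)[OF s]]])
                (use Hh s in \<open>auto simp: W'_def trivial_limit_at\<close>)
            then have xi: "\<xi> s = coord_vec At c (\<gamma> s) (?hw (0, s))" unfolding \<xi>_def using H0 near(3)[OF s] by simp
            show ?thesis unfolding \<Psi>_def vel xi momentum_coord[OF cs coord_vec_tangent[OF cs] coord_vec_tangent[OF cs]] coord_vec_self[OF cs] K(6)[OF s] ..
          qed
          then show ?thesis using pq(1) by simp
        qed
        finally show ?thesis using \<rho>(3,4) by simp
      qed
      then show ?thesis using d r(1) by (intro exI[of _ "min d r"]) auto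
    qed
    have "\<exists>d>0. \<forall>p q. 0 \<le> p \<and> p < q \<and> q \<le> 1 \<and> (s0 = p \<or> s0 = q) \<and> q - p < d \<longrightarrow> {p<..<q} \<inter> S = {} \<and> ?Q p q"
      by (rule two_sided_intervals[OF S(1) s0]) (rule piece)
    then obtain e where "e > 0" "\<forall>p q. 0 \<le> p \<and> p < q \<and> q \<le> 1 \<and> (s0 = p \<or> s0 = q) \<and> q - p < e \<longrightarrow> {p<..<q} \<inter> S = {} \<and> ?Q p q"
      by (elim exE conjE)
    then show ?thesis by (intro exI[of _ e] conjI[of "e > 0"] allI impI) simp_all
  qed
  have tot: "?Q 0 1"
    by (rule integral_derivative_glue[where J = "\<lambda>u v. 2 * (\<Psi> v - \<Psi> u)"]) (use loc in auto)
  \<comment> \<open>A transversal curve that stands still has zero velocity; together with tangency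
    of the velocity of \<gamma>, this kills the boundary term.\<close>
  have \<Psi>0: "\<Psi> s = 0" if s: "s \<in> {0..1}" and const: "\<And>x. x \<in> {-\<delta><..<\<delta>} \<Longrightarrow> H (x, s) = \<gamma> s" for s
  proof -
    obtain c where c: "c \<in> charts_at At (\<gamma> s)" using chart_exists by blast
    have cA: "c \<in> At" "\<gamma> s \<in> fst c" using charts_atD[OF c] by auto
    have "velocity_within At (\<lambda>x. H (x, s)) UNIV 0 = coord_vec At c (H (0, s)) 0"
      by (rule velocity_within_eq[OF cA(1) open_greaterThanLessThan[of "-\<delta>" \<delta>], where h = "\<lambda>x. snd c (\<gamma> s)"])
        (use const cA \<delta> in \<open>auto simp: trivial_limit_at\<close>)
    then have xi: "\<xi> s = coord_vec At c (\<gamma> s) 0" using H0[OF s] by (simp add: \<xi>_def)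
    have z: "coord_vec At c (\<gamma> s) 0 = (\<lambda>c. 0)" using coord_vec_linear[OF c, of 0 0 0 0] by simp
    have "linear_on_tangent At (\<gamma> s) (\<omega> (\<gamma> s))" using \<omega> by (simp add: smooth_one_form_def)
    then have w0: "\<omega> (\<gamma> s) (\<lambda>c. 0) = 0" by (rule linear_on_tangent_zero)
    obtain c' d v P P' where c': "c' \<in> charts_at At (\<gamma> s)" and d: "d > 0"
      and *: "\<forall>r\<in>{0..1}. \<bar>r - s\<bar> < d \<longrightarrow> \<gamma> r \<in> fst c' \<and>
       (snd c' \<circ> \<gamma> has_vector_derivative v r) (at r within {0..1})"
      using crit[OF s] unfolding chart_critical_def by blast
    have "velocity_within At \<gamma> {0..1} s = coord_vec At c' (\<gamma> s) (v s)"
      by (rule velocity_within_eq[OF _ open_greaterThanLessThan[of "s - d" "s + d"] _ s at_within_nontrivial[OF zero_less_one s], where h = "snd c' \<circ> \<gamma>"])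
        (use * s d c' charts_atD in \<open>auto simp: abs_less_iff\<close>)
    then have vt: "velocity At \<gamma> s \<in> tangent_space At (\<gamma> s)"
      unfolding velocity_def using coord_vec_tangent[OF c'] by simp
    have "g0 (\<gamma> s) (velocity At \<gamma> s) (\<lambda>c. 0) = 0" by (rule linear_on_tangent_zero[OF g0_linear[OF vt]])
    then show ?thesis unfolding \<Psi>_def xi z momentum_def w0 by simp
  qed
  have ends: "H (x, 0) = x0" "H (x, 1) = x1" if "x \<in> {-\<delta><..<\<delta>}" for x
    using Hc[OF that] unfolding curves_between_def by auto
  have "H (x, 0) = \<gamma> 0" "H (x, 1) = \<gamma> 1" if "x \<in> {-\<delta><..<\<delta>}" for x
    using ends[OF that] curve unfolding curves_between_def by auto
  then have "\<Psi> 0 = 0" "\<Psi> 1 = 0" using \<Psi>0 by auto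
  then have der: "((\<lambda>x. integral {0..1} (?f x)) has_real_derivative 0) (at 0)" using tot by simp
  show "\<forall>\<^sub>F x in nhds 0. finite_energy At (rk_fun \<mu>) (\<lambda>s. H (x, s))"
    unfolding finite_energy_def using tot by simp
  show "((\<lambda>x. energy At (rk_fun \<mu>) (\<lambda>s. H (x, s))) has_real_derivative 0) (at 0)"
    unfolding energy_def using DERIV_cmult[OF der, of "1 / 2"] by simp
qed

end

section \<open>Trapezoidal variations\<close>

lemma continuous_on_strip_join:
  fixes f :: "'x::topological_space \<times> real \<Rightarrow> 'y::topological_space"
  assumes "continuous_on (X \<times> {p..q}) f" "continuous_on (X \<times> {q..r}) f" "p \<le> q" "q \<le> r"
  shows "continuous_on (X \<times> {p..r}) f"
proof -
  have e: "X \<times> {p..r} = X \<times> {p..q} \<union> X \<times> {q..r}" using assms(3,4) by auto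
  have "closedin (top_of_set (X \<times> {p..r})) (X \<times> {p..q})" "closedin (top_of_set (X \<times> {p..r})) (X \<times> {q..r})"
    unfolding closedin_closed using assms(3,4)
    by (intro exI[of _ "UNIV \<times> {p..q}"] exI[of _ "UNIV \<times> {q..r}"]; auto intro: closed_Times)+
  then show ?thesis unfolding e by (intro continuous_on_Un_local assms(1,2)) (simp_all add: e)
qed

lemma trap_abs_le: "\<bar>trap s t h r\<bar> \<le> 1"
  by (auto simp: trap_def ramp_def min_def max_def)

text \<open>On a piece where the trapezoid is \<alpha> + \<beta> r, the displaced curve is explicit,
  and so are the derivatives that enter the first variation, the mixed second one included.\<close>

lemma frechet_affine_variation:
  fixes h0 :: "real \<Rightarrow> 'b::euclidean_space" and \<alpha> \<beta> r x :: real and e :: 'b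
  assumes W: "open W" "smooth_on W h0" and r: "r \<in> W"
  defines "h \<equiv> \<lambda>z. h0 (snd z) + (fst z * (\<alpha> + \<beta> * snd z)) *\<^sub>R e"
  shows "smooth_on (UNIV \<times> W) h"
    "frechet_derivative h (at (x, r)) (0, 1) = frechet_derivative h0 (at r) 1 + (x * \<beta>) *\<^sub>R e"
    "frechet_derivative h (at (x, r)) (1, 0) = (\<alpha> + \<beta> * r) *\<^sub>R e"
    "frechet_derivative (\<lambda>z. frechet_derivative h (at z) (0, 1)) (at (x, r)) (1, 0) = \<beta> *\<^sub>R e"
proof -
  have oW: "open ((UNIV :: real set) \<times> W)" by (intro open_Times W(1) open_UNIV)
  have sm0: "smooth_on (UNIV \<times> W) (\<lambda>z :: real \<times> real. h0 (snd z))"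
    by (rule smooth_on_compose[where V = W, OF oW W(1) _ smooth_on_snd[OF oW] W(2)]) auto
  show "smooth_on (UNIV \<times> W) h"
    unfolding h_def by (intro smooth_intros sm0 oW)
  have dsnd: "((\<lambda>z. g (snd z)) has_derivative (\<lambda>d. frechet_derivative g (at r) (snd d))) (at (x, r))"
    if "smooth_on W g" "r \<in> W" for g :: "real \<Rightarrow> 'b" and x r :: real
    by (rule has_derivative_compose[where g = g, OF has_derivative_snd[OF has_derivative_ident]])
      (simp add: smooth_onD(1)[OF that])
  have D: "(h has_derivative (\<lambda>d. frechet_derivative h0 (at r) (snd d) + (x * (\<beta> * snd d) + fst d * (\<alpha> + \<beta> * r)) *\<^sub>R e)) (at (x, r))"
    if "r \<in> W" for x r :: real
    unfolding h_def by (intro has_derivative_add dsnd[OF W(2) that])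
      (auto intro!: derivative_eq_intros simp: algebra_simps)
  have f: "frechet_derivative h (at (x, r)) d = frechet_derivative h0 (at r) (snd d) + (x * (\<beta> * snd d) + fst d * (\<alpha> + \<beta> * r)) *\<^sub>R e"
    if "r \<in> W" for x r d
    using fun_cong[OF frechet_derivative_at[OF D[OF that, of x]], of d] by (rule sym)
  have lin: "frechet_derivative h0 (at r) 0 = 0"
    by (rule linear_0[OF has_derivative_linear[OF smooth_onD(1)[OF W(2) r]]])
  show "frechet_derivative h (at (x, r)) (0, 1) = frechet_derivative h0 (at r) 1 + (x * \<beta>) *\<^sub>R e"
    "frechet_derivative h (at (x, r)) (1, 0) = (\<alpha> + \<beta> * r) *\<^sub>R e"
    unfolding f[OF r] using lin by simp_all
  let ?g = "\<lambda>r. frechet_derivative h0 (at r) 1"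
  have sg: "smooth_on W ?g" by (rule smooth_onD(2)[OF W(2)])
  have "((\<lambda>z. ?g (snd z) + (fst z * \<beta>) *\<^sub>R e) has_derivative (\<lambda>d. frechet_derivative ?g (at r) (snd d) + (fst d * \<beta>) *\<^sub>R e)) (at (x, r))"
    by (intro has_derivative_add dsnd[OF sg r]) (auto intro!: derivative_eq_intros)
  then have "((\<lambda>z. frechet_derivative h (at z) (0, 1)) has_derivative (\<lambda>d. frechet_derivative ?g (at r) (snd d) + (fst d * \<beta>) *\<^sub>R e)) (at (x, r))"
    by (rule has_derivative_transform_within_open[OF _ oW]) (use r f in auto)
  from fun_cong[OF frechet_derivative_at[OF this], of "(1, 0)"]
  show "frechet_derivative (\<lambda>z. frechet_derivative h (at z) (0, 1)) (at (x, r)) (1, 0) = \<beta> *\<^sub>R e"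
    using linear_0[OF has_derivative_linear[OF smooth_onD(1)[OF sg r]]] by simp
qed

context manifold_atlas
begin

lemma smooth_map_snd:
  assumes "smooth_map At J \<gamma>"
  shows "smooth_map At (X \<times> J) (\<lambda>z :: real \<times> real. \<gamma> (snd z))"
proof (rule smooth_mapI)
  have "continuous_on J \<gamma>" using assms by (simp add: smooth_map_def)
  then show "continuous_on (X \<times> J) (\<lambda>z. \<gamma> (snd z))"
    by (rule continuous_on_compose2) (auto intro: continuous_intros)
  fix p :: "real \<times> real" assume p: "p \<in> X \<times> J"
  obtain c where c: "c \<in> charts_at At (\<gamma> (snd p))" using chart_exists by blast
  have sp: "snd p \<in> J" using p by auto
  obtain W h where W: "open W" "snd p \<in> W" "smooth_on W h" "\<And>q. q \<in> J \<Longrightarrow> q \<in> W \<Longrightarrow> \<gamma> q \<in> fst c \<and> h q = snd c (\<gamma> q)"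
    using smooth_mapD[OF assms sp c] by blast
  have oW: "open ((UNIV :: real set) \<times> W)" by (intro open_Times W(1) open_UNIV)
  have "smooth_on (UNIV \<times> W) (\<lambda>z :: real \<times> real. h (snd z))"
    by (rule smooth_on_compose[where V = W, OF oW W(1) _ smooth_on_snd[OF oW] W(3)]) auto
  then show "\<exists>c\<in>charts_at At (\<gamma> (snd p)). \<exists>W h. open W \<and> p \<in> W \<and> smooth_on W h \<and> (\<forall>q\<in>X \<times> J \<inter> W. \<gamma> (snd q) \<in> fst c \<and> h q = snd c (\<gamma> (snd q)))"
  proof (intro bexI[OF _ c] exI conjI)
    show "open ((UNIV :: real set) \<times> W)" by (rule oW)
    show "p \<in> UNIV \<times> W" using W(2) by (cases p) auto
    show "\<forall>q\<in>X \<times> J \<inter> UNIV \<times> W. \<gamma> (snd q) \<in> fst c \<and> h (snd q) = snd c (\<gamma> (snd q))" using W(4) by auto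
  qed
qed

lemma smooth_map_slice:
  fixes H :: "real \<times> real \<Rightarrow> 'a"
  assumes "smooth_map At (X \<times> J) H" "x \<in> X"
  shows "smooth_map At J (\<lambda>r. H (x, r))"
proof (rule smooth_mapI)
  have "continuous_on (X \<times> J) H" using assms by (simp add: smooth_map_def)
  then show "continuous_on J (\<lambda>r. H (x, r))"
    by (rule continuous_on_compose2) (use assms(2) in \<open>auto intro!: continuous_intros\<close>)
  fix r assume r: "r \<in> J"
  obtain c where c: "c \<in> charts_at At (H (x, r))" using chart_exists by blast
  have xr: "(x, r) \<in> X \<times> J" using r assms(2) by auto
  obtain W h where W: "open W" "(x, r) \<in> W" "smooth_on W h" "\<And>q. q \<in> X \<times> J \<Longrightarrow> q \<in> W \<Longrightarrow> H q \<in> fst c \<and> h q = snd c (H q)"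
    using smooth_mapD[OF assms(1) xr c] by blast
  have oW: "open ((\<lambda>r. (x, r)) -` W)" by (rule open_vimage[OF W(1)]) (intro continuous_intros)
  have "smooth_on ((\<lambda>r. (x, r)) -` W) (\<lambda>r. h (x, r))"
    by (rule smooth_on_compose[where V = W, OF oW W(1) _ _ W(3)]) (auto intro!: smooth_intros oW)
  then show "\<exists>c\<in>charts_at At (H (x, r)). \<exists>W h. open W \<and> r \<in> W \<and> smooth_on W h \<and> (\<forall>q\<in>J \<inter> W. H (x, q) \<in> fst c \<and> h q = snd c (H (x, q)))"
  proof (intro bexI[OF _ c] exI conjI)
    show "open ((\<lambda>r. (x, r)) -` W)" by (rule oW)
    show "r \<in> (\<lambda>r. (x, r)) -` W" using W(2) by simp
    show "\<forall>q\<in>J \<inter> (\<lambda>r. (x, r)) -` W. H (x, q) \<in> fst c \<and> h (x, q) = snd c (H (x, q))"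
      using W(4) assms(2) by auto
  qed
qed

text \<open>One smooth function on an open set represents the curve on all of \<open>{p..q}\<close>,
  end points included, so its derivative has limits at \<open>p\<close> and \<open>q\<close> even if
  these are corners of \<gamma>.\<close>

definition coord_extension :: "(real \<Rightarrow> 'a) \<Rightarrow> ('a, 'b) chart \<Rightarrow> real \<Rightarrow> real \<Rightarrow> bool" where
  "coord_extension \<gamma> c p q \<longleftrightarrow> (\<exists>W h. open W \<and> smooth_on W h \<and> {p..q} \<subseteq> W \<and> (\<forall>s\<in>{p..q}. \<gamma> s \<in> fst c \<and> h s = snd c (\<gamma> s)) \<and>
      (\<forall>s\<in>{p<..<q}. ((snd c \<circ> \<gamma>) has_vector_derivative frechet_derivative h (at s) 1) (at s)))"

lemma interior_velocity:
  assumes S: "finite S" "\<And>u v. 0 \<le> u \<Longrightarrow> u < v \<Longrightarrow> v \<le> 1 \<Longrightarrow> {u<..<v} \<inter> S = {} \<Longrightarrow> smooth_map At {u..v} \<gamma>"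
    and s: "s \<in> {0<..<1} - S" and c: "c \<in> charts_at At (\<gamma> s)"
  obtains e where "velocity At \<gamma> s = coord_vec At c (\<gamma> s) e" "(snd c \<circ> \<gamma> has_vector_derivative e) (at s)"
proof -
  obtain d where d: "d > 0" "{s - d<..<s} \<inter> S = {}" "{s<..<s + d} \<inter> S = {}" using finite_gap[OF S(1)] by blast
  define u v where "u = max 0 (s - d)" and "v = min 1 (s + d)"
  have uv: "0 \<le> u" "u < s" "s < v" "v \<le> 1" using d(1) s by (auto simp: u_def v_def)
  have "{u<..<v} \<subseteq> {s - d<..<s} \<union> {s} \<union> {s<..<s + d}" by (auto simp: u_def v_def)
  then have "smooth_map At {u..v} \<gamma>" using d s uv by (intro S(2)) auto
  from smooth_curve_velocity[OF this _ _ c]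
  obtain e where e: "velocity_within At \<gamma> {u..v} s = coord_vec At c (\<gamma> s) e"
    "(snd c \<circ> \<gamma> has_vector_derivative e) (at s within {u..v})" using uv by auto
  have "velocity At \<gamma> s = coord_vec At c (\<gamma> s) e"
    unfolding velocity_def e(1)[symmetric] by (rule velocity_within_local[of _ _ _ "{u<..<v}"]) (use uv in auto)
  then show ?thesis using that e(2) at_within_Icc_at[OF uv(2,3)] by simp
qed

lemma smooth_curve_extension:
  assumes sm: "smooth_map At {lo..hi} \<gamma>" and s0: "s0 \<in> {lo..hi}" and c: "c \<in> charts_at At (\<gamma> s0)"
  shows "\<exists>r>0. \<forall>p q. lo \<le> p \<and> p < q \<and> q \<le> hi \<and> (s0 = p \<or> s0 = q) \<and> q - p < r \<longrightarrow>
    coord_extension \<gamma> c p q"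
proof -
  obtain W h where W: "open W" "s0 \<in> W" "smooth_on W h" and h: "\<And>q. q \<in> {lo..hi} \<Longrightarrow> q \<in> W \<Longrightarrow> \<gamma> q \<in> fst c \<and> h q = snd c (\<gamma> q)"
    using smooth_mapD[OF sm s0 c] by blast
  obtain r where r: "r > 0" "ball s0 r \<subseteq> W" using W(1,2) open_contains_ball by blast
  show ?thesis
  proof (intro exI[of _ r] conjI[OF r(1)] allI impI)
    fix p q assume "lo \<le> p \<and> p < q \<and> q \<le> hi \<and> (s0 = p \<or> s0 = q) \<and> q - p < r"
    then have pq: "lo \<le> p" "p < q" "q \<le> hi" "s0 \<in> {p..q}" "q - p < r" by auto
    have W1: "{p..q} \<subseteq> W" using r(2) pq by (force simp: dist_real_def subset_iff)
    have h1: "\<gamma> s \<in> fst c \<and> h s = snd c (\<gamma> s)" if "s \<in> {p..q}" for s using h[of s] W1 that pq by auto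
    have "((snd c \<circ> \<gamma>) has_vector_derivative frechet_derivative h (at s) 1) (at s)" if s: "s \<in> {p<..<q}" for s
    proof -
      have sW: "s \<in> W" using W1 s by auto
      have "(h has_vector_derivative frechet_derivative h (at s) 1) (at s)" by (rule smooth_on_has_vector_derivative[OF W(3) sW])
      then show ?thesis
        by (rule has_vector_derivative_transform_within_open[OF _ open_greaterThanLessThan s]) (use h1 in auto)
    qed
    then have "\<exists>W h. open W \<and> smooth_on W h \<and> {p..q} \<subseteq> W \<and> (\<forall>s\<in>{p..q}. \<gamma> s \<in> fst c \<and> h s = snd c (\<gamma> s)) \<and>
      (\<forall>s\<in>{p<..<q}. ((snd c \<circ> \<gamma>) has_vector_derivative frechet_derivative h (at s) 1) (at s))"
      using W1 h1 W(1,3) by (intro exI[of _ W] exI[of _ h]) simp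
    then show "coord_extension \<gamma> c p q" unfolding coord_extension_def .
  qed
qed

lemma piecewise_curve_extension:
  assumes S: "finite S" "\<And>u v. 0 \<le> u \<Longrightarrow> u < v \<Longrightarrow> v \<le> 1 \<Longrightarrow> {u<..<v} \<inter> S = {} \<Longrightarrow> smooth_map At {u..v} \<gamma>"
    and s0: "s0 \<in> {0..1}" and c: "c \<in> charts_at At (\<gamma> s0)"
  shows "\<exists>d>0. \<forall>p q. 0 \<le> p \<and> p < q \<and> q \<le> 1 \<and> (s0 = p \<or> s0 = q) \<and> q - p < d \<longrightarrow> {p<..<q} \<inter> S = {} \<and>
     coord_extension \<gamma> c p q"
proof (rule two_sided_intervals[OF S(1) s0])
  fix lo hi assume lohi: "0 \<le> lo" "lo < hi" "hi \<le> 1" "{lo<..<hi} \<inter> S = {}" "s0 = lo \<or> s0 = hi"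
  then have "s0 \<in> {lo..hi}" by auto
  from smooth_curve_extension[OF S(2)[OF lohi(1-4)] this c]
  show "\<exists>e>0. \<forall>p q. lo \<le> p \<and> p < q \<and> q \<le> hi \<and> (s0 = p \<or> s0 = q) \<and> q - p < e \<longrightarrow>
     coord_extension \<gamma> c p q" .
qed

lemma velocity_interior:
  assumes "c \<in> At" "p < q" "{p<..<q} \<subseteq> {0..1}" "\<And>s. s \<in> {p<..<q} \<Longrightarrow> \<gamma> s \<in> fst c" "s \<in> {p<..<q}"
    "((snd c \<circ> \<gamma>) has_vector_derivative e) (at s)"
  shows "velocity At \<gamma> s = coord_vec At c (\<gamma> s) e"
proof -
  have "s \<in> {0..1}" using assms(3,5) by blast
  then show ?thesis unfolding velocity_def
    by (intro velocity_within_eq[OF assms(1) open_greaterThanLessThan[of p q], where h = "snd c \<circ> \<gamma>"]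
        at_within_nontrivial has_vector_derivative_at_within[OF assms(6)])
      (use assms in auto)
qed

lemma velocity_tangent_ae:
  assumes "piecewise_smooth_curve At \<gamma>"
  obtains S where "finite S" "\<And>s. s \<in> {0..1} - S \<Longrightarrow> velocity At \<gamma> s \<in> tangent_space At (\<gamma> s)"
proof -
  obtain S where S: "finite S" "continuous_on {0..1} \<gamma>"
    "\<And>u v. 0 \<le> u \<Longrightarrow> u < v \<Longrightarrow> v \<le> 1 \<Longrightarrow> {u<..<v} \<inter> S = {} \<Longrightarrow> smooth_map At {u..v} \<gamma>"
    using piecewise_smooth_curveE[OF assms] by metis
  have "velocity At \<gamma> s \<in> tangent_space At (\<gamma> s)" if s: "s \<in> {0..1} - (S \<union> {0, 1})" for s
  proof -
    obtain c where c: "c \<in> charts_at At (\<gamma> s)" using chart_exists by blast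
    have s': "s \<in> {0<..<1} - S" using s by auto
    obtain e where "velocity At \<gamma> s = coord_vec At c (\<gamma> s) e" "(snd c \<circ> \<gamma> has_vector_derivative e) (at s)"
      by (rule interior_velocity[OF S(1,3) s' c])
    then show ?thesis using coord_vec_tangent[OF c] by simp
  qed
  then show ?thesis using that[of "S \<union> {0, 1}"] S(1) by simp
qed

end

context rk_manifold
begin

text \<open>The two expressions agree on tangent vectors only. Velocities are tangent off a finite
  set, so the energies of all piecewise smooth curves, hence the critical points, coincide.\<close>

lemma randers_geodesic_rk:
  assumes eps: "\<mu> > 0" and geo: "geodesic_between At (tangent_bundle At) (randers_metric g0 \<omega> \<Lambda> \<mu>) x0 x1 \<sigma>"
  shows "geodesic_between At (tangent_bundle At) (rk_fun \<mu>) x0 x1 \<sigma>"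
proof -
  let ?F = "randers_metric g0 \<omega> \<Lambda> \<mu>"
  have eq: "finite_energy At ?F \<gamma> = finite_energy At (rk_fun \<mu>) \<gamma>" "energy At ?F \<gamma> = energy At (rk_fun \<mu>) \<gamma>"
    if pw: "piecewise_smooth_curve At \<gamma>" for \<gamma>
  proof -
    obtain S where S: "finite S" "\<And>s. s \<in> {0..1} - S \<Longrightarrow> velocity At \<gamma> s \<in> tangent_space At (\<gamma> s)"
      using velocity_tangent_ae[OF pw] by blast
    have e: "(?F (\<gamma> s) (velocity At \<gamma> s))\<^sup>2 = (rk_fun \<mu> (\<gamma> s) (velocity At \<gamma> s))\<^sup>2" if "s \<in> {0..1} - S" for s
      using randers_eq_rk[OF eps S(2)[OF that]] by simp
    have neg: "negligible S" using S(1) by (rule negligible_finite)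
    show "finite_energy At ?F \<gamma> = finite_energy At (rk_fun \<mu>) \<gamma>"
      unfolding finite_energy_def
      by (rule iffI; rule integrable_spike_finite[OF S(1)], use e in auto)
    show "energy At ?F \<gamma> = energy At (rk_fun \<mu>) \<gamma>"
    proof -
      have "integral {0..1} (\<lambda>s. (rk_fun \<mu> (\<gamma> s) (velocity At \<gamma> s))\<^sup>2) = integral {0..1} (\<lambda>s. (?F (\<gamma> s) (velocity At \<gamma> s))\<^sup>2)"
        by (rule integral_spike[OF neg]) (use e in auto)
      then show ?thesis by (simp add: energy_def)
    qed
  qed
  show ?thesis
    unfolding geodesic_between_def
  proof (intro conjI allI impI)
    show "\<sigma> \<in> curves_between At (tangent_bundle At) x0 x1" using geo by (simp add: geodesic_between_def)
    fix \<delta> H assume var: "variation_of At (tangent_bundle At) x0 x1 \<sigma> \<delta> H"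
    have g: "\<forall>\<^sub>F x in nhds 0. finite_energy At ?F (\<lambda>s. H (x, s))"
      "((\<lambda>x. energy At ?F (\<lambda>s. H (x, s))) has_real_derivative 0) (at 0)"
      using geo var unfolding geodesic_between_def by blast+
    have \<delta>: "\<delta> > 0" and pw: "piecewise_smooth_curve At (\<lambda>s. H (x, s))" if "x \<in> {-\<delta><..<\<delta>}" for x
      using var that unfolding variation_of_def curves_between_def by auto
    have \<delta>0: "\<delta> > 0" using var unfolding variation_of_def by simp
    have nb: "\<forall>\<^sub>F x in nhds 0. x \<in> {-\<delta><..<\<delta>}" using \<delta>0 by (intro eventually_nhds_in_open) auto
    show "\<forall>\<^sub>F x in nhds 0. finite_energy At (rk_fun \<mu>) (\<lambda>s. H (x, s))"
      using g(1) nb by eventually_elim (simp add: eq(1)[OF pw])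
    show "((\<lambda>x. energy At (rk_fun \<mu>) (\<lambda>s. H (x, s))) has_real_derivative 0) (at 0)"
      by (rule has_field_derivative_transform_within_open[OF g(2) open_greaterThanLessThan[of "-\<delta>" \<delta>]])
        (use \<delta>0 eq(2)[OF pw] in auto)
  qed
qed

end

context manifold_atlas
begin

text \<open>Displaces the curve inside a chart and leaves it untouched outside
  \<open>{a..b}\<close>; with \<eta> vanishing at \<open>a\<close> and \<open>b\<close> the two
  parts fit together.\<close>

definition bump :: "('a, 'b) chart \<Rightarrow> (real \<Rightarrow> 'a) \<Rightarrow> real \<Rightarrow> real \<Rightarrow> (real \<Rightarrow> real) \<Rightarrow> 'b \<Rightarrow> real \<times> real \<Rightarrow> 'a" where
  "bump c \<sigma> a b \<eta> e z = (if snd z \<in> {a..b} then cinv c (snd c (\<sigma> (snd z)) + (fst z * \<eta> (snd z)) *\<^sub>R e) else \<sigma> (snd z))"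

text \<open>Compactness of the coordinate arc leaves room of radius \<rho> inside the chart, and the
  trapezoid is bounded by 1. Away from the corners of the curve and of the trapezoid the
  displacement is affine in time, hence smooth.\<close>

lemma bump_variation:
  assumes curve: "\<sigma> \<in> curves_between At (tangent_bundle At) x0 x1"
    and S: "finite S" "\<And>u v. 0 \<le> u \<Longrightarrow> u < v \<Longrightarrow> v \<le> 1 \<Longrightarrow> {u<..<v} \<inter> S = {} \<Longrightarrow> smooth_map At {u..v} \<sigma>"
    and c: "c \<in> At" and ab: "0 \<le> a" "a < b" "b \<le> 1" and U: "\<sigma> ` {a..b} \<subseteq> fst c"
    and st: "a \<le> s" "h > 0" "s + h < t - h" "t \<le> b"
  obtains \<delta> where "\<delta> > 0"
    "\<And>x r. x \<in> {-\<delta><..<\<delta>} \<Longrightarrow> r \<in> {a..b} \<Longrightarrow> snd c (\<sigma> r) + (x * trap s t h r) *\<^sub>R e \<in> img c"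
    "variation_of At (tangent_bundle At) x0 x1 \<sigma> \<delta> (bump c \<sigma> a b (trap s t h) e)"
proof -
  let ?\<eta> = "trap s t h" and ?T = "{s, s + h, t - h, t}"
  let ?H = "bump c \<sigma> a b ?\<eta> e"
  have \<sigma>: "piecewise_smooth_curve At \<sigma>" "\<sigma> 0 = x0" "\<sigma> 1 = x1" using curve by (auto simp: curves_between_tangent)
  have c\<sigma>: "continuous_on {0..1} \<sigma>" using \<sigma>(1) by (simp add: piecewise_smooth_curve_def)
  have cy: "continuous_on {a..b} (\<lambda>r. snd c (\<sigma> r))"
    by (rule continuous_on_compose2[OF chart_continuous[OF c] continuous_on_subset[OF c\<sigma>]]) (use U ab in auto)
  have "compact ((\<lambda>r. snd c (\<sigma> r)) ` {a..b})" by (rule compact_continuous_image[OF cy]) simp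
  moreover have "(\<lambda>r. snd c (\<sigma> r)) ` {a..b} \<subseteq> img c" using U by auto
  ultimately obtain \<rho> where \<rho>: "\<rho> > 0" "(\<Union>y\<in>(\<lambda>r. snd c (\<sigma> r)) ` {a..b}. cball y \<rho>) \<subseteq> img c"
    using compact_subset_open_imp_cball_epsilon_subset[OF _ chart_props(2)[OF c]] by metis
  \<comment> \<open>The displacement is at most \<delta> times the norm of \<open>e\<close>, hence
    at most \<rho>; the added 1 avoids division by 0.\<close>
  define \<delta> where "\<delta> = \<rho> / (norm e + 1)"
  have ne: "norm e + 1 > 0" by (smt (verit) norm_ge_zero)
  have \<delta>: "\<delta> > 0" using \<rho>(1) ne by (simp add: \<delta>_def)
  let ?X = "{-\<delta><..<\<delta>}"
  have inimg: "snd c (\<sigma> r) + (x * ?\<eta> r) *\<^sub>R e \<in> img c" if x: "x \<in> ?X" and r: "r \<in> {a..b}" for x r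
  proof -
    have "\<bar>x\<bar> * \<bar>?\<eta> r\<bar> \<le> \<delta> * 1" using x trap_abs_le[of s t h r] by (intro mult_mono) auto
    then have "\<bar>x * ?\<eta> r\<bar> * norm e \<le> \<delta> * norm e" by (intro mult_right_mono) (auto simp: abs_mult)
    also have "\<dots> \<le> \<delta> * (norm e + 1)" using \<delta> by simp
    also have "\<dots> = \<rho>" using ne by (simp add: \<delta>_def)
    finally have "snd c (\<sigma> r) + (x * ?\<eta> r) *\<^sub>R e \<in> cball (snd c (\<sigma> r)) \<rho>" by (simp add: dist_norm)
    then show ?thesis using \<rho>(2) r by blast
  qed
  have \<eta>0: "?\<eta> r = 0" if "r \<le> a \<or> b \<le> r" for r using trap_zero[OF st(2), of r s t] that st by auto
  have Hout: "?H z = \<sigma> (snd z)" if "snd z \<le> a \<or> b \<le> snd z" for z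
  proof (cases "snd z \<in> {a..b}")
    case True
    then have "\<sigma> (snd z) \<in> fst c" using U by blast
    then show ?thesis using True \<eta>0[OF that] cinv_chart[OF c] by (simp add: bump_def)
  next
    case False then show ?thesis unfolding bump_def by (simp only: if_False)
  qed
  have Hin: "?H z = cinv c (snd c (\<sigma> (snd z)) + (fst z * ?\<eta> (snd z)) *\<^sub>R e)" if "snd z \<in> {a..b}" for z
    using that by (simp add: bump_def)
  have cin: "continuous_on (?X \<times> {a..b}) ?H"
  proof -
    have 1: "continuous_on (?X \<times> {a..b}) (\<lambda>z. snd c (\<sigma> (snd z)))"
      by (rule continuous_on_compose2[OF cy]) (auto intro: continuous_intros)
    have 2: "continuous_on (?X \<times> {a..b}) (\<lambda>z. ?\<eta> (snd z))"
      by (rule continuous_on_compose2[OF trap_continuous[OF st(2)]]) (auto intro: continuous_intros)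
    have "continuous_on (?X \<times> {a..b}) (\<lambda>z. snd c (\<sigma> (snd z)) + (fst z * ?\<eta> (snd z)) *\<^sub>R e)"
      by (intro continuous_intros 1 2)
    then have "continuous_on (?X \<times> {a..b}) (\<lambda>z. cinv c (snd c (\<sigma> (snd z)) + (fst z * ?\<eta> (snd z)) *\<^sub>R e))"
      by (rule continuous_on_compose2[OF cinv_continuous[OF c]]) (use inimg in auto)
    then show ?thesis by (rule continuous_on_eq) (use Hin in auto)
  qed
  have cout: "continuous_on (?X \<times> {u..v}) ?H" if "0 \<le> u" "v \<le> 1" "v \<le> a \<or> b \<le> u" for u v
  proof -
    have "continuous_on (?X \<times> {u..v}) (\<lambda>z. \<sigma> (snd z))"
      by (rule continuous_on_compose2[OF c\<sigma>]) (use that in \<open>auto intro: continuous_intros\<close>)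
    then show ?thesis by (rule continuous_on_eq) (use Hout that in force)
  qed
  have cH: "continuous_on (?X \<times> {0..1}) ?H"
    by (rule continuous_on_strip_join[OF continuous_on_strip_join[OF cout cin] cout]) (use ab in auto)
  let ?S = "S \<union> ?T \<union> {a, b}"
  have finS: "finite ?S" using S(1) by simp
  have sm: "smooth_map At (?X \<times> {u..v}) ?H" if uv: "0 \<le> u" "u < v" "v \<le> 1" "{u<..<v} \<inter> ?S = {}" for u v
  proof -
    have s\<sigma>: "smooth_map At {u..v} \<sigma>" using S(2)[OF uv(1-3)] uv(4) by blast
    have "a \<notin> {u<..<v}" "b \<notin> {u<..<v}" using uv(4) by auto
    then consider "v \<le> a \<or> b \<le> u" | "a \<le> u" "v \<le> b" using uv(2) ab(2) by fastforce
    then show ?thesis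
    proof cases
      case 1
      have "smooth_map At (?X \<times> {u..v}) (\<lambda>z. \<sigma> (snd z))" by (rule smooth_map_snd[OF s\<sigma>])
      moreover have "?H z = \<sigma> (snd z)" if "z \<in> ?X \<times> {u..v}" for z using Hout[of z] that 1 by auto
      ultimately show ?thesis
        unfolding smooth_map_def using continuous_on_cong[of "?X \<times> {u..v}" _ ?H "\<lambda>z. \<sigma> (snd z)"] by simp
    next
      case 2
      show ?thesis
      proof (rule smooth_mapI)
        show "continuous_on (?X \<times> {u..v}) ?H" by (rule continuous_on_subset[OF cin]) (use 2 in auto)
        fix p :: "real \<times> real" assume p: "p \<in> ?X \<times> {u..v}"
        obtain x r where pr: "p = (x, r)" "x \<in> ?X" "r \<in> {u..v}" using p by auto
        have rab: "q \<in> {a..b}" if "q \<in> {u..v}" for q using that 2 by auto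
        have cr: "c \<in> charts_at At (\<sigma> r)" using c U rab[OF pr(3)] by (auto simp: charts_at_def)
        obtain W h0 where W: "open W" "r \<in> W" "smooth_on W h0" and h0: "\<And>q. q \<in> {u..v} \<Longrightarrow> q \<in> W \<Longrightarrow> \<sigma> q \<in> fst c \<and> h0 q = snd c (\<sigma> q)"
          using smooth_mapD[OF s\<sigma> pr(3) cr] by blast
        define \<beta> where "\<beta> = trap' s t h ((u + v) / 2)"
        define \<alpha> where "\<alpha> = ?\<eta> u - u * \<beta>"
        have T: "?T \<inter> {u<..<v} = {}" using uv(4) by blast
        have aff: "?\<eta> q = \<alpha> + \<beta> * q" if "q \<in> {u..v}" for q
          using trap_affine[OF st(2) uv(2) T that] by (simp add: \<alpha>_def \<beta>_def algebra_simps)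
        let ?h = "\<lambda>z. h0 (snd z) + (fst z * (\<alpha> + \<beta> * snd z)) *\<^sub>R e"
        have smh: "smooth_on (UNIV \<times> W) ?h" by (rule frechet_affine_variation(1)[OF W(1,3,2)])
        have eq: "?H q \<in> fst c \<and> ?h q = snd c (?H q)" if q: "q \<in> ?X \<times> {u..v} \<inter> UNIV \<times> W" for q
        proof -
          obtain x' r' where qr: "q = (x', r')" "x' \<in> ?X" "r' \<in> {u..v}" "r' \<in> W" using q by auto
          have "?h q = snd c (\<sigma> r') + (x' * ?\<eta> r') *\<^sub>R e" using h0[OF qr(3,4)] aff[OF qr(3)] by (simp add: qr(1))
          moreover have "?H q = cinv c (snd c (\<sigma> r') + (x' * ?\<eta> r') *\<^sub>R e)" using Hin[of q] rab[OF qr(3)] by (simp add: qr(1))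
          ultimately show ?thesis using inimg[OF qr(2) rab[OF qr(3)]] cinv_in[OF c] chart_cinv[OF c] by auto
        qed
        have pW: "p \<in> UNIV \<times> W" using W(2) pr(1) by simp
        have cp: "c \<in> charts_at At (?H p)" using eq[of p] p pW c by (simp add: charts_at_def)
        show "\<exists>c\<in>charts_at At (?H p). \<exists>W h. open W \<and> p \<in> W \<and> smooth_on W h \<and> (\<forall>q\<in>?X \<times> {u..v} \<inter> W. ?H q \<in> fst c \<and> h q = snd c (?H q))"
        proof (intro bexI[OF _ cp] exI conjI)
          show "open ((UNIV :: real set) \<times> W)" by (intro open_Times open_UNIV W(1))
          show "p \<in> UNIV \<times> W" by (rule pW)
          show "smooth_on (UNIV \<times> W) ?h" by (rule smh)
          show "\<forall>q\<in>?X \<times> {u..v} \<inter> UNIV \<times> W. ?H q \<in> fst c \<and> ?h q = snd c (?H q)" using eq by blast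
        qed
      qed
    qed
  qed
  have H0: "?H (0, r) = \<sigma> r" for r
  proof (cases "r \<in> {a..b}")
    case True
    then have "\<sigma> r \<in> fst c" using U by blast
    then show ?thesis using cinv_chart[OF c] by (simp add: bump_def)
  next
    case False then show ?thesis unfolding bump_def by (simp only: snd_conv if_False)
  qed
  have crv: "(\<lambda>r. ?H (x, r)) \<in> curves_between At (tangent_bundle At) x0 x1" if x: "x \<in> ?X" for x
    unfolding curves_between_tangent
  proof (intro conjI piecewise_smooth_curveI[OF finS])
    show "continuous_on {0..1} (\<lambda>r. ?H (x, r))"
      by (rule continuous_on_compose2[OF cH]) (use x in \<open>auto intro!: continuous_intros\<close>)
    show "?H (x, 0) = x0" "?H (x, 1) = x1" using Hout[of "(x, 0)"] Hout[of "(x, 1)"] ab \<sigma> by auto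
    fix u v :: real assume "0 \<le> u" "u < v" "v \<le> 1" "{u<..<v} \<inter> ?S = {}"
    then show "smooth_map At {u..v} (\<lambda>r. ?H (x, r))" by (rule smooth_map_slice[OF sm x])
  qed
  have "variation_of At (tangent_bundle At) x0 x1 \<sigma> \<delta> ?H"
    unfolding variation_of_def
  proof (intro conjI ballI \<delta> cH H0 crv)
    obtain n p where p: "partition01 n p" "\<And>i. i < n \<Longrightarrow> {p i<..<p (Suc i)} \<inter> ?S = {}" "\<And>i. i \<le> n \<Longrightarrow> p i \<in> {0..1}"
      using partition01_exists[OF finS] by blast
    have "smooth_map At (?X \<times> {p i..p (Suc i)}) ?H" if "i < n" for i
      using sm[OF _ _ _ p(2)[OF that]] p(1) p(3)[of i] p(3)[of "Suc i"] that by (auto simp: partition01_def)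
    then show "\<exists>n t. partition01 n t \<and> (\<forall>i<n. smooth_map At (?X \<times> {t i..t (Suc i)}) ?H)" using p(1) by blast
  qed
  then show ?thesis using that \<delta> inimg by blast
qed

end

section \<open>Weak Euler-Lagrange equation and momentum of a Randers geodesic\<close>

context rk_manifold
begin

text \<open>The energy of the trapezoidal variation has derivative 0 by criticality. It varies only
  through the integral over \<open>{a..b}\<close>, which is differentiated piecewise; the resulting
  integral of \<open>DLag\<close> must therefore vanish.\<close>

lemma test_identity:
  assumes eps: "\<mu> > 0" and geo: "geodesic_between At (tangent_bundle At) (rk_fun \<mu>) x0 x1 \<sigma>"
    and S: "finite S" "\<And>u v. 0 \<le> u \<Longrightarrow> u < v \<Longrightarrow> v \<le> 1 \<Longrightarrow> {u<..<v} \<inter> S = {} \<Longrightarrow> smooth_map At {u..v} \<sigma>"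
    and c: "c \<in> At" and ab: "0 \<le> a" "a < b" "b \<le> 1" and U: "\<sigma> ` {a..b} \<subseteq> fst c"
    and st: "a \<le> s" "h > 0" "s + h < t - h" "t \<le> b"
  defines "v \<equiv> \<lambda>r. vector_derivative (snd c \<circ> \<sigma>) (at r)"
  shows "((\<lambda>r. rk_chart.DLag (Gc c) (wc c) (lc c) \<mu> (snd c (\<sigma> r), v r) (trap s t h r *\<^sub>R e, trap' s t h r *\<^sub>R e)) has_integral 0) {a..b}"
proof -
  interpret C: rk_chart "img c" "Gc c" "wc c" "lc c" by (rule chart_rk[OF c])
  have eps0: "\<mu> \<ge> 0" using eps by simp
  have curve: "\<sigma> \<in> curves_between At (tangent_bundle At) x0 x1" using geo by (simp add: geodesic_between_def)
  let ?\<eta> = "trap s t h" and ?T = "{s, s + h, t - h, t}"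
  let ?H = "bump c \<sigma> a b ?\<eta> e"
  obtain \<delta> where \<delta>: "\<delta> > 0"
    and inimg: "\<And>x r. x \<in> {-\<delta><..<\<delta>} \<Longrightarrow> r \<in> {a..b} \<Longrightarrow> snd c (\<sigma> r) + (x * trap s t h r) *\<^sub>R e \<in> img c"
    and var: "variation_of At (tangent_bundle At) x0 x1 \<sigma> \<delta> ?H"
    using bump_variation[OF curve S c ab U st, of e] by blast
  define D where "D r = C.DLag \<mu> (snd c (\<sigma> r), v r) (?\<eta> r *\<^sub>R e, trap' s t h r *\<^sub>R e)" for r
  let ?f = "\<lambda>x r. (rk_fun \<mu> (?H (x, r)) (velocity At (\<lambda>r. ?H (x, r)) r))\<^sup>2"
  let ?S = "S \<union> ?T"
  have S': "finite ?S" "\<And>u v. 0 \<le> u \<Longrightarrow> u < v \<Longrightarrow> v \<le> 1 \<Longrightarrow> {u<..<v} \<inter> ?S = {} \<Longrightarrow> smooth_map At {u..v} \<sigma>"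
    using S by (auto simp: Int_Un_distrib)
  \<comment> \<open>For \<mu> > 0 every vector is admissible, so the variation needs no further
    restriction.\<close>
  have Oall: "(y, e') \<in> C.Omega \<mu>" if "y \<in> img c" for y e'
    using that C.l_nonneg[OF that] eps by (simp add: C.Omega_def)
  have piece: "\<exists>d>0. \<forall>p q. a \<le> p \<and> p < q \<and> q \<le> b \<and> (s0 = p \<or> s0 = q) \<and> q - p < d \<longrightarrow>
      (\<exists>g. continuous_on {p..q} g \<and> (\<forall>r\<in>{p<..<q}. D r = g r)) \<and>
      (\<forall>\<^sub>F x in nhds 0. ?f x integrable_on {p..q}) \<and> ((\<lambda>x. integral {p..q} (?f x)) has_real_derivative 2 * integral {p..q} D) (at 0)"
    if s0: "s0 \<in> {a..b}" for s0
  proof -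
    have s01: "s0 \<in> {0..1}" using s0 ab by auto
    have cs: "c \<in> charts_at At (\<sigma> s0)" using c U s0 by (auto simp: charts_at_def)
    obtain d where d: "d > 0" and ext: "\<forall>p q. 0 \<le> p \<and> p < q \<and> q \<le> 1 \<and> (s0 = p \<or> s0 = q) \<and> q - p < d \<longrightarrow> {p<..<q} \<inter> ?S = {} \<and>
     coord_extension \<sigma> c p q"
      using piecewise_curve_extension[OF S' s01 cs] by blast
    show ?thesis
    proof (intro exI[of _ d] conjI[OF d] allI impI)
      fix p q assume pq': "a \<le> p \<and> p < q \<and> q \<le> b \<and> (s0 = p \<or> s0 = q) \<and> q - p < d"
      then have pq: "a \<le> p" "p < q" "q \<le> b" "0 \<le> p" "q \<le> 1" using ab by auto
      obtain W h0 where gap: "{p<..<q} \<inter> ?S = {}" and W: "open W" "smooth_on W h0" "{p..q} \<subseteq> W"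
        and h0: "\<And>r. r \<in> {p..q} \<Longrightarrow> \<sigma> r \<in> fst c \<and> h0 r = snd c (\<sigma> r)"
        and d0: "\<And>r. r \<in> {p<..<q} \<Longrightarrow> ((snd c \<circ> \<sigma>) has_vector_derivative frechet_derivative h0 (at r) 1) (at r)"
        using ext[rule_format, of p q, unfolded coord_extension_def] pq' pq by blast
      define \<beta> where "\<beta> = trap' s t h ((p + q) / 2)"
      define \<alpha> where "\<alpha> = ?\<eta> p - p * \<beta>"
      have T: "?T \<inter> {p<..<q} = {}" using gap by blast
      have aff: "?\<eta> r = \<alpha> + \<beta> * r" if "r \<in> {p..q}" for r
        using trap_affine[OF st(2) pq(2) T that] by (simp add: \<alpha>_def \<beta>_def algebra_simps)
      have aff': "trap' s t h r = \<beta>" if "r \<in> {p<..<q}" for r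
        unfolding \<beta>_def by (rule trap'_const[OF st(2) T that])
      let ?h = "\<lambda>z. h0 (snd z) + (fst z * (\<alpha> + \<beta> * snd z)) *\<^sub>R e"
      let ?E = "\<lambda>s. C.DLag \<mu> (?h (0, s), frechet_derivative ?h (at (0, s)) (0, 1))
            (frechet_derivative ?h (at (0, s)) (1, 0), frechet_derivative (\<lambda>z. frechet_derivative ?h (at z) (0, 1)) (at (0, s)) (1, 0))"
      have rW: "r \<in> W" if "r \<in> {p..q}" for r using that W(3) by auto
      note fr = frechet_affine_variation[OF W(1,2)]
      have oW: "open ((UNIV :: real set) \<times> W)" by (intro open_Times open_UNIV W(1))
      have smh: "smooth_on (UNIV \<times> W) ?h"
        by (rule fr(1)[of p]) (use rW pq in auto)
      have sub: "{0} \<times> {p..q} \<subseteq> (UNIV :: real set) \<times> W" using W(3) by auto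
      have Hh: "?H (x, r) \<in> fst c \<and> ?h (x, r) = snd c (?H (x, r))" if "x \<in> {-\<delta><..<\<delta>}" "r \<in> {p..q}" "(x, r) \<in> UNIV \<times> W" for x r
      proof -
        have rab: "r \<in> {a..b}" using that pq by auto
        have "?h (x, r) = snd c (\<sigma> r) + (x * ?\<eta> r) *\<^sub>R e" using h0[OF that(2)] aff[OF that(2)] by simp
        moreover have "?H (x, r) = cinv c (snd c (\<sigma> r) + (x * ?\<eta> r) *\<^sub>R e)" using rab by (simp add: bump_def)
        ultimately show ?thesis using inimg[OF that(1) rab] cinv_in[OF c] chart_cinv[OF c] by auto
      qed
      have Om: "(?h (0, r), frechet_derivative ?h (at (0, r)) (0, 1)) \<in> C.Omega \<mu>" if "r \<in> {p..q}" for r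
        by (rule Oall) (use h0[OF that] in auto)
      obtain \<rho> where \<rho>: "\<rho> > 0" "{-\<rho>..\<rho>} \<times> {p..q} \<subseteq> (UNIV :: real set) \<times> W" "\<forall>\<^sub>F x in nhds 0. ?f x integrable_on {p..q}"
        "((\<lambda>x. integral {p..q} (?f x)) has_real_derivative
          2 * integral {p..q} ?E) (at 0)"
        by (rule energy_piece[where H = ?H and h = ?h, OF c eps0 pq(4,2,5) oW smh sub \<delta> Hh Om])
      define g where "g r = C.DLag \<mu> (h0 r, frechet_derivative h0 (at r) 1) ((\<alpha> + \<beta> * r) *\<^sub>R e, \<beta> *\<^sub>R e)" for r
      have geq: "?E r = g r"
        if "r \<in> {p..q}" for r
        unfolding fr(2,3,4)[OF rW[OF that]] g_def by simp
      have gD: "D r = g r" if r: "r \<in> {p<..<q}" for r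
      proof -
        have "v r = frechet_derivative h0 (at r) 1" unfolding v_def using d0[OF r] by (rule vector_derivative_at)
        then show ?thesis unfolding D_def g_def using h0[of r] aff[of r] aff'[OF r] r by auto
      qed
      have cg: "continuous_on {p..q} g"
        unfolding g_def
      proof (rule C.DLag_continuous[OF eps0])
        show "continuous_on {p..q} (\<lambda>r. (h0 r, frechet_derivative h0 (at r) 1))"
          by (intro continuous_intros continuous_on_subset[OF smooth_on_continuous[OF W(2)] W(3)]
            continuous_on_subset[OF smooth_on_continuous[OF smooth_onD(2)[OF W(2)]] W(3)])
        show "continuous_on {p..q} (\<lambda>r. ((\<alpha> + \<beta> * r) *\<^sub>R e, \<beta> *\<^sub>R e))" by (intro continuous_intros)
        show "(\<lambda>r. (h0 r, frechet_derivative h0 (at r) 1)) ` {p..q} \<subseteq> C.Omega \<mu>"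
          using Oall h0 by auto
      qed
      have "integral {p..q} ?E = integral {p..q} g"
        by (rule integral_cong) (rule geq)
      also have "integral {p..q} g = integral {p..q} D"
        by (rule integral_spike[of "{p, q}"]) (use gD in auto)
      finally have Ieq: "integral {p..q} ?E = integral {p..q} D" .
      have 1: "\<exists>g. continuous_on {p..q} g \<and> (\<forall>r\<in>{p<..<q}. D r = g r)" using cg gD by blast
      have 2: "((\<lambda>x. integral {p..q} (?f x)) has_real_derivative 2 * integral {p..q} D) (at 0)"
        using \<rho>(4) unfolding Ieq .
      show "(\<exists>g. continuous_on {p..q} g \<and> (\<forall>r\<in>{p<..<q}. D r = g r)) \<and>
        (\<forall>\<^sub>F x in nhds 0. ?f x integrable_on {p..q}) \<and> ((\<lambda>x. integral {p..q} (?f x)) has_real_derivative 2 * integral {p..q} D) (at 0)"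
        using 1 2 \<rho>(3) by blast
    qed
  qed
  have Dint: "D integrable_on {a..b}"
  proof (rule piecewise_continuous_integrable[OF less_imp_le[OF ab(2)]])
    fix s0 assume "s0 \<in> {a..b}"
    from piece[OF this] show "\<exists>d>0. \<forall>p q. a \<le> p \<and> p < q \<and> q \<le> b \<and> (s0 = p \<or> s0 = q) \<and> q - p < d \<longrightarrow> (\<exists>g. continuous_on {p..q} g \<and> (\<forall>r\<in>{p<..<q}. D r = g r))"
      by (elim exE conjE) (intro exI conjI, assumption, blast)
  qed
  have tot: "(\<forall>\<^sub>F x in nhds 0. ?f x integrable_on {a..b}) \<and> ((\<lambda>x. integral {a..b} (?f x)) has_real_derivative 2 * integral {a..b} D) (at 0)"
  proof (rule integral_derivative_glue[where J = "\<lambda>u v. 2 * integral {u..v} D", OF less_imp_le[OF ab(2)]])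
    fix u v w assume "a \<le> u" "u \<le> v" "v \<le> w" "w \<le> b"
    then show "2 * integral {u..w} D = 2 * integral {u..v} D + 2 * integral {v..w} D"
      using Henstock_Kurzweil_Integration.integral_combine[of u v w D] integrable_on_subinterval[OF Dint, of u w] by simp
  next
    fix s0 assume "s0 \<in> {a..b}"
    from piece[OF this] show "\<exists>d>0. \<forall>p q. a \<le> p \<and> p < q \<and> q \<le> b \<and> (s0 = p \<or> s0 = q) \<and> q - p < d \<longrightarrow>
      (\<forall>\<^sub>F x in nhds 0. ?f x integrable_on {p..q}) \<and> ((\<lambda>x. integral {p..q} (?f x)) has_real_derivative 2 * integral {p..q} D) (at 0)"
      by (elim exE conjE) (intro exI conjI, assumption, blast)
  qed
  have gE: "\<forall>\<^sub>F x in nhds 0. finite_energy At (rk_fun \<mu>) (\<lambda>r. ?H (x, r))"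
    "((\<lambda>x. energy At (rk_fun \<mu>) (\<lambda>r. ?H (x, r))) has_real_derivative 0) (at 0)"
    using geo var unfolding geodesic_between_def by blast+
  have H0: "?H (0, r) = \<sigma> r" for r
  proof (cases "r \<in> {a..b}")
    case True
    then have "\<sigma> r \<in> fst c" using U by blast
    then show ?thesis using cinv_chart[OF c] by (simp add: bump_def)
  next
    case False then show ?thesis unfolding bump_def by (simp only: snd_conv if_False)
  qed
  \<comment> \<open>Only open intervals: at \<open>a\<close> and \<open>b\<close> the velocity may
    change with \<open>x\<close>, but single points are negligible.\<close>
  have outer: "?f x r = ?f 0 r" if "r \<in> {0<..<a} \<union> {b<..<1}" for x r
  proof -
    have eqn: "?H (x, q) = \<sigma> q" if "q \<in> - {a..b}" for q
      using that unfolding bump_def by (simp only: snd_conv Compl_iff if_False)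
    have "velocity At (\<lambda>r. ?H (x, r)) r = velocity At \<sigma> r"
    proof -
      have vd: "vector_derivative (snd c' \<circ> (\<lambda>r. ?H (x, r))) (at r within {0..1}) = vector_derivative (snd c' \<circ> \<sigma>) (at r within {0..1})" for c' :: "('a, 'b) chart"
      proof (rule vector_derivative_cong_eq[OF _ refl refl])
        have "\<forall>\<^sub>F q in nhds r. q \<in> - {a..b}" using that by (intro eventually_nhds_in_open) auto
        then show "\<forall>\<^sub>F q in nhds r. q \<in> {0..1} \<longrightarrow> (snd c' \<circ> (\<lambda>r. ?H (x, r))) q = (snd c' \<circ> \<sigma>) q"
          by eventually_elim (simp add: eqn)
      qed (use that ab in auto)
      have Hr: "?H (x, r) = \<sigma> r" using eqn[of r] that by auto
      show ?thesis unfolding velocity_def velocity_within_def Hr by (rule ext) (simp only: vd)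
    qed
    moreover have "?H (x, r) = \<sigma> r" using eqn[of r] that by auto
    moreover have "(\<lambda>r. ?H (0, r)) = \<sigma>" using H0 by (rule ext)
    ultimately show ?thesis using H0[of r] by simp
  qed
  have sumeq: "\<forall>\<^sub>F x in nhds 0. energy At (rk_fun \<mu>) (\<lambda>r. ?H (x, r)) = 1 / 2 * (integral {0..a} (?f 0) + integral {a..b} (?f x) + integral {b..1} (?f 0))"
    using gE(1)
  proof eventually_elim
    case (elim x)
    then have i: "?f x integrable_on {0..1}" by (simp add: finite_energy_def)
    have "integral {0..1} (?f x) = integral {0..a} (?f x) + integral {a..b} (?f x) + integral {b..1} (?f x)"
      using Henstock_Kurzweil_Integration.integral_combine[of 0 a 1 "?f x"]
        Henstock_Kurzweil_Integration.integral_combine[of a b 1 "?f x"] ab i integrable_on_subinterval[OF i, of a 1] by simp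
    moreover have "integral {0..a} (?f x) = integral {0..a} (?f 0)"
      by (rule integral_spike[of "{0, a}"]) (use outer[of _ x] in auto)
    moreover have "integral {b..1} (?f x) = integral {b..1} (?f 0)"
      by (rule integral_spike[of "{b, 1}"]) (use outer[of _ x] in auto)
    ultimately show ?case by (simp add: energy_def)
  qed
  have "((\<lambda>x. 1 / 2 * (integral {0..a} (?f 0) + integral {a..b} (?f x) + integral {b..1} (?f 0))) has_real_derivative 1 / 2 * (0 + 2 * integral {a..b} D + 0)) (at 0)"
    by (intro DERIV_cmult DERIV_add DERIV_const) (use tot in blast)
  then have "((\<lambda>x. energy At (rk_fun \<mu>) (\<lambda>r. ?H (x, r))) has_real_derivative 1 / 2 * (0 + 2 * integral {a..b} D + 0)) (at 0)"
    using DERIV_cong_ev[OF refl sumeq refl] by blast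
  from DERIV_unique[OF gE(2) this] have "integral {a..b} D = 0" by simp
  then show ?thesis using integrable_integral[OF Dint] unfolding D_def by simp
qed

end

lemma infinite_interval_minus_finite:
  fixes a b :: real assumes "a < b" "finite S" obtains s where "s \<in> {a<..<b} - S"
proof -
  have "infinite ({a<..<b} - S)" using infinite_Ioo[OF assms(1)] assms(2) by (rule Diff_infinite_finite[rotated])
  then show ?thesis using that by (metis finite.emptyI ex_in_conv)
qed

context manifold_atlas
begin

lemma chart_interval:
  fixes \<sigma> :: "real \<Rightarrow> 'a"
  assumes "continuous_on {0..1} \<sigma>" "s \<in> {0..1}" "c \<in> charts_at At (\<sigma> s)"
  obtains d where "d > 0" "\<And>r. r \<in> {0..1} \<Longrightarrow> \<bar>r - s\<bar> \<le> d \<Longrightarrow> \<sigma> r \<in> fst c"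
proof -
  have c: "c \<in> At" "\<sigma> s \<in> fst c" using charts_atD[OF assms(3)] by auto
  have "(\<sigma> \<longlongrightarrow> \<sigma> s) (at s within {0..1})" using assms(1,2) by (simp add: continuous_on_def)
  then have "\<forall>\<^sub>F r in at s within {0..1}. \<sigma> r \<in> fst c"
    by (rule topological_tendstoD[OF _ chart_props(1)[OF c(1)] c(2)])
  then obtain d where d: "d > 0" "\<And>r. r \<in> {0..1} \<Longrightarrow> r \<noteq> s \<Longrightarrow> dist r s < d \<Longrightarrow> \<sigma> r \<in> fst c"
    unfolding eventually_at by auto
  show ?thesis
  proof (rule that[of "d / 2"])
    fix r assume r: "r \<in> {0..1}" "\<bar>r - s\<bar> \<le> d / 2"
    show "\<sigma> r \<in> fst c"
    proof (cases "r = s")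
      case True then show ?thesis using c by simp
    next
      case False then show ?thesis using d r by (simp add: dist_real_def)
    qed
  qed (use d in simp)
qed

end

context rk_manifold
begin

text \<open>\<open>P\<close> is a momentum along a coordinate arc of speed \<open>k\<close>: its
  dual norm is \<open>k\<close>, and the pair solves the Hamiltonian system up to and including the
  end points.\<close>

definition momentum_lift :: "real \<Rightarrow> real \<Rightarrow> (real \<Rightarrow> 'a) \<Rightarrow> ('a, 'b) chart \<Rightarrow> real \<Rightarrow> real \<Rightarrow> (real \<Rightarrow> 'b) \<Rightarrow> bool" where
  "momentum_lift \<mu> k \<sigma> c a b P \<longleftrightarrow> (\<forall>s\<in>{a..b}. P s \<noteq> 0 \<and> rk_chart.Fs (Gc c) (wc c) (lc c) \<mu> (snd c (\<sigma> s)) (P s) = k \<and>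
       ((snd c \<circ> \<sigma>) has_vector_derivative k *\<^sub>R rk_chart.V1 (Gc c) (wc c) (lc c) \<mu> (snd c (\<sigma> s)) (P s)) (at s within {a..b}) \<and>
       (P has_vector_derivative k *\<^sub>R rk_chart.B1 (Gc c) (wc c) (lc c) \<mu> (snd c (\<sigma> s)) (P s)) (at s within {a..b}))"

text \<open>The Du Bois-Reymond argument, applied in each basis direction, shows that the fibre
  derivative along the geodesic is the primitive of the base derivative up to a constant;
  \<open>euler_lagrange_ode\<close> does the rest.\<close>

lemma geodesic_chart:
  assumes eps: "\<mu> > 0" and geo: "geodesic_between At (tangent_bundle At) (rk_fun \<mu>) x0 x1 \<sigma>"
    and S: "finite S" "\<And>u v. 0 \<le> u \<Longrightarrow> u < v \<Longrightarrow> v \<le> 1 \<Longrightarrow> {u<..<v} \<inter> S = {} \<Longrightarrow> smooth_map At {u..v} \<sigma>"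
    and c: "c \<in> At" and ab: "0 \<le> a" "a < b" "b \<le> 1" and U: "\<sigma> ` {a..b} \<subseteq> fst c"
  shows "\<exists>k\<ge>0. (\<forall>s\<in>{a<..<b} - S. rk_fun \<mu> (\<sigma> s) (velocity At \<sigma> s) = k) \<and>
    (k > 0 \<longrightarrow> (\<exists>P. momentum_lift \<mu> k \<sigma> c a b P)) \<and>
    (k = 0 \<longrightarrow> (\<forall>s\<in>{a..b}. \<sigma> s = \<sigma> a))"
proof -
  interpret C: rk_chart "img c" "Gc c" "wc c" "lc c" by (rule chart_rk[OF c])
  have eps0: "\<mu> \<ge> 0" using eps by simp
  have curve: "\<sigma> \<in> curves_between At (tangent_bundle At) x0 x1" using geo by (simp add: geodesic_between_def)
  then have c\<sigma>: "continuous_on {0..1} \<sigma>" by (simp add: curves_between_tangent piecewise_smooth_curve_def)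
  define y where "y = snd c \<circ> \<sigma>"
  define v where "v r = vector_derivative y (at r)" for r
  have Us: "\<sigma> r \<in> fst c" if "r \<in> {a..b}" for r using U that by blast
  have yimg: "y r \<in> img c" if "r \<in> {a..b}" for r using Us[OF that] by (auto simp: y_def)
  have cy: "continuous_on {a..b} y" unfolding y_def o_def
    by (rule continuous_on_compose2[OF chart_continuous[OF c] continuous_on_subset[OF c\<sigma>]]) (use U ab in auto)
  have Oall: "(z, e') \<in> C.Omega \<mu>" if "z \<in> img c" for z e'
    using that C.l_nonneg[OF that] eps by (simp add: C.Omega_def)
  define D where "D u u' r = C.DLag \<mu> (y r, v r) (u, u')" for u u' r
  have Dlin: "D (\<alpha> *\<^sub>R u) (\<beta> *\<^sub>R u') r = \<alpha> * D u 0 r + \<beta> * D 0 u' r" if "r \<in> {a..b}" for \<alpha> \<beta> u u' r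
    unfolding D_def C.DLag_def using linear_scale[OF C.bb_linear[OF yimg[OF that]]] linear_0[OF C.bb_linear[OF yimg[OF that]]]
    by (simp add: algebra_simps)
  have nbhd: "\<exists>W h. open W \<and> s \<in> W \<and> W \<subseteq> {a<..<b} \<and> smooth_on W h \<and>
      (\<forall>q\<in>W. y q = h q \<and> (y has_vector_derivative frechet_derivative h (at q) 1) (at q) \<and> v q = frechet_derivative h (at q) 1)"
    if s: "s \<in> {a<..<b} - S" for s
  proof -
    obtain d where d: "d > 0" "{s - d<..<s} \<inter> S = {}" "{s<..<s + d} \<inter> S = {}" using finite_gap[OF S(1)] by blast
    define u w where "u = max a (s - d)" and "w = min b (s + d)"
    have uw: "a \<le> u" "u < s" "s < w" "w \<le> b" using d(1) s by (auto simp: u_def w_def)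
    have "{u<..<w} \<inter> S = {}"
    proof -
      have "{u<..<w} \<subseteq> {s - d<..<s} \<union> {s} \<union> {s<..<s + d}" by (auto simp: u_def w_def)
      then show ?thesis using d s by blast
    qed
    then have sm: "smooth_map At {u..w} \<sigma>" using S(2) uw ab by auto
    have cs: "c \<in> charts_at At (\<sigma> s)" using c Us[of s] s by (simp add: charts_at_def)
    have "s \<in> {u..w}" using uw by simp
    then obtain W0 h where W0: "open W0" "s \<in> W0" "smooth_on W0 h" and h: "\<And>q. q \<in> {u..w} \<Longrightarrow> q \<in> W0 \<Longrightarrow> \<sigma> q \<in> fst c \<and> h q = snd c (\<sigma> q)"
      using smooth_mapD[OF sm _ cs] by blast
    define W where "W = W0 \<inter> {u<..<w}"
    have W: "open W" "s \<in> W" "W \<subseteq> {a<..<b}" "smooth_on W h"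
      using W0 uw by (auto simp: W_def intro: smooth_on_subset)
    have yh: "y q = h q" if "q \<in> W" for q using h[of q] that by (auto simp: W_def y_def)
    note dh = smooth_on_has_vector_derivative[OF W(4)]
    have dy: "(y has_vector_derivative frechet_derivative h (at q) 1) (at q)" if "q \<in> W" for q
      by (rule has_vector_derivative_transform_within_open[OF dh[OF that] W(1) that]) (simp add: yh)
    have "v q = frechet_derivative h (at q) 1" if "q \<in> W" for q
      unfolding v_def by (rule vector_derivative_at[OF dy[OF that]])
    then show ?thesis using W yh dy by blast
  qed
  have dy: "(y has_vector_derivative v s) (at s)" if "s \<in> {a<..<b} - S" for s
    using nbhd[OF that] by metis
  have dv: "(v has_vector_derivative vector_derivative v (at s)) (at s)" if s: "s \<in> {a<..<b} - S" for s
  proof -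
    obtain W h where W: "open W" "s \<in> W" "smooth_on W h" "\<And>q. q \<in> W \<Longrightarrow> v q = frechet_derivative h (at q) 1"
      using nbhd[OF s] by blast
    have "(\<lambda>q. frechet_derivative h (at q) 1) differentiable (at s)"
      using smooth_onD(1)[OF smooth_onD(2)[OF W(3)] W(2)] by (auto simp: differentiable_def)
    then have "((\<lambda>q. frechet_derivative h (at q) 1) has_vector_derivative vector_derivative (\<lambda>q. frechet_derivative h (at q) 1) (at s)) (at s)"
      by (simp add: vector_derivative_works)
    then have "(v has_vector_derivative vector_derivative (\<lambda>q. frechet_derivative h (at q) 1) (at s)) (at s)"
      by (rule has_vector_derivative_transform_within_open[OF _ W(1,2)]) (simp add: W(4))
    from vector_derivative_at[OF this] this show ?thesis by (simp only:)
  qed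
  have Dcont: "isCont (D u u') s" if s: "s \<in> {a<..<b} - S" for u u' s
  proof -
    obtain W h where W: "open W" "s \<in> W" "W \<subseteq> {a<..<b}" "smooth_on W h" "\<And>q. q \<in> W \<Longrightarrow> y q = h q \<and> v q = frechet_derivative h (at q) 1"
      using nbhd[OF s] by blast
    have "continuous_on W (\<lambda>q. C.DLag \<mu> (h q, frechet_derivative h (at q) 1) (u, u'))"
    proof (rule C.DLag_continuous[OF eps0])
      show "continuous_on W (\<lambda>r. (h r, frechet_derivative h (at r) 1))"
        by (intro continuous_intros smooth_on_continuous[OF W(4)] smooth_on_continuous[OF smooth_onD(2)[OF W(4)]])
      show "(\<lambda>r. (h r, frechet_derivative h (at r) 1)) ` W \<subseteq> C.Omega \<mu>"
      proof safe
        fix q assume q: "q \<in> W"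
        then have "q \<in> {a..b}" using W(3) by auto
        then have "h q \<in> img c" using yimg[of q] W(5)[OF q] by simp
        then show "(h q, frechet_derivative h (at q) 1) \<in> C.Omega \<mu>" by (rule Oall)
      qed
    qed simp
    then have "continuous_on W (D u u')" by (rule continuous_on_eq) (simp add: D_def W(5))
    then show ?thesis using continuous_on_eq_continuous_at[OF W(1)] W(2) by blast
  qed
  have Dint: "D u u' integrable_on {a..b}" for u u'
  proof (rule piecewise_continuous_integrable[OF less_imp_le[OF ab(2)]])
    fix s0 assume s0: "s0 \<in> {a..b}"
    have s01: "s0 \<in> {0..1}" using s0 ab by auto
    have cs: "c \<in> charts_at At (\<sigma> s0)" using c Us[OF s0] by (auto simp: charts_at_def)
    obtain d where d: "d > 0" and ext: "\<forall>p q. 0 \<le> p \<and> p < q \<and> q \<le> 1 \<and> (s0 = p \<or> s0 = q) \<and> q - p < d \<longrightarrow> {p<..<q} \<inter> S = {} \<and>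
     coord_extension \<sigma> c p q"
      using piecewise_curve_extension[OF S s01 cs] by blast
    show "\<exists>d>0. \<forall>p q. a \<le> p \<and> p < q \<and> q \<le> b \<and> (s0 = p \<or> s0 = q) \<and> q - p < d \<longrightarrow> (\<exists>g. continuous_on {p..q} g \<and> (\<forall>r\<in>{p<..<q}. D u u' r = g r))"
    proof (intro exI[of _ d] conjI[OF d] allI impI)
      fix p q assume pq': "a \<le> p \<and> p < q \<and> q \<le> b \<and> (s0 = p \<or> s0 = q) \<and> q - p < d"
      then obtain W h where W: "open W" "smooth_on W h" "{p..q} \<subseteq> W"
        and h: "\<And>r. r \<in> {p..q} \<Longrightarrow> \<sigma> r \<in> fst c \<and> h r = snd c (\<sigma> r)"
        and d0: "\<And>r. r \<in> {p<..<q} \<Longrightarrow> ((snd c \<circ> \<sigma>) has_vector_derivative frechet_derivative h (at r) 1) (at r)"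
        using ext[rule_format, of p q, unfolded coord_extension_def] ab by auto
      let ?g = "\<lambda>q. C.DLag \<mu> (h q, frechet_derivative h (at q) 1) (u, u')"
      have "continuous_on {p..q} ?g"
      proof (rule C.DLag_continuous[OF eps0])
        show "continuous_on {p..q} (\<lambda>r. (h r, frechet_derivative h (at r) 1))"
          by (intro continuous_intros continuous_on_subset[OF smooth_on_continuous[OF W(2)] W(3)]
            continuous_on_subset[OF smooth_on_continuous[OF smooth_onD(2)[OF W(2)]] W(3)])
        show "(\<lambda>r. (h r, frechet_derivative h (at r) 1)) ` {p..q} \<subseteq> C.Omega \<mu>" using Oall h by auto
      qed simp
      moreover have "D u u' r = ?g r" if r: "r \<in> {p<..<q}" for r
      proof -
        have "v r = frechet_derivative h (at r) 1" unfolding v_def y_def using d0[OF r] by (rule vector_derivative_at)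
        then show ?thesis using h[of r] r by (simp add: D_def y_def)
      qed
      ultimately show "\<exists>g. continuous_on {p..q} g \<and> (\<forall>r\<in>{p<..<q}. D u u' r = g r)" by blast
    qed
  qed
  have exC: "\<exists>C. \<forall>s\<in>{a<..<b} - S. D 0 i s = C + integral {a..s} (D i 0)" for i
  proof (rule du_bois_reymond[OF ab(2) S(1) Dint[of i 0] Dint[of 0 i]])
    fix s t h assume st: "a \<le> s" "h > 0" "s + h < t - h" "t \<le> b"
    have "((\<lambda>r. D (trap s t h r *\<^sub>R i) (trap' s t h r *\<^sub>R i) r) has_integral 0) {a..b}"
      unfolding D_def v_def y_def o_def by (rule test_identity[OF eps geo S(1) S(2) c ab U st, of i, unfolded o_def])
    then show "((\<lambda>r. trap s t h r * D i 0 r + trap' s t h r * D 0 i r) has_integral 0) {a..b}"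
      by (rule has_integral_eq[rotated]) (rule Dlin)
  qed (use Dcont in auto)
  from choice[OF allI[OF exC]] obtain C0 where C0': "\<forall>i. \<forall>s\<in>{a<..<b} - S. D 0 i s = C0 i + integral {a..s} (D i 0)" ..
  note C0 = C0'[rule_format]
  \<comment> \<open>Defined as a primitive rather than as \<open>mom\<close> of the velocity: this
    version is continuous at the corners and agrees with \<open>mom\<close> off
    \<open>S\<close>.\<close>
  define P where "P s = (\<Sum>i\<in>Basis. (C0 i + integral {a..s} (D i 0)) *\<^sub>R i)" for s
  define P' where "P' s = (\<Sum>i\<in>Basis. D i 0 s *\<^sub>R i)" for s
  have cP: "continuous_on {a..b} P"
    unfolding P_def by (intro continuous_intros indefinite_integral_continuous_1 Dint)
  have Pmom: "P s = C.mom \<mu> (y s) (v s)" if s: "s \<in> {a<..<b} - S" for s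
  proof (rule euclidean_eqI)
    fix j :: 'b assume j: "j \<in> Basis"
    have "s \<in> {a..b}" using s by auto
    then have "D 0 j s = C.mom \<mu> (y s) (v s) \<bullet> j"
      unfolding D_def C.DLag_def using linear_0[OF C.bb_linear[OF yimg]] by simp
    then show "P s \<bullet> j = C.mom \<mu> (y s) (v s) \<bullet> j"
      unfolding P_def using C0[OF s, of j] j by (simp add: inner_sum_left_Basis)
  qed
  have dP: "(P has_vector_derivative P' s) (at s)" if s: "s \<in> {a<..<b} - S" for s
  proof -
    have "((\<lambda>s. integral {a..s} (D i 0)) has_vector_derivative D i 0 s) (at s)" for i
      using integral_has_vector_derivative_continuous_at[OF Dint, of s "{}" i 0] Dcont[OF s] s
      by (auto simp: at_within_Icc_at continuous_at_imp_continuous_at_within)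
    then have d: "((\<lambda>s. C0 i + integral {a..s} (D i 0)) has_real_derivative D i 0 s) (at s)" for i
      unfolding has_real_derivative_iff_has_vector_derivative
      using has_vector_derivative_add[OF has_vector_derivative_const[of "C0 i"]] by simp
    have "((\<lambda>s. (C0 i + integral {a..s} (D i 0)) *\<^sub>R i) has_vector_derivative D i 0 s *\<^sub>R i) (at s)" for i :: 'b
      using has_vector_derivative_scaleR[OF d has_vector_derivative_const[of i]] by simp
    then show ?thesis unfolding P_def P'_def by (intro has_vector_derivative_sum)
  qed
  have P'D: "P' s \<bullet> e = C.DLag \<mu> (y s, v s) (e, 0)" if s: "s \<in> {a<..<b} - S" for s e
  proof -
    have sab: "s \<in> {a..b}" using s by auto
    have "P' s \<bullet> e = (\<Sum>i\<in>Basis. (e \<bullet> i) * D i 0 s)"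
      unfolding P'_def by (simp add: inner_sum_left inner_commute[of e] mult.commute)
    also have "\<dots> = C.DLag \<mu> (y s, v s) (e, 0)"
      unfolding D_def C.DLag_def using C.bb_expand[OF yimg[OF sab], of "C.F \<mu> (y s) (v s)" "v s" e]
      by (simp add: sum_distrib_left mult.assoc mult.left_commute)
    finally show ?thesis .
  qed
  have velF: "rk_fun \<mu> (\<sigma> s) (velocity At \<sigma> s) = C.F \<mu> (y s) (v s)" if s: "s \<in> {a<..<b} - S" for s
  proof -
    have cs: "c \<in> charts_at At (\<sigma> s)" using c Us[of s] s by (simp add: charts_at_def)
    have "velocity At \<sigma> s = coord_vec At c (\<sigma> s) (v s)"
      by (rule velocity_interior[OF c ab(2), of _ s]) (use ab Us s dy[OF s] y_def in auto)
    then show ?thesis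
      using rk_metric_coord[OF cs coord_vec_tangent[OF cs], of \<mu>] coord_vec_self[OF cs] by (simp add: y_def)
  qed
  show ?thesis
  proof (rule C.euler_lagrange_ode[OF eps0 ab(2) S(1) cy _ _ dy dv cP Pmom dP P'D])
    show "y ` {a..b} \<subseteq> img c" using yimg by auto
    show "\<And>s. s \<in> {a<..<b} - S \<Longrightarrow> (y s, v s) \<in> C.Omega \<mu>" by (rule Oall) (use yimg in auto)
  next
    fix k assume k: "k \<ge> 0" "\<And>s. s \<in> {a<..<b} - S \<Longrightarrow> C.F \<mu> (y s) (v s) = k"
      "k > 0 \<Longrightarrow> \<forall>s\<in>{a..b}. P s \<noteq> 0 \<and> C.Fs \<mu> (y s) (P s) = k \<and>
         (y has_vector_derivative k *\<^sub>R C.V1 \<mu> (y s) (P s)) (at s within {a..b}) \<and>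
         (P has_vector_derivative k *\<^sub>R C.B1 \<mu> (y s) (P s)) (at s within {a..b})"
      "k = 0 \<Longrightarrow> \<forall>s\<in>{a..b}. y s = y a"
    have 1: "\<forall>s\<in>{a<..<b} - S. rk_fun \<mu> (\<sigma> s) (velocity At \<sigma> s) = k" using velF k(2) by simp
    have 2: "\<exists>P. momentum_lift \<mu> k \<sigma> c a b P" if k0: "k > 0"
      unfolding momentum_lift_def by (rule exI[of _ P], rule k(3)[OF k0, unfolded y_def comp_apply, folded comp_def])
    have 3: "\<forall>s\<in>{a..b}. \<sigma> s = \<sigma> a" if k0: "k = 0"
    proof
      fix s assume s: "s \<in> {a..b}"
      have aab: "a \<in> {a..b}" using ab(2) by simp
      have "y s = y a" by (rule bspec[OF k(4)[OF k0] s])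
      then have "cinv c (snd c (\<sigma> s)) = cinv c (snd c (\<sigma> a))" unfolding y_def comp_apply by (rule arg_cong)
      then show "\<sigma> s = \<sigma> a" unfolding cinv_chart[OF c Us[OF s]] cinv_chart[OF c Us[OF aab]] .
    qed
    show ?thesis by (rule exI[of _ k], intro conjI impI; (rule 1 2 3 k(1); assumption?))
  qed
qed

text \<open>Each chart arc has its own constant speed; arcs that overlap in an interval share a
  point outside the finite set \<open>S\<close> and hence their speeds.\<close>

lemma geodesic_global:
  assumes eps: "\<mu> > 0" and geo: "geodesic_between At (tangent_bundle At) (randers_metric g0 \<omega> \<Lambda> \<mu>) x0 x1 \<sigma>"
  obtains k S where "k \<ge> 0" "finite S"
    "\<And>s. s \<in> {0..1} - S \<Longrightarrow> velocity At \<sigma> s \<in> tangent_space At (\<sigma> s) \<and> randers_metric g0 \<omega> \<Lambda> \<mu> (\<sigma> s) (velocity At \<sigma> s) = k"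
    "\<And>c a b. k > 0 \<Longrightarrow> c \<in> At \<Longrightarrow> 0 \<le> a \<Longrightarrow> a < b \<Longrightarrow> b \<le> 1 \<Longrightarrow> \<sigma> ` {a..b} \<subseteq> fst c \<Longrightarrow> \<exists>P. momentum_lift \<mu> k \<sigma> c a b P"
    "\<And>s. k = 0 \<Longrightarrow> s \<in> {0..1} \<Longrightarrow> \<sigma> s = x0"
proof -
  note geo' = randers_geodesic_rk[OF eps geo]
  have \<sigma>: "piecewise_smooth_curve At \<sigma>" "\<sigma> 0 = x0" using geo by (auto simp: geodesic_between_def curves_between_tangent)
  then have c\<sigma>: "continuous_on {0..1} \<sigma>" by (simp add: piecewise_smooth_curve_def)
  obtain S where S: "finite S" "\<And>u v. 0 \<le> u \<Longrightarrow> u < v \<Longrightarrow> v \<le> 1 \<Longrightarrow> {u<..<v} \<inter> S = {} \<Longrightarrow> smooth_map At {u..v} \<sigma>"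
    using piecewise_smooth_curveE[OF \<sigma>(1)] by metis
  define g where "g s = rk_fun \<mu> (\<sigma> s) (velocity At \<sigma> s)" for s
  have chart: "\<exists>k\<ge>0. (\<forall>s\<in>{a<..<b} - S. g s = k) \<and> (k > 0 \<longrightarrow> (\<exists>P. momentum_lift \<mu> k \<sigma> c a b P)) \<and> (k = 0 \<longrightarrow> (\<forall>s\<in>{a..b}. \<sigma> s = \<sigma> a))"
    if cab: "c \<in> At" "0 \<le> a" "a < b" "b \<le> 1" "\<sigma> ` {a..b} \<subseteq> fst c" for c a b
    unfolding g_def by (rule geodesic_chart[OF eps geo' S(1) S(2) cab])
  have nbhd: "\<exists>d>0. \<exists>c\<in>At. \<sigma> ` {max 0 (x - d)..min 1 (x + d)} \<subseteq> fst c" if x: "x \<in> {0..1}" for x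
  proof -
    obtain c where c: "c \<in> charts_at At (\<sigma> x)" using chart_exists by blast
    obtain d where d: "d > 0" "\<And>r. r \<in> {0..1} \<Longrightarrow> \<bar>r - x\<bar> \<le> d \<Longrightarrow> \<sigma> r \<in> fst c" using chart_interval[OF c\<sigma> x c] by blast
    have "\<sigma> ` {max 0 (x - d)..min 1 (x + d)} \<subseteq> fst c" using d(2) by auto
    then show ?thesis using d(1) charts_atD[OF c] by blast
  qed
  \<comment> \<open>The margin \<eta> makes adjacent intervals overlap in an open interval, so that
    the two constants can be compared outside \<open>S\<close>.\<close>
  let ?Q = "\<lambda>u v. \<exists>\<eta>>0. \<exists>k\<ge>0. \<forall>s\<in>{u - \<eta><..<v + \<eta>} \<inter> {0<..<1} - S. g s = k"
  have "?Q 0 1"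
  proof (rule Bolzano_within[of 0 1 ?Q])
    fix u v w :: real assume Q: "?Q u v" "?Q v w" and uvw: "0 \<le> u" "u \<le> v" "v \<le> w" "w \<le> 1"
    obtain \<eta>1 k1 where 1: "\<eta>1 > 0" "k1 \<ge> 0" "\<And>s. s \<in> {u - \<eta>1<..<v + \<eta>1} \<inter> {0<..<1} - S \<Longrightarrow> g s = k1" using Q(1) by blast
    obtain \<eta>2 k2 where 2: "\<eta>2 > 0" "k2 \<ge> 0" "\<And>s. s \<in> {v - \<eta>2<..<w + \<eta>2} \<inter> {0<..<1} - S \<Longrightarrow> g s = k2" using Q(2) by blast
    define \<eta> where "\<eta> = min \<eta>1 \<eta>2"
    have \<eta>: "\<eta> > 0" using 1 2 by (simp add: \<eta>_def)
    have "max 0 (v - \<eta>) < min 1 (v + \<eta>)" using \<eta> uvw by auto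
    then obtain s where s: "s \<in> {max 0 (v - \<eta>)<..<min 1 (v + \<eta>)} - S" using infinite_interval_minus_finite[OF _ S(1)] by blast
    have "g s = k1" by (rule 1(3)) (use s uvw in \<open>auto simp: \<eta>_def\<close>)
    moreover have "g s = k2" by (rule 2(3)) (use s uvw in \<open>auto simp: \<eta>_def\<close>)
    ultimately have k12: "k2 = k1" by simp
    have "g s = k1" if s: "s \<in> {u - \<eta><..<w + \<eta>} \<inter> {0<..<1} - S" for s
    proof (cases "s \<le> v")
      case True
      have "s < v + \<eta>1" using True 1(1) by linarith
      then show ?thesis by (intro 1(3)) (use s in \<open>auto simp: \<eta>_def\<close>)
    next
      case False
      have "v - \<eta>2 < s" using False 2(1) by linarith
      then have "g s = k2" by (intro 2(3)) (use s in \<open>auto simp: \<eta>_def\<close>)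
      then show ?thesis using k12 by simp
    qed
    then show "?Q u w" using \<eta> 1(2) by blast
  next
    fix x :: real assume x: "0 \<le> x" "x \<le> 1"
    obtain d c where d: "d > 0" "c \<in> At" "\<sigma> ` {max 0 (x - d)..min 1 (x + d)} \<subseteq> fst c" using nbhd[of x] x by auto
    have lt: "max 0 (x - d) < min 1 (x + d)" using d(1) x by auto
    obtain k where k: "k \<ge> 0" "\<forall>s\<in>{max 0 (x - d)<..<min 1 (x + d)} - S. g s = k"
      using chart[OF d(2) _ lt _ d(3)] by auto
    have "?Q u v" if uv: "u \<le> x" "x \<le> v" "v - u < d / 2" for u v
    proof (rule exI[of _ "d / 2"], rule conjI[OF _ exI[of _ k]], goal_cases)
      case 1 show ?case using d(1) by simp
    next
      case 2 show ?case
    proof (intro conjI[OF k(1)] ballI)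
      fix s assume "s \<in> {u - d / 2<..<v + d / 2} \<inter> {0<..<1} - S"
      then have "s \<in> {max 0 (x - d)<..<min 1 (x + d)} - S" using uv by auto
      then show "g s = k" using k(2) by blast
    qed
    qed
    then show "\<exists>d>0. \<forall>u v. 0 \<le> u \<and> u \<le> x \<and> x \<le> v \<and> v \<le> 1 \<and> v - u < d \<longrightarrow> ?Q u v"
      using d(1) by (intro exI[of _ "d / 2"]) auto
  qed simp
  then obtain \<eta> k where k: "\<eta> > 0" "k \<ge> 0" "\<forall>s\<in>{0 - \<eta><..<1 + \<eta>} \<inter> {0<..<1} - S. g s = k" by blast
  have gk: "g s = k" if "s \<in> {0<..<1} - S" for s using k(1,3) that by auto
  have lift: "(k > 0 \<longrightarrow> (\<exists>P. momentum_lift \<mu> k \<sigma> c a b P)) \<and> (k = 0 \<longrightarrow> (\<forall>s\<in>{a..b}. \<sigma> s = \<sigma> a))"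
    if cab: "c \<in> At" "0 \<le> a" "a < b" "b \<le> 1" "\<sigma> ` {a..b} \<subseteq> fst c" for c a b
  proof -
    obtain k' where k': "\<forall>s\<in>{a<..<b} - S. g s = k'"
      "(k' > 0 \<longrightarrow> (\<exists>P. momentum_lift \<mu> k' \<sigma> c a b P)) \<and> (k' = 0 \<longrightarrow> (\<forall>s\<in>{a..b}. \<sigma> s = \<sigma> a))"
      using chart[OF cab] by blast
    obtain s where s: "s \<in> {a<..<b} - S" using infinite_interval_minus_finite[OF cab(3) S(1)] .
    have "k' = k" using k'(1) s gk[of s] cab by auto
    then show ?thesis using k'(2) by (simp only:)
  qed
  have const: "\<sigma> s = x0" if k0: "k = 0" and s: "s \<in> {0..1}" for s
  proof -
    have "\<sigma> 0 = \<sigma> s"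
    proof (rule Bolzano_within[of 0 s "\<lambda>u v. \<sigma> u = \<sigma> v"])
      fix x assume x: "0 \<le> x" "x \<le> s"
      obtain d c where d: "d > 0" "c \<in> At" "\<sigma> ` {max 0 (x - d)..min 1 (x + d)} \<subseteq> fst c" using nbhd[of x] x s by auto
      have lt: "max 0 (x - d) < min 1 (x + d)" using d(1) x s by auto
      have l: "\<forall>s\<in>{max 0 (x - d)..min 1 (x + d)}. \<sigma> s = \<sigma> (max 0 (x - d))" 
        by (rule mp[OF conjunct2[OF lift[OF d(2) _ lt _ d(3)]] k0]) auto
      have "\<sigma> u = \<sigma> v" if "0 \<le> u" "u \<le> x" "x \<le> v" "v \<le> s" "v - u < d" for u v
        using bspec[OF l, of u] bspec[OF l, of v] that s by simp
      then show "\<exists>d>0. \<forall>u v. 0 \<le> u \<and> u \<le> x \<and> x \<le> v \<and> v \<le> s \<and> v - u < d \<longrightarrow> \<sigma> u = \<sigma> v"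
        using d(1) by blast
    qed (use s in auto)
    then show ?thesis using \<sigma>(2) by simp
  qed
  obtain S' where S': "finite S'" "\<And>s. s \<in> {0..1} - S' \<Longrightarrow> velocity At \<sigma> s \<in> tangent_space At (\<sigma> s)"
    using velocity_tangent_ae[OF \<sigma>(1)] by blast
  have off: "velocity At \<sigma> s \<in> tangent_space At (\<sigma> s) \<and> randers_metric g0 \<omega> \<Lambda> \<mu> (\<sigma> s) (velocity At \<sigma> s) = k"
    if "s \<in> {0..1} - (S \<union> S' \<union> {0, 1})" for s
    using S'(2)[of s] randers_eq_rk[OF eps S'(2)[of s]] gk[of s] that by (auto simp: g_def)
  show ?thesis
  proof (rule that[OF k(2) _ off])
    show "finite (S \<union> S' \<union> {0, 1})" using S(1) S'(1) by simp
    show "\<And>c a b. k > 0 \<Longrightarrow> c \<in> At \<Longrightarrow> 0 \<le> a \<Longrightarrow> a < b \<Longrightarrow> b \<le> 1 \<Longrightarrow> \<sigma> ` {a..b} \<subseteq> fst c \<Longrightarrow> \<exists>P. momentum_lift \<mu> k \<sigma> c a b P"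
      using lift by blast
    show "\<And>s. k = 0 \<Longrightarrow> s \<in> {0..1} \<Longrightarrow> \<sigma> s = x0" by (rule const)
  qed assumption
qed

end

section \<open>Compactness\<close>

text \<open>Equicontinuity without a metric, since \<open>'a\<close> carries only a topology. The
  neighbourhood \<open>V\<close> lives in the space of values, so one \<open>d\<close> serves all
  times at which a curve of the family is near \<open>x\<close>.\<close>

definition equicontinuous_family :: "(real \<Rightarrow> 'a::topological_space) set \<Rightarrow> bool" where
  "equicontinuous_family \<F> \<longleftrightarrow> (\<forall>x U. open U \<longrightarrow> x \<in> U \<longrightarrow> (\<exists>V d. open V \<and> x \<in> V \<and> d > 0 \<and>
     (\<forall>\<gamma>\<in>\<F>. \<forall>s\<in>{0..1}. \<forall>t\<in>{0..1}. \<bar>t - s\<bar> < d \<longrightarrow> \<gamma> s \<in> V \<longrightarrow> \<gamma> t \<in> U)))"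

lemma equicontinuous_family_subset:
  assumes "equicontinuous_family \<F>" "\<G> \<subseteq> \<F>" shows "equicontinuous_family \<G>"
  unfolding equicontinuous_family_def
proof (intro allI impI)
  fix x and U :: "'a set" assume U: "open U" "x \<in> U"
  obtain V d where V: "open V" "x \<in> V" "d > 0"
    "\<forall>\<gamma>\<in>\<F>. \<forall>s\<in>{0..1}. \<forall>t\<in>{0..1}. \<bar>t - s\<bar> < d \<longrightarrow> \<gamma> s \<in> V \<longrightarrow> \<gamma> t \<in> U"
    using assms(1)[unfolded equicontinuous_family_def, rule_format, OF U] by blast
  show "\<exists>V d. open V \<and> x \<in> V \<and> d > 0 \<and> (\<forall>\<gamma>\<in>\<G>. \<forall>s\<in>{0..1}. \<forall>t\<in>{0..1}. \<bar>t - s\<bar> < d \<longrightarrow> \<gamma> s \<in> V \<longrightarrow> \<gamma> t \<in> U)"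
    by (rule exI[of _ V], rule exI[of _ d]) (use V assms(2) in blast)
qed

context manifold_atlas
begin

lemma chart_ball:
  assumes "c \<in> charts_at At x" "open U" "x \<in> U"
  obtains \<rho> where "\<rho> > 0" "cball (snd c x) \<rho> \<subseteq> img c" "cinv c ` cball (snd c x) \<rho> \<subseteq> U"
proof -
  have c: "c \<in> At" "x \<in> fst c" using charts_atD[OF assms(1)] by auto
  have "open (snd c ` (fst c \<inter> U))" "snd c x \<in> snd c ` (fst c \<inter> U)"
    using open_chart_image[OF c(1) assms(2)] c(2) assms(3) by auto
  then obtain \<rho> where \<rho>: "\<rho> > 0" "cball (snd c x) \<rho> \<subseteq> snd c ` (fst c \<inter> U)"
    using open_contains_cball by blast
  show ?thesis
  proof (rule that[OF \<rho>(1)])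
    show "cball (snd c x) \<rho> \<subseteq> img c" using \<rho>(2) by blast
    show "cinv c ` cball (snd c x) \<rho> \<subseteq> U"
    proof
      fix z assume "z \<in> cinv c ` cball (snd c x) \<rho>"
      then obtain p where "p \<in> fst c" "p \<in> U" "z = cinv c (snd c p)" using \<rho>(2) by blast
      then show "z \<in> U" using cinv_chart[OF c(1)] by simp
    qed
  qed
qed

lemma chart_ball_nbhd:
  assumes "c \<in> charts_at At x" "\<rho> > 0" "cball (snd c x) \<rho> \<subseteq> img c"
  shows "open (cinv c ` ball (snd c x) \<rho>)" "x \<in> cinv c ` ball (snd c x) \<rho>"
    "closed (cinv c ` cball (snd c x) \<rho>)"
proof -
  have c: "c \<in> At" "x \<in> fst c" using charts_atD[OF assms(1)] by auto
  show "open (cinv c ` ball (snd c x) \<rho>)"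
    by (rule open_cinv_image[OF c(1)]) (use assms(3) ball_subset_cball in auto)
  show "x \<in> cinv c ` ball (snd c x) \<rho>"
    using cinv_chart[OF c] assms(2) by (intro image_eqI[of _ _ "snd c x"]) auto
  show "closed (cinv c ` cball (snd c x) \<rho>)"
    by (rule compact_imp_closed[OF compact_cinv_image[OF c(1) compact_cball assms(3)]])
qed

text \<open>Closed coordinate balls are compact, hence closed in the Hausdorff space; this supplies
  the regularity used in the limit arguments.\<close>

lemma regular_nbhd:
  fixes x :: 'a
  assumes "open U" "x \<in> U"
  obtains V where "open V" "x \<in> V" "closure V \<subseteq> U"
proof -
  obtain c where c: "c \<in> charts_at At x" using chart_exists by blast
  obtain \<rho> where \<rho>: "\<rho> > 0" "cball (snd c x) \<rho> \<subseteq> img c" "cinv c ` cball (snd c x) \<rho> \<subseteq> U"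
    using chart_ball[OF c assms] by blast
  note n = chart_ball_nbhd[OF c \<rho>(1,2)]
  have "cinv c ` ball (snd c x) \<rho> \<subseteq> cinv c ` cball (snd c x) \<rho>" by (intro image_mono ball_subset_cball)
  then have "closure (cinv c ` ball (snd c x) \<rho>) \<subseteq> cinv c ` cball (snd c x) \<rho>" by (rule closure_minimal[OF _ n(3)])
  then show ?thesis using that[OF n(1,2)] \<rho>(3) by blast
qed

lemma disjoint_closures:
  fixes x y :: 'a
  assumes "x \<noteq> y"
  obtains V W where "open V" "x \<in> V" "open W" "y \<in> W" "closure V \<inter> closure W = {}"
proof -
  obtain U1 U2 where U: "open U1" "open U2" "x \<in> U1" "y \<in> U2" "U1 \<inter> U2 = {}" using hausdorff[OF assms] by blast
  obtain V where V: "open V" "x \<in> V" "closure V \<subseteq> U1" using regular_nbhd[OF U(1,3)] .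
  obtain W where W: "open W" "y \<in> W" "closure W \<subseteq> U2" using regular_nbhd[OF U(2,4)] .
  show ?thesis using that[OF V(1,2) W(1,2)] V(3) W(3) U(5) by blast
qed

lemma tendsto_closure:
  fixes f :: "nat \<Rightarrow> 'a"
  assumes "f \<longlonglongrightarrow> l" "\<exists>\<^sub>F n in sequentially. f n \<in> V"
  shows "l \<in> closure V"
proof (rule ccontr)
  assume "l \<notin> closure V"
  then have "\<forall>\<^sub>F n in sequentially. f n \<in> - closure V" by (intro topological_tendstoD[OF assms(1)]) auto
  then have "\<forall>\<^sub>F n in sequentially. \<not> f n \<in> V" by (rule eventually_mono) (use closure_subset in auto)
  then show False using assms(2) by (simp add: frequently_def)
qed

lemma frequently_subseq:
  assumes "strict_mono (r :: nat \<Rightarrow> nat)" "\<forall>\<^sub>F n in sequentially. P (r n)"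
  shows "\<exists>\<^sub>F n in sequentially. P n"
  unfolding frequently_sequentially
proof
  fix N
  obtain M where M: "\<And>n. n \<ge> M \<Longrightarrow> P (r n)" using assms(2) by (auto simp: eventually_sequentially)
  have "r (max M N) \<ge> N" using seq_suble[OF assms(1), of "max M N"] by simp
  then show "\<exists>n\<ge>N. P n" using M[of "max M N"] by auto
qed

text \<open>Two different cluster values at \<open>s\<close> would have neighbourhoods with disjoint
  closures. By equicontinuity the same curves lie in these neighbourhoods at a nearby rational time,
  where the whole sequence converges: a contradiction. Compactness of \<open>K\<close> provides the
  cluster values.\<close>

lemma equicontinuous_limit:
  fixes \<sigma> :: "nat \<Rightarrow> real \<Rightarrow> 'a"
  assumes eq: "equicontinuous_family (range \<sigma>)" and K: "compact K"
    and \<sigma>K: "\<And>n s. s \<in> {0..1} \<Longrightarrow> \<sigma> n s \<in> K"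
    and q: "\<And>s. s \<in> {0..1} \<Longrightarrow> s \<in> \<rat> \<Longrightarrow> \<exists>l. (\<lambda>n. \<sigma> n s) \<longlonglongrightarrow> l"
    and s: "s \<in> {0..1}"
  shows "\<exists>x. (\<lambda>n. \<sigma> n s) \<longlonglongrightarrow> x"
proof -
  have unique: "x = x'"
    if r: "strict_mono r" "(\<lambda>n. \<sigma> (r n) s) \<longlonglongrightarrow> x" and r': "strict_mono r'" "(\<lambda>n. \<sigma> (r' n) s) \<longlonglongrightarrow> x'" for r r' :: "nat \<Rightarrow> nat" and x x'
  proof (rule ccontr)
    assume "x \<noteq> x'"
    then obtain V W where VW: "open V" "x \<in> V" "open W" "x' \<in> W" "closure V \<inter> closure W = {}" by (rule disjoint_closures)
    obtain V' d where V': "open V'" "x \<in> V'" "d > 0"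
      "\<forall>\<gamma>\<in>range \<sigma>. \<forall>s\<in>{0..1}. \<forall>t\<in>{0..1}. \<bar>t - s\<bar> < d \<longrightarrow> \<gamma> s \<in> V' \<longrightarrow> \<gamma> t \<in> V"
      using eq[unfolded equicontinuous_family_def, rule_format, OF VW(1,2)] by blast
    obtain W' e where W': "open W'" "x' \<in> W'" "e > 0"
      "\<forall>\<gamma>\<in>range \<sigma>. \<forall>s\<in>{0..1}. \<forall>t\<in>{0..1}. \<bar>t - s\<bar> < e \<longrightarrow> \<gamma> s \<in> W' \<longrightarrow> \<gamma> t \<in> W"
      using eq[unfolded equicontinuous_family_def, rule_format, OF VW(3,4)] by blast
    have "max 0 (s - min d e) < min 1 (s + min d e)" using V'(3) W'(3) s by auto
    then obtain t where t: "t \<in> \<rat>" "max 0 (s - min d e) < t" "t < min 1 (s + min d e)" using Rats_dense_in_real by blast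
    then have t': "t \<in> {0..1}" "\<bar>t - s\<bar> < d" "\<bar>t - s\<bar> < e" by auto
    obtain l where l: "(\<lambda>n. \<sigma> n t) \<longlonglongrightarrow> l" using q[OF t'(1) t(1)] ..
    have "\<forall>\<^sub>F n in sequentially. \<sigma> (r n) s \<in> V'" by (rule topological_tendstoD[OF r(2) V'(1,2)])
    then have "\<forall>\<^sub>F n in sequentially. \<sigma> (r n) t \<in> V" by (rule eventually_mono) (use V'(4) s t' in blast)
    then have "\<exists>\<^sub>F n in sequentially. \<sigma> n t \<in> V" by (rule frequently_subseq[OF r(1)])
    then have 1: "l \<in> closure V" by (rule tendsto_closure[OF l])
    have "\<forall>\<^sub>F n in sequentially. \<sigma> (r' n) s \<in> W'" by (rule topological_tendstoD[OF r'(2) W'(1,2)])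
    then have "\<forall>\<^sub>F n in sequentially. \<sigma> (r' n) t \<in> W" by (rule eventually_mono) (use W'(4) s t' in blast)
    then have "\<exists>\<^sub>F n in sequentially. \<sigma> n t \<in> W" by (rule frequently_subseq[OF r'(1)])
    then have 2: "l \<in> closure W" by (rule tendsto_closure[OF l])
    show False using 1 2 VW(5) by blast
  qed
  have cluster: "\<exists>r x. strict_mono r \<and> x \<in> K \<and> (\<lambda>n. \<sigma> (r (n::nat)) s) \<longlonglongrightarrow> x \<and> (\<forall>n. r n \<in> A)" if A: "infinite A" for A :: "nat set"
  proof -
    obtain f :: "nat \<Rightarrow> nat" where f: "strict_mono f" "\<And>n. f n \<in> A" using infinite_enumerate[OF A] by blast
    obtain x r where x: "x \<in> K" "strict_mono r" "((\<lambda>n. \<sigma> (f n) s) \<circ> r) \<longlonglongrightarrow> x"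
      using seq_compactE[OF compact_imp_seq_compact[OF K], of "\<lambda>n. \<sigma> (f n) s"] \<sigma>K[OF s] by blast
    show ?thesis
      by (rule exI[of _ "f \<circ> r"], rule exI[of _ x]) (use f x strict_mono_o[OF f(1) x(2)] in \<open>auto simp: o_def\<close>)
  qed
  obtain r x where x: "strict_mono r" "(\<lambda>n. \<sigma> (r n) s) \<longlonglongrightarrow> x" using cluster[of UNIV] by auto
  have "(\<lambda>n. \<sigma> n s) \<longlonglongrightarrow> x"
  proof (rule topological_tendstoI, rule ccontr)
    fix V assume V: "open V" "x \<in> V" "\<not> (\<forall>\<^sub>F n in sequentially. \<sigma> n s \<in> V)"
    then have "infinite {n. \<sigma> n s \<notin> V}" by (simp add: eventually_cofinite flip: cofinite_eq_sequentially)
    then obtain r' x' where x': "strict_mono r'" "(\<lambda>n. \<sigma> (r' n) s) \<longlonglongrightarrow> x'" "\<And>n. \<sigma> (r' n) s \<notin> V"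
      using cluster[of "{n. \<sigma> n s \<notin> V}"] by auto
    have "x' \<in> V" using unique[OF x x'(1,2)] V(2) by simp
    then have "\<forall>\<^sub>F n in sequentially. \<sigma> (r' n) s \<in> V" by (rule topological_tendstoD[OF x'(2) V(1)])
    then show False using x'(3) by (simp add: eventually_sequentially) 
  qed
  then show ?thesis ..
qed

text \<open>Ascoli's theorem for manifold-valued curves: a product over the rationals replaces the
  diagonal sequence, and equicontinuity extends convergence to all times and makes the limit
  continuous.\<close>

lemma equicontinuous_subsequence:
  fixes \<sigma> :: "nat \<Rightarrow> real \<Rightarrow> 'a"
  assumes eq: "equicontinuous_family (range \<sigma>)" and K: "compact K"
    and \<sigma>K: "\<And>n s. s \<in> {0..1} \<Longrightarrow> \<sigma> n s \<in> K"
  obtains r \<sigma>0 where "strict_mono r" "continuous_on {0..1} \<sigma>0"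
    "\<And>s. s \<in> {0..1} \<Longrightarrow> (\<lambda>n. \<sigma> (r n) s) \<longlonglongrightarrow> \<sigma>0 s"
proof -
  \<comment> \<open>Clamping defines the value at every rational. The product of copies of
    \<open>K\<close> over the countable index type is compact and first countable, hence
    sequentially compact.\<close>
  define f where "f n (q::rat) = \<sigma> n (max 0 (min 1 (of_rat q)))" for n q
  have "compactin (product_topology (\<lambda>_::rat. euclidean) UNIV) (PiE UNIV (\<lambda>_. K))"
    unfolding compactin_PiE using K by simp
  then have cpt: "compact (PiE UNIV (\<lambda>_::rat. K))" by (simp add: euclidean_product_topology)
  have fK: "f n \<in> PiE UNIV (\<lambda>_. K)" for n using \<sigma>K by (auto simp: f_def PiE_def)
  have "\<exists>l\<in>PiE UNIV (\<lambda>_. K). \<exists>r. strict_mono r \<and> (f \<circ> r) \<longlonglongrightarrow> l"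
    using compact_imp_seq_compact[OF cpt, unfolded seq_compact_def, THEN spec[of _ f], THEN mp, OF allI[of "\<lambda>n. f n \<in> PiE UNIV (\<lambda>_. K)", OF fK]] .
  then obtain l where "\<exists>r. strict_mono r \<and> (f \<circ> r) \<longlonglongrightarrow> l" by (rule bexE)
  then obtain r where "strict_mono r \<and> (f \<circ> r) \<longlonglongrightarrow> l" ..
  then have r: "strict_mono r" "(f \<circ> r) \<longlonglongrightarrow> l" by (rule conjunct1, rule conjunct2)
  have lim_q: "(\<lambda>n. f (r n) q) \<longlonglongrightarrow> l q" for q
    using continuous_on_tendsto_compose[OF continuous_on_product_coordinates[of q] r(2)] by (simp add: o_def)
  have sub: "range (\<lambda>n. \<sigma> (r n)) \<subseteq> range \<sigma>" by auto
  have eq': "equicontinuous_family (range (\<lambda>n. \<sigma> (r n)))"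
    by (rule equicontinuous_family_subset[OF eq sub])
  have "\<exists>x. (\<lambda>n. \<sigma> (r n) s) \<longlonglongrightarrow> x" if s: "s \<in> {0..1}" for s
  proof (rule equicontinuous_limit[OF eq' K _ _ s])
    fix s :: real assume s: "s \<in> {0..1}" "s \<in> \<rat>"
    then obtain q where q: "s = of_rat q" by (auto elim: Rats_cases)
    have "f n q = \<sigma> n s" for n using s(1) by (simp add: f_def q[symmetric])
    then show "\<exists>l. (\<lambda>n. \<sigma> (r n) s) \<longlonglongrightarrow> l" using lim_q[of q] by auto
  qed (rule \<sigma>K)
  then obtain \<sigma>0 where lim: "\<And>s. s \<in> {0..1} \<Longrightarrow> (\<lambda>n. \<sigma> (r n) s) \<longlonglongrightarrow> \<sigma>0 s" by metis
  have "continuous_on {0..1} \<sigma>0"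
    unfolding continuous_on_def
  proof (intro ballI topological_tendstoI)
    fix s and U :: "'a set" assume s: "s \<in> {0..1}" and U: "open U" "\<sigma>0 s \<in> U"
    obtain V where V: "open V" "\<sigma>0 s \<in> V" "closure V \<subseteq> U" using regular_nbhd[OF U] .
    obtain V' d where V': "open V'" "\<sigma>0 s \<in> V'" "d > 0"
      "\<forall>\<gamma>\<in>range \<sigma>. \<forall>s\<in>{0..1}. \<forall>t\<in>{0..1}. \<bar>t - s\<bar> < d \<longrightarrow> \<gamma> s \<in> V' \<longrightarrow> \<gamma> t \<in> V"
      using eq[unfolded equicontinuous_family_def, rule_format, OF V(1,2)] by blast
    have ev: "\<forall>\<^sub>F n in sequentially. \<sigma> (r n) s \<in> V'" by (rule topological_tendstoD[OF lim[OF s] V'(1,2)])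
    have "\<sigma>0 t \<in> U" if t: "t \<in> {0..1}" "\<bar>t - s\<bar> < d" for t
    proof -
      have "\<forall>\<^sub>F n in sequentially. \<sigma> (r n) t \<in> V" using ev by (rule eventually_mono) (use V'(4) s t in blast)
      then have "\<exists>\<^sub>F n in sequentially. \<sigma> (r n) t \<in> V" by (rule eventually_frequently[OF sequentially_bot])
      then show ?thesis using tendsto_closure[OF lim[OF t(1)]] V(3) by blast
    qed
    then show "\<forall>\<^sub>F t in at s within {0..1}. \<sigma>0 t \<in> U"
      unfolding eventually_at using V'(3) by (intro exI[of _ d]) (auto simp: dist_real_def)
  qed
  then show ?thesis using that[OF r(1) _ lim] by blast
qed

text \<open>At the first exit time from the large ball the curve would have travelled a coordinate
  distance at least \<rho>, while the Lipschitz bound, valid up to that time, allows less.\<close>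

lemma no_early_exit:
  fixes \<gamma> :: "real \<Rightarrow> 'a"
  assumes c: "c \<in> charts_at At x" and \<rho>: "\<rho> > 0" "cball (snd c x) (2 * \<rho>) \<subseteq> img c" and M: "M \<ge> 0"
    and cont: "continuous_on {0..1} \<gamma>"
    and lip: "\<And>a b. 0 \<le> a \<Longrightarrow> a < b \<Longrightarrow> b \<le> 1 \<Longrightarrow> \<gamma> ` {a..b} \<subseteq> cinv c ` ball (snd c x) (2 * \<rho>) \<Longrightarrow>
      norm (snd c (\<gamma> b) - snd c (\<gamma> a)) \<le> M * (b - a)"
    and s: "0 \<le> s" "\<gamma> s \<in> cinv c ` ball (snd c x) \<rho>" and t: "s \<le> t" "t \<le> 1" "M * (t - s) < \<rho>"
  shows "\<gamma> t \<in> cinv c ` ball (snd c x) (2 * \<rho>)"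
proof (rule ccontr)
  assume nt: "\<gamma> t \<notin> cinv c ` ball (snd c x) (2 * \<rho>)"
  let ?y = "snd c x" let ?O = "cinv c ` ball ?y (2 * \<rho>)"
  have cA: "c \<in> At" using charts_atD[OF c] by simp
  have "2 * \<rho> > 0" using \<rho> by simp
  note n = chart_ball_nbhd[OF c this \<rho>(2)]
  have img2: "ball ?y (2 * \<rho>) \<subseteq> img c" using \<rho>(2) ball_subset_cball by blast
  have c\<gamma>: "continuous_on {s..t} \<gamma>" by (rule continuous_on_subset[OF cont]) (use s t in auto)
  define Z where "Z = {s..t} \<inter> \<gamma> -` (- ?O)"
  have "closed Z" unfolding Z_def by (rule continuous_closed_preimage[OF c\<gamma>]) (use n(1) in auto)
  then have "compact Z" by (auto simp: Z_def compact_eq_bounded_closed intro: bounded_subset[OF bounded_closed_interval])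
  moreover have "t \<in> Z" using nt t by (simp add: Z_def)
  ultimately obtain u where u: "u \<in> Z" "\<And>z. z \<in> Z \<Longrightarrow> u \<le> z" using compact_attains_inf[of Z] by auto
  have before: "\<gamma> z \<in> ?O" if "s \<le> z" "z < u" for z using u(2)[of z] that u(1) by (force simp: Z_def)
  have sO: "\<gamma> s \<in> ?O" using s(2) \<rho>(1) by (auto simp: subset_ball)
  have su: "s < u" using u(1) sO by (cases "s = u") (auto simp: Z_def)
  obtain p where p: "p \<in> ball ?y \<rho>" "\<gamma> s = cinv c p" using s(2) by blast
  have ps: "snd c (\<gamma> s) = p" unfolding p(2) by (rule chart_cinv[OF cA]) (use p(1) img2 \<rho>(1) in auto)
  \<comment> \<open>Before the exit time the curve stays in the closed ball of this radius, which is
    smaller than 2 \<rho>. The image of that ball is closed, so it also contains the supposed exit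
    point.\<close>
  define \<rho>' where "\<rho>' = dist ?y p + M * (t - s)"
  have \<rho>': "\<rho>' < 2 * \<rho>" using p(1) t(3) by (simp add: \<rho>'_def)
  have clos: "\<gamma> z \<in> cinv c ` cball ?y \<rho>'" if z: "s \<le> z" "z < u" for z
  proof -
    have "norm (snd c (\<gamma> z) - p) \<le> M * (z - s)"
    proof (cases "z = s")
      case True then show ?thesis by (simp add: ps)
    next
      case False
      have "norm (snd c (\<gamma> z) - snd c (\<gamma> s)) \<le> M * (z - s)"
        by (rule lip) (use False z s u(1) t before in \<open>auto simp: Z_def\<close>)
      then show ?thesis by (simp add: ps)
    qed
    also have "\<dots> \<le> M * (t - s)" using M z u(1) by (intro mult_left_mono) (auto simp: Z_def)
    finally have "dist p (snd c (\<gamma> z)) \<le> M * (t - s)" by (simp add: dist_norm norm_minus_commute)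
    then have "snd c (\<gamma> z) \<in> cball ?y \<rho>'" using dist_triangle[of ?y "snd c (\<gamma> z)" p] by (simp add: \<rho>'_def)
    moreover have "\<gamma> z = cinv c (snd c (\<gamma> z))"
    proof -
      obtain p' where p': "p' \<in> ball ?y (2 * \<rho>)" "\<gamma> z = cinv c p'" using before[OF z] by blast
      then show ?thesis using chart_cinv[OF cA, of p'] img2 by auto
    qed
    ultimately show ?thesis by blast
  qed
  have "cball ?y \<rho>' \<subseteq> img c" using \<rho>(2) \<rho>' by (meson order_trans subset_cball less_imp_le)
  then have cl: "closed (cinv c ` cball ?y \<rho>')" by (intro compact_imp_closed compact_cinv_image[OF cA compact_cball])
  have u01: "u \<le> t" using u(1) by (simp add: Z_def)
  have tend: "(\<gamma> \<longlongrightarrow> \<gamma> u) (at u within {s..<u})"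
    using c\<gamma> u01 su by (meson continuous_on_def atLeastAtMost_iff less_imp_le tendsto_within_subset[of _ _ u "{s..t}"] subset_iff atLeastLessThan_iff order_trans)
  have nb: "at u within {s..<u} \<noteq> bot"
    using su by (simp add: at_within_eq_bot_iff closure_atLeastLessThan) 
  have "\<gamma> u \<in> cinv c ` cball ?y \<rho>'"
    by (rule Lim_in_closed_set[OF cl _ nb tend]) (use clos in \<open>auto simp: eventually_at_filter\<close>)
  moreover have "cball ?y \<rho>' \<subseteq> ball ?y (2 * \<rho>)" using \<rho>' by auto
  ultimately have "\<gamma> u \<in> ?O" by blast
  then show False using u(1) by (simp add: Z_def)
qed

end

section \<open>Lengths, distances and confinement of the geodesics\<close>

lemma integral_finite_exceptions:
  fixes f :: "real \<Rightarrow> real"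
  assumes "finite S" "\<And>s. s \<in> {0..1} - S \<Longrightarrow> f s = k"
  shows "integral {0..1} f = k"
proof -
  have "((\<lambda>s. k) has_integral (1 - 0) *\<^sub>R k) {0..1::real}" using has_integral_const_real[of k 0 1] by simp 
  then have "(f has_integral k) {0..1}"
    by (intro has_integral_spike_finite[OF assms(1), of "{0..1}" f "\<lambda>s. k"]) (use assms(2) in auto)
  then show ?thesis by (rule integral_unique)
qed

text \<open>A function that is not integrable has integral 0 by convention; that case is covered by
  \<open>k \<ge> 0\<close>.\<close>

lemma integral_le_finite_exceptions:
  fixes f :: "real \<Rightarrow> real"
  assumes "finite S" "\<And>s. s \<in> {0..1} - S \<Longrightarrow> f s \<le> k" "k \<ge> 0"
  shows "integral {0..1} f \<le> k"
proof (cases "f integrable_on {0..1}")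
  case True
  let ?f = "\<lambda>s. if s \<in> S then k else f s"
  have "(?f has_integral integral {0..1} f) {0..1}"
    by (rule has_integral_spike_finite[OF assms(1) _ integrable_integral[OF True]]) auto
  moreover have "((\<lambda>s. k) has_integral (1 - 0) *\<^sub>R k) {0..1::real}" using has_integral_const_real[of k 0 1] by simp
  ultimately show ?thesis using has_integral_le[of ?f _ "{0..1}" "\<lambda>s. k" k] assms(2) by auto
next
  case False then show ?thesis using assms(3) by (simp add: not_integrable_integral)
qed

lemma integral_nonneg_finite_exceptions:
  fixes f :: "real \<Rightarrow> real"
  assumes "finite S" "\<And>s. s \<in> {0..1} - S \<Longrightarrow> f s \<ge> 0"
  shows "integral {0..1} f \<ge> 0"
proof -
  have "integral {0..1} (\<lambda>s. - f s) \<le> 0" by (rule integral_le_finite_exceptions[OF assms(1)]) (use assms(2) in auto)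
  then show ?thesis by simp
qed

context manifold_atlas
begin

text \<open>Nonnegativity bounds all lengths from below, so the real infimum in
  \<open>path_dist\<close> is a genuine lower bound; it is compared with the curve at hand.\<close>

lemma path_dist_le:
  assumes nn: "\<And>x v. v \<in> tangent_space At x \<Longrightarrow> F x v \<ge> 0"
    and \<gamma>: "\<gamma> \<in> curves_between At (tangent_bundle At) x y"
    and S: "finite S" "\<And>s. s \<in> {0..1} - S \<Longrightarrow> F (\<gamma> s) (velocity At \<gamma> s) \<le> k" and k: "k \<ge> 0"
  shows "path_dist At F x y \<le> k"
proof -
  have "bdd_below (curve_length At F ` curves_between At (tangent_bundle At) x y)"
  proof (rule bdd_belowI2[of _ 0])
    fix \<gamma> assume "\<gamma> \<in> curves_between At (tangent_bundle At) x y"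
    then have "piecewise_smooth_curve At \<gamma>" by (simp add: curves_between_tangent)
    then obtain S where "finite S" "\<And>s. s \<in> {0..1} - S \<Longrightarrow> velocity At \<gamma> s \<in> tangent_space At (\<gamma> s)"
      using velocity_tangent_ae by blast
    then show "0 \<le> curve_length At F \<gamma>" unfolding curve_length_def
      using nn by (intro integral_nonneg_finite_exceptions[of S]) auto
  qed
  then have "path_dist At F x y \<le> curve_length At F \<gamma>" unfolding path_dist_def using \<gamma> by (rule cINF_lower)
  also have "\<dots> \<le> k" unfolding curve_length_def by (rule integral_le_finite_exceptions[OF S k])
  finally show ?thesis .
qed

text \<open>An arc is reparametrised affinely over [0,1] because distances are defined through such
  curves only; its velocity is multiplied by \<open>b - a\<close>.\<close>

lemma subcurve:
  assumes \<sigma>: "piecewise_smooth_curve At \<sigma>" and ab: "0 \<le> a" "a < b" "b \<le> 1"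
  defines "\<phi> \<equiv> \<lambda>s. a + (b - a) * s"
  shows "(\<lambda>s. \<sigma> (\<phi> s)) \<in> curves_between At (tangent_bundle At) (\<sigma> a) (\<sigma> b)"
    and "\<exists>S. finite S \<and> (\<forall>s\<in>{0..1} - S. velocity At \<sigma> (\<phi> s) \<in> tangent_space At (\<sigma> (\<phi> s)) \<and>
      velocity At (\<lambda>s. \<sigma> (\<phi> s)) s = (\<lambda>c. (b - a) *\<^sub>R velocity At \<sigma> (\<phi> s) c))"
proof -
  let ?\<gamma> = "\<lambda>s. \<sigma> (\<phi> s)"
  obtain S where S: "finite S" "continuous_on {0..1} \<sigma>"
    "\<And>u v. 0 \<le> u \<Longrightarrow> u < v \<Longrightarrow> v \<le> 1 \<Longrightarrow> {u<..<v} \<inter> S = {} \<Longrightarrow> smooth_map At {u..v} \<sigma>"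
    using piecewise_smooth_curveE[OF \<sigma>] by metis
  have mono: "\<phi> s < \<phi> t \<longleftrightarrow> s < t" "\<phi> s \<le> \<phi> t \<longleftrightarrow> s \<le> t" for s t using ab(2) by (auto simp: \<phi>_def)
  have \<phi>ends: "\<phi> 0 = a" "\<phi> 1 = b" by (simp_all add: \<phi>_def)
  have \<phi>01: "\<phi> s \<in> {0..1}" if "s \<in> {0..1}" for s
    using mono(2)[of 0 s] mono(2)[of s 1] that ab unfolding \<phi>ends by simp
  have c\<phi>: "continuous_on A \<phi>" for A unfolding \<phi>_def by (intro continuous_intros)
  have cont: "continuous_on {0..1} ?\<gamma>"
    by (rule continuous_on_compose2[OF S(2) c\<phi>]) (use \<phi>01 in auto)
  define T where "T = (\<lambda>u. (u - a) / (b - a)) ` S"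
  have T: "finite T" using S(1) by (simp add: T_def)
  have TS: "s \<in> T" if "\<phi> s \<in> S" for s
    unfolding T_def by (rule image_eqI[OF _ that]) (use ab in \<open>simp add: \<phi>_def\<close>)
  have sm: "smooth_map At {u..v} ?\<gamma>" if uv: "0 \<le> u" "u < v" "v \<le> 1" "{u<..<v} \<inter> T = {}" for u v
  proof -
    have "{\<phi> u<..<\<phi> v} \<inter> S = {}"
    proof (rule ccontr)
      assume "{\<phi> u<..<\<phi> v} \<inter> S \<noteq> {}"
      then obtain t where t: "t \<in> S" "\<phi> u < t" "t < \<phi> v" by auto
      have eq: "\<phi> ((t - a) / (b - a)) = t" using ab by (simp add: \<phi>_def)
      then have "(t - a) / (b - a) \<in> {u<..<v} \<inter> T" using TS[of "(t - a) / (b - a)"] t mono(1)[of u "(t - a) / (b - a)"] mono(1)[of "(t - a) / (b - a)" v] by simp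
      then show False using uv(4) by blast
    qed
    then have sm\<sigma>: "smooth_map At {\<phi> u..\<phi> v} \<sigma>"
      using uv \<phi>01[of u] \<phi>01[of v] mono(1)[of u v] by (intro S(3)) auto
    show ?thesis
    proof (rule smooth_mapI)
      show "continuous_on {u..v} ?\<gamma>" by (rule continuous_on_subset[OF cont]) (use uv in auto)
      fix p assume p: "p \<in> {u..v}"
      obtain c where c: "c \<in> charts_at At (\<sigma> (\<phi> p))" using chart_exists by blast
      have "\<phi> p \<in> {\<phi> u..\<phi> v}" using p mono(2) by auto
      then obtain W h where W: "open W" "\<phi> p \<in> W" "smooth_on W h"
        and h: "\<And>q. q \<in> {\<phi> u..\<phi> v} \<Longrightarrow> q \<in> W \<Longrightarrow> \<sigma> q \<in> fst c \<and> h q = snd c (\<sigma> q)"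
        using smooth_mapD[OF sm\<sigma> _ c] by blast
      have oW: "open (\<phi> -` W)" using c\<phi>[of UNIV] W(1) by (simp add: continuous_on_open_vimage)
      have s\<phi>: "smooth_on (\<phi> -` W) \<phi>" unfolding \<phi>_def using oW by (intro smooth_intros) (auto simp: \<phi>_def)
      have "smooth_on (\<phi> -` W) (\<lambda>q. h (\<phi> q))" by (rule smooth_on_compose[OF oW W(1) _ s\<phi> W(3)]) auto
      then show "\<exists>c\<in>charts_at At (\<sigma> (\<phi> p)). \<exists>W h. open W \<and> p \<in> W \<and> smooth_on W h \<and>
           (\<forall>q\<in>{u..v} \<inter> W. \<sigma> (\<phi> q) \<in> fst c \<and> h q = snd c (\<sigma> (\<phi> q)))"
        using c oW W(2) h mono(2) by (intro bexI[of _ c] exI[of _ "\<phi> -` W"] exI[of _ "\<lambda>q. h (\<phi> q)"]) auto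
    qed
  qed
  have pw: "piecewise_smooth_curve At ?\<gamma>" by (rule piecewise_smooth_curveI[OF T cont sm])
  show "?\<gamma> \<in> curves_between At (tangent_bundle At) (\<sigma> a) (\<sigma> b)"
    unfolding curves_between_tangent using pw \<phi>ends by simp
  have "velocity At \<sigma> (\<phi> s) \<in> tangent_space At (\<sigma> (\<phi> s)) \<and> velocity At ?\<gamma> s = (\<lambda>c. (b - a) *\<^sub>R velocity At \<sigma> (\<phi> s) c)"
    if s: "s \<in> {0..1} - (T \<union> {0, 1})" for s
  proof -
    obtain c where c: "c \<in> charts_at At (\<sigma> (\<phi> s))" using chart_exists by blast
    have \<phi>s: "\<phi> s \<in> {0<..<1} - S" using mono(1)[of 0 s] mono(1)[of s 1] s ab TS \<phi>ends by auto
    obtain e where v1: "velocity At \<sigma> (\<phi> s) = coord_vec At c (\<sigma> (\<phi> s)) e" and d1: "(snd c \<circ> \<sigma> has_vector_derivative e) (at (\<phi> s))"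
      by (rule interior_velocity[OF S(1,3) \<phi>s c])
    have sT: "s \<in> {0<..<1} - T" using s by auto
    obtain e' where v2: "velocity At ?\<gamma> s = coord_vec At c (\<sigma> (\<phi> s)) e'" and d2: "(snd c \<circ> ?\<gamma> has_vector_derivative e') (at s)"
      by (rule interior_velocity[OF T sm sT c])
    have "(\<phi> has_vector_derivative (b - a)) (at s)"
      unfolding \<phi>_def has_real_derivative_iff_has_vector_derivative[symmetric] by (auto intro!: derivative_eq_intros)
    from vector_diff_chain_at[OF this d1]
    have "(snd c \<circ> ?\<gamma> has_vector_derivative (b - a) *\<^sub>R e) (at s)" by (simp add: o_def)
    then have "e' = (b - a) *\<^sub>R e" using d2 by (rule vector_derivative_unique_at[symmetric])
    then show ?thesis
      unfolding v1 v2 using coord_vec_linear[OF c, of "b - a" e 0 0] coord_vec_tangent[OF c] by simp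
  qed
  then show "\<exists>S. finite S \<and> (\<forall>s\<in>{0..1} - S. velocity At \<sigma> (\<phi> s) \<in> tangent_space At (\<sigma> (\<phi> s)) \<and>
      velocity At ?\<gamma> s = (\<lambda>c. (b - a) *\<^sub>R velocity At \<sigma> (\<phi> s) c))"
    using T by (intro exI[of _ "T \<union> {0, 1}"]) auto
qed

text \<open>Coordinate segments are the comparison curves by which Riemannian distances are bounded
  from above.\<close>

lemma segment_curve:
  assumes c: "c \<in> At" and pq: "closed_segment p q \<subseteq> img c"
  defines "\<gamma> \<equiv> \<lambda>s. cinv c (p + s *\<^sub>R (q - p))"
  shows "\<gamma> \<in> curves_between At (tangent_bundle At) (cinv c p) (cinv c q)"
    and "\<And>s. s \<in> {0..1} \<Longrightarrow> p + s *\<^sub>R (q - p) \<in> closed_segment p q"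
    and "\<And>s. s \<in> {0..1} \<Longrightarrow> velocity At \<gamma> s = coord_vec At c (\<gamma> s) (q - p)"
proof -
  let ?h = "\<lambda>s. p + s *\<^sub>R (q - p)"
  show seg: "?h s \<in> closed_segment p q" if "s \<in> {0..1}" for s
    using that unfolding closed_segment_def by (auto intro!: exI[of _ s] simp: algebra_simps)
  have hi: "?h s \<in> img c" if "s \<in> {0..1}" for s using seg[OF that] pq by blast
  have cont: "continuous_on {0..1} \<gamma>" unfolding \<gamma>_def
    by (rule continuous_on_compose2[OF cinv_continuous[OF c]]) (use hi in \<open>auto intro!: continuous_intros\<close>)
  have sm: "smooth_map At {u..v} \<gamma>" if uv: "0 \<le> u" "v \<le> 1" for u v
  proof (rule smooth_mapI)
    show "continuous_on {u..v} \<gamma>" by (rule continuous_on_subset[OF cont]) (use uv in auto)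
    fix s assume s: "s \<in> {u..v}"
    have ch: "c \<in> charts_at At (\<gamma> s)" using c cinv_in[OF c hi[of s]] s uv by (simp add: charts_at_def \<gamma>_def)
    have "smooth_on UNIV ?h" by (intro smooth_intros) auto
    moreover have "\<gamma> r \<in> fst c \<and> ?h r = snd c (\<gamma> r)" if "r \<in> {u..v}" for r
      using cinv_in[OF c hi[of r]] chart_cinv[OF c hi[of r]] that uv by (simp add: \<gamma>_def)
    ultimately show "\<exists>c\<in>charts_at At (\<gamma> s). \<exists>W h. open W \<and> s \<in> W \<and> smooth_on W h \<and>
           (\<forall>q\<in>{u..v} \<inter> W. \<gamma> q \<in> fst c \<and> h q = snd c (\<gamma> q))"
      by (intro bexI[OF _ ch] exI[of _ UNIV] exI[of _ ?h]) auto
  qed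
  show "\<gamma> \<in> curves_between At (tangent_bundle At) (cinv c p) (cinv c q)"
    using piecewise_smooth_curveI[of "{}", OF _ cont sm] by (simp add: curves_between_tangent \<gamma>_def)
  show "velocity At \<gamma> s = coord_vec At c (\<gamma> s) (q - p)" if s: "s \<in> {0..1}" for s
    unfolding velocity_def
  proof (rule velocity_within_eq[OF c open_UNIV UNIV_I s at_within_nontrivial[OF _ s]])
    show "\<gamma> r \<in> fst c \<and> snd c (\<gamma> r) = ?h r" if "r \<in> {0..1} \<inter> UNIV" for r
      using cinv_in[OF c hi[of r]] chart_cinv[OF c hi[of r]] that by (simp add: \<gamma>_def)
    show "(?h has_vector_derivative q - p) (at s within {0..1})"
      by (auto intro!: derivative_eq_intros)
  qed simp
qed

end

context rk_chart
begin

lemma G_upper_bound: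
  assumes "compact C" "C \<subseteq> Y"
  obtains M where "M \<ge> 0" "\<And>y u. y \<in> C \<Longrightarrow> G y u u \<le> M * (norm u)\<^sup>2"
proof -
  have "continuous_on (C \<times> cball 0 1) (\<lambda>z. G (fst z) (snd z) (snd z))"
    by (rule G_continuous) (use assms(2) in \<open>auto intro!: continuous_intros\<close>)
  then have "compact ((\<lambda>z. G (fst z) (snd z) (snd z)) ` (C \<times> cball 0 1))"
    by (rule compact_continuous_image) (intro compact_Times assms(1) compact_cball)
  from compact_imp_bounded[OF this] obtain M where M': "\<forall>x\<in>(\<lambda>z. G (fst z) (snd z) (snd z)) ` (C \<times> cball 0 1). norm x \<le> M"
    unfolding bounded_iff ..
  have M: "norm (G (fst z) (snd z) (snd z)) \<le> M" if "z \<in> C \<times> cball 0 1" for z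
    by (rule bspec[OF M' imageI[OF that]])
  show ?thesis
  proof (rule that[of "\<bar>M\<bar>"])
    fix y u assume y: "y \<in> C"
    then have yY: "y \<in> Y" using assms(2) by blast
    show "G y u u \<le> \<bar>M\<bar> * (norm u)\<^sup>2"
    proof (cases "u = 0")
      case True then show ?thesis using linear_0[OF G_linear[OF yY]] by simp
    next
      case False
      define e where "e = (1 / norm u) *\<^sub>R u"
      have u: "u = norm u *\<^sub>R e" and ne: "norm e = 1" using False by (auto simp: e_def)
      have "G y u u = G y (norm u *\<^sub>R e) (norm u *\<^sub>R e)" using u by simp
      also have "\<dots> = (norm u)\<^sup>2 * G y e e"
        using linear_scale[OF G_linear[OF yY], of "norm u *\<^sub>R e" "norm u" e] linear_scale[OF G_linear[OF yY], of e "norm u" e]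
          G_sym[OF yY, of "norm u *\<^sub>R e" e] by (simp add: power2_eq_square)
      also have "\<dots> \<le> (norm u)\<^sup>2 * \<bar>M\<bar>" using M[of "(y, e)"] y ne by (intro mult_left_mono) auto
      finally show ?thesis by (simp add: mult.commute)
    qed
  qed simp
qed

end

context rk_manifold
begin

lemma g0_nonneg: "v \<in> tangent_space At x \<Longrightarrow> g0 x v v \<ge> 0"
  using g0_pos[of v x] linear_on_tangent_zero[OF g0_linear[OF zero_tangent[of x]]] by (cases "v = (\<lambda>c. 0)") auto

lemma randers_nonneg:
  assumes "\<mu> > 0" "v \<in> tangent_space At x" shows "randers_metric g0 \<omega> \<Lambda> \<mu> x v \<ge> 0"
proof -
  have "\<bar>\<omega> x v\<bar> \<le> sqrt ((\<Lambda> x + \<mu>) * g0 x v v + (\<omega> x v)\<^sup>2)"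
    using g0_nonneg[OF assms(2)] \<Lambda>_nonneg[of x] assms(1) by (intro real_le_rsqrt) auto
  then show ?thesis unfolding randers_metric_def using \<Lambda>_nonneg[of x] assms(1) by (intro mult_nonneg_nonneg) auto
qed

text \<open>In the Kropina form only the denominator depends on \<mu>, and it increases.\<close>

lemma randers_antimono:
  assumes "0 < \<mu>" "\<mu> \<le> \<mu>'" "v \<in> tangent_space At x"
  shows "randers_metric g0 \<omega> \<Lambda> \<mu>' x v \<le> randers_metric g0 \<omega> \<Lambda> \<mu> x v"
proof -
  let ?g = "g0 x v v" and ?R = "\<lambda>\<mu>. sqrt ((\<Lambda> x + \<mu>) * g0 x v v + (\<omega> x v)\<^sup>2)"
  have "?g / (- \<omega> x v + ?R \<mu>') \<le> ?g / (- \<omega> x v + ?R \<mu>)"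
  proof (cases "?g = 0")
    case False
    then have g: "?g > 0" using g0_nonneg[OF assms(3)] by simp
    have "(\<Lambda> x + \<mu>) * ?g > 0" using g \<Lambda>_nonneg[of x] assms(1) by (intro mult_pos_pos) auto
    then have "\<bar>\<omega> x v\<bar> < ?R \<mu>" by (intro real_less_rsqrt) auto
    moreover have "?R \<mu> \<le> ?R \<mu>'" using g assms(2) by (intro real_sqrt_le_mono add_right_mono mult_right_mono) auto
    ultimately show ?thesis using g by (intro frac_le) auto
  qed simp
  then show ?thesis using randers_eq_rk[OF assms(1,3)] randers_eq_rk[of \<mu>' v x] assms by (simp add: rk_metric_def)
qed

lemma randers_scale:
  assumes "\<mu> > 0" "v \<in> tangent_space At x" "r \<ge> 0"
  shows "randers_metric g0 \<omega> \<Lambda> \<mu> x (\<lambda>c. r *\<^sub>R v c) = r * randers_metric g0 \<omega> \<Lambda> \<mu> x v"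
proof -
  obtain c where c: "c \<in> charts_at At x" using chart_exists by blast
  have cA: "c \<in> At" "x \<in> fst c" using charts_atD[OF c] by auto
  interpret C: rk_chart "img c" "Gc c" "wc c" "lc c" by (rule chart_rk[OF cA(1)])
  have "(\<lambda>c'. r *\<^sub>R v c') = coord_vec At c x (r *\<^sub>R v c)"
    using coord_vec_linear[OF c, of r "v c" 0 0] tangent_coord_vec[OF assms(2) c] by simp
  then have t: "(\<lambda>c'. r *\<^sub>R v c') \<in> tangent_space At x" using coord_vec_tangent[OF c] by simp
  show ?thesis
    unfolding randers_eq_rk[OF assms(1) t] randers_eq_rk[OF assms(1,2)] rk_metric_coord[OF c t] rk_metric_coord[OF c assms(2)]
    by (rule C.F_scale(1)[OF _ assms(3)]) (use cA in auto)
qed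

text \<open>The reparametrised arc has speed at most (b - a) k in the metric for \<mu>, and not more
  in the one for \<mu>'. Distances of one fixed metric thus control the geodesics of all smaller
  parameters.\<close>

lemma geodesic_in_balls:
  assumes \<mu>: "0 < \<mu>" "\<mu> \<le> \<mu>'" and \<sigma>: "piecewise_smooth_curve At \<sigma>" and k: "k \<ge> 0" and S: "finite S"
    "\<And>s. s \<in> {0..1} - S \<Longrightarrow> randers_metric g0 \<omega> \<Lambda> \<mu> (\<sigma> s) (velocity At \<sigma> s) \<le> k"
    and ab: "0 \<le> a" "a < b" "b \<le> 1"
  shows "path_dist At (randers_metric g0 \<omega> \<Lambda> \<mu>') (\<sigma> a) (\<sigma> b) \<le> k"
proof -
  define \<phi> where "\<phi> s = a + (b - a) * s" for s
  have \<phi>01: "\<phi> s \<in> {0..1}" if "s \<in> {0..1}" for s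
  proof -
    have "(b - a) * s \<le> b - a" "0 \<le> (b - a) * s" using that ab by (auto intro!: mult_left_le)
    then have "0 \<le> a + (b - a) * s" "a + (b - a) * s \<le> 1" using ab by - (linarith+)
    then show ?thesis by (simp add: \<phi>_def)
  qed
  have \<mu>': "\<mu>' > 0" using \<mu> by simp
  obtain T where T: "finite T" "\<And>s. s \<in> {0..1} - T \<Longrightarrow> velocity At \<sigma> (\<phi> s) \<in> tangent_space At (\<sigma> (\<phi> s)) \<and>
      velocity At (\<lambda>s. \<sigma> (\<phi> s)) s = (\<lambda>c. (b - a) *\<^sub>R velocity At \<sigma> (\<phi> s) c)"
    using subcurve(2)[OF \<sigma> ab] unfolding \<phi>_def by blast
  show ?thesis
  proof (rule path_dist_le[OF randers_nonneg[OF \<mu>'] subcurve(1)[OF \<sigma> ab], folded \<phi>_def])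
    show "finite (T \<union> (\<lambda>u. (u - a) / (b - a)) ` S)" using T(1) S(1) by simp
    fix s assume s: "s \<in> {0..1} - (T \<union> (\<lambda>u. (u - a) / (b - a)) ` S)"
    have "\<phi> s \<notin> S"
    proof
      assume "\<phi> s \<in> S"
      moreover have "s = (\<phi> s - a) / (b - a)" using ab by (simp add: \<phi>_def)
      ultimately show False using s by blast
    qed
    then have le: "randers_metric g0 \<omega> \<Lambda> \<mu> (\<sigma> (\<phi> s)) (velocity At \<sigma> (\<phi> s)) \<le> k" using S(2)[of "\<phi> s"] \<phi>01[of s] s by auto
    have t: "velocity At \<sigma> (\<phi> s) \<in> tangent_space At (\<sigma> (\<phi> s))" using T(2) s by blast
    have "randers_metric g0 \<omega> \<Lambda> \<mu>' (\<sigma> (\<phi> s)) (velocity At (\<lambda>s. \<sigma> (\<phi> s)) s)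
      = (b - a) * randers_metric g0 \<omega> \<Lambda> \<mu>' (\<sigma> (\<phi> s)) (velocity At \<sigma> (\<phi> s))"
      using randers_scale[OF \<mu>' t, of "b - a"] T(2)[of s] s ab by auto
    also have "\<dots> \<le> (b - a) * k" using randers_antimono[OF \<mu> t] le ab by (intro mult_left_mono) auto
    also have "\<dots> \<le> 1 * k" using ab k by (intro mult_right_mono) auto
    finally show "randers_metric g0 \<omega> \<Lambda> \<mu>' (\<sigma> (\<phi> s)) (velocity At (\<lambda>s. \<sigma> (\<phi> s)) s) \<le> k" by simp
  qed (assumption | rule k)+
qed

lemma riemannian_dist_chart:
  assumes c: "c \<in> charts_at At x" and \<rho>: "cball (snd c x) \<rho> \<subseteq> img c"
  obtains M where "M \<ge> 0" "\<And>p q. p \<in> cball (snd c x) \<rho> \<Longrightarrow> q \<in> cball (snd c x) \<rho> \<Longrightarrow>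
    path_dist At (\<lambda>x v. sqrt (g0 x v v)) (cinv c p) (cinv c q) \<le> M * norm (q - p)"
proof -
  have cA: "c \<in> At" using charts_atD[OF c] by simp
  interpret C: rk_chart "img c" "Gc c" "wc c" "lc c" by (rule chart_rk[OF cA])
  obtain M where M: "M \<ge> 0" "\<And>y u. y \<in> cball (snd c x) \<rho> \<Longrightarrow> Gc c y u u \<le> M * (norm u)\<^sup>2"
    using C.G_upper_bound[OF compact_cball \<rho>] by blast
  show ?thesis
  proof (rule that[of "sqrt M"])
    fix p q assume pq: "p \<in> cball (snd c x) \<rho>" "q \<in> cball (snd c x) \<rho>"
    have seg: "closed_segment p q \<subseteq> cball (snd c x) \<rho>" by (rule closed_segment_subset[OF pq convex_cball])
    then have seg': "closed_segment p q \<subseteq> img c" using \<rho> by (rule order_trans)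
    note \<gamma> = segment_curve[OF cA seg']
    show "path_dist At (\<lambda>x v. sqrt (g0 x v v)) (cinv c p) (cinv c q) \<le> sqrt M * norm (q - p)"
    proof (rule path_dist_le[OF _ \<gamma>(1)])
      show "0 \<le> sqrt (g0 x v v)" if "v \<in> tangent_space At x" for x v using g0_nonneg[OF that] by simp
      fix s :: real assume "s \<in> {0..1} - {}"
      then have s: "s \<in> {0..1}" by simp
      let ?h = "p + s *\<^sub>R (q - p)"
      have h: "?h \<in> img c" "?h \<in> cball (snd c x) \<rho>" using \<gamma>(2)[OF s] seg seg' by blast+
      have "g0 (cinv c ?h) (velocity At (\<lambda>s. cinv c (p + s *\<^sub>R (q - p))) s) (velocity At (\<lambda>s. cinv c (p + s *\<^sub>R (q - p))) s)
        = Gc c ?h (q - p) (q - p)" unfolding \<gamma>(3)[OF s] Gc_def ..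
      also have "\<dots> \<le> M * (norm (q - p))\<^sup>2" by (rule M(2)[OF h(2)])
      finally show "sqrt (g0 (cinv c ?h) (velocity At (\<lambda>s. cinv c (p + s *\<^sub>R (q - p))) s) (velocity At (\<lambda>s. cinv c (p + s *\<^sub>R (q - p))) s))
        \<le> sqrt M * norm (q - p)" using real_sqrt_le_mono by (fastforce simp: real_sqrt_mult)
    qed (use M(1) in auto)
  qed (use M(1) in auto)
qed

text \<open>Near a time \<open>x\<close>, equicontinuity puts almost all curves, and continuity puts
  the limit, into one small coordinate ball, whose points are close in the Riemannian distance;
  bisection makes this uniform on [0,1].\<close>

lemma uniformly_converges_equicontinuous:
  assumes eq: "equicontinuous_family (range \<sigma>)" and cont: "continuous_on {0..1} \<sigma>0"
    and lim: "\<And>s. s \<in> {0..1} \<Longrightarrow> (\<lambda>n. \<sigma> n s) \<longlonglongrightarrow> \<sigma>0 s"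
  shows "uniformly_converges At g0 \<sigma> \<sigma>0"
  unfolding uniformly_converges_def
proof (intro allI impI)
  fix e :: real assume e: "e > 0"
  let ?d = "path_dist At (\<lambda>x v. sqrt (g0 x v v))"
  let ?P = "\<lambda>u v. \<forall>\<^sub>F n in sequentially. \<forall>s\<in>{u..v}. ?d (\<sigma> n s) (\<sigma>0 s) < e"
  show "?P 0 1"
  proof (rule Bolzano_within[of 0 1 ?P])
    fix u v w assume P: "?P u v" "?P v w"
    show "?P u w" using P(1) P(2)
    proof eventually_elim
      case (elim n)
      show ?case
      proof
        fix s assume "s \<in> {u..w}"
        then show "?d (\<sigma> n s) (\<sigma>0 s) < e" using elim by (cases "s \<le> v") auto
      qed
    qed
  next
    fix x :: real assume x: "0 \<le> x" "x \<le> 1"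
    then have x01: "x \<in> {0..1}" by simp
    obtain c where c: "c \<in> charts_at At (\<sigma>0 x)" using chart_exists by blast
    have cA: "c \<in> At" using charts_atD[OF c] by simp
    obtain \<rho> where \<rho>: "\<rho> > 0" "cball (snd c (\<sigma>0 x)) \<rho> \<subseteq> img c" "cinv c ` cball (snd c (\<sigma>0 x)) \<rho> \<subseteq> UNIV"
      using chart_ball[OF c open_UNIV UNIV_I] .
    obtain M where M: "M \<ge> 0" "\<And>p q. p \<in> cball (snd c (\<sigma>0 x)) \<rho> \<Longrightarrow> q \<in> cball (snd c (\<sigma>0 x)) \<rho> \<Longrightarrow> ?d (cinv c p) (cinv c q) \<le> M * norm (q - p)"
      using riemannian_dist_chart[OF c \<rho>(2)] by blast
    \<comment> \<open>Two points of the ball of radius \<open>r\<close> are at distance at most 2 M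
      r, which is below \<open>e\<close>; the added 1 covers \<open>M = 0\<close>.\<close>
    define r where "r = min \<rho> (e / (4 * (M + 1)))"
    have r: "r > 0" "r \<le> \<rho>" "M * (2 * r) < e"
    proof -
      show "r > 0" "r \<le> \<rho>" using \<rho> e M by (auto simp: r_def)
      have "r \<le> e / (4 * (M + 1))" by (simp add: r_def)
      then have "r * (4 * (M + 1)) \<le> e" using M by (simp add: pos_le_divide_eq)
      moreover have "M * (2 * r) < r * (4 * (M + 1))" using M \<open>r > 0\<close> by (simp add: algebra_simps add_pos_nonneg)
      ultimately show "M * (2 * r) < e" by simp
    qed
    have rsub: "cball (snd c (\<sigma>0 x)) r \<subseteq> img c" using \<rho>(2) r(2) by (meson order_trans subset_cball)
    define U where "U = cinv c ` ball (snd c (\<sigma>0 x)) r"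
    have U: "open U" "\<sigma>0 x \<in> U" using chart_ball_nbhd(1,2)[OF c r(1) rsub] by (auto simp: U_def)
    have near: "?d z z' < e" if z: "z \<in> U" "z' \<in> U" for z z'
    proof -
      obtain p q where pq: "p \<in> ball (snd c (\<sigma>0 x)) r" "z = cinv c p" "q \<in> ball (snd c (\<sigma>0 x)) r" "z' = cinv c q" using z by (auto simp: U_def)
      have "norm (q - p) \<le> 2 * r" using pq(1,3) dist_triangle[of q p "snd c (\<sigma>0 x)"] by (simp add: dist_norm[symmetric] dist_commute)
      then have "M * norm (q - p) \<le> M * (2 * r)" using M(1) by (rule mult_left_mono)
      moreover have "?d z z' \<le> M * norm (q - p)" unfolding pq(2,4) by (rule M(2)) (use pq r(2) in auto)
      ultimately show ?thesis using r(3) by simp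
    qed
    obtain V d where V: "open V" "\<sigma>0 x \<in> V" "d > 0"
      "\<forall>\<gamma>\<in>range \<sigma>. \<forall>s\<in>{0..1}. \<forall>t\<in>{0..1}. \<bar>t - s\<bar> < d \<longrightarrow> \<gamma> s \<in> V \<longrightarrow> \<gamma> t \<in> U"
      using eq[unfolded equicontinuous_family_def, rule_format, OF U] by blast
    have "(\<sigma>0 \<longlongrightarrow> \<sigma>0 x) (at x within {0..1})" using cont x01 by (simp add: continuous_on_def)
    then have "\<forall>\<^sub>F t in at x within {0..1}. \<sigma>0 t \<in> U" by (rule topological_tendstoD[OF _ U])
    then obtain d' where d': "d' > 0" "\<And>t. t \<in> {0..1} \<Longrightarrow> t \<noteq> x \<Longrightarrow> dist t x < d' \<Longrightarrow> \<sigma>0 t \<in> U" unfolding eventually_at by auto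
    have \<sigma>0U: "\<sigma>0 t \<in> U" if "t \<in> {0..1}" "\<bar>t - x\<bar> < d'" for t using d'(2)[of t] that U(2) by (cases "t = x") (auto simp: dist_real_def)
    have ev: "\<forall>\<^sub>F n in sequentially. \<sigma> n x \<in> V" by (rule topological_tendstoD[OF lim[OF x01] V(1,2)])
    have "?P u v" if uv: "0 \<le> u" "u \<le> x" "x \<le> v" "v \<le> 1" "v - u < min d d'" for u v
      using ev
    proof eventually_elim
      case (elim n)
      show ?case
      proof
        fix s assume s: "s \<in> {u..v}"
        then have s': "s \<in> {0..1}" "\<bar>s - x\<bar> < d" "\<bar>s - x\<bar> < d'" using uv by auto
        have "\<sigma> n s \<in> U" using V(4) x01 s'(1,2) elim by blast
        then show "?d (\<sigma> n s) (\<sigma>0 s) < e" by (rule near[OF _ \<sigma>0U[OF s'(1,3)]])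
      qed
    qed
    then show "\<exists>d>0. \<forall>u v. 0 \<le> u \<and> u \<le> x \<and> x \<le> v \<and> v \<le> 1 \<and> v - u < d \<longrightarrow> ?P u v"
      using V(3) d'(1) by (intro exI[of _ "min d d'"]) simp
  qed simp
qed

text \<open>What the compactness argument retains of a geodesic. A momentum is demanded only for
  positive speed, because a constant curve has zero momentum, where the dual field is not
  defined.\<close>

definition momentum_curve :: "real \<Rightarrow> real \<Rightarrow> (real \<Rightarrow> 'a) \<Rightarrow> bool" where
  "momentum_curve \<mu> k \<sigma> \<longleftrightarrow> continuous_on {0..1} \<sigma> \<and> k \<ge> 0 \<and>
     (k > 0 \<longrightarrow> (\<forall>c\<in>At. \<forall>a b. 0 \<le> a \<longrightarrow> a < b \<longrightarrow> b \<le> 1 \<longrightarrow> \<sigma> ` {a..b} \<subseteq> fst c \<longrightarrow> (\<exists>P. momentum_lift \<mu> k \<sigma> c a b P))) \<and>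
     (k = 0 \<longrightarrow> (\<forall>s\<in>{0..1}. \<sigma> s = \<sigma> 0))"

text \<open>The coordinate velocity is the speed times \<open>V1\<close>, and \<open>V1\<close> is
  bounded whatever the size of the momentum.\<close>

lemma momentum_curve_lipschitz:
  assumes \<sigma>: "momentum_curve \<mu> k \<sigma>" and k: "k \<le> \<kappa>" and \<mu>: "\<mu> \<in> {0..1}" and c: "c \<in> At" and C: "C \<subseteq> img c"
    and M: "M > 0" "\<And>\<mu> y p. \<mu> \<in> {0..1} \<Longrightarrow> y \<in> C \<Longrightarrow> p \<noteq> 0 \<Longrightarrow> norm (rk_chart.V1 (Gc c) (wc c) (lc c) \<mu> y p) \<le> M"
    and ab: "0 \<le> a" "a < b" "b \<le> 1" "\<sigma> ` {a..b} \<subseteq> cinv c ` C"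
  shows "norm (snd c (\<sigma> b) - snd c (\<sigma> a)) \<le> \<kappa> * M * (b - a)"
proof (cases "k = 0")
  case True
  then have "\<sigma> b = \<sigma> a" using \<sigma> ab unfolding momentum_curve_def by (metis atLeastAtMost_iff less_imp_le order_trans)
  then show ?thesis using k True ab M(1) by simp
next
  case False
  then have k0: "k > 0" using \<sigma> by (simp add: momentum_curve_def)
  have inC: "snd c (\<sigma> s) \<in> C \<and> \<sigma> s \<in> fst c" if s: "s \<in> {a..b}" for s
  proof -
    obtain p where "p \<in> C" "\<sigma> s = cinv c p" using ab(4) s by blast
    then show ?thesis using chart_cinv[OF c, of p] cinv_in[OF c, of p] C by auto
  qed
  then have "\<sigma> ` {a..b} \<subseteq> fst c" by auto
  then obtain P where P: "momentum_lift \<mu> k \<sigma> c a b P" using \<sigma> k0 c ab unfolding momentum_curve_def by blast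
  let ?V = "\<lambda>s. rk_chart.V1 (Gc c) (wc c) (lc c) \<mu> (snd c (\<sigma> s)) (P s)"
  have d: "((snd c \<circ> \<sigma>) has_vector_derivative k *\<^sub>R ?V s) (at s within {a..b})" "P s \<noteq> 0" if "s \<in> {a..b}" for s
    using P that unfolding momentum_lift_def by auto
  have "norm ((snd c \<circ> \<sigma>) b - (snd c \<circ> \<sigma>) a) \<le> (\<kappa> * M) * \<bar>b - a\<bar>"
  proof (rule vector_derivative_lipschitz[OF d(1)])
    fix s assume s: "s \<in> {a..b}"
    have "norm (?V s) \<le> M" using M(2)[OF \<mu>] inC[OF s] d(2)[OF s] by blast
    then have "k * norm (?V s) \<le> \<kappa> * M" using k k0 by (intro mult_mono) auto
    then show "norm (k *\<^sub>R ?V s) \<le> \<kappa> * M" using k0 by simp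
  qed (use ab in auto)
  then show ?thesis using ab by simp
qed

text \<open>The coordinate Lipschitz constant depends on the chart ball and the speed bound only.
  Since it holds only while the curve stays in the ball, \<open>no_early_exit\<close> is needed to
  know that it does.\<close>

lemma momentum_curves_equicontinuous:
  "equicontinuous_family {\<sigma>. \<exists>\<mu>\<in>{0..1}. \<exists>k\<le>\<kappa>. momentum_curve \<mu> k \<sigma>}"
  unfolding equicontinuous_family_def
proof (intro allI impI)
  fix x and U :: "'a set" assume U: "open U" "x \<in> U"
  obtain c where c: "c \<in> charts_at At x" using chart_exists by blast
  have cA: "c \<in> At" using charts_atD[OF c] by simp
  interpret C: rk_chart "img c" "Gc c" "wc c" "lc c" by (rule chart_rk[OF cA])
  obtain \<rho>' where \<rho>': "\<rho>' > 0" "cball (snd c x) \<rho>' \<subseteq> img c" "cinv c ` cball (snd c x) \<rho>' \<subseteq> U" using chart_ball[OF c U] .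
  define \<rho> where "\<rho> = \<rho>' / 2"
  have \<rho>: "\<rho> > 0" "cball (snd c x) (2 * \<rho>) \<subseteq> img c" "cinv c ` cball (snd c x) (2 * \<rho>) \<subseteq> U" using \<rho>' by (auto simp: \<rho>_def)
  have bim: "ball (snd c x) (2 * \<rho>) \<subseteq> img c" using \<rho>(2) ball_subset_cball by blast
  obtain M where M: "M > 0" "\<And>\<mu> y p. \<mu> \<in> {0..1} \<Longrightarrow> y \<in> cball (snd c x) (2 * \<rho>) \<Longrightarrow> p \<noteq> 0 \<Longrightarrow> norm (C.V1 \<mu> y p) \<le> M"
    "\<And>\<mu> y p. \<mu> \<in> {0..1} \<Longrightarrow> y \<in> cball (snd c x) (2 * \<rho>) \<Longrightarrow> p \<noteq> 0 \<Longrightarrow> norm (C.B1 \<mu> y p) \<le> M * norm p"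
  proof (rule C.momentum_field_bounds[OF compact_cball \<rho>(2)])
    fix M :: real
    assume M: "M > 0" "\<And>\<mu> y p. \<mu> \<in> {0..1} \<Longrightarrow> y \<in> cball (snd c x) (2 * \<rho>) \<Longrightarrow> p \<noteq> 0 \<Longrightarrow> norm (C.V1 \<mu> y p) \<le> M"
      "\<And>\<mu> y p. \<mu> \<in> {0..1} \<Longrightarrow> y \<in> cball (snd c x) (2 * \<rho>) \<Longrightarrow> p \<noteq> 0 \<Longrightarrow> norm (C.B1 \<mu> y p) \<le> M * norm p"
    show thesis by (rule that[OF M])
  qed
  \<comment> \<open>The absolute value and the added 1 give a positive constant for any real
    \<kappa>.\<close>
  define L where "L = (\<bar>\<kappa>\<bar> + 1) * M"
  have L: "L > 0" using M(1) by (simp add: L_def add_nonneg_pos)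
  have \<rho>2: "cball (snd c x) \<rho> \<subseteq> img c" by (rule order_trans[OF subset_cball \<rho>(2)]) (use \<rho>(1) in simp)
  let ?V = "cinv c ` ball (snd c x) \<rho>" and ?O = "cinv c ` ball (snd c x) (2 * \<rho>)"
  have main: "\<gamma> t \<in> U" if \<gamma>: "\<exists>\<mu>\<in>{0..1}. \<exists>k\<le>\<kappa>. momentum_curve \<mu> k \<gamma>"
    and st: "s \<in> {0..1}" "t \<in> {0..1}" "\<bar>t - s\<bar> < \<rho> / L" "\<gamma> s \<in> ?V" for \<gamma> s t
  proof -
    obtain \<mu> k where ek: "\<mu> \<in> {0..1}" "k \<le> \<kappa>" "momentum_curve \<mu> k \<gamma>" using \<gamma> by blast
    have cont: "continuous_on {0..1} \<gamma>" using ek(3) by (simp add: momentum_curve_def)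
    have k1: "k \<le> \<bar>\<kappa>\<bar> + 1" using ek(2) by simp
    have lip: "norm (snd c (\<gamma> b) - snd c (\<gamma> a)) \<le> L * (b - a)"
      if ab: "0 \<le> a" "a < b" "b \<le> 1" "\<gamma> ` {a..b} \<subseteq> ?O" for a b
      unfolding L_def
      by (rule momentum_curve_lipschitz[OF ek(3) k1 ek(1) cA bim M(1) M(2) ab]) (use ball_subset_cball in auto)
    have Lts: "L * \<bar>t - s\<bar> < \<rho>" using st(3) L by (simp add: pos_less_divide_eq mult.commute)
    have "\<gamma> t \<in> ?O"
    proof (cases "s \<le> t")
      case True
      show ?thesis
        by (rule no_early_exit[OF c \<rho>(1,2) less_imp_le[OF L] cont lip _ st(4) True]) (use st Lts True in auto)
    next
      case False
      \<comment> \<open>For earlier times the argument runs along the reversed curve, which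
        satisfies the same two-point bound although it need not be a geodesic.\<close>
      have "(\<lambda>r. \<gamma> (1 - r)) (1 - t) \<in> ?O"
      proof (rule no_early_exit[OF c \<rho>(1,2) less_imp_le[OF L], of "\<lambda>r. \<gamma> (1 - r)" "1 - s" "1 - t"])
        show "continuous_on {0..1} (\<lambda>r. \<gamma> (1 - r))"
          by (rule continuous_on_compose2[OF cont]) (auto intro!: continuous_intros)
        fix a b assume ab: "0 \<le> a" "a < b" "b \<le> 1" "(\<lambda>r. \<gamma> (1 - r)) ` {a..b} \<subseteq> ?O"
        have "\<gamma> ` {1 - b..1 - a} \<subseteq> ?O"
        proof
          fix z assume "z \<in> \<gamma> ` {1 - b..1 - a}"
          then obtain r where r: "r \<in> {1 - b..1 - a}" "z = \<gamma> (1 - (1 - r))" by auto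
          then have "1 - r \<in> {a..b}" by auto
          then show "z \<in> ?O" using ab(4) r(2) by blast
        qed
        then have "norm (snd c (\<gamma> (1 - a)) - snd c (\<gamma> (1 - b))) \<le> L * ((1 - a) - (1 - b))" using ab by (intro lip) auto
        then show "norm (snd c (\<gamma> (1 - b)) - snd c (\<gamma> (1 - a))) \<le> L * (b - a)" by (simp add: norm_minus_commute)
      qed (use st Lts False in auto)
      then show ?thesis by simp
    qed
    then show ?thesis using \<rho>(3) ball_subset_cball by blast
  qed
  show "\<exists>V d. open V \<and> x \<in> V \<and> d > 0 \<and> (\<forall>\<gamma>\<in>{\<sigma>. \<exists>\<mu>\<in>{0..1}. \<exists>k\<le>\<kappa>. momentum_curve \<mu> k \<sigma>}.
      \<forall>s\<in>{0..1}. \<forall>t\<in>{0..1}. \<bar>t - s\<bar> < d \<longrightarrow> \<gamma> s \<in> V \<longrightarrow> \<gamma> t \<in> U)"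
    using chart_ball_nbhd(1,2)[OF c \<rho>(1) \<rho>2] \<rho>(1) L main
    by (intro exI[of _ ?V] exI[of _ "\<rho> / L"]) simp
qed

end

section \<open>The limit curve\<close>

lemma zero_derivative_constant:
  fixes y :: "real \<Rightarrow> 'e::real_normed_vector"
  assumes "\<And>s. s \<in> {a..b} \<Longrightarrow> (y has_vector_derivative 0) (at s within {a..b})" "s \<in> {a..b}" "t \<in> {a..b}"
  shows "y s = y t"
  using vector_derivative_lipschitz[of a b y "\<lambda>s. 0" 0 s t] assms by simp

text \<open>A local solution starting at the end value is appended; the right-hand side is
  continuous along the joined curve, so the junction is a removable exception.\<close>

lemma ode_extend_right:
  fixes z :: "real \<Rightarrow> 'e::euclidean_space"
  assumes f: "open W" "smooth_on W f" and ab: "a < b"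
    and zW: "\<And>s. s \<in> {a..b} \<Longrightarrow> z s \<in> W"
    and dz: "\<And>s. s \<in> {a..b} \<Longrightarrow> (z has_vector_derivative f (z s)) (at s within {a..b})"
  obtains r Z where "r > 0" "\<And>s. s \<in> {a..b + r} \<Longrightarrow> Z s \<in> W"
    "\<And>s. s \<in> {a..b + r} \<Longrightarrow> (Z has_vector_derivative f (Z s)) (at s within {a..b + r})"
    "\<And>s. s \<in> {a..b} \<Longrightarrow> Z s = z s"
proof -
  have "z b \<in> W" using zW ab by simp
  then obtain r w where r: "r > 0" "w 0 = z b" "\<And>t. t \<in> {0..r} \<Longrightarrow> w t \<in> W"
    "\<And>t. t \<in> {0..r} \<Longrightarrow> (w has_vector_derivative f (w t)) (at t within {0..r})"
    using local_ode_solution[OF f] by metis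
  define Z where "Z s = (if s \<le> b then z s else w (s - b))" for s
  have ZW: "Z s \<in> W" if "s \<in> {a..b + r}" for s using that zW r(3) by (auto simp: Z_def)
  have cz: "continuous_on {a..b} z" by (rule has_vector_derivative_on_imp_continuous_on[OF dz])
  have cw: "continuous_on {0..r} w" by (rule has_vector_derivative_on_imp_continuous_on[OF r(4)])
  have "continuous_on ({a..b} \<union> {b..b + r}) Z"
    unfolding Z_def
  proof (rule continuous_on_cases[OF closed_atLeastAtMost closed_atLeastAtMost cz])
    show "continuous_on {b..b + r} (\<lambda>s. w (s - b))"
      by (rule continuous_on_compose2[OF cw]) (auto intro!: continuous_intros)
  qed (auto simp: r(2) intro: arg_cong[where f = w])
  moreover have "{a..b} \<union> {b..b + r} = {a..b + r}" using ab r(1) by auto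
  ultimately have cZ: "continuous_on {a..b + r} Z" by simp
  have cf: "continuous_on W f" by (rule smooth_on_continuous[OF f(2)])
  have cfZ: "continuous_on {a..b + r} (\<lambda>s. f (Z s))" by (rule continuous_on_compose2[OF cf cZ]) (use ZW in auto)
  have dZ: "(Z has_vector_derivative f (Z s)) (at s)" if s: "s \<in> {a<..<b + r} - {b}" for s
  proof (cases "s < b")
    case True
    then have sI: "s \<in> {a<..<b}" using s by simp
    have "(z has_vector_derivative f (z s)) (at s)" using dz[of s] sI at_within_Icc_at[of a s b] by simp
    then have "(Z has_vector_derivative f (z s)) (at s)"
      by (rule has_vector_derivative_transform_within_open[OF _ open_greaterThanLessThan sI]) (simp add: Z_def)
    then show ?thesis using sI by (simp add: Z_def)
  next
    case False
    then have sI: "s \<in> {b<..<b + r}" using s by auto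
    have "(w has_vector_derivative f (w (s - b))) (at (s - b))" using r(4)[of "s - b"] sI at_within_Icc_at[of 0 "s - b" r] by simp
    moreover have "((\<lambda>s. s - b) has_vector_derivative 1) (at s)"
      unfolding has_real_derivative_iff_has_vector_derivative[symmetric] by (auto intro!: derivative_eq_intros)
    ultimately have "((\<lambda>s. w (s - b)) has_vector_derivative f (w (s - b))) (at s)"
      using vector_diff_chain_at[of "\<lambda>s. s - b" 1 s w "f (w (s - b))"] by (simp add: o_def)
    then have "(Z has_vector_derivative f (w (s - b))) (at s)"
      by (rule has_vector_derivative_transform_within_open[OF _ open_greaterThanLessThan sI]) (simp add: Z_def)
    then show ?thesis using sI by (simp add: Z_def)
  qed
  show ?thesis
  proof (rule that[OF r(1) ZW])
    show "(Z has_vector_derivative f (Z s)) (at s within {a..b + r})" if "s \<in> {a..b + r}" for s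
      by (rule ode_from_finite_exceptions[of "{b}", OF _ cZ cfZ dZ that]) simp_all
  qed (auto simp: Z_def)
qed

text \<open>Smoothness on a closed interval means local smooth extension to open sets, so the
  solution is continued past both ends: on the right directly, on the left by reversing time and the
  sign of the field. Bootstrapping then gives smoothness.\<close>

lemma ode_extend:
  fixes z :: "real \<Rightarrow> 'e::euclidean_space"
  assumes f: "open W" "smooth_on W f" and ab: "a < b"
    and zW: "\<And>s. s \<in> {a..b} \<Longrightarrow> z s \<in> W"
    and dz: "\<And>s. s \<in> {a..b} \<Longrightarrow> (z has_vector_derivative f (z s)) (at s within {a..b})"
  obtains r h where "r > 0" "smooth_on {a - r<..<b + r} h" "\<And>s. s \<in> {a..b} \<Longrightarrow> h s = z s"
proof -
  obtain r Z where r: "r > 0" "\<And>s. s \<in> {a..b + r} \<Longrightarrow> Z s \<in> W"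
    "\<And>s. s \<in> {a..b + r} \<Longrightarrow> (Z has_vector_derivative f (Z s)) (at s within {a..b + r})"
    "\<And>s. s \<in> {a..b} \<Longrightarrow> Z s = z s"
    using ode_extend_right[OF f ab zW dz] by metis
  let ?a = "- (b + r)" and ?b = "- a" and ?f = "\<lambda>x. - f x" and ?z = "\<lambda>s. Z (- s)"
  have f': "smooth_on W ?f" by (rule smooth_on_minus[OF f])
  have ab': "?a < ?b" using ab r(1) by simp
  have zW': "?z s \<in> W" if "s \<in> {?a..?b}" for s using r(2)[of "- s"] that by auto
  have dz': "(?z has_vector_derivative ?f (?z s)) (at s within {?a..?b})" if s: "s \<in> {?a..?b}" for s
  proof -
    have "((\<lambda>s. - s) has_vector_derivative - 1) (at s within {?a..?b})"
      unfolding has_real_derivative_iff_has_vector_derivative[symmetric] by (auto intro!: derivative_eq_intros)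
    moreover have im: "uminus ` {?a..?b} = {a..b + r}" by (simp add: add.commute)
    then have "(Z has_vector_derivative f (Z (- s))) (at (- s) within uminus ` {?a..?b})"
      unfolding im using r(3)[of "- s"] s by simp
    ultimately have "(Z \<circ> uminus has_vector_derivative - 1 *\<^sub>R f (Z (- s))) (at s within {?a..?b})"
      by (rule vector_diff_chain_within)
    then show ?thesis by (simp add: o_def)
  qed
  obtain r' Z' where r': "r' > 0" "\<And>s. s \<in> {?a..?b + r'} \<Longrightarrow> Z' s \<in> W"
    "\<And>s. s \<in> {?a..?b + r'} \<Longrightarrow> (Z' has_vector_derivative ?f (Z' s)) (at s within {?a..?b + r'})"
    "\<And>s. s \<in> {?a..?b} \<Longrightarrow> Z' s = ?z s"
    using ode_extend_right[OF f(1) f' ab' zW' dz'] by metis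
  define h where "h s = Z' (- s)" for s
  let ?I = "{a - r'<..<b + r}"
  have dh: "(h has_vector_derivative f (h s)) (at s)" if s: "s \<in> ?I" for s
  proof -
    have "(Z' has_vector_derivative ?f (Z' (- s))) (at (- s))"
      using r'(3)[of "- s"] s at_within_Icc_at[of ?a "- s" "?b + r'"] by auto
    moreover have "((\<lambda>s. - s) has_vector_derivative - 1) (at s)"
      unfolding has_real_derivative_iff_has_vector_derivative[symmetric] by (auto intro!: derivative_eq_intros)
    ultimately have "(Z' \<circ> uminus has_vector_derivative - 1 *\<^sub>R ?f (Z' (- s))) (at s)" by (intro vector_diff_chain_at)
    then show ?thesis by (simp add: o_def h_def[abs_def])
  qed
  have hW: "h ` ?I \<subseteq> W" using r'(2) by (auto simp: h_def)
  have sm: "smooth_on ?I h" by (rule smooth_ode_solution[OF f open_greaterThanLessThan hW dh])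
  have "smooth_on {a - min r r'<..<b + min r r'} h" by (rule smooth_on_subset[OF sm]) auto
  moreover have "h s = z s" if "s \<in> {a..b}" for s using r'(4)[of "- s"] r(4)[OF that] that r(1) by (simp add: h_def)
  ultimately show ?thesis using that[of "min r r'" h] r(1) r'(1) by simp
qed

context rk_manifold
begin

text \<open>The counterpart of \<open>momentum_lift\<close> at parameter 0, with the speed
  \<open>c0\<close> and the dual norm \<kappa> separated, because the limit momentum is known only
  up to scaling and \<kappa> may be 0.\<close>

definition limit_lift :: "real \<Rightarrow> real \<Rightarrow> (real \<Rightarrow> 'a) \<Rightarrow> ('a, 'b) chart \<Rightarrow> real \<Rightarrow> real \<Rightarrow> (real \<Rightarrow> 'b) \<Rightarrow> bool" where
  "limit_lift c0 \<kappa> \<sigma> c a b \<pi> \<longleftrightarrow> (\<forall>s\<in>{a..b}. \<sigma> s \<in> fst c \<and> \<pi> s \<noteq> 0 \<and> rk_chart.Fs (Gc c) (wc c) (lc c) 0 (snd c (\<sigma> s)) (\<pi> s) = \<kappa> \<and>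
       ((snd c \<circ> \<sigma>) has_vector_derivative c0 *\<^sub>R rk_chart.V1 (Gc c) (wc c) (lc c) 0 (snd c (\<sigma> s)) (\<pi> s)) (at s within {a..b}) \<and>
       (\<pi> has_vector_derivative c0 *\<^sub>R rk_chart.B1 (Gc c) (wc c) (lc c) 0 (snd c (\<sigma> s)) (\<pi> s)) (at s within {a..b}))"

text \<open>Equicontinuity keeps almost all curves in one compact chart ball during a fixed time
  window around \<open>s0\<close>; there \<open>ode_limit\<close> applies.\<close>

lemma local_limit:
  assumes mc: "\<And>n. momentum_curve (\<mu> n) (k n) (\<sigma> n)" and k: "\<And>n. k n > 0" "k \<longlonglongrightarrow> c0"
    and eps: "\<And>n. \<mu> n \<in> {0..1}" "\<mu> \<longlonglongrightarrow> 0" and eq: "equicontinuous_family (range \<sigma>)"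
    and lim: "\<And>s. s \<in> {0..1} \<Longrightarrow> (\<lambda>n. \<sigma> n s) \<longlonglongrightarrow> \<sigma>0 s"
    and s0: "s0 \<in> {0..1}" and c: "c \<in> charts_at At (\<sigma>0 s0)"
  obtains \<rho> \<kappa> \<pi> where "\<rho> > 0" "\<kappa> \<ge> 0" "limit_lift c0 \<kappa> \<sigma>0 c (max 0 (s0 - \<rho>)) (min 1 (s0 + \<rho>)) \<pi>"
proof -
  have cA: "c \<in> At" using charts_atD[OF c] by simp
  interpret C: rk_chart "img c" "Gc c" "wc c" "lc c" by (rule chart_rk[OF cA])
  obtain r where r: "r > 0" "cball (snd c (\<sigma>0 s0)) r \<subseteq> img c" "cinv c ` cball (snd c (\<sigma>0 s0)) r \<subseteq> UNIV"
    using chart_ball[OF c open_UNIV UNIV_I] .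
  let ?B = "cball (snd c (\<sigma>0 s0)) r"
  note nb = chart_ball_nbhd[OF c r(1,2)]
  obtain V d where V: "open V" "\<sigma>0 s0 \<in> V" "d > 0"
    "\<forall>\<gamma>\<in>range \<sigma>. \<forall>s\<in>{0..1}. \<forall>t\<in>{0..1}. \<bar>t - s\<bar> < d \<longrightarrow> \<gamma> s \<in> V \<longrightarrow> \<gamma> t \<in> cinv c ` ball (snd c (\<sigma>0 s0)) r"
    using eq[unfolded equicontinuous_family_def, rule_format, OF nb(1,2)] by blast
  have "\<forall>\<^sub>F n in sequentially. \<sigma> n s0 \<in> V" by (rule topological_tendstoD[OF lim[OF s0] V(1,2)])
  then obtain N where N: "\<And>n. n \<ge> N \<Longrightarrow> \<sigma> n s0 \<in> V" by (auto simp: eventually_sequentially)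
  \<comment> \<open>Half of \<open>d\<close>, so that the closed window satisfies the strict bound
    of equicontinuity.\<close>
  define \<rho> where "\<rho> = d / 2"
  have \<rho>: "\<rho> > 0" "\<rho> < d" using V(3) by (auto simp: \<rho>_def)
  define a b where "a = max 0 (s0 - \<rho>)" and "b = min 1 (s0 + \<rho>)"
  have ab: "0 \<le> a" "a < b" "b \<le> 1" using s0 \<rho> by (auto simp: a_def b_def)
  have inB: "\<sigma> (n + N) s \<in> cinv c ` ?B" if s: "s \<in> {a..b}" for n s
  proof -
    have "s \<in> {0..1}" "\<bar>s - s0\<bar> < d" using s ab \<rho> by (auto simp: a_def b_def)
    then have "\<sigma> (n + N) s \<in> cinv c ` ball (snd c (\<sigma>0 s0)) r" using V(4) s0 N[of "n + N"] by auto
    then show ?thesis using ball_subset_cball by blast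
  qed
  have inB': "snd c x \<in> ?B \<and> x \<in> fst c" if x: "x \<in> cinv c ` ?B" for x
  proof -
    obtain p where p: "p \<in> ?B" "x = cinv c p" using x by blast
    have "p \<in> img c" using p(1) r(2) by blast
    then show ?thesis using chart_cinv[OF cA, of p] cinv_in[OF cA, of p] p by simp
  qed
  have \<sigma>0B: "\<sigma>0 s \<in> cinv c ` ?B" if s: "s \<in> {a..b}" for s
  proof (rule Lim_in_closed_set[OF nb(3) _ sequentially_bot])
    have "s \<in> {0..1}" using s ab by auto
    from LIMSEQ_ignore_initial_segment[OF lim[OF this], of N] show "(\<lambda>n. \<sigma> (n + N) s) \<longlonglongrightarrow> \<sigma>0 s" .
  qed (use inB[OF s] in simp)
  have ylim: "(\<lambda>n. snd c (\<sigma> (n + N) s)) \<longlonglongrightarrow> snd c (\<sigma>0 s)" if s: "s \<in> {a..b}" for s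
  proof (rule continuous_on_tendsto_compose[OF chart_continuous[OF cA]])
    have "s \<in> {0..1}" using s ab by auto
    from LIMSEQ_ignore_initial_segment[OF lim[OF this], of N] show "(\<lambda>n. \<sigma> (n + N) s) \<longlonglongrightarrow> \<sigma>0 s" .
    show "\<sigma>0 s \<in> fst c" using inB'[OF \<sigma>0B[OF s]] by simp
    show "\<forall>\<^sub>F n in sequentially. \<sigma> (n + N) s \<in> fst c" using inB'[OF inB[OF s]] by simp
  qed
  have "\<exists>P. momentum_lift (\<mu> (n + N)) (k (n + N)) (\<sigma> (n + N)) c a b P" for n
  proof -
    have "\<sigma> (n + N) ` {a..b} \<subseteq> fst c" using inB' inB by blast
    then show ?thesis using mc[of "n + N"] k(1)[of "n + N"] cA ab unfolding momentum_curve_def by blast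
  qed
  then obtain P where P: "\<And>n. momentum_lift (\<mu> (n + N)) (k (n + N)) (\<sigma> (n + N)) c a b (P n)" by metis
  show ?thesis
  proof (rule C.ode_limit[of a b ?B "\<lambda>n. snd c \<circ> \<sigma> (n + N)" P "\<lambda>n. \<mu> (n + N)" "\<lambda>n. k (n + N)" c0 "snd c \<circ> \<sigma>0"])
    fix n s assume s: "s \<in> {a..b}"
    note p = P[of n, unfolded momentum_lift_def, THEN bspec, OF s]
    show "P n s \<noteq> 0" using p by (elim conjE)
    show "C.Fs (\<mu> (n + N)) ((snd c \<circ> \<sigma> (n + N)) s) (P n s) = k (n + N)" unfolding comp_apply using p by (elim conjE)
    show "(snd c \<circ> \<sigma> (n + N) has_vector_derivative k (n + N) *\<^sub>R C.V1 (\<mu> (n + N)) ((snd c \<circ> \<sigma> (n + N)) s) (P n s)) (at s within {a..b})"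
      unfolding comp_apply[of "snd c" "\<sigma> (n + N)" s] using p by (elim conjE)
    show "(P n has_vector_derivative k (n + N) *\<^sub>R C.B1 (\<mu> (n + N)) ((snd c \<circ> \<sigma> (n + N)) s) (P n s)) (at s within {a..b})"
      unfolding comp_apply[of "snd c" "\<sigma> (n + N)" s] using p by (elim conjE)
    show "(snd c \<circ> \<sigma> (n + N)) s \<in> ?B" using inB'[OF inB[OF s]] by simp
  next
    fix s assume s: "s \<in> {a..b}"
    show "(\<lambda>n. (snd c \<circ> \<sigma> (n + N)) s) \<longlonglongrightarrow> (snd c \<circ> \<sigma>0) s" using ylim[OF s] by simp
  next
    show "(\<lambda>n. \<mu> (n + N)) \<longlonglongrightarrow> 0" by (rule LIMSEQ_ignore_initial_segment[OF eps(2)])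
    show "(\<lambda>n. k (n + N)) \<longlonglongrightarrow> c0" by (rule LIMSEQ_ignore_initial_segment[OF k(2)])
  next
    fix \<pi> \<kappa>
    assume \<kappa>: "\<kappa> \<ge> (0::real)" and \<pi>: "\<And>s. s \<in> {a..b} \<Longrightarrow> (snd c \<circ> \<sigma>0) s \<in> ?B \<and> \<pi> s \<noteq> 0 \<and> C.Fs 0 ((snd c \<circ> \<sigma>0) s) (\<pi> s) = \<kappa> \<and>
       (snd c \<circ> \<sigma>0 has_vector_derivative c0 *\<^sub>R C.V1 0 ((snd c \<circ> \<sigma>0) s) (\<pi> s)) (at s within {a..b}) \<and>
       (\<pi> has_vector_derivative c0 *\<^sub>R C.B1 0 ((snd c \<circ> \<sigma>0) s) (\<pi> s)) (at s within {a..b})"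
    have "limit_lift c0 \<kappa> \<sigma>0 c a b \<pi>"
      unfolding limit_lift_def
    proof
      fix s assume s: "s \<in> {a..b}"
      have "\<sigma>0 s \<in> fst c" using inB'[OF \<sigma>0B[OF s]] by simp
      then show "\<sigma>0 s \<in> fst c \<and> \<pi> s \<noteq> 0 \<and> C.Fs 0 (snd c (\<sigma>0 s)) (\<pi> s) = \<kappa> \<and>
       (snd c \<circ> \<sigma>0 has_vector_derivative c0 *\<^sub>R C.V1 0 (snd c (\<sigma>0 s)) (\<pi> s)) (at s within {a..b}) \<and>
       (\<pi> has_vector_derivative c0 *\<^sub>R C.B1 0 (snd c (\<sigma>0 s)) (\<pi> s)) (at s within {a..b})"
        using \<pi>[OF s] unfolding comp_apply[of "snd c" \<sigma>0 s] by (elim conjE, intro conjI)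
    qed
    then show thesis unfolding a_def b_def by (rule that[OF \<rho>(1) \<kappa>])
  qed (use ab r k(1)[THEN less_imp_le] eps(1) in auto)
qed

lemma at_within_window:
  fixes s s0 \<rho> :: real
  assumes "\<bar>s - s0\<bar> < \<rho>"
  shows "at s within {max 0 (s0 - \<rho>)..min 1 (s0 + \<rho>)} = at s within {0..1}"
  by (rule at_within_nhd[of s "{s0 - \<rho><..<s0 + \<rho>}"]) (use assms in auto)

text \<open>If \<kappa> = 0, then \<open>V1\<close> vanishes by \<open>V1_zero\<close>; if
  \<open>c0 = 0\<close>, the equation has zero right-hand side. In either case the coordinates have
  derivative 0.\<close>

lemma limit_lift_zero:
  assumes lift: "limit_lift c0 \<kappa> \<sigma> c a b \<pi>" and c: "c \<in> At" and 0: "\<kappa> = 0 \<or> c0 = 0" and s: "s \<in> {a..b}" "t \<in> {a..b}"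
  shows "\<sigma> s = \<sigma> t" "\<kappa> = 0 \<Longrightarrow> \<Lambda> (\<sigma> s) = 0"
proof -
  interpret C: rk_chart "img c" "Gc c" "wc c" "lc c" by (rule chart_rk[OF c])
  note L = lift[unfolded limit_lift_def, THEN bspec]
  have in_c: "\<sigma> r \<in> fst c" if "r \<in> {a..b}" for r using L[OF that] by (elim conjE)
  have V0: "c0 *\<^sub>R C.V1 0 (snd c (\<sigma> r)) (\<pi> r) = 0 \<and> (\<kappa> = 0 \<longrightarrow> lc c (snd c (\<sigma> r)) = 0)" if r: "r \<in> {a..b}" for r
  proof (cases "\<kappa> = 0")
    case True
    have "snd c (\<sigma> r) \<in> img c" using in_c[OF r] by simp
    moreover have "\<pi> r \<noteq> 0" "C.Fs 0 (snd c (\<sigma> r)) (\<pi> r) = 0" using L[OF r] True by auto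
    ultimately show ?thesis using C.V1_zero[of "snd c (\<sigma> r)" "\<pi> r" 0] by simp
  next
    case False then show ?thesis using 0 by simp
  qed
  have "(snd c \<circ> \<sigma> has_vector_derivative 0) (at r within {a..b})" if r: "r \<in> {a..b}" for r
  proof -
    have "(snd c \<circ> \<sigma> has_vector_derivative c0 *\<^sub>R C.V1 0 (snd c (\<sigma> r)) (\<pi> r)) (at r within {a..b})" using L[OF r] by (elim conjE)
    then show ?thesis unfolding conjunct1[OF V0[OF r]] .
  qed
  then have "(snd c \<circ> \<sigma>) s = (snd c \<circ> \<sigma>) t" using s by (rule zero_derivative_constant)
  then have "cinv c (snd c (\<sigma> s)) = cinv c (snd c (\<sigma> t))" by simp
  then show "\<sigma> s = \<sigma> t" unfolding cinv_chart[OF c in_c[OF s(1)]] cinv_chart[OF c in_c[OF s(2)]] .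
  show "\<Lambda> (\<sigma> s) = 0" if "\<kappa> = 0"
    using V0[OF s(1)] that cinv_chart[OF c in_c[OF s(1)]] by (simp add: lc_def)
qed

text \<open>With both numbers positive the coordinate velocity \<open>c0\<close> times
  \<open>V1\<close> is nonzero, so the curve cannot rest. This is how local descriptions in
  different charts, whose \<kappa> are not comparable, are forced to agree on being
  degenerate.\<close>

lemma limit_lift_moving:
  assumes lift: "limit_lift c0 \<kappa> \<sigma> c (max 0 (s0 - \<rho>)) (min 1 (s0 + \<rho>)) \<pi>" and c: "c \<in> At" and pos: "\<kappa> > 0" "c0 > 0"
    and s: "s \<in> {0..1}" "\<bar>s - s0\<bar> < \<rho>" and d: "d > 0" "\<And>t. t \<in> {0..1} \<Longrightarrow> \<bar>t - s\<bar> < d \<Longrightarrow> \<sigma> t = \<sigma> s"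
  shows False
proof -
  interpret C: rk_chart "img c" "Gc c" "wc c" "lc c" by (rule chart_rk[OF c])
  have sJ: "s \<in> {max 0 (s0 - \<rho>)..min 1 (s0 + \<rho>)}" using s by auto
  note L = lift[unfolded limit_lift_def, THEN bspec, OF sJ, unfolded at_within_window[OF s(2)]]
  have d1: "(snd c \<circ> \<sigma> has_vector_derivative c0 *\<^sub>R C.V1 0 (snd c (\<sigma> s)) (\<pi> s)) (at s within {0..1})" using L by (elim conjE)
  have "((\<lambda>_. snd c (\<sigma> s)) has_vector_derivative 0) (at s within {0..1})" by (rule has_vector_derivative_const)
  then have d2: "(snd c \<circ> \<sigma> has_vector_derivative 0) (at s within {0..1})"
    by (rule has_vector_derivative_transform_within[OF _ d(1) s(1)]) (use d(2) in \<open>force simp: dist_real_def\<close>)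
  have "c0 *\<^sub>R C.V1 0 (snd c (\<sigma> s)) (\<pi> s) = 0"
    by (rule vector_derivative_unique_within[OF at_within_nontrivial[OF _ s(1)] d1 d2]) simp
  moreover have "C.V1 0 (snd c (\<sigma> s)) (\<pi> s) \<noteq> 0"
    by (rule C.V1_Omega(4)[of _ _ _ c0]) (use L pos in auto)
  ultimately show False using pos(2) by simp
qed

definition regular_limit :: "real \<Rightarrow> (real \<Rightarrow> 'a) \<Rightarrow> bool" where
  "regular_limit c0 \<sigma> \<longleftrightarrow> (\<forall>s0\<in>{0..1}. \<exists>c\<in>charts_at At (\<sigma> s0). \<exists>\<rho>>0. \<exists>\<kappa>>0. \<exists>\<pi>.
     limit_lift c0 \<kappa> \<sigma> c (max 0 (s0 - \<rho>)) (min 1 (s0 + \<rho>)) \<pi>)"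

text \<open>Points near which the limit is degenerate form an open and closed set of parameters.\<close>

lemma limit_alternative:
  assumes c0: "c0 > 0"
    and loc: "\<And>s0. s0 \<in> {0..1} \<Longrightarrow> \<exists>c\<in>charts_at At (\<sigma> s0). \<exists>\<rho>>0. \<exists>\<kappa>\<ge>0. \<exists>\<pi>.
      limit_lift c0 \<kappa> \<sigma> c (max 0 (s0 - \<rho>)) (min 1 (s0 + \<rho>)) \<pi>"
  shows "regular_limit c0 \<sigma> \<or> \<sigma> 0 = \<sigma> 1 \<and> \<Lambda> (\<sigma> 0) = 0"
proof -
  \<comment> \<open>Degeneracy is expressed through the curve alone, resting at a zero of \<Lambda>,
    because \<kappa> depends on the chart and on the normalisation.\<close>
  define Z where "Z s \<longleftrightarrow> (\<exists>d>0. \<forall>t\<in>{0..1}. \<bar>t - s\<bar> < d \<longrightarrow> \<sigma> t = \<sigma> s \<and> \<Lambda> (\<sigma> t) = 0)" for s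
  have Z0: "Z s" if lift: "limit_lift c0 0 \<sigma> c (max 0 (x - \<rho>)) (min 1 (x + \<rho>)) \<pi>" "c \<in> At" and s: "s \<in> {0..1}" "\<bar>s - x\<bar> < \<rho>" for c \<rho> \<pi> x s
    unfolding Z_def
  proof (rule exI[of _ "\<rho> - \<bar>s - x\<bar>"], intro conjI ballI impI)
    fix t assume t: "t \<in> {0..1}" "\<bar>t - s\<bar> < \<rho> - \<bar>s - x\<bar>"
    have J: "t \<in> {max 0 (x - \<rho>)..min 1 (x + \<rho>)}" "s \<in> {max 0 (x - \<rho>)..min 1 (x + \<rho>)}" using s t by auto
    show "\<sigma> t = \<sigma> s" "\<Lambda> (\<sigma> t) = 0" using limit_lift_zero[OF lift _ J] by blast+
  qed (use s in simp)
  have Z1: "\<not> Z s" if lift: "limit_lift c0 \<kappa> \<sigma> c (max 0 (x - \<rho>)) (min 1 (x + \<rho>)) \<pi>" "c \<in> At" "\<kappa> > 0" and s: "s \<in> {0..1}" "\<bar>s - x\<bar> < \<rho>" for c \<rho> \<pi> \<kappa> x s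
  proof
    assume "Z s"
    then obtain d where "d > 0" "\<And>t. t \<in> {0..1} \<Longrightarrow> \<bar>t - s\<bar> < d \<Longrightarrow> \<sigma> t = \<sigma> s" unfolding Z_def by blast
    then show False by (rule limit_lift_moving[OF lift(1,2,3) c0 s])
  qed
  let ?Q = "\<lambda>u v. (\<forall>s\<in>{u..v}. Z s) \<or> (\<forall>s\<in>{u..v}. \<not> Z s)"
  have "?Q 0 1"
  proof (rule Bolzano_within[of 0 1 ?Q])
    fix u v w :: real assume Q: "?Q u v" "?Q v w" and uvw: "u \<le> v" "v \<le> w"
    have split: "{u..w} = {u..v} \<union> {v..w}" using uvw by auto
    have "v \<in> {u..v}" "v \<in> {v..w}" using uvw by auto
    then show "?Q u w" unfolding split using Q by blast
  next
    fix x :: real assume "0 \<le> x" "x \<le> 1"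
    then have x: "x \<in> {0..1}" by simp
    obtain c \<rho> \<kappa> \<pi> where l: "c \<in> charts_at At (\<sigma> x)" "\<rho> > 0" "\<kappa> \<ge> 0" "limit_lift c0 \<kappa> \<sigma> c (max 0 (x - \<rho>)) (min 1 (x + \<rho>)) \<pi>"
      using loc[OF x] by blast
    have cA: "c \<in> At" using charts_atD[OF l(1)] by simp
    have "?Q u v" if uv: "0 \<le> u" "u \<le> x" "x \<le> v" "v \<le> 1" "v - u < \<rho>" for u v
    proof (cases "\<kappa> = 0")
      case True
      have "\<forall>s\<in>{u..v}. Z s" using Z0[OF l(4)[unfolded True] cA] uv by auto
      then show ?thesis ..
    next
      case False
      then have "\<kappa> > 0" using l(3) by simp
      from Z1[OF l(4) cA this] have "\<forall>s\<in>{u..v}. \<not> Z s" using uv by auto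
      then show ?thesis ..
    qed
    then show "\<exists>d>0. \<forall>u v. 0 \<le> u \<and> u \<le> x \<and> x \<le> v \<and> v \<le> 1 \<and> v - u < d \<longrightarrow> ?Q u v"
      using l(2) by blast
  qed simp
  then show ?thesis
  proof
    assume all: "\<forall>s\<in>{0..1}. Z s"
    have "\<sigma> 0 = \<sigma> 1"
    proof (rule Bolzano_within[of 0 1 "\<lambda>u v. \<sigma> u = \<sigma> v"])
      fix x :: real assume "0 \<le> x" "x \<le> 1"
      then have "Z x" using all by simp
      then obtain d where d: "d > 0" "\<forall>t\<in>{0..1}. \<bar>t - x\<bar> < d \<longrightarrow> \<sigma> t = \<sigma> x \<and> \<Lambda> (\<sigma> t) = 0" unfolding Z_def by blast
      have "\<sigma> u = \<sigma> v" if uv: "0 \<le> u \<and> u \<le> x \<and> x \<le> v \<and> v \<le> 1 \<and> v - u < d" for u v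
      proof -
        have "\<sigma> u = \<sigma> x" "\<sigma> v = \<sigma> x" using d(2)[THEN bspec, of u] d(2)[THEN bspec, of v] uv by auto
        then show ?thesis by (simp only:)
      qed
      then show "\<exists>d>0. \<forall>u v. 0 \<le> u \<and> u \<le> x \<and> x \<le> v \<and> v \<le> 1 \<and> v - u < d \<longrightarrow> \<sigma> u = \<sigma> v" using d(1) by blast
    qed (simp_all only: zero_le_one)
    moreover have "Z 0" using all by simp
    then obtain d where d: "d > 0" "\<forall>t\<in>{0..1}. \<bar>t - 0\<bar> < d \<longrightarrow> \<sigma> t = \<sigma> 0 \<and> \<Lambda> (\<sigma> t) = 0" unfolding Z_def by blast
    have "\<Lambda> (\<sigma> 0) = 0" using bspec[OF d(2), of 0] d(1) by auto
    ultimately show ?thesis by blast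
  next
    assume all: "\<forall>s\<in>{0..1}. \<not> Z s"
    have "regular_limit c0 \<sigma>"
      unfolding regular_limit_def
    proof
      fix x :: real assume x: "x \<in> {0..1}"
      obtain c \<rho> \<kappa> \<pi> where l: "c \<in> charts_at At (\<sigma> x)" "\<rho> > 0" "\<kappa> \<ge> 0" "limit_lift c0 \<kappa> \<sigma> c (max 0 (x - \<rho>)) (min 1 (x + \<rho>)) \<pi>"
        using loc[OF x] by blast
      have cA: "c \<in> At" using charts_atD[OF l(1)] by simp
      have "\<kappa> \<noteq> 0"
      proof
        assume "\<kappa> = 0"
        then have "Z x" using Z0[OF l(4)[unfolded \<open>\<kappa> = 0\<close>] cA x] l(2) by simp
        then show False using all x by blast
      qed
      then have "\<kappa> > 0" using l(3) by simp
      then show "\<exists>c\<in>charts_at At (\<sigma> x). \<exists>\<rho>>0. \<exists>\<kappa>>0. \<exists>\<pi>. limit_lift c0 \<kappa> \<sigma> c (max 0 (x - \<rho>)) (min 1 (x + \<rho>)) \<pi>"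
        using l(1,2,4) by blast
    qed
    then show ?thesis ..
  qed
qed

lemma constant_limit:
  assumes loc: "\<And>s0. s0 \<in> {0..1} \<Longrightarrow> \<exists>c\<in>charts_at At (\<sigma> s0). \<exists>\<rho>>0. \<exists>\<kappa>\<ge>0. \<exists>\<pi>.
      limit_lift 0 \<kappa> \<sigma> c (max 0 (s0 - \<rho>)) (min 1 (s0 + \<rho>)) \<pi>" and s: "s \<in> {0..1}"
  shows "\<sigma> 0 = \<sigma> s"
proof (rule Bolzano_within[of 0 s "\<lambda>u v. \<sigma> u = \<sigma> v"])
  fix x assume "0 \<le> x" "x \<le> s"
  then have x: "x \<in> {0..1}" using s by simp
  obtain c \<rho> \<kappa> \<pi> where l: "c \<in> charts_at At (\<sigma> x)" "\<rho> > 0" "limit_lift 0 \<kappa> \<sigma> c (max 0 (x - \<rho>)) (min 1 (x + \<rho>)) \<pi>"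
    using loc[OF x] by blast
  have cA: "c \<in> At" using charts_atD[OF l(1)] by simp
  have "\<sigma> u = \<sigma> v" if uv: "0 \<le> u \<and> u \<le> x \<and> x \<le> v \<and> v \<le> s \<and> v - u < \<rho>" for u v
    by (rule limit_lift_zero(1)[OF l(3) cA]) (use uv s in auto)
  then show "\<exists>d>0. \<forall>u v. 0 \<le> u \<and> u \<le> x \<and> x \<le> v \<and> v \<le> s \<and> v - u < d \<longrightarrow> \<sigma> u = \<sigma> v" using l(2) by blast
qed (use s in simp_all)

text \<open>Adds to \<open>chart_critical\<close> at parameter 0 the speed \<open>c0\<close> and a
  smooth local extension of the coordinate curve; at \<open>s0 = 0\<close> and \<open>s0 = 1\<close>
  this extension reaches beyond [0,1], as smoothness on a closed interval demands.\<close>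

definition extremal_at :: "real \<Rightarrow> (real \<Rightarrow> 'a) \<Rightarrow> real \<Rightarrow> bool" where
  "extremal_at c0 \<sigma> s0 \<longleftrightarrow> (\<exists>c\<in>charts_at At (\<sigma> s0). \<exists>\<rho>>0. \<exists>v P P'.
     (\<forall>s\<in>{0..1}. \<bar>s - s0\<bar> < \<rho> \<longrightarrow> \<sigma> s \<in> fst c \<and>
       (snd c \<circ> \<sigma> has_vector_derivative v s) (at s within {0..1}) \<and> (snd c (\<sigma> s), v s) \<in> Omc c 0 \<and>
       Fc c 0 (snd c (\<sigma> s)) (v s) = c0 \<and>
       (P has_vector_derivative P' s) (at s within {0..1}) \<and> continuous (at s within {0..1}) P' \<and>
       P s = rk_chart.mom (Gc c) (wc c) (lc c) 0 (snd c (\<sigma> s)) (v s) \<and>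
       (\<forall>e. P' s \<bullet> e = rk_chart.DLag (Gc c) (wc c) (lc c) 0 (snd c (\<sigma> s), v s) (e, 0))) \<and>
     (\<exists>W h. open W \<and> s0 \<in> W \<and> smooth_on W h \<and> (\<forall>q\<in>{0..1} \<inter> W. \<sigma> q \<in> fst c \<and> h q = snd c (\<sigma> q))))"

text \<open>A positive dual norm permits the inverse Legendre transform: the velocity is admissible
  for F, has speed \<open>c0\<close>, and its momentum is the limit momentum rescaled. Smoothness
  comes from the Hamiltonian system, whose field is smooth off zero momentum.\<close>

lemma regular_limit_extremal:
  assumes reg: "regular_limit c0 \<sigma>" and c0: "c0 > 0" and s0: "s0 \<in> {0..1}"
  shows "extremal_at c0 \<sigma> s0"
proof -
  obtain c \<rho> \<kappa> \<pi> where l: "c \<in> charts_at At (\<sigma> s0)" "\<rho> > 0" "\<kappa> > 0"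
    and lift: "limit_lift c0 \<kappa> \<sigma> c (max 0 (s0 - \<rho>)) (min 1 (s0 + \<rho>)) \<pi>"
    using bspec[OF reg[unfolded regular_limit_def] s0] by blast
  have cA: "c \<in> At" using charts_atD[OF l(1)] by simp
  interpret C: rk_chart "img c" "Gc c" "wc c" "lc c" by (rule chart_rk[OF cA])
  define a b where "a = max 0 (s0 - \<rho>)" and "b = min 1 (s0 + \<rho>)"
  have ab: "a < b" using s0 l(2) by (auto simp: a_def b_def)
  note L = lift[unfolded limit_lift_def a_def[symmetric] b_def[symmetric], THEN bspec]
  define y where "y = snd c \<circ> \<sigma>"
  have in_c: "\<sigma> s \<in> fst c" and \<pi>0: "\<pi> s \<noteq> 0" and Fs: "C.Fs 0 (y s) (\<pi> s) = \<kappa>"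
    and dy: "(y has_vector_derivative c0 *\<^sub>R C.V1 0 (y s) (\<pi> s)) (at s within {a..b})"
    and d\<pi>: "(\<pi> has_vector_derivative c0 *\<^sub>R C.B1 0 (y s) (\<pi> s)) (at s within {a..b})"
    if "s \<in> {a..b}" for s
    using L[OF that] unfolding y_def comp_apply[of "snd c" \<sigma> s] by blast+
  have yY: "y s \<in> img c" if "s \<in> {a..b}" for s using in_c[OF that] by (simp add: y_def)
  define f where "f z = c0 *\<^sub>R (C.V1 0 (fst z) (snd z), C.B1 0 (fst z) (snd z))" for z
  let ?W = "img c \<times> (- {0 :: 'b})"
  have oW: "open ?W" by (intro open_Times chart_props(2)[OF cA]) auto
  have sf0: "smooth_on ?W (\<lambda>z. (C.V1 0 (fst z) (snd z), C.B1 0 (fst z) (snd z)))" by (rule C.smooth_field) simp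
  have sf: "smooth_on ?W f" unfolding f_def by (rule smooth_on_bounded_linear[OF oW bounded_linear_scaleR_right sf0])
  have zW: "(y s, \<pi> s) \<in> ?W" if "s \<in> {a..b}" for s using yY[OF that] \<pi>0[OF that] by simp
  have dz: "((\<lambda>s. (y s, \<pi> s)) has_vector_derivative f (y s, \<pi> s)) (at s within {a..b})" if "s \<in> {a..b}" for s
    using has_vector_derivative_Pair[OF dy[OF that] d\<pi>[OF that]] by (simp add: f_def)
  obtain r h where h: "r > 0" "smooth_on {a - r<..<b + r} h" "\<And>s. s \<in> {a..b} \<Longrightarrow> h s = (y s, \<pi> s)"
    using ode_extend[OF oW sf ab zW dz] by metis
  have cz: "continuous_on {a..b} (\<lambda>s. (y s, \<pi> s))" by (rule has_vector_derivative_on_imp_continuous_on[OF dz])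
  have "continuous_on {a..b} (\<lambda>s. f (y s, \<pi> s))"
    by (rule continuous_on_compose2[OF smooth_on_continuous[OF sf] cz]) (use zW in auto)
  then have cB: "continuous_on {a..b} (\<lambda>s. c0 *\<^sub>R C.B1 0 (y s) (\<pi> s))"
    using continuous_on_snd by (fastforce simp: f_def)
  define v where "v s = c0 *\<^sub>R C.V1 0 (y s) (\<pi> s)" for s
  \<comment> \<open>The factor restores the dual norm \<open>c0\<close> that a momentum of speed
    \<open>c0\<close> must have; \<open>B1\<close> has degree 1, so the equation is
    preserved.\<close>
  define P where "P s = (c0 / \<kappa>) *\<^sub>R \<pi> s" for s
  define P' where "P' s = (c0 / \<kappa>) *\<^sub>R (c0 *\<^sub>R C.B1 0 (y s) (\<pi> s))" for s
  have main: "\<sigma> s \<in> fst c \<and>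
       (y has_vector_derivative v s) (at s within {0..1}) \<and> (y s, v s) \<in> C.Omega 0 \<and>
       C.F 0 (y s) (v s) = c0 \<and>
       (P has_vector_derivative P' s) (at s within {0..1}) \<and> continuous (at s within {0..1}) P' \<and>
       P s = C.mom 0 (y s) (v s) \<and> (\<forall>e. P' s \<bullet> e = C.DLag 0 (y s, v s) (e, 0))"
    if s: "s \<in> {0..1}" "\<bar>s - s0\<bar> < \<rho>" for s
  proof -
    have sJ: "s \<in> {a..b}" using s by (auto simp: a_def b_def)
    have at: "at s within {a..b} = at s within {0..1}" unfolding a_def b_def by (rule at_within_window[OF s(2)])
    have Fp: "C.Fs 0 (y s) (\<pi> s) > 0" using Fs[OF sJ] l(3) by simp
    note O = C.V1_Omega[OF yY[OF sJ] \<pi>0[OF sJ] order_refl Fp c0, folded v_def, unfolded Fs[OF sJ]]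
    have v0: "v s \<noteq> 0" using O(4) c0 by (simp add: v_def)
    have "(P has_vector_derivative P' s) (at s within {a..b})"
      unfolding P_def P'_def by (rule bounded_linear.has_vector_derivative[OF bounded_linear_scaleR_right d\<pi>[OF sJ]])
    moreover have "continuous (at s within {a..b}) P'"
      unfolding P'_def
      by (rule continuous_scaleR[OF continuous_const bspec[OF cB[unfolded continuous_on_eq_continuous_within] sJ]])
    moreover have "P' s \<bullet> e = C.DLag 0 (y s, v s) (e, 0)" for e
    proof -
      have "c0 / \<kappa> > 0" using c0 l(3) by simp
      then show ?thesis
        unfolding C.DLag_momentum[OF O(1) order_refl v0] O(2,3) C.momentum_scale(2)[OF yY[OF sJ] \<open>c0 / \<kappa> > 0\<close>]
        by (simp add: P'_def)
    qed
    ultimately show ?thesis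
      using in_c[OF sJ] dy[OF sJ] O(1,2,3) unfolding at v_def[symmetric] P_def by simp
  qed
  let ?I = "{a - r<..<b + r} \<inter> {s0 - \<rho><..<s0 + \<rho>}"
  have "smooth_on ?I (\<lambda>s. fst (h s))"
    by (rule smooth_on_bounded_linear[OF _ bounded_linear_fst smooth_on_subset[OF h(2)]]) auto
  moreover have "s0 \<in> ?I" using s0 l(2) h(1) by (auto simp: a_def b_def)
  moreover have "\<sigma> q \<in> fst c \<and> fst (h q) = snd c (\<sigma> q)" if "q \<in> {0..1} \<inter> ?I" for q
  proof -
    have "q \<in> {a..b}" using that by (auto simp: a_def b_def)
    then show ?thesis using in_c h(3) by (simp add: y_def)
  qed
  ultimately have ext: "\<exists>W h. open W \<and> s0 \<in> W \<and> smooth_on W h \<and> (\<forall>q\<in>{0..1} \<inter> W. \<sigma> q \<in> fst c \<and> h q = snd c (\<sigma> q))"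
    by (intro exI[of _ ?I] exI[of _ "\<lambda>s. fst (h s)"]) auto
  show ?thesis
    unfolding extremal_at_def
  proof (rule bexI[OF _ l(1)], rule exI[of _ \<rho>], rule conjI[OF l(2)], rule exI[of _ v], rule exI[of _ P], rule exI[of _ P'],
      rule conjI[OF _ ext], intro ballI impI)
    fix s assume "s \<in> {0..1}" "\<bar>s - s0\<bar> < \<rho>"
    from main[OF this, unfolded y_def comp_apply[of "snd c" \<sigma> s]]
    show "\<sigma> s \<in> fst c \<and>
       (snd c \<circ> \<sigma> has_vector_derivative v s) (at s within {0..1}) \<and> (snd c (\<sigma> s), v s) \<in> C.Omega 0 \<and>
       C.F 0 (snd c (\<sigma> s)) (v s) = c0 \<and>
       (P has_vector_derivative P' s) (at s within {0..1}) \<and> continuous (at s within {0..1}) P' \<and>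
       P s = C.mom 0 (snd c (\<sigma> s)) (v s) \<and> (\<forall>e. P' s \<bullet> e = C.DLag 0 (snd c (\<sigma> s), v s) (e, 0))" .
  qed
qed

text \<open>The local extensions make the curve smooth on all of [0,1], so its one-sided velocities
  are read from one chart and lie in the domain; criticality is then \<open>critical_curve\<close>,
  and constant speed gives the length.\<close>

lemma extremal_geodesic:
  assumes cont: "continuous_on {0..1} \<sigma>"
    and chart: "\<And>s0. s0 \<in> {0..1} \<Longrightarrow> extremal_at c0 \<sigma> s0"
  shows "geodesic_between At (rk_domain At \<omega> \<Lambda>) (rk_metric g0 \<omega> \<Lambda>) (\<sigma> 0) (\<sigma> 1) \<sigma>"
    and "curve_length At (rk_metric g0 \<omega> \<Lambda>) \<sigma> = c0"
proof -
  have "smooth_map At {0..1} \<sigma>"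
  proof (rule smooth_mapI[OF cont])
    fix s :: real assume s: "s \<in> {0..1}"
    from chart[OF s, unfolded extremal_at_def] show "\<exists>c\<in>charts_at At (\<sigma> s). \<exists>W h. open W \<and> s \<in> W \<and> smooth_on W h \<and> (\<forall>q\<in>{0..1} \<inter> W. \<sigma> q \<in> fst c \<and> h q = snd c (\<sigma> q))"
      by (elim bexE exE conjE) (rule bexI[rotated], assumption, rule exI, rule exI, (intro conjI; assumption))
  qed
  then have pw: "piecewise_smooth_curve At \<sigma>"
    by (intro piecewise_smooth_curveI[of "{}"] cont) (auto intro: smooth_map_subset)
  have vel: "\<exists>c\<in>charts_at At (\<sigma> s). \<exists>v. velocity_within At \<sigma> I s = coord_vec At c (\<sigma> s) v \<and> (snd c (\<sigma> s), v) \<in> Omc c 0 \<and> Fc c 0 (snd c (\<sigma> s)) v = c0"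
    if I: "I \<subseteq> {0..1}" "s \<in> I" "at s within I \<noteq> bot" for I s
  proof -
    have s: "s \<in> {0..1}" using I by blast
    obtain c \<rho> v where c: "c \<in> charts_at At (\<sigma> s)" "\<rho> > 0" and cv: "\<forall>r\<in>{0..1}. \<bar>r - s\<bar> < \<rho> \<longrightarrow> \<sigma> r \<in> fst c \<and>
       (snd c \<circ> \<sigma> has_vector_derivative v r) (at r within {0..1}) \<and> (snd c (\<sigma> r), v r) \<in> Omc c 0 \<and> Fc c 0 (snd c (\<sigma> r)) (v r) = c0"
      using chart[OF s, unfolded extremal_at_def] by blast
    note cs = cv[THEN bspec, OF s, THEN mp]
    have cA: "c \<in> At" using charts_atD[OF c(1)] by simp
    have "velocity_within At \<sigma> I s = coord_vec At c (\<sigma> s) (v s)"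
    proof (rule velocity_within_eq[OF cA, of "{s - \<rho><..<s + \<rho>}" s I \<sigma> "snd c \<circ> \<sigma>" "v s"])
      show "(snd c \<circ> \<sigma> has_vector_derivative v s) (at s within I)"
        using cs c(2) by (intro has_vector_derivative_within_subset[OF _ I(1)]) simp
      show "\<sigma> q \<in> fst c \<and> snd c (\<sigma> q) = (snd c \<circ> \<sigma>) q" if "q \<in> I \<inter> {s - \<rho><..<s + \<rho>}" for q
        using cv[THEN bspec, of q] that I(1) by auto
    qed (use I c(2) in auto)
    then show ?thesis using c cs by (intro bexI[of _ c] exI[of _ "v s"]) auto
  qed
  have dom: "(\<sigma> s, velocity_within At \<sigma> I s) \<in> rk_dom 0" if I: "I \<subseteq> {0..1}" "s \<in> I" "at s within I \<noteq> bot" for I s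
  proof -
    obtain c v where c: "c \<in> charts_at At (\<sigma> s)" "velocity_within At \<sigma> I s = coord_vec At c (\<sigma> s) v" "(snd c (\<sigma> s), v) \<in> Omc c 0"
      using vel[OF I] by blast
    show ?thesis unfolding c(2) rk_domain_coord[OF c(1) coord_vec_tangent[OF c(1)] order_refl] coord_vec_self[OF c(1)] by (rule c(3))
  qed
  have curve: "\<sigma> \<in> curves_between At (rk_dom 0) (\<sigma> 0) (\<sigma> 1)"
    unfolding curves_between_def mem_Collect_eq
  proof (intro conjI ballI pw refl)
    fix s :: real assume s: "s \<in> {0<..<1}"
    show "(\<sigma> s, velocity_within At \<sigma> {0..s} s) \<in> rk_dom 0"
      by (rule dom) (use s at_within_nontrivial[of 0 s s] in auto)
    show "(\<sigma> s, velocity_within At \<sigma> {s..1} s) \<in> rk_dom 0"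
      by (rule dom) (use s at_within_nontrivial[of s 1 s] in auto)
  qed
  have crit: "chart_critical 0 \<sigma> s0" if s0: "s0 \<in> {0..1}" for s0
  proof -
    obtain c \<rho> v P P' where c: "c \<in> charts_at At (\<sigma> s0)" "\<rho> > 0" and cv: "\<forall>s\<in>{0..1}. \<bar>s - s0\<bar> < \<rho> \<longrightarrow> \<sigma> s \<in> fst c \<and>
       (snd c \<circ> \<sigma> has_vector_derivative v s) (at s within {0..1}) \<and> (snd c (\<sigma> s), v s) \<in> Omc c 0 \<and>
       Fc c 0 (snd c (\<sigma> s)) (v s) = c0 \<and>
       (P has_vector_derivative P' s) (at s within {0..1}) \<and> continuous (at s within {0..1}) P' \<and>
       P s = rk_chart.mom (Gc c) (wc c) (lc c) 0 (snd c (\<sigma> s)) (v s) \<and>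
       (\<forall>e. P' s \<bullet> e = rk_chart.DLag (Gc c) (wc c) (lc c) 0 (snd c (\<sigma> s), v s) (e, 0))"
      using chart[OF s0, unfolded extremal_at_def] by (elim bexE exE conjE) (rule that)
    show ?thesis
      unfolding chart_critical_def
    proof (rule bexI[OF _ c(1)], rule exI[of _ \<rho>], rule conjI[OF c(2)], rule exI[of _ v], rule exI[of _ P], rule exI[of _ P'], intro ballI impI)
      fix s assume "s \<in> {0..1}" "\<bar>s - s0\<bar> < \<rho>"
      note m = mp[OF bspec[OF cv this(1)] this(2)]
      show "\<sigma> s \<in> fst c \<and> (snd c \<circ> \<sigma> has_vector_derivative v s) (at s within {0..1}) \<and> (snd c (\<sigma> s), v s) \<in> Omc c 0 \<and>
       (P has_vector_derivative P' s) (at s within {0..1}) \<and> continuous (at s within {0..1}) P' \<and>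
       P s = rk_chart.mom (Gc c) (wc c) (lc c) 0 (snd c (\<sigma> s)) (v s) \<and>
       (\<forall>e. P' s \<bullet> e = rk_chart.DLag (Gc c) (wc c) (lc c) 0 (snd c (\<sigma> s), v s) (e, 0))"
        using m by (elim conjE, intro conjI)
    qed
  qed
  show "geodesic_between At (rk_domain At \<omega> \<Lambda>) (rk_metric g0 \<omega> \<Lambda>) (\<sigma> 0) (\<sigma> 1) \<sigma>"
    using critical_curve[OF order_refl curve crit] by simp
  have len: "rk_metric g0 \<omega> \<Lambda> (\<sigma> s) (velocity At \<sigma> s) = c0" if s: "s \<in> {0..1}" for s
  proof -
    obtain c v where c: "c \<in> charts_at At (\<sigma> s)" "velocity At \<sigma> s = coord_vec At c (\<sigma> s) v" "Fc c 0 (snd c (\<sigma> s)) v = c0"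
      using vel[OF order_refl s at_within_nontrivial[OF _ s]] unfolding velocity_def by auto
    have "rk_fun 0 (\<sigma> s) (velocity At \<sigma> s) = c0"
      unfolding c(2) rk_metric_coord[OF c(1) coord_vec_tangent[OF c(1)]] coord_vec_self[OF c(1)] by (rule c(3))
    then show ?thesis by simp
  qed
  show "curve_length At (rk_metric g0 \<omega> \<Lambda>) \<sigma> = c0"
    unfolding curve_length_def by (rule integral_finite_exceptions[of "{}"]) (use len in auto)
qed

text \<open>Where \<Lambda> > 0 the zero vector is admissible, and the Lagrangian has zero
  derivative there, so velocity and momentum 0 fulfil \<open>extremal_at\<close> with
  \<open>c0 = 0\<close>.\<close>

lemma constant_geodesic:
  assumes const: "\<And>s. s \<in> {0..1} \<Longrightarrow> \<sigma> s = x" and \<Lambda>x: "\<Lambda> x > 0"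
  shows "geodesic_between At (rk_domain At \<omega> \<Lambda>) (rk_metric g0 \<omega> \<Lambda>) (\<sigma> 0) (\<sigma> 1) \<sigma>"
    and "curve_length At (rk_metric g0 \<omega> \<Lambda>) \<sigma> = 0"
proof -
  have cont: "continuous_on {0..1} \<sigma>"
    by (rule continuous_on_eq[OF continuous_on_const[of _ x]]) (simp add: const)
  have "extremal_at 0 \<sigma> s0"
    if s0: "s0 \<in> {0..1}" for s0
  proof -
    obtain c where c: "c \<in> charts_at At (\<sigma> s0)" using chart_exists by blast
    have cx: "c \<in> charts_at At x" using c const[OF s0] by simp
    have cA: "c \<in> At" "x \<in> fst c" using charts_atD[OF cx] by auto
    interpret C: rk_chart "img c" "Gc c" "wc c" "lc c" by (rule chart_rk[OF cA(1)])
    have yY: "snd c x \<in> img c" using cA by simp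
    have l: "lc c (snd c x) > 0" using \<Lambda>x metric_coord(3)[OF cx zero_tangent zero_tangent] by simp
    have O: "(snd c x, 0) \<in> C.Omega 0" using l yY by (simp add: C.Omega_def)
    have F0: "C.F 0 (snd c x) 0 = 0" using C.F_scale(1)[OF yY order_refl, of 0 0] by simp
    have D0: "C.DLag 0 (snd c x, 0) (e, 0) = 0" for e unfolding C.DLag_eq[OF yY] F0 by simp
    have d: "(snd c \<circ> \<sigma> has_vector_derivative 0) (at s within {0..1})" if s: "s \<in> {0..1}" for s
      by (rule has_vector_derivative_transform[OF s _ has_vector_derivative_const[of "snd c x"]]) (simp add: const)
    have 1: "\<sigma> s \<in> fst c \<and>
       (snd c \<circ> \<sigma> has_vector_derivative 0) (at s within {0..1}) \<and> (snd c (\<sigma> s), 0) \<in> C.Omega 0 \<and>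
       C.F 0 (snd c (\<sigma> s)) 0 = 0 \<and>
       ((\<lambda>_. 0) has_vector_derivative 0) (at s within {0..1}) \<and> continuous (at s within {0..1}) (\<lambda>_. 0 :: 'b) \<and>
       0 = C.mom 0 (snd c (\<sigma> s)) 0 \<and> (\<forall>e. 0 \<bullet> e = C.DLag 0 (snd c (\<sigma> s), 0) (e, 0))" if s: "s \<in> {0..1}" for s
      unfolding const[OF s] using cA d[OF s] O F0 D0 C.mom_zero[OF yY] by simp
    have 2: "\<exists>W h. open W \<and> s0 \<in> W \<and> smooth_on W h \<and> (\<forall>q\<in>{0..1} \<inter> W. \<sigma> q \<in> fst c \<and> h q = snd c (\<sigma> q))"
      using cA(2) const by (intro exI[of _ UNIV] exI[of _ "\<lambda>_. snd c x"]) (auto intro: smooth_intros)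
    show ?thesis
      unfolding extremal_at_def
      by (rule bexI[OF _ c], rule exI[of _ 1], rule conjI[OF zero_less_one], rule exI[of _ "\<lambda>_. 0"], rule exI[of _ "\<lambda>_. 0"], rule exI[of _ "\<lambda>_. 0"],
        rule conjI[OF _ 2], intro ballI impI, rule 1)
  qed
  note g = extremal_geodesic[OF cont this]
  show "geodesic_between At (rk_domain At \<omega> \<Lambda>) (rk_metric g0 \<omega> \<Lambda>) (\<sigma> 0) (\<sigma> 1) \<sigma>"
    "curve_length At (rk_metric g0 \<omega> \<Lambda>) \<sigma> = 0" by (rule g(1), assumption, rule g(2), assumption)
qed

text \<open>A nonnegative function has a minimum wherever it vanishes.\<close>

lemma differential_zero:
  assumes "\<Lambda> x = 0" shows "differential At \<Lambda> x v = 0"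
proof -
  define c where "c = (SOME c. c \<in> charts_at At x)"
  obtain c' where "c' \<in> charts_at At x" using chart_exists by blast
  then have c: "c \<in> charts_at At x" unfolding c_def by (rule someI)
  then have cA: "c \<in> At" "x \<in> fst c" using charts_atD by auto
  interpret C: rk_chart "img c" "Gc c" "wc c" "lc c" by (rule chart_rk[OF cA(1)])
  have y: "snd c x \<in> img c" using cA by simp
  have lc: "lc c = \<Lambda> \<circ> inv_into (fst c) (snd c)" by (simp add: fun_eq_iff lc_def cinv_def)
  have "(lc c has_derivative frechet_derivative (lc c) (at (snd c x))) (at (snd c x))"
    by (rule smooth_onD(1)[OF C.l_smooth y])
  moreover have "\<forall>y\<in>img c. lc c (snd c x) \<le> lc c y"
    using assms \<Lambda>_nonneg cinv_chart[OF cA] by (auto simp: lc_def)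
  ultimately have "frechet_derivative (lc c) (at (snd c x)) = (\<lambda>v. 0)"
    by (intro differential_zero_maxmin[OF y chart_props(2)[OF cA(1)]]) auto
  then show ?thesis by (simp add: differential_def c_def[symmetric] lc[symmetric])
qed

text \<open>Constant speed \<open>k\<close> off a finite set makes the energy
  \<open>k\<^sup>2 / 2\<close> and the length \<open>k\<close>. The energy bound thus becomes a
  speed bound, and convergence of lengths becomes convergence of speeds.\<close>

lemma geodesic_momentum_curve:
  assumes eps: "\<mu> > 0" and geo: "geodesic_between At (tangent_bundle At) (randers_metric g0 \<omega> \<Lambda> \<mu>) x0 x1 \<sigma>"
  shows "\<exists>k\<ge>0. momentum_curve \<mu> k \<sigma> \<and> energy At (randers_metric g0 \<omega> \<Lambda> \<mu>) \<sigma> = k\<^sup>2 / 2 \<and>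
    curve_length At (randers_metric g0 \<omega> \<Lambda> \<mu>) \<sigma> = k \<and>
    (\<forall>\<mu>'\<ge>\<mu>. \<forall>a b. 0 \<le> a \<longrightarrow> a < b \<longrightarrow> b \<le> 1 \<longrightarrow> path_dist At (randers_metric g0 \<omega> \<Lambda> \<mu>') (\<sigma> a) (\<sigma> b) \<le> k)"
proof (rule geodesic_global[OF eps geo])
  fix k S
  assume k: "k \<ge> 0" and S: "finite S"
    "\<And>s. s \<in> {0..1} - S \<Longrightarrow> velocity At \<sigma> s \<in> tangent_space At (\<sigma> s) \<and> randers_metric g0 \<omega> \<Lambda> \<mu> (\<sigma> s) (velocity At \<sigma> s) = k"
    and lift: "\<And>c a b. k > 0 \<Longrightarrow> c \<in> At \<Longrightarrow> 0 \<le> a \<Longrightarrow> a < b \<Longrightarrow> b \<le> 1 \<Longrightarrow> \<sigma> ` {a..b} \<subseteq> fst c \<Longrightarrow> \<exists>P. momentum_lift \<mu> k \<sigma> c a b P"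
    and const: "\<And>s. k = 0 \<Longrightarrow> s \<in> {0..1} \<Longrightarrow> \<sigma> s = x0"
  have pw: "piecewise_smooth_curve At \<sigma>" using geo by (simp add: geodesic_between_def curves_between_tangent)
  have "momentum_curve \<mu> k \<sigma>"
    unfolding momentum_curve_def
  proof (intro conjI impI ballI allI)
    show "continuous_on {0..1} \<sigma>" using pw by (simp add: piecewise_smooth_curve_def)
    show "\<sigma> s = \<sigma> 0" if "k = 0" "s \<in> {0..1}" for s
      using const[OF that] const[OF that(1), of 0] by simp
  qed (fact k, rule lift)
  moreover have "energy At (randers_metric g0 \<omega> \<Lambda> \<mu>) \<sigma> = k\<^sup>2 / 2"
    unfolding energy_def by (subst integral_finite_exceptions[OF S(1), of _ "k\<^sup>2"]) (use S(2) in auto)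
  moreover have "curve_length At (randers_metric g0 \<omega> \<Lambda> \<mu>) \<sigma> = k"
    unfolding curve_length_def by (rule integral_finite_exceptions[OF S(1)]) (use S(2) in auto)
  moreover have "path_dist At (randers_metric g0 \<omega> \<Lambda> \<mu>') (\<sigma> a) (\<sigma> b) \<le> k"
    if "\<mu>' \<ge> \<mu>" "0 \<le> a" "a < b" "b \<le> 1" for \<mu>' a b
    by (rule geodesic_in_balls[OF eps that(1) pw k S(1) _ that(2-4)]) (use S(2) in auto)
  ultimately show ?thesis using k by blast
qed

text \<open>A zero limit speed makes the limit constant, so that \<open>x0 = x1\<close> and
  \<open>loop\<close> provides a positive value of \<Lambda>. For a positive limit speed,
  \<open>loop\<close> rules out the degenerate alternative of
  \<open>limit_alternative\<close>.\<close>

lemma limit_geodesic: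
  assumes mc: "\<And>n. momentum_curve (\<mu> n) (k n) (\<sigma> n)" and k: "(\<forall>n. k n = 0) \<or> (\<forall>n. k n > 0)" "k \<longlonglongrightarrow> c0"
    and eps: "\<And>n. \<mu> n \<in> {0..1}" "\<mu> \<longlonglongrightarrow> 0" and eq: "equicontinuous_family (range \<sigma>)"
    and lim: "\<And>s. s \<in> {0..1} \<Longrightarrow> (\<lambda>n. \<sigma> n s) \<longlonglongrightarrow> \<sigma>0 s" and cont: "continuous_on {0..1} \<sigma>0"
    and ends: "\<And>n. \<sigma> n 0 = x0" "\<And>n. \<sigma> n 1 = x1" and loop: "x0 = x1 \<Longrightarrow> \<Lambda> x0 > 0"
  shows "geodesic_between At (rk_domain At \<omega> \<Lambda>) (rk_metric g0 \<omega> \<Lambda>) x0 x1 \<sigma>0 \<and> curve_length At (rk_metric g0 \<omega> \<Lambda>) \<sigma>0 = c0"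
proof -
  have e0: "\<sigma>0 0 = x0" by (rule LIMSEQ_unique[OF lim]) (simp_all add: ends)
  have e1: "\<sigma>0 1 = x1" by (rule LIMSEQ_unique[OF lim]) (simp_all add: ends)
  have const: ?thesis if c: "\<And>s. s \<in> {0..1} \<Longrightarrow> \<sigma>0 s = x0" and "c0 = 0"
  proof -
    have "x0 = x1" using c[of 1] e1 by simp
    then show ?thesis using constant_geodesic[of \<sigma>0 x0, OF c loop] that(2) e0 e1 by simp
  qed
  show ?thesis using k(1)
  proof
    assume 0: "\<forall>n. k n = 0"
    show ?thesis
    proof (rule const)
      fix s :: real assume s: "s \<in> {0..1}"
      have "\<sigma> n s = x0" for n using mc[of n] 0 s ends(1)[of n] by (simp add: momentum_curve_def)
      then show "\<sigma>0 s = x0" using LIMSEQ_unique[OF lim[OF s], of x0] by simp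
    next
      have "k = (\<lambda>_. 0)" using 0 by auto
      then show "c0 = 0" using LIMSEQ_unique[OF k(2), of 0] by simp
    qed
  next
    assume pos: "\<forall>n. k n > 0"
    have loc: "\<exists>c\<in>charts_at At (\<sigma>0 s0). \<exists>\<rho>>0. \<exists>\<kappa>\<ge>0. \<exists>\<pi>. limit_lift c0 \<kappa> \<sigma>0 c (max 0 (s0 - \<rho>)) (min 1 (s0 + \<rho>)) \<pi>"
      if s0: "s0 \<in> {0..1}" for s0
    proof -
      obtain c where c: "c \<in> charts_at At (\<sigma>0 s0)" using chart_exists by blast
      obtain \<rho> \<kappa> \<pi> where l: "\<rho> > 0" "\<kappa> \<ge> 0" "limit_lift c0 \<kappa> \<sigma>0 c (max 0 (s0 - \<rho>)) (min 1 (s0 + \<rho>)) \<pi>"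
        by (rule local_limit[OF mc pos[rule_format] k(2) eps eq lim s0 c])
      show ?thesis by (rule bexI[OF _ c]) (use l in blast)
    qed
    have "c0 \<ge> 0" using pos by (intro LIMSEQ_le_const[OF k(2)]) (auto intro: less_imp_le)
    then consider "c0 = 0" | "c0 > 0" by linarith
    then show ?thesis
    proof cases
      case 1
      have "\<sigma>0 s = x0" if s: "s \<in> {0..1}" for s using constant_limit[OF loc[unfolded 1] s] e0 by simp
      then show ?thesis using const 1 by blast
    next
      case 2
      have "\<not> (\<sigma>0 0 = \<sigma>0 1 \<and> \<Lambda> (\<sigma>0 0) = 0)" using loop e0 e1 by auto
      then have "regular_limit c0 \<sigma>0" using limit_alternative[OF 2 loc] by blast
      from extremal_geodesic[OF cont regular_limit_extremal[OF this 2]] show ?thesis unfolding e0 e1 by blast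
    qed
  qed
qed

text \<open>Momenta exist only for curves of positive speed, so sequences that mix constant and
  nonconstant curves have to be thinned out first.\<close>

lemma subsequence_zero_or_positive:
  fixes k :: "nat \<Rightarrow> real"
  assumes "\<And>n. k n \<ge> 0"
  obtains r :: "nat \<Rightarrow> nat" where "strict_mono r" "(\<forall>n. k (r n) = 0) \<or> (\<forall>n. k (r n) > 0)"
proof (cases "infinite {n. k n = 0}")
  case True
  then obtain r :: "nat \<Rightarrow> nat" where "strict_mono r" "\<And>n. r n \<in> {n. k n = 0}" using infinite_enumerate by blast
  then show ?thesis using that[of r] by simp
next
  case False
  then have "infinite (- {n. k n = 0})" by (simp add: Compl_eq_Diff_UNIV)
  then obtain r :: "nat \<Rightarrow> nat" where r: "strict_mono r" "\<And>n. r n \<in> - {n. k n = 0}" using infinite_enumerate by blast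
  have "k (r n) > 0" for n using r(2)[of n] assms[of "r n"] by simp
  then show ?thesis using that[of r] r(1) by simp
qed

end

theorem proposition3p9:
  fixes At :: "('a::{t2_space, second_countable_topology}, 'b::euclidean_space) chart set"
    and g0 :: "'a \<Rightarrow> ('a, 'b) tvec \<Rightarrow> ('a, 'b) tvec \<Rightarrow> real"
    and \<omega> :: "'a \<Rightarrow> ('a, 'b) tvec \<Rightarrow> real"
    and \<Lambda> :: "'a \<Rightarrow> real"
    and \<epsilon>bar :: real
    and x0 x1 :: 'a
    and \<sigma> :: "real \<Rightarrow> real \<Rightarrow> 'a"
  assumes "smooth_atlas At"
    and "connected (UNIV :: 'a set)"
    and "DIM('b) \<ge> 2"
    and "riemannian_metric At g0"
    and "smooth_one_form At \<omega>"
    and "\<And>x. \<exists>v\<in>tangent_space At x. \<omega> x v \<noteq> 0"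
    and "smooth_fun At \<Lambda>"
    and "\<And>x. \<Lambda> x \<ge> 0"
    and "\<epsilon>bar \<in> {0<..1}"
    and "\<And>x y r s. r > 0 \<Longrightarrow> s > 0 \<Longrightarrow>
           compact (closure (forward_ball At (randers_metric g0 \<omega> \<Lambda> \<epsilon>bar) x r) \<inter>
                    closure (backward_ball At (randers_metric g0 \<omega> \<Lambda> \<epsilon>bar) y s))"
    and "\<And>\<epsilon>. \<epsilon> \<in> {0<..1} \<Longrightarrow>
           geodesic_between At (tangent_bundle At) (randers_metric g0 \<omega> \<Lambda> \<epsilon>) x0 x1 (\<sigma> \<epsilon>)"
    and "bdd_above ((\<lambda>\<epsilon>. energy At (randers_metric g0 \<omega> \<Lambda> \<epsilon>) (\<sigma> \<epsilon>)) ` {0<..1})"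
    and "x0 \<noteq> x1 \<or>
         x1 = x0 \<and>
           (\<Lambda> x0 \<noteq> 0 \<or>
            \<Lambda> x0 = 0 \<and>
            (\<exists>v\<in>tangent_space At x0. \<omega> x0 v = 0 \<and> differential At \<Lambda> x0 v \<noteq> 0) \<and>
            (\<forall>\<epsilon>\<in>{0<..1}. \<exists>s\<in>{0..1}. \<sigma> \<epsilon> s \<noteq> x0))"
  shows "\<exists>(\<epsilon> :: nat \<Rightarrow> real) \<sigma>0.
           (\<forall>n. \<epsilon> n \<in> {0<..1}) \<and> \<epsilon> \<longlonglongrightarrow> 0 \<and>
           geodesic_between At (rk_domain At \<omega> \<Lambda>) (rk_metric g0 \<omega> \<Lambda>) x0 x1 \<sigma>0 \<and>
           uniformly_converges At g0 (\<lambda>n. \<sigma> (\<epsilon> n)) \<sigma>0 \<and>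
           (\<lambda>n. curve_length At (randers_metric g0 \<omega> \<Lambda> (\<epsilon> n)) (\<sigma> (\<epsilon> n)))
             \<longlonglongrightarrow> curve_length At (rk_metric g0 \<omega> \<Lambda>) \<sigma>0"
proof -
  interpret rk_manifold At g0 \<omega> \<Lambda> by unfold_locales (fact assms)+
  have loop: "\<Lambda> x0 > 0" if "x0 = x1"
    using assms(13) that differential_zero[of x0] \<Lambda>_nonneg[of x0] by force
  let ?R = "randers_metric g0 \<omega> \<Lambda>"
  have "\<forall>\<epsilon>\<in>{0<..1}. \<exists>k\<ge>0. momentum_curve \<epsilon> k (\<sigma> \<epsilon>) \<and> energy At (?R \<epsilon>) (\<sigma> \<epsilon>) = k\<^sup>2 / 2 \<and>
      curve_length At (?R \<epsilon>) (\<sigma> \<epsilon>) = k \<and>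
      (\<forall>\<epsilon>'\<ge>\<epsilon>. \<forall>a b. 0 \<le> a \<longrightarrow> a < b \<longrightarrow> b \<le> 1 \<longrightarrow> path_dist At (?R \<epsilon>') (\<sigma> \<epsilon> a) (\<sigma> \<epsilon> b) \<le> k)"
    using geodesic_momentum_curve[OF _ assms(11)] by simp
  from bchoice[OF this] obtain k where kk: "\<forall>\<epsilon>\<in>{0<..1}. k \<epsilon> \<ge> 0 \<and> momentum_curve \<epsilon> (k \<epsilon>) (\<sigma> \<epsilon>) \<and> energy At (?R \<epsilon>) (\<sigma> \<epsilon>) = (k \<epsilon>)\<^sup>2 / 2 \<and>
      curve_length At (?R \<epsilon>) (\<sigma> \<epsilon>) = k \<epsilon> \<and>
      (\<forall>\<epsilon>'\<ge>\<epsilon>. \<forall>a b. 0 \<le> a \<longrightarrow> a < b \<longrightarrow> b \<le> 1 \<longrightarrow> path_dist At (?R \<epsilon>') (\<sigma> \<epsilon> a) (\<sigma> \<epsilon> b) \<le> k \<epsilon>)" ..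
  note k = bspec[OF kk]
  obtain B where B: "\<And>\<epsilon>. \<epsilon> \<in> {0<..1} \<Longrightarrow> energy At (?R \<epsilon>) (\<sigma> \<epsilon>) \<le> B" using assms(12) unfolding bdd_above_def by blast
  \<comment> \<open>A common bound for the speeds, since the energy is half the square of the
    speed.\<close>
  define \<kappa> where "\<kappa> = sqrt (2 * B)"
  have k\<kappa>: "k \<epsilon> \<le> \<kappa>" if "\<epsilon> \<in> {0<..1}" for \<epsilon>
    unfolding \<kappa>_def using k[OF that] B[OF that] by (intro real_le_rsqrt) simp
  have \<kappa>0: "\<kappa> \<ge> 0" using k[of 1] k\<kappa>[of 1] by (meson greaterThanAtMost_iff order_refl order_trans zero_less_one)
  \<comment> \<open>All parameters are at most the given one, for which the balls have compact
    intersections; by monotonicity its distances are bounded by the lengths of these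
    geodesics.\<close>
  define e where "e n = \<epsilon>bar / real (Suc n)" for n
  have e: "e n \<in> {0<..1}" "e n \<le> \<epsilon>bar" for n
  proof -
    show le: "e n \<le> \<epsilon>bar" using assms(9) divide_left_mono[of 1 "real (Suc n)" \<epsilon>bar] by (simp add: e_def)
    show "e n \<in> {0<..1}" using le assms(9) by (simp add: e_def)
  qed
  have elim: "e \<longlonglongrightarrow> 0" unfolding e_def using tendsto_mult_right_zero[OF LIMSEQ_inverse_real_of_nat, of \<epsilon>bar] by (simp add: divide_inverse)
  \<comment> \<open>The added 1 turns the bound \<kappa> into the strict inequality in the
    definition of the balls and makes the radius positive.\<close>
  define K where "K = closure (forward_ball At (?R \<epsilon>bar) x0 (\<kappa> + 1)) \<inter> closure (backward_ball At (?R \<epsilon>bar) x1 (\<kappa> + 1))"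
  have K: "compact K" unfolding K_def by (rule assms(10)) (use \<kappa>0 in auto)
  have ends: "\<sigma> \<epsilon> 0 = x0" "\<sigma> \<epsilon> 1 = x1" if "\<epsilon> \<in> {0<..1}" for \<epsilon>
    using assms(11)[OF that] by (auto simp: geodesic_between_def curves_between_def)
  have inK: "\<sigma> (e n) s \<in> K" if s: "s \<in> {0..1}" for n s
  proof -
    \<comment> \<open>At interior times the arcs to both end points are nondegenerate, as the
      distance bound requires; the times 0 and 1 follow because \<open>K\<close> is closed.\<close>
    have "\<sigma> (e n) s \<in> K" if s: "s \<in> {0<..<1}" for s
    proof -
      have "path_dist At (?R \<epsilon>bar) (\<sigma> (e n) 0) (\<sigma> (e n) s) \<le> k (e n)" "path_dist At (?R \<epsilon>bar) (\<sigma> (e n) s) (\<sigma> (e n) 1) \<le> k (e n)"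
        using k[OF e(1)[of n]] e(2)[of n] s by auto
      then have "\<sigma> (e n) s \<in> forward_ball At (?R \<epsilon>bar) x0 (\<kappa> + 1)" "\<sigma> (e n) s \<in> backward_ball At (?R \<epsilon>bar) x1 (\<kappa> + 1)"
        using k\<kappa>[OF e(1)[of n]] by (auto simp: forward_ball_def backward_ball_def ends[OF e(1)[of n]])
      then show ?thesis unfolding K_def using closure_subset by blast
    qed
    then have "\<sigma> (e n) ` {0<..<1} \<subseteq> K" by blast
    moreover have "continuous_on (closure {0<..<1}) (\<sigma> (e n))" using k[OF e(1)[of n]] by (simp add: momentum_curve_def)
    ultimately have "\<sigma> (e n) ` closure {0<..<1} \<subseteq> K" by (intro image_closure_subset compact_imp_closed[OF K])
    then show ?thesis using s by auto
  qed
  have sub: "range (\<lambda>n. \<sigma> (e (r n))) \<subseteq> {\<sigma>. \<exists>\<epsilon>\<in>{0..1}. \<exists>k\<le>\<kappa>. momentum_curve \<epsilon> k \<sigma>}" for r :: "nat \<Rightarrow> nat"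
  proof
    fix \<gamma> assume "\<gamma> \<in> range (\<lambda>n. \<sigma> (e (r n)))"
    then obtain n where "\<gamma> = \<sigma> (e (r n))" by blast
    then show "\<gamma> \<in> {\<sigma>. \<exists>\<epsilon>\<in>{0..1}. \<exists>k\<le>\<kappa>. momentum_curve \<epsilon> k \<sigma>}"
      using k[OF e(1)[of "r n"]] k\<kappa>[OF e(1)[of "r n"]] e(1)[of "r n"] by (intro CollectI bexI[of _ "e (r n)"]) auto
  qed
  note eq = equicontinuous_family_subset[OF momentum_curves_equicontinuous sub]
  obtain r1 \<sigma>0 where r1: "strict_mono r1" and \<sigma>0: "continuous_on {0..1} \<sigma>0" "\<And>s. s \<in> {0..1} \<Longrightarrow> (\<lambda>n. \<sigma> (e (r1 n)) s) \<longlonglongrightarrow> \<sigma>0 s"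
    using equicontinuous_subsequence[of "\<lambda>n. \<sigma> (e n)" K, OF eq[of "\<lambda>n. n"] K inK] by metis
  have "\<forall>n. k (e (r1 n)) \<in> {0..\<kappa>}" using k[OF e(1)] k\<kappa>[OF e(1)] by auto
  from compact_imp_seq_compact[OF compact_Icc, unfolded seq_compact_def, THEN spec, THEN mp, OF this]
  obtain c0 r2 where r2: "strict_mono r2" "((\<lambda>n. k (e (r1 n))) \<circ> r2) \<longlonglongrightarrow> c0" by blast
  have "k (e (r1 (r2 n))) \<ge> 0" for n using k[OF e(1)] by (rule conjunct1)
  from subsequence_zero_or_positive[of "\<lambda>n. k (e (r1 (r2 n)))", OF this]
  obtain r3 :: "nat \<Rightarrow> nat" where r3: "strict_mono r3" "(\<forall>n. k (e (r1 (r2 (r3 n)))) = 0) \<or> (\<forall>n. k (e (r1 (r2 (r3 n)))) > 0)" .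
  \<comment> \<open>Three successive choices: convergence of the curves, convergence of the speeds,
    and speeds that are all zero or all positive.\<close>
  define r where "r n = r1 (r2 (r3 n))" for n
  have r: "strict_mono r" unfolding r_def using strict_mono_o[OF r1 strict_mono_o[OF r2(1) r3(1)]] by (simp add: o_def)
  have lim: "(\<lambda>n. \<sigma> (e (r n)) s) \<longlonglongrightarrow> \<sigma>0 s" if "s \<in> {0..1}" for s
    using LIMSEQ_subseq_LIMSEQ[OF \<sigma>0(2)[OF that] strict_mono_o[OF r2(1) r3(1)]] by (simp add: o_def r_def)
  have klim: "(\<lambda>n. k (e (r n))) \<longlonglongrightarrow> c0" using LIMSEQ_subseq_LIMSEQ[OF r2(2) r3(1)] by (simp add: o_def r_def)
  have erlim: "(\<lambda>n. e (r n)) \<longlonglongrightarrow> 0" using LIMSEQ_subseq_LIMSEQ[OF elim r] by (simp add: o_def)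
  have "geodesic_between At (rk_domain At \<omega> \<Lambda>) (rk_metric g0 \<omega> \<Lambda>) x0 x1 \<sigma>0 \<and> curve_length At (rk_metric g0 \<omega> \<Lambda>) \<sigma>0 = c0"
  proof (rule limit_geodesic[OF _ _ klim _ erlim eq[of r] lim \<sigma>0(1)])
    show "momentum_curve (e (r n)) (k (e (r n))) (\<sigma> (e (r n)))" for n using k[OF e(1)] by blast
    show "(\<forall>n. k (e (r n)) = 0) \<or> (\<forall>n. k (e (r n)) > 0)" using r3(2) by (simp only: r_def)
    show "e (r n) \<in> {0..1}" for n using e(1)[of "r n"] by simp
  qed (use ends[OF e(1)] loop in auto)
  moreover have "uniformly_converges At g0 (\<lambda>n. \<sigma> (e (r n))) \<sigma>0"
    by (rule uniformly_converges_equicontinuous[OF eq \<sigma>0(1) lim])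
  moreover have "(\<lambda>n. curve_length At (?R (e (r n))) (\<sigma> (e (r n)))) \<longlonglongrightarrow> c0"
  proof -
    have "curve_length At (?R (e (r n))) (\<sigma> (e (r n))) = k (e (r n))" for n using k[OF e(1)] by blast
    then show ?thesis using klim by simp
  qed
  ultimately show ?thesis
    using e(1) erlim by (intro exI[of _ "\<lambda>n. e (r n)"] exI[of _ \<sigma>0]) simp
qed

end
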